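(* Let $S$ and $T$ be theories and $\phi:S\to T$ a morphism of theories. Let $U$ be the forgetful 2-functor associated to $\phi$, from the 2-category of small pseudo $T$-algebras to the 2-category of small pseudo $S$-algebras. Then $U$ admits a left biadjoint $F$, and moreover this pseudo functor $F$ is a strict 2-functor.
   Context: Theories. A theory $T$ is a category with objects $0,1,2,\dots$ in which $n$ is the product of $n$ copies of $1$, with chosen projections $pr_i:n\to 1$. A morphism of theories is a functor sending $n$ to $n$ and $pr_i$ to $pr_i$. Put $T(n)=Mor_T(n,1)$ (words of arity $n$). For a function $f:\{1,\dots,k\}\to\{1,\dots,\ell\}$ let $f':\ell\to k$ be the morphism with $pr_i f'=pr_{f(i)}$, and for $w\in T(k)$ put $w_f=w\circ f'\in T(\ell)$. For $w\in T(k)$, $w_i\in T(n_i)$ put $\gamma(w,w_1,\dots,w_k)=w\circ(w_1,\dots,w_k)\in T(n_1+\dots+n_k)$, where $(w_1,\dots,w_k):n_1+\dots+n_k\to k$ has $i$-th component $(w_i)_{\iota_i}$, $\iota_i$ being the inclusion onto the $i$-th block. The unit $1\in T(1)$ is the projection $pr_1:1\to1$. For a category $X$, $End(X)$ is the theory with $End(X)(n)=Functors(X^n,X)$; there $\gamma(F,F_1,\dots,F_k)=F\circ(F_1\times\dots\times F_k)$, $F_f(x_1,\dots,x_\ell)=F(x_{f1},\dots,x_{fk})$, and the unit is $1_X$; these operations also apply to natural transformations. Pseudo $T$-algebras. A pseudo $T$-algebra is a category $X$ with functions $\Phi:T(n)\to Functors(X^n,X)$ for all $n\ge 0$ and natural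 isomorphisms $c_{w,w_1,\dots,w_k}:\Phi(\gamma(w,w_1,\dots,w_k))\Rightarrow\gamma(\Phi(w),\Phi(w_1),\dots,\Phi(w_k))$, $I:\Phi(1)\Rightarrow 1_X$, $s_{w,f}:\Phi(w_f)\Rightarrow\Phi(w)_f$, such that (vertical composition written $\circ$, $i$ = identity 2-cell): (1) $\gamma(c_{w,w_1,\dots,w_k},i,\dots,i)\circ c_{\gamma(w,w_1,\dots,w_k),w_{11},\dots,w_{kn_k}}=\gamma(i_{\Phi(w)},c_{w_1,w_{11},\dots,w_{1n_1}},\dots,c_{w_k,w_{k1},\dots,w_{kn_k}})\circ c_{w,\gamma(w_1,w_{11},\dots),\dots,\gamma(w_k,w_{k1},\dots)}$; (2) $\gamma(i_{\Phi(w)},I,\dots,I)\circ c_{w,1,\dots,1}=i$; (3) $\gamma(I,i_{\Phi(w)})\circ c_{1,w}=i$; (4) for $f:\{1,\dots,k\}\to\{1,\dots,\ell\}$, $w\in T(k)$, $w_j\in T(n_j)$ ($1\le j\le\ell$), with $\bar f:\{1,\dots,n_{f1}+\dots+n_{fk}\}\to\{1,\dots,n_1+\dots+n_\ell\}$ carrying the $i$-th block identically onto the $f(i)$-th block: $(c_{w,w_{f1},\dots,w_{fk}})_{\bar f}\circ s_{\gamma(w,w_{f1},\dots,w_{fk}),\bar f}=\gamma(s_{w,f},i,\dots,i)\circ c_{w_f,w_1,\dots,w_\ell}$; (5) for functions $g_i:\{1,\dots,n_i\}\to\{1,\dots,n_i'\}$ with block sum $g=g_1+\dots+g_k$: $(c_{w,w_1,\dots,w_k})_g\circ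 s_{\gamma(w,w_1,\dots,w_k),g}=\gamma(i_{\Phi(w)},s_{w_1,g_1},\dots,s_{w_k,g_k})\circ c_{w,(w_1)_{g_1},\dots,(w_k)_{g_k}}$; (6) $(s_{w,f})_g\circ s_{w_f,g}=s_{w,g\circ f}$; (7) $s_{w,id}$ is the identity. A morphism $H:(X,\Phi)\to(Y,\Psi)$ of pseudo $T$-algebras is a functor with natural isomorphisms $\rho_w:H\circ\Phi(w)\Rightarrow\Psi(w)\circ(H,\dots,H)$ for all words $w$ such that $(c*i)\circ\rho_{\gamma(w,w_1,\dots,w_k)}=(i_{\Psi(w)}*(\rho_{w_1},\dots,\rho_{w_k}))\circ(\rho_w*i)\circ(i_H*c)$, $(I*i_H)\circ\rho_1=i_H*I$, and $(s_{w,f}*i)\circ\rho_{w_f}=(\rho_w)_f\circ(i_H*s_{w,f})$. Composites have $\rho^{HG}_w=(\rho^H_w*i)\circ(i_H*\rho^G_w)$. A 2-cell $\alpha:G\Rightarrow H$ is a natural transformation with $\rho^H_w\circ(\alpha*i_{\Phi(w)})=(i_{\Psi(w)}*(\alpha,\dots,\alpha))\circ\rho^G_w$ for all $w$. Forgetful 2-functor. $U$ sends a pseudo $T$-algebra $X$ with structure maps $\Phi$ to the pseudo $S$-algebra on the same category with structure maps $w\mapsto\Phi(\phi(w))$ and the coherence isomorphisms of $X$ at the words $\phi(w)$; similarly on morphisms and 2-cells. Left biadjoint. A left biadjoint for a pseudo functor $G:\mathcal{A}\to\mathcal{X}$ is a pseudo functor $F:\mathcal{X}\to\mathcal{A}$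 together with equivalences of categories $Mor_{\mathcal{A}}(FX,A)\to Mor_{\mathcal{X}}(X,GA)$ that are pseudo natural (with invertible coherence 2-cells) in each variable. *)

theory Defs
  imports "HOL-Library.FuncSet" "HOL-Library.Equipollence" "HOL-Library.Countable_Set"
begin

section \<open>Categories, functors, natural transformations\<close>

record ('o, 'a) cat =
  Ob :: "'o set"
  Ar :: "'a set"
  Dom :: "'a \<Rightarrow> 'o"
  Cod :: "'a \<Rightarrow> 'o"
  Idt :: "'o \<Rightarrow> 'a"
  Comp :: "'a \<Rightarrow> 'a \<Rightarrow> 'a"  \<comment> \<open>\<open>Comp C g f\<close> is \<open>g\<close> after \<open>f\<close>\<close>

definition hom :: "('o, 'a, 'z) cat_scheme \<Rightarrow> 'o \<Rightarrow> 'o \<Rightarrow> 'a set" where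
  "hom C x y = {f \<in> Ar C. Dom C f = x \<and> Cod C f = y}"

definition category :: "('o, 'a, 'z) cat_scheme \<Rightarrow> bool" where
  "category C \<longleftrightarrow>
     (\<forall>f\<in>Ar C. Dom C f \<in> Ob C \<and> Cod C f \<in> Ob C) \<and>
     (\<forall>x\<in>Ob C. Idt C x \<in> hom C x x) \<and>
     (\<forall>f\<in>Ar C. \<forall>g\<in>Ar C. Cod C f = Dom C g \<longrightarrow> Comp C g f \<in> hom C (Dom C f) (Cod C g)) \<and>
     (\<forall>f\<in>Ar C. Comp C f (Idt C (Dom C f)) = f \<and> Comp C (Idt C (Cod C f)) f = f) \<and>
     (\<forall>f\<in>Ar C. \<forall>g\<in>Ar C. \<forall>h\<in>Ar C. Cod C f = Dom C g \<longrightarrow> Cod C g = Dom C h \<longrightarrow>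
        Comp C h (Comp C g f) = Comp C (Comp C h g) f)"

text \<open>
  HOL functions are total.  Whenever equality of structures matters, all operations are required
  to be \<open>undefined\<close> outside the set on which they are meaningful, so that HOL equality is the
  set-theoretic equality of the structures.
\<close>

definition extensional_cat :: "('o, 'a) cat \<Rightarrow> bool" where
  "extensional_cat C \<longleftrightarrow>
     Dom C \<in> extensional (Ar C) \<and> Cod C \<in> extensional (Ar C) \<and> Idt C \<in> extensional (Ob C) \<and>
     (\<forall>g f. \<not> (g \<in> Ar C \<and> f \<in> Ar C \<and> Cod C f = Dom C g) \<longrightarrow> Comp C g f = undefined)"

definition iso :: "('o, 'a, 'z) cat_scheme \<Rightarrow> 'a \<Rightarrow> bool" where
  "iso C f \<longleftrightarrow> f \<in> Ar C \<and> (\<exists>g \<in> hom C (Cod C f) (Dom C f).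
     Comp C g f = Idt C (Dom C f) \<and> Comp C f g = Idt C (Cod C f))"

record ('o, 'a, 'p, 'b) functr =
  fob :: "'o \<Rightarrow> 'p"
  far :: "'a \<Rightarrow> 'b"

definition is_functor ::
  "('o, 'a, 'z) cat_scheme \<Rightarrow> ('p, 'b, 'y) cat_scheme \<Rightarrow> ('o, 'a, 'p, 'b) functr \<Rightarrow> bool" where
  "is_functor C D F \<longleftrightarrow> category C \<and> category D \<and>
     fob F \<in> Ob C \<rightarrow>\<^sub>E Ob D \<and> far F \<in> Ar C \<rightarrow>\<^sub>E Ar D \<and>
     (\<forall>f\<in>Ar C. Dom D (far F f) = fob F (Dom C f) \<and> Cod D (far F f) = fob F (Cod C f)) \<and>
     (\<forall>x\<in>Ob C. far F (Idt C x) = Idt D (fob F x)) \<and>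
     (\<forall>f\<in>Ar C. \<forall>g\<in>Ar C. Cod C f = Dom C g \<longrightarrow>
        far F (Comp C g f) = Comp D (far F g) (far F f))"

definition id_fun :: "('o, 'a) cat \<Rightarrow> ('o, 'a, 'o, 'a) functr" where
  "id_fun C = \<lparr>fob = (\<lambda>x\<in>Ob C. x), far = (\<lambda>f\<in>Ar C. f)\<rparr>"

definition fcomp :: "('o, 'a) cat \<Rightarrow> ('p, 'b, 'q, 'c) functr \<Rightarrow> ('o, 'a, 'p, 'b) functr
    \<Rightarrow> ('o, 'a, 'q, 'c) functr" where
  "fcomp C G F = \<lparr>fob = (\<lambda>x\<in>Ob C. fob G (fob F x)), far = (\<lambda>f\<in>Ar C. far G (far F f))\<rparr>"

record ('o, 'a, 'p, 'b) nattr =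
  nsrc :: "('o, 'a, 'p, 'b) functr"
  ntgt :: "('o, 'a, 'p, 'b) functr"
  ncomp :: "'o \<Rightarrow> 'b"

definition is_nat :: "('o, 'a) cat \<Rightarrow> ('p, 'b) cat \<Rightarrow> ('o, 'a, 'p, 'b) nattr \<Rightarrow> bool" where
  "is_nat C D \<alpha> \<longleftrightarrow> is_functor C D (nsrc \<alpha>) \<and> is_functor C D (ntgt \<alpha>) \<and>
     ncomp \<alpha> \<in> extensional (Ob C) \<and>
     (\<forall>x\<in>Ob C. ncomp \<alpha> x \<in> hom D (fob (nsrc \<alpha>) x) (fob (ntgt \<alpha>) x)) \<and>
     (\<forall>f\<in>Ar C. Comp D (ncomp \<alpha> (Cod C f)) (far (nsrc \<alpha>) f)
              = Comp D (far (ntgt \<alpha>) f) (ncomp \<alpha> (Dom C f)))"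

definition nat_iso :: "('o, 'a) cat \<Rightarrow> ('p, 'b) cat \<Rightarrow> ('o, 'a, 'p, 'b) nattr
    \<Rightarrow> ('o, 'a, 'p, 'b) functr \<Rightarrow> ('o, 'a, 'p, 'b) functr \<Rightarrow> bool" where
  "nat_iso C D \<alpha> F G \<longleftrightarrow> is_nat C D \<alpha> \<and> nsrc \<alpha> = F \<and> ntgt \<alpha> = G \<and>
     (\<forall>x\<in>Ob C. iso D (ncomp \<alpha> x))"

definition id_nat :: "('o, 'a) cat \<Rightarrow> ('p, 'b) cat \<Rightarrow> ('o, 'a, 'p, 'b) functr
    \<Rightarrow> ('o, 'a, 'p, 'b) nattr" where
  "id_nat C D F = \<lparr>nsrc = F, ntgt = F, ncomp = (\<lambda>x\<in>Ob C. Idt D (fob F x))\<rparr>"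

definition vcomp :: "('o, 'a) cat \<Rightarrow> ('p, 'b) cat \<Rightarrow> ('o, 'a, 'p, 'b) nattr
    \<Rightarrow> ('o, 'a, 'p, 'b) nattr \<Rightarrow> ('o, 'a, 'p, 'b) nattr" where
  "vcomp C D \<beta> \<alpha> = \<lparr>nsrc = nsrc \<alpha>, ntgt = ntgt \<beta>,
     ncomp = (\<lambda>x\<in>Ob C. Comp D (ncomp \<beta> x) (ncomp \<alpha> x))\<rparr>"

text \<open>
  Horizontal composite \<open>\<beta> * \<alpha>\<close> for \<open>\<alpha>\<close> between functors \<open>C \<rightarrow> D\<close> and \<open>\<beta>\<close> between functors
  \<open>D \<rightarrow> E\<close>; the middle category \<open>D\<close> is not needed to write it down.
\<close>

definition hcomp :: "('o, 'a) cat \<Rightarrow> ('q, 'c) cat \<Rightarrow> ('p, 'b, 'q, 'c) nattr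
    \<Rightarrow> ('o, 'a, 'p, 'b) nattr \<Rightarrow> ('o, 'a, 'q, 'c) nattr" where
  "hcomp C E \<beta> \<alpha> = \<lparr>nsrc = fcomp C (nsrc \<beta>) (nsrc \<alpha>), ntgt = fcomp C (ntgt \<beta>) (ntgt \<alpha>),
     ncomp = (\<lambda>x\<in>Ob C. Comp E (ncomp \<beta> (fob (ntgt \<alpha>) x)) (far (nsrc \<beta>) (ncomp \<alpha> x)))\<rparr>"

definition equivalence :: "('o, 'a) cat \<Rightarrow> ('p, 'b) cat \<Rightarrow> ('o, 'a, 'p, 'b) functr \<Rightarrow> bool" where
  "equivalence C D E \<longleftrightarrow> is_functor C D E \<and>
     (\<exists>E' \<eta> \<epsilon>. is_functor D C E' \<and>
        nat_iso C C \<eta> (id_fun C) (fcomp C E' E) \<and> nat_iso D D \<epsilon> (fcomp D E E') (id_fun D))"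

definition prod_cat :: "('o, 'a) cat \<Rightarrow> ('p, 'b) cat \<Rightarrow> ('o \<times> 'p, 'a \<times> 'b) cat" where
  "prod_cat C D = \<lparr>Ob = Ob C \<times> Ob D, Ar = Ar C \<times> Ar D,
     Dom = (\<lambda>(f, g). (Dom C f, Dom D g)), Cod = (\<lambda>(f, g). (Cod C f, Cod D g)),
     Idt = (\<lambda>(x, y). (Idt C x, Idt D y)),
     Comp = (\<lambda>(f', g') (f, g). (Comp C f' f, Comp D g' g))\<rparr>"

section \<open>2-categories, pseudo functors, left biadjoints\<close>

text \<open>
  A (strict) 2-category: hom-categories indexed by pairs of objects (vertical composition is the
  composition in the hom-categories), identity 1-cells, and composition functors
  \<open>HomC Y Z \<times> HomC X Y \<rightarrow> HomC X Z\<close>.  A 1-cell need not determine its source and target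
  objects, so these are passed explicitly.
\<close>

record ('o, 'm, 'c) twocat =
  Obj :: "'o set"
  HomC :: "'o \<Rightarrow> 'o \<Rightarrow> ('m, 'c) cat"
  Id1 :: "'o \<Rightarrow> 'm"
  Cmp :: "'o \<Rightarrow> 'o \<Rightarrow> 'o \<Rightarrow> ('m \<times> 'm, 'c \<times> 'c, 'm, 'c) functr"

definition cmp1 :: "('o, 'm, 'c) twocat \<Rightarrow> 'o \<Rightarrow> 'o \<Rightarrow> 'o \<Rightarrow> 'm \<Rightarrow> 'm \<Rightarrow> 'm" where
  "cmp1 K X Y Z g f = fob (Cmp K X Y Z) (g, f)"

definition cmp2 :: "('o, 'm, 'c) twocat \<Rightarrow> 'o \<Rightarrow> 'o \<Rightarrow> 'o \<Rightarrow> 'c \<Rightarrow> 'c \<Rightarrow> 'c" where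
  "cmp2 K X Y Z \<beta> \<alpha> = far (Cmp K X Y Z) (\<beta>, \<alpha>)"

definition id2 :: "('o, 'm, 'c) twocat \<Rightarrow> 'o \<Rightarrow> 'o \<Rightarrow> 'm \<Rightarrow> 'c" where
  "id2 K X Y f = Idt (HomC K X Y) f"

definition two_category :: "('o, 'm, 'c) twocat \<Rightarrow> bool" where
  "two_category K \<longleftrightarrow>
     (\<forall>X\<in>Obj K. \<forall>Y\<in>Obj K. category (HomC K X Y)) \<and>
     (\<forall>X\<in>Obj K. Id1 K X \<in> Ob (HomC K X X)) \<and>
     (\<forall>X\<in>Obj K. \<forall>Y\<in>Obj K. \<forall>Z\<in>Obj K.
        is_functor (prod_cat (HomC K Y Z) (HomC K X Y)) (HomC K X Z) (Cmp K X Y Z)) \<and>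
     (\<forall>X\<in>Obj K. \<forall>Y\<in>Obj K. \<forall>f\<in>Ob (HomC K X Y).
        cmp1 K X X Y f (Id1 K X) = f \<and> cmp1 K X Y Y (Id1 K Y) f = f) \<and>
     (\<forall>X\<in>Obj K. \<forall>Y\<in>Obj K. \<forall>\<alpha>\<in>Ar (HomC K X Y).
        cmp2 K X X Y \<alpha> (id2 K X X (Id1 K X)) = \<alpha> \<and> cmp2 K X Y Y (id2 K Y Y (Id1 K Y)) \<alpha> = \<alpha>) \<and>
     (\<forall>W\<in>Obj K. \<forall>X\<in>Obj K. \<forall>Y\<in>Obj K. \<forall>Z\<in>Obj K.
        (\<forall>f\<in>Ob (HomC K W X). \<forall>g\<in>Ob (HomC K X Y). \<forall>h\<in>Ob (HomC K Y Z).
           cmp1 K W Y Z h (cmp1 K W X Y g f) = cmp1 K W X Z (cmp1 K X Y Z h g) f) \<and>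
        (\<forall>\<alpha>\<in>Ar (HomC K W X). \<forall>\<beta>\<in>Ar (HomC K X Y). \<forall>\<gamma>\<in>Ar (HomC K Y Z).
           cmp2 K W Y Z \<gamma> (cmp2 K W X Y \<beta> \<alpha>) = cmp2 K W X Z (cmp2 K X Y Z \<gamma> \<beta>) \<alpha>))"

text \<open>The opposite 2-category: 1-cells are reversed, 2-cells are not.\<close>

definition op2 :: "('o, 'm, 'c) twocat \<Rightarrow> ('o, 'm, 'c) twocat" where
  "op2 K = \<lparr>Obj = Obj K, HomC = (\<lambda>X Y. HomC K Y X), Id1 = Id1 K,
     Cmp = (\<lambda>X Y Z. \<lparr>fob = (\<lambda>(g, f). fob (Cmp K Z Y X) (f, g)),
                     far = (\<lambda>(\<beta>, \<alpha>). far (Cmp K Z Y X) (\<alpha>, \<beta>))\<rparr>)\<rparr>"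

text \<open>
  The data of a pseudo functor \<open>P\<close>: object map, functors on hom-categories, and coherence 2-cells
  \<open>PC P X Y Z g f : P g \<circ> P f \<Rightarrow> P (g \<circ> f)\<close> for \<open>f : X \<rightarrow> Y\<close>, \<open>g : Y \<rightarrow> Z\<close>, and
  \<open>PU P X : 1 \<Rightarrow> P 1\<close>.
\<close>

record ('o, 'm, 'c, 'p, 'n, 'd) psfun =
  P0 :: "'o \<Rightarrow> 'p"
  P1 :: "'o \<Rightarrow> 'o \<Rightarrow> ('m, 'c, 'n, 'd) functr"
  PC :: "'o \<Rightarrow> 'o \<Rightarrow> 'o \<Rightarrow> 'm \<Rightarrow> 'm \<Rightarrow> 'd"
  PU :: "'o \<Rightarrow> 'd"

definition pseudo_functor :: "('o, 'm, 'c) twocat \<Rightarrow> ('p, 'n, 'd) twocat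
    \<Rightarrow> ('o, 'm, 'c, 'p, 'n, 'd) psfun \<Rightarrow> bool" where
  "pseudo_functor K L P \<longleftrightarrow> two_category K \<and> two_category L \<and>
     (\<forall>X\<in>Obj K. P0 P X \<in> Obj L) \<and>
     (\<forall>X\<in>Obj K. \<forall>Y\<in>Obj K. is_functor (HomC K X Y) (HomC L (P0 P X) (P0 P Y)) (P1 P X Y)) \<and>
     (\<forall>X\<in>Obj K. iso (HomC L (P0 P X) (P0 P X)) (PU P X) \<and>
        PU P X \<in> hom (HomC L (P0 P X) (P0 P X)) (Id1 L (P0 P X)) (fob (P1 P X X) (Id1 K X))) \<and>
     (\<forall>X\<in>Obj K. \<forall>Y\<in>Obj K. \<forall>Z\<in>Obj K. \<forall>f\<in>Ob (HomC K X Y). \<forall>g\<in>Ob (HomC K Y Z).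
        iso (HomC L (P0 P X) (P0 P Z)) (PC P X Y Z g f) \<and>
        PC P X Y Z g f \<in> hom (HomC L (P0 P X) (P0 P Z))
          (cmp1 L (P0 P X) (P0 P Y) (P0 P Z) (fob (P1 P Y Z) g) (fob (P1 P X Y) f))
          (fob (P1 P X Z) (cmp1 K X Y Z g f))) \<and>
     (\<forall>X\<in>Obj K. \<forall>Y\<in>Obj K. \<forall>Z\<in>Obj K. \<forall>\<alpha>\<in>Ar (HomC K X Y). \<forall>\<beta>\<in>Ar (HomC K Y Z).
        Comp (HomC L (P0 P X) (P0 P Z))
          (PC P X Y Z (Cod (HomC K Y Z) \<beta>) (Cod (HomC K X Y) \<alpha>))
          (cmp2 L (P0 P X) (P0 P Y) (P0 P Z) (far (P1 P Y Z) \<beta>) (far (P1 P X Y) \<alpha>))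
        = Comp (HomC L (P0 P X) (P0 P Z))
          (far (P1 P X Z) (cmp2 K X Y Z \<beta> \<alpha>))
          (PC P X Y Z (Dom (HomC K Y Z) \<beta>) (Dom (HomC K X Y) \<alpha>))) \<and>
     (\<forall>W\<in>Obj K. \<forall>X\<in>Obj K. \<forall>Y\<in>Obj K. \<forall>Z\<in>Obj K.
        \<forall>f\<in>Ob (HomC K W X). \<forall>g\<in>Ob (HomC K X Y). \<forall>h\<in>Ob (HomC K Y Z).
        Comp (HomC L (P0 P W) (P0 P Z))
          (PC P W Y Z h (cmp1 K W X Y g f))
          (cmp2 L (P0 P W) (P0 P Y) (P0 P Z)
             (id2 L (P0 P Y) (P0 P Z) (fob (P1 P Y Z) h)) (PC P W X Y g f))
        = Comp (HomC L (P0 P W) (P0 P Z))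
          (PC P W X Z (cmp1 K X Y Z h g) f)
          (cmp2 L (P0 P W) (P0 P X) (P0 P Z)
             (PC P X Y Z h g) (id2 L (P0 P W) (P0 P X) (fob (P1 P W X) f)))) \<and>
     (\<forall>X\<in>Obj K. \<forall>Y\<in>Obj K. \<forall>f\<in>Ob (HomC K X Y).
        Comp (HomC L (P0 P X) (P0 P Y))
          (PC P X X Y f (Id1 K X))
          (cmp2 L (P0 P X) (P0 P X) (P0 P Y)
             (id2 L (P0 P X) (P0 P Y) (fob (P1 P X Y) f)) (PU P X))
        = id2 L (P0 P X) (P0 P Y) (fob (P1 P X Y) f) \<and>
        Comp (HomC L (P0 P X) (P0 P Y))
          (PC P X Y Y (Id1 K Y) f)
          (cmp2 L (P0 P X) (P0 P Y) (P0 P Y)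
             (PU P Y) (id2 L (P0 P X) (P0 P Y) (fob (P1 P X Y) f)))
        = id2 L (P0 P X) (P0 P Y) (fob (P1 P X Y) f))"

definition strict_2functor :: "('o, 'm, 'c) twocat \<Rightarrow> ('p, 'n, 'd) twocat
    \<Rightarrow> ('o, 'm, 'c, 'p, 'n, 'd) psfun \<Rightarrow> bool" where
  "strict_2functor K L P \<longleftrightarrow> pseudo_functor K L P \<and>
     (\<forall>X\<in>Obj K. fob (P1 P X X) (Id1 K X) = Id1 L (P0 P X) \<and>
        PU P X = id2 L (P0 P X) (P0 P X) (Id1 L (P0 P X))) \<and>
     (\<forall>X\<in>Obj K. \<forall>Y\<in>Obj K. \<forall>Z\<in>Obj K. \<forall>f\<in>Ob (HomC K X Y). \<forall>g\<in>Ob (HomC K Y Z).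
        fob (P1 P X Z) (cmp1 K X Y Z g f)
          = cmp1 L (P0 P X) (P0 P Y) (P0 P Z) (fob (P1 P Y Z) g) (fob (P1 P X Y) f) \<and>
        PC P X Y Z g f = id2 L (P0 P X) (P0 P Z) (fob (P1 P X Z) (cmp1 K X Y Z g f)))"

definition op_psfun :: "('o, 'm, 'c, 'p, 'n, 'd) psfun \<Rightarrow> ('o, 'm, 'c, 'p, 'n, 'd) psfun" where
  "op_psfun P = \<lparr>P0 = P0 P, P1 = (\<lambda>X Y. P1 P Y X),
     PC = (\<lambda>X Y Z g f. PC P Z Y X f g), PU = PU P\<rparr>"

text \<open>Composite \<open>Q \<circ> P\<close> of pseudo functors \<open>P : K \<rightarrow> L\<close> and \<open>Q : L \<rightarrow> M\<close>.\<close>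

definition psfun_comp :: "('o, 'm, 'c) twocat \<Rightarrow> ('q, 'k, 'e) twocat
    \<Rightarrow> ('p, 'n, 'd, 'q, 'k, 'e) psfun \<Rightarrow> ('o, 'm, 'c, 'p, 'n, 'd) psfun
    \<Rightarrow> ('o, 'm, 'c, 'q, 'k, 'e) psfun" where
  "psfun_comp K M Q P = \<lparr>P0 = (\<lambda>X. P0 Q (P0 P X)),
     P1 = (\<lambda>X Y. fcomp (HomC K X Y) (P1 Q (P0 P X) (P0 P Y)) (P1 P X Y)),
     PC = (\<lambda>X Y Z g f. Comp (HomC M (P0 Q (P0 P X)) (P0 Q (P0 P Z)))
        (far (P1 Q (P0 P X) (P0 P Z)) (PC P X Y Z g f))
        (PC Q (P0 P X) (P0 P Y) (P0 P Z) (fob (P1 P Y Z) g) (fob (P1 P X Y) f))),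
     PU = (\<lambda>X. Comp (HomC M (P0 Q (P0 P X)) (P0 Q (P0 P X)))
        (far (P1 Q (P0 P X) (P0 P X)) (PU P X)) (PU Q (P0 P X)))\<rparr>"

definition fun_cat :: "('o, 'a) cat \<Rightarrow> ('p, 'b) cat
    \<Rightarrow> (('o, 'a, 'p, 'b) functr, ('o, 'a, 'p, 'b) nattr) cat" where
  "fun_cat C D = \<lparr>Ob = {F. is_functor C D F}, Ar = {\<alpha>. is_nat C D \<alpha>},
     Dom = nsrc, Cod = ntgt, Idt = id_nat C D, Comp = vcomp C D\<rparr>"

definition Cat2 ::
  "(('x, 'a) cat, ('x, 'a, 'x, 'a) functr, ('x, 'a, 'x, 'a) nattr) twocat" where
  "Cat2 = \<lparr>Obj = {C. category C}, HomC = fun_cat, Id1 = id_fun,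
     Cmp = (\<lambda>C D E. \<lparr>
       fob = (\<lambda>(G, F) \<in> {G. is_functor D E G} \<times> {F. is_functor C D F}. fcomp C G F),
       far = (\<lambda>(\<beta>, \<alpha>) \<in> {\<beta>. is_nat D E \<beta>} \<times> {\<alpha>. is_nat C D \<alpha>}. hcomp C E \<beta> \<alpha>)\<rparr>)\<rparr>"

text \<open>
  The representable \<open>Mor(Z, -) : K \<rightarrow> Cat\<close>.  The contravariant \<open>Mor(-, Z)\<close> is
  \<open>hom_psfun (op2 K) Z\<close>.
\<close>

definition hom_psfun :: "('o, 'm, 'c) twocat \<Rightarrow> 'o
    \<Rightarrow> ('o, 'm, 'c, ('m, 'c) cat, ('m, 'c, 'm, 'c) functr, ('m, 'c, 'm, 'c) nattr) psfun" where
  "hom_psfun K Z =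
    (let post = (\<lambda>X Y f. \<lparr>fob = (\<lambda>h\<in>Ob (HomC K Z X). cmp1 K Z X Y f h),
                         far = (\<lambda>\<theta>\<in>Ar (HomC K Z X). cmp2 K Z X Y (id2 K X Y f) \<theta>)\<rparr>)
     in \<lparr>P0 = (\<lambda>X. HomC K Z X),
         P1 = (\<lambda>X Y. \<lparr>
           fob = (\<lambda>f\<in>Ob (HomC K X Y). post X Y f),
           far = (\<lambda>\<alpha>\<in>Ar (HomC K X Y). \<lparr>
             nsrc = post X Y (Dom (HomC K X Y) \<alpha>), ntgt = post X Y (Cod (HomC K X Y) \<alpha>),
             ncomp = (\<lambda>h\<in>Ob (HomC K Z X). cmp2 K Z X Y \<alpha> (id2 K Z X h))\<rparr>)\<rparr>),
         PC = (\<lambda>X Y W g f. id_nat (HomC K Z X) (HomC K Z W) (post X W (cmp1 K X Y W g f))),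
         PU = (\<lambda>X. id_nat (HomC K Z X) (HomC K Z X) (post X X (Id1 K X)))\<rparr>)"

text \<open>
  \<open>E\<close> with the invertible 2-cells \<open>\<tau> f : Q f \<circ> E \<Rightarrow> E \<circ> P f\<close> is a pseudo natural transformation
  between the \<open>Cat\<close>-valued pseudo functors \<open>P\<close> and \<open>Q\<close>.  The values of \<open>P\<close> and of \<open>Q\<close> are allowed
  to have different HOL types, which is needed to compare hom-categories of two 2-categories.
\<close>

definition pseudo_natural :: "('o, 'm, 'c) twocat
    \<Rightarrow> ('o, 'm, 'c, ('x, 'a) cat, ('x, 'a, 'x, 'a) functr, ('x, 'a, 'x, 'a) nattr) psfun
    \<Rightarrow> ('o, 'm, 'c, ('y, 'b) cat, ('y, 'b, 'y, 'b) functr, ('y, 'b, 'y, 'b) nattr) psfun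
    \<Rightarrow> ('o \<Rightarrow> ('x, 'a, 'y, 'b) functr) \<Rightarrow> ('o \<Rightarrow> 'o \<Rightarrow> 'm \<Rightarrow> ('x, 'a, 'y, 'b) nattr) \<Rightarrow> bool" where
  "pseudo_natural K P Q E \<tau> \<longleftrightarrow>
     (\<forall>X\<in>Obj K. is_functor (P0 P X) (P0 Q X) (E X)) \<and>
     (\<forall>X\<in>Obj K. \<forall>Y\<in>Obj K. \<forall>f\<in>Ob (HomC K X Y).
        nat_iso (P0 P X) (P0 Q Y) (\<tau> X Y f)
          (fcomp (P0 P X) (fob (P1 Q X Y) f) (E X)) (fcomp (P0 P X) (E Y) (fob (P1 P X Y) f))) \<and>
     (\<forall>X\<in>Obj K. \<forall>Y\<in>Obj K. \<forall>\<alpha>\<in>Ar (HomC K X Y).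
        vcomp (P0 P X) (P0 Q Y) (\<tau> X Y (Cod (HomC K X Y) \<alpha>))
          (hcomp (P0 P X) (P0 Q Y) (far (P1 Q X Y) \<alpha>) (id_nat (P0 P X) (P0 Q X) (E X)))
        = vcomp (P0 P X) (P0 Q Y)
          (hcomp (P0 P X) (P0 Q Y) (id_nat (P0 P Y) (P0 Q Y) (E Y)) (far (P1 P X Y) \<alpha>))
          (\<tau> X Y (Dom (HomC K X Y) \<alpha>))) \<and>
     (\<forall>X\<in>Obj K. \<forall>Y\<in>Obj K. \<forall>Z\<in>Obj K. \<forall>f\<in>Ob (HomC K X Y). \<forall>g\<in>Ob (HomC K Y Z).
        vcomp (P0 P X) (P0 Q Z) (\<tau> X Z (cmp1 K X Y Z g f))
          (hcomp (P0 P X) (P0 Q Z) (PC Q X Y Z g f) (id_nat (P0 P X) (P0 Q X) (E X)))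
        = vcomp (P0 P X) (P0 Q Z)
          (hcomp (P0 P X) (P0 Q Z) (id_nat (P0 P Z) (P0 Q Z) (E Z)) (PC P X Y Z g f))
          (vcomp (P0 P X) (P0 Q Z)
            (hcomp (P0 P X) (P0 Q Z) (\<tau> Y Z g) (id_nat (P0 P X) (P0 P Y) (fob (P1 P X Y) f)))
            (hcomp (P0 P X) (P0 Q Z) (id_nat (P0 Q Y) (P0 Q Z) (fob (P1 Q Y Z) g)) (\<tau> X Y f)))) \<and>
     (\<forall>X\<in>Obj K.
        vcomp (P0 P X) (P0 Q X) (\<tau> X X (Id1 K X))
          (hcomp (P0 P X) (P0 Q X) (PU Q X) (id_nat (P0 P X) (P0 Q X) (E X)))
        = hcomp (P0 P X) (P0 Q X) (id_nat (P0 P X) (P0 Q X) (E X)) (PU P X))"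

text \<open>
  \<open>F : K \<rightarrow> L\<close> is a left biadjoint for \<open>G : L \<rightarrow> K\<close>.  The last two clauses compare
  \<open>Mor(F X, -)\<close> with \<open>Mor(X, G -)\<close> for fixed \<open>X\<close>, and \<open>Mor(F -, A)\<close> with \<open>Mor(-, G A)\<close> for
  fixed \<open>A\<close>.
\<close>

definition left_biadjoint :: "('o, 'm, 'c) twocat \<Rightarrow> ('p, 'n, 'd) twocat
    \<Rightarrow> ('p, 'n, 'd, 'o, 'm, 'c) psfun \<Rightarrow> ('o, 'm, 'c, 'p, 'n, 'd) psfun \<Rightarrow> bool" where
  "left_biadjoint K L G F \<longleftrightarrow> pseudo_functor L K G \<and> pseudo_functor K L F \<and>
     (\<exists>E. (\<forall>X\<in>Obj K. \<forall>A\<in>Obj L.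
             equivalence (HomC L (P0 F X) A) (HomC K X (P0 G A)) (E X A)) \<and>
          (\<forall>X\<in>Obj K. \<exists>\<tau>. pseudo_natural L
             (hom_psfun L (P0 F X)) (psfun_comp L Cat2 (hom_psfun K X) G) (\<lambda>A. E X A) \<tau>) \<and>
          (\<forall>A\<in>Obj L. \<exists>\<sigma>. pseudo_natural (op2 K)
             (psfun_comp (op2 K) Cat2 (hom_psfun (op2 L) A) (op_psfun F))
             (hom_psfun (op2 K) (P0 G A)) (\<lambda>X. E X A) \<sigma>))"

section \<open>Theories\<close>

text \<open>
  Arities and indices are counted from \<open>0\<close>: \<open>Pr T n i\<close> (for \<open>i < n\<close>) is the projection called
  \<open>pr\<^sub>i\<^sub>+\<^sub>1 : n \<rightarrow> 1\<close> on paper.  A function \<open>f : {1..k} \<rightarrow> {1..l}\<close> is given by the list of its values,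
  a list of length \<open>k\<close> with entries \<open>< l\<close>, together with \<open>l\<close>.
\<close>

record 't thry = "(nat, 't) cat" +
  Pr :: "nat \<Rightarrow> nat \<Rightarrow> 't"

definition is_theory :: "'t thry \<Rightarrow> bool" where
  "is_theory T \<longleftrightarrow> category T \<and> Ob T = UNIV \<and> (\<forall>n. \<forall>i<n. Pr T n i \<in> hom T n 1) \<and>
     (\<forall>m vs. set vs \<subseteq> hom T m 1 \<longrightarrow>
        (\<exists>!u. u \<in> hom T m (length vs) \<and> (\<forall>i<length vs. Comp T (Pr T (length vs) i) u = vs ! i)))"

definition theory_morphism :: "'s thry \<Rightarrow> 't thry \<Rightarrow> (nat, 's, nat, 't) functr \<Rightarrow> bool" where
  "theory_morphism S T \<phi> \<longleftrightarrow> is_functor S T \<phi> \<and> (\<forall>n. fob \<phi> n = n) \<and>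
     (\<forall>n. \<forall>i<n. far \<phi> (Pr S n i) = Pr T n i)"

text \<open>The words of all arities; the arity of a word \<open>w\<close> is \<open>Dom T w\<close>.\<close>

definition words :: "'t thry \<Rightarrow> 't set" where
  "words T = {w \<in> Ar T. Cod T w = 1}"

definition tuple :: "'t thry \<Rightarrow> nat \<Rightarrow> 't list \<Rightarrow> 't" where
  "tuple T m vs = (THE u. u \<in> hom T m (length vs) \<and>
     (\<forall>i<length vs. Comp T (Pr T (length vs) i) u = vs ! i))"

text \<open>\<open>w\<^sub>f = w \<circ> f'\<close>\<close>

definition subst_word :: "'t thry \<Rightarrow> 't \<Rightarrow> nat \<Rightarrow> nat list \<Rightarrow> 't" where
  "subst_word T w l f = Comp T w (tuple T l (map (Pr T l) f))"

text \<open>\<open>block ns i\<close>: the inclusion of the \<open>i\<close>-th block into \<open>n\<^sub>0 + \<dots> + n\<^sub>k\<^sub>-\<^sub>1\<close>.\<close>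

definition block :: "nat list \<Rightarrow> nat \<Rightarrow> nat list" where
  "block ns i = [sum_list (take i ns) ..< sum_list (take i ns) + ns ! i]"

definition gamma_word :: "'t thry \<Rightarrow> 't \<Rightarrow> 't list \<Rightarrow> 't" where
  "gamma_word T w ws =
    (let ns = map (Dom T) ws; m = sum_list ns
     in Comp T w (tuple T m (map (\<lambda>i. subst_word T (ws ! i) m (block ns i)) [0..<length ws])))"

definition unit_word :: "'t thry \<Rightarrow> 't" where
  "unit_word T = Pr T 1 0"

text \<open>
  For \<open>f\<close> with values \<open>< length ns\<close>, the map that carries the \<open>i\<close>-th block (of size
  \<open>ns ! (f ! i)\<close>) identically onto the \<open>f ! i\<close>-th block of \<open>ns\<close>.
\<close>

definition block_map :: "nat list \<Rightarrow> nat list \<Rightarrow> nat list" where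
  "block_map ns f = concat (map (block ns) f)"

text \<open>The block sum of the \<open>gs ! i\<close>, where \<open>ns' ! i\<close> is the size of the codomain of \<open>gs ! i\<close>.\<close>

definition block_sum :: "nat list \<Rightarrow> nat list list \<Rightarrow> nat list" where
  "block_sum ns' gs =
     concat (map (\<lambda>i. map (\<lambda>j. sum_list (take i ns') + j) (gs ! i)) [0..<length gs])"

definition cwords :: "'t thry \<Rightarrow> ('t \<times> 't list) set" where
  "cwords T = {(w, ws). w \<in> words T \<and> set ws \<subseteq> words T \<and> length ws = Dom T w}"

definition swords :: "'t thry \<Rightarrow> ('t \<times> nat \<times> nat list) set" where
  "swords T = {(w, l, f). w \<in> words T \<and> length f = Dom T w \<and> set f \<subseteq> {..<l}}"

section \<open>The theory of endofunctors of a category\<close>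

text \<open>The power \<open>C\<^sup>n\<close>, with tuples represented as lists.\<close>

definition pow_cat :: "('o, 'a) cat \<Rightarrow> nat \<Rightarrow> ('o list, 'a list) cat" where
  "pow_cat C n = \<lparr>Ob = {xs. length xs = n \<and> set xs \<subseteq> Ob C},
     Ar = {fs. length fs = n \<and> set fs \<subseteq> Ar C},
     Dom = map (Dom C), Cod = map (Cod C), Idt = map (Idt C), Comp = map2 (Comp C)\<rparr>"

definition pow_fun :: "('o, 'a) cat \<Rightarrow> nat \<Rightarrow> ('o, 'a, 'p, 'b) functr
    \<Rightarrow> ('o list, 'a list, 'p list, 'b list) functr" where
  "pow_fun C n F = \<lparr>fob = (\<lambda>xs\<in>Ob (pow_cat C n). map (fob F) xs),
     far = (\<lambda>fs\<in>Ar (pow_cat C n). map (far F) fs)\<rparr>"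

definition pow_nat :: "('o, 'a) cat \<Rightarrow> nat \<Rightarrow> ('o, 'a, 'p, 'b) nattr
    \<Rightarrow> ('o list, 'a list, 'p list, 'b list) nattr" where
  "pow_nat C n \<alpha> = \<lparr>nsrc = pow_fun C n (nsrc \<alpha>), ntgt = pow_fun C n (ntgt \<alpha>),
     ncomp = (\<lambda>xs\<in>Ob (pow_cat C n). map (ncomp \<alpha>) xs)\<rparr>"

fun blocks :: "nat list \<Rightarrow> 'a list \<Rightarrow> 'a list list" where
  "blocks [] xs = []"
| "blocks (n # ns) xs = take n xs # blocks ns (drop n xs)"

text \<open>
  \<open>F\<^sub>1 \<times> \<dots> \<times> F\<^sub>k : C\<^sup>n \<rightarrow> D\<^sup>k\<close> for \<open>F\<^sub>i : C\<^bsup>ns ! i\<^esup> \<rightarrow> D\<close> and \<open>n = sum_list ns\<close>, and likewise for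
  natural transformations.
\<close>

definition prod_fun :: "('o, 'a) cat \<Rightarrow> nat list \<Rightarrow> ('o list, 'a list, 'p, 'b) functr list
    \<Rightarrow> ('o list, 'a list, 'p list, 'b list) functr" where
  "prod_fun C ns Fs = \<lparr>
     fob = (\<lambda>xs\<in>Ob (pow_cat C (sum_list ns)). map2 fob Fs (blocks ns xs)),
     far = (\<lambda>fs\<in>Ar (pow_cat C (sum_list ns)). map2 far Fs (blocks ns fs))\<rparr>"

definition prod_nat :: "('o, 'a) cat \<Rightarrow> nat list \<Rightarrow> ('o list, 'a list, 'p, 'b) nattr list
    \<Rightarrow> ('o list, 'a list, 'p list, 'b list) nattr" where
  "prod_nat C ns \<alpha>s = \<lparr>
     nsrc = prod_fun C ns (map nsrc \<alpha>s), ntgt = prod_fun C ns (map ntgt \<alpha>s),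
     ncomp = (\<lambda>xs\<in>Ob (pow_cat C (sum_list ns)). map2 ncomp \<alpha>s (blocks ns xs))\<rparr>"

definition gamma_fun :: "('o, 'a) cat \<Rightarrow> nat list \<Rightarrow> ('o list, 'a list, 'o, 'a) functr
    \<Rightarrow> ('o list, 'a list, 'o, 'a) functr list \<Rightarrow> ('o list, 'a list, 'o, 'a) functr" where
  "gamma_fun C ns F Fs = fcomp (pow_cat C (sum_list ns)) F (prod_fun C ns Fs)"

definition gamma_nat :: "('o, 'a) cat \<Rightarrow> nat list \<Rightarrow> ('o list, 'a list, 'o, 'a) nattr
    \<Rightarrow> ('o list, 'a list, 'o, 'a) nattr list \<Rightarrow> ('o list, 'a list, 'o, 'a) nattr" where
  "gamma_nat C ns \<alpha> \<alpha>s = hcomp (pow_cat C (sum_list ns)) C \<alpha> (prod_nat C ns \<alpha>s)"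

text \<open>The functor \<open>C\<^sup>l \<rightarrow> C\<^sup>k\<close> induced by \<open>f : {1..k} \<rightarrow> {1..l}\<close>, and \<open>F\<^sub>f\<close> and \<open>\<alpha>\<^sub>f\<close>.\<close>

definition reindex_fun :: "('o, 'a) cat \<Rightarrow> nat \<Rightarrow> nat list
    \<Rightarrow> ('o list, 'a list, 'o list, 'a list) functr" where
  "reindex_fun C l f = \<lparr>fob = (\<lambda>xs\<in>Ob (pow_cat C l). map ((!) xs) f),
     far = (\<lambda>gs\<in>Ar (pow_cat C l). map ((!) gs) f)\<rparr>"

definition subst_fun :: "('o, 'a) cat \<Rightarrow> ('o list, 'a list, 'p, 'b) functr \<Rightarrow> nat \<Rightarrow> nat list
    \<Rightarrow> ('o list, 'a list, 'p, 'b) functr" where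
  "subst_fun C F l f = fcomp (pow_cat C l) F (reindex_fun C l f)"

definition subst_nat :: "('o, 'a) cat \<Rightarrow> ('p, 'b) cat \<Rightarrow> ('o list, 'a list, 'p, 'b) nattr
    \<Rightarrow> nat \<Rightarrow> nat list \<Rightarrow> ('o list, 'a list, 'p, 'b) nattr" where
  "subst_nat C D \<alpha> l f = hcomp (pow_cat C l) D \<alpha>
     (id_nat (pow_cat C l) (pow_cat C (length f)) (reindex_fun C l f))"

text \<open>The identity functor of \<open>C\<close>, regarded as a functor \<open>C\<^sup>1 \<rightarrow> C\<close>.\<close>

definition unit_fun :: "('o, 'a) cat \<Rightarrow> ('o list, 'a list, 'o, 'a) functr" where
  "unit_fun C = \<lparr>fob = (\<lambda>xs\<in>Ob (pow_cat C 1). hd xs), far = (\<lambda>fs\<in>Ar (pow_cat C 1). hd fs)\<rparr>"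

section \<open>Pseudo algebras\<close>

record ('t, 'o, 'a) psalg =
  Car :: "('o, 'a) cat"
  Phi :: "'t \<Rightarrow> ('o list, 'a list, 'o, 'a) functr"
  CC :: "'t \<times> 't list \<Rightarrow> ('o list, 'a list, 'o, 'a) nattr"
  II :: "('o list, 'a list, 'o, 'a) nattr"
  SS :: "'t \<times> nat \<times> nat list \<Rightarrow> ('o list, 'a list, 'o, 'a) nattr"

abbreviation i_Phi :: "'t thry \<Rightarrow> ('t, 'o, 'a) psalg \<Rightarrow> 't
    \<Rightarrow> ('o list, 'a list, 'o, 'a) nattr" where
  "i_Phi T X w \<equiv> id_nat (pow_cat (Car X) (Dom T w)) (Car X) (Phi X w)"

definition is_psalg :: "'t thry \<Rightarrow> ('t, 'o, 'a) psalg \<Rightarrow> bool" where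
  "is_psalg T X \<longleftrightarrow>
    (let C = Car X; ar = Dom T; \<Phi> = Phi X; c = CC X; s = SS X; i = i_Phi T X;
         \<gamma> = gamma_word T; one = unit_word T;
         ars = (\<lambda>ws. map ar ws);
         Cpow = (\<lambda>n. pow_cat C n)
     in category C \<and> extensional_cat C \<and>
     \<Phi> \<in> extensional (words T) \<and> (\<forall>w\<in>words T. is_functor (Cpow (ar w)) C (\<Phi> w)) \<and>
     c \<in> extensional (cwords T) \<and>
     (\<forall>(w, ws)\<in>cwords T. nat_iso (Cpow (sum_list (ars ws))) C (c (w, ws))
        (\<Phi> (\<gamma> w ws)) (gamma_fun C (ars ws) (\<Phi> w) (map \<Phi> ws))) \<and>
     nat_iso (Cpow 1) C (II X) (\<Phi> one) (unit_fun C) \<and>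
     s \<in> extensional (swords T) \<and>
     (\<forall>(w, l, f)\<in>swords T. nat_iso (Cpow l) C (s (w, l, f))
        (\<Phi> (subst_word T w l f)) (subst_fun C (\<Phi> w) l f)) \<and>
     (\<forall>(w, ws)\<in>cwords T. \<forall>wss. length wss = length ws \<and>
          (\<forall>j<length ws. (ws ! j, wss ! j) \<in> cwords T) \<longrightarrow>
        (let ns = ars (concat wss); N = Cpow (sum_list ns)
         in vcomp N C (gamma_nat C ns (c (w, ws)) (map i (concat wss))) (c (\<gamma> w ws, concat wss))
          = vcomp N C
              (gamma_nat C (map (\<lambda>vs. sum_list (ars vs)) wss) (i w)
                 (map2 (\<lambda>v vs. c (v, vs)) ws wss))
              (c (w, map2 \<gamma> ws wss)))) \<and>
     (\<forall>w\<in>words T. let k = ar w in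
        vcomp (Cpow k) C (gamma_nat C (replicate k 1) (i w) (replicate k (II X)))
          (c (w, replicate k one)) = i w) \<and>
     (\<forall>w\<in>words T.
        vcomp (Cpow (ar w)) C (gamma_nat C [ar w] (II X) [i w]) (c (one, [w])) = i w) \<and>
     (\<forall>(w, l, f)\<in>swords T. \<forall>ws. length ws = l \<and> set ws \<subseteq> words T \<longrightarrow>
        (let n = sum_list (ars ws); N = Cpow n; wsf = map ((!) ws) f; fb = block_map (ars ws) f
         in vcomp N C (subst_nat C C (c (w, wsf)) n fb) (s (\<gamma> w wsf, n, fb))
          = vcomp N C (gamma_nat C (ars ws) (s (w, l, f)) (map i ws))
              (c (subst_word T w l f, ws)))) \<and>
     (\<forall>(w, ws)\<in>cwords T. \<forall>ns' gs. length ns' = length ws \<and> length gs = length ws \<and>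
          (\<forall>j<length ws. (ws ! j, ns' ! j, gs ! j) \<in> swords T) \<longrightarrow>
        (let n' = sum_list ns'; N = Cpow n'; g = block_sum ns' gs
         in vcomp N C (subst_nat C C (c (w, ws)) n' g) (s (\<gamma> w ws, n', g))
          = vcomp N C
              (gamma_nat C ns' (i w) (map (\<lambda>j. s (ws ! j, ns' ! j, gs ! j)) [0..<length ws]))
              (c (w, map (\<lambda>j. subst_word T (ws ! j) (ns' ! j) (gs ! j)) [0..<length ws])))) \<and>
     (\<forall>(w, l, f)\<in>swords T. \<forall>m g. length g = l \<and> set g \<subseteq> {..<m} \<longrightarrow>
        vcomp (Cpow m) C (subst_nat C C (s (w, l, f)) m g) (s (subst_word T w l f, m, g))
          = s (w, m, map ((!) g) f)) \<and>
     (\<forall>w\<in>words T. s (w, ar w, [0..<ar w]) = i w))"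

section \<open>Morphisms and 2-cells of pseudo algebras\<close>

record ('t, 'o, 'a, 'p, 'b) psmor =
  Fn :: "('o, 'a, 'p, 'b) functr"
  Rho :: "'t \<Rightarrow> ('o list, 'a list, 'p, 'b) nattr"

definition is_psmor :: "'t thry \<Rightarrow> ('t, 'o, 'a) psalg \<Rightarrow> ('t, 'p, 'b) psalg
    \<Rightarrow> ('t, 'o, 'a, 'p, 'b) psmor \<Rightarrow> bool" where
  "is_psmor T X Y H \<longleftrightarrow>
    (let C = Car X; D = Car Y; ar = Dom T; \<rho> = Rho H; iH = id_nat C D (Fn H);
         iHpow = (\<lambda>n. id_nat (pow_cat C n) (pow_cat D n) (pow_fun C n (Fn H)))
     in is_functor C D (Fn H) \<and> \<rho> \<in> extensional (words T) \<and>
     (\<forall>w\<in>words T. nat_iso (pow_cat C (ar w)) D (\<rho> w)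
        (fcomp (pow_cat C (ar w)) (Fn H) (Phi X w))
        (fcomp (pow_cat C (ar w)) (Phi Y w) (pow_fun C (ar w) (Fn H)))) \<and>
     (\<forall>(w, ws)\<in>cwords T.
        (let ns = map ar ws; n = sum_list ns; N = pow_cat C n
         in vcomp N D (hcomp N D (CC Y (w, ws)) (iHpow n)) (\<rho> (gamma_word T w ws))
          = vcomp N D (hcomp N D (i_Phi T Y w) (prod_nat C ns (map \<rho> ws)))
              (vcomp N D
                (hcomp N D (\<rho> w)
                  (id_nat N (pow_cat C (length ws)) (prod_fun C ns (map (Phi X) ws))))
                (hcomp N D iH (CC X (w, ws)))))) \<and>
     vcomp (pow_cat C 1) D (hcomp (pow_cat C 1) D (II Y) (iHpow 1)) (\<rho> (unit_word T))
       = hcomp (pow_cat C 1) D iH (II X) \<and>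
     (\<forall>(w, l, f)\<in>swords T.
        vcomp (pow_cat C l) D (hcomp (pow_cat C l) D (SS Y (w, l, f)) (iHpow l))
          (\<rho> (subst_word T w l f))
        = vcomp (pow_cat C l) D (subst_nat C D (\<rho> w) l f)
          (hcomp (pow_cat C l) D iH (SS X (w, l, f)))))"

definition psmor_id :: "'t thry \<Rightarrow> ('t, 'o, 'a) psalg \<Rightarrow> ('t, 'o, 'a, 'o, 'a) psmor" where
  "psmor_id T X = \<lparr>Fn = id_fun (Car X), Rho = (\<lambda>w\<in>words T. i_Phi T X w)\<rparr>"

text \<open>The composite of \<open>G : X \<rightarrow> Y\<close> and \<open>H : Y \<rightarrow> Z\<close>.\<close>

definition psmor_comp :: "'t thry \<Rightarrow> ('t, 'o, 'a) psalg \<Rightarrow> ('t, 'p, 'b) psalg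
    \<Rightarrow> ('t, 'q, 'c) psalg \<Rightarrow> ('t, 'p, 'b, 'q, 'c) psmor \<Rightarrow> ('t, 'o, 'a, 'p, 'b) psmor
    \<Rightarrow> ('t, 'o, 'a, 'q, 'c) psmor" where
  "psmor_comp T X Y Z H G = \<lparr>Fn = fcomp (Car X) (Fn H) (Fn G),
     Rho = (\<lambda>w\<in>words T. let n = Dom T w; N = pow_cat (Car X) n in
       vcomp N (Car Z)
         (hcomp N (Car Z) (Rho H w) (id_nat N (pow_cat (Car Y) n) (pow_fun (Car X) n (Fn G))))
         (hcomp N (Car Z) (id_nat (Car Y) (Car Z) (Fn H)) (Rho G w)))\<rparr>"

record ('t, 'o, 'a, 'p, 'b) pscell =
  Src :: "('t, 'o, 'a, 'p, 'b) psmor"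
  Tgt :: "('t, 'o, 'a, 'p, 'b) psmor"
  Nt :: "('o, 'a, 'p, 'b) nattr"

definition is_pscell :: "'t thry \<Rightarrow> ('t, 'o, 'a) psalg \<Rightarrow> ('t, 'p, 'b) psalg
    \<Rightarrow> ('t, 'o, 'a, 'p, 'b) pscell \<Rightarrow> bool" where
  "is_pscell T X Y \<alpha> \<longleftrightarrow> is_psmor T X Y (Src \<alpha>) \<and> is_psmor T X Y (Tgt \<alpha>) \<and>
     is_nat (Car X) (Car Y) (Nt \<alpha>) \<and> nsrc (Nt \<alpha>) = Fn (Src \<alpha>) \<and> ntgt (Nt \<alpha>) = Fn (Tgt \<alpha>) \<and>
     (\<forall>w\<in>words T. let n = Dom T w; N = pow_cat (Car X) n in
        vcomp N (Car Y) (Rho (Tgt \<alpha>) w) (hcomp N (Car Y) (Nt \<alpha>) (i_Phi T X w))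
        = vcomp N (Car Y) (hcomp N (Car Y) (i_Phi T Y w) (pow_nat (Car X) n (Nt \<alpha>)))
            (Rho (Src \<alpha>) w))"

definition psalg_hom :: "'t thry \<Rightarrow> ('t, 'o, 'a) psalg \<Rightarrow> ('t, 'p, 'b) psalg
    \<Rightarrow> (('t, 'o, 'a, 'p, 'b) psmor, ('t, 'o, 'a, 'p, 'b) pscell) cat" where
  "psalg_hom T X Y = \<lparr>Ob = {H. is_psmor T X Y H}, Ar = {\<alpha>. is_pscell T X Y \<alpha>},
     Dom = Src, Cod = Tgt,
     Idt = (\<lambda>H. \<lparr>Src = H, Tgt = H, Nt = id_nat (Car X) (Car Y) (Fn H)\<rparr>),
     Comp = (\<lambda>\<beta> \<alpha>. \<lparr>Src = Src \<alpha>, Tgt = Tgt \<beta>, Nt = vcomp (Car X) (Car Y) (Nt \<beta>) (Nt \<alpha>)\<rparr>)\<rparr>"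

text \<open>
  The 2-category of small pseudo \<open>T\<close>-algebras.  The type \<open>'u\<close> plays the role of the universe of
  sets: objects and arrows of small categories are elements of \<open>'u\<close>, and a set is small if it has
  strictly fewer elements than \<open>'u\<close>.  (A Grothendieck universe \<open>V\<^sub>\<kappa>\<close> has \<open>\<kappa>\<close> elements, and its
  elements are exactly its subsets of cardinality less than \<open>\<kappa>\<close>.)
\<close>

definition PsAlg :: "'t thry \<Rightarrow> (('t, 'u, 'u) psalg, ('t, 'u, 'u, 'u, 'u) psmor,
    ('t, 'u, 'u, 'u, 'u) pscell) twocat" where
  "PsAlg T = \<lparr>
     Obj = {X. is_psalg T X \<and>
       Ob (Car X) \<prec> (UNIV :: 'u set) \<and> Ar (Car X) \<prec> (UNIV :: 'u set)},
     HomC = psalg_hom T,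
     Id1 = psmor_id T,
     Cmp = (\<lambda>X Y Z. \<lparr>
       fob = (\<lambda>(H, G) \<in> Ob (psalg_hom T Y Z) \<times> Ob (psalg_hom T X Y). psmor_comp T X Y Z H G),
       far = (\<lambda>(\<beta>, \<alpha>) \<in> Ar (psalg_hom T Y Z) \<times> Ar (psalg_hom T X Y).
         \<lparr>Src = psmor_comp T X Y Z (Src \<beta>) (Src \<alpha>), Tgt = psmor_comp T X Y Z (Tgt \<beta>) (Tgt \<alpha>),
          Nt = hcomp (Car X) (Car Z) (Nt \<beta>) (Nt \<alpha>)\<rparr>)\<rparr>)\<rparr>"

section \<open>The forgetful 2-functor\<close>

definition forget_alg :: "'s thry \<Rightarrow> (nat, 's, nat, 't) functr
    \<Rightarrow> ('t, 'o, 'a) psalg \<Rightarrow> ('s, 'o, 'a) psalg" where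
  "forget_alg S \<phi> X = \<lparr>Car = Car X,
     Phi = (\<lambda>w\<in>words S. Phi X (far \<phi> w)),
     CC = (\<lambda>(w, ws)\<in>cwords S. CC X (far \<phi> w, map (far \<phi>) ws)),
     II = II X,
     SS = (\<lambda>(w, l, f)\<in>swords S. SS X (far \<phi> w, l, f))\<rparr>"

definition forget_mor :: "'s thry \<Rightarrow> (nat, 's, nat, 't) functr
    \<Rightarrow> ('t, 'o, 'a, 'p, 'b) psmor \<Rightarrow> ('s, 'o, 'a, 'p, 'b) psmor" where
  "forget_mor S \<phi> H = \<lparr>Fn = Fn H, Rho = (\<lambda>w\<in>words S. Rho H (far \<phi> w))\<rparr>"

definition forget_cell :: "'s thry \<Rightarrow> (nat, 's, nat, 't) functr
    \<Rightarrow> ('t, 'o, 'a, 'p, 'b) pscell \<Rightarrow> ('s, 'o, 'a, 'p, 'b) pscell" where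
  "forget_cell S \<phi> \<alpha> = \<lparr>Src = forget_mor S \<phi> (Src \<alpha>), Tgt = forget_mor S \<phi> (Tgt \<alpha>), Nt = Nt \<alpha>\<rparr>"

definition forgetful :: "'s thry \<Rightarrow> 't thry \<Rightarrow> (nat, 's, nat, 't) functr
    \<Rightarrow> (('t, 'u, 'u) psalg, ('t, 'u, 'u, 'u, 'u) psmor, ('t, 'u, 'u, 'u, 'u) pscell,
        ('s, 'u, 'u) psalg, ('s, 'u, 'u, 'u, 'u) psmor, ('s, 'u, 'u, 'u, 'u) pscell) psfun" where
  "forgetful S T \<phi> = \<lparr>
     P0 = forget_alg S \<phi>,
     P1 = (\<lambda>X Y. \<lparr>fob = (\<lambda>H\<in>Ob (psalg_hom T X Y). forget_mor S \<phi> H),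
                  far = (\<lambda>\<alpha>\<in>Ar (psalg_hom T X Y). forget_cell S \<phi> \<alpha>)\<rparr>),
     PC = (\<lambda>X Y Z H G. id2 (PsAlg S) (forget_alg S \<phi> X) (forget_alg S \<phi> Z)
        (forget_mor S \<phi> (psmor_comp T X Y Z H G))),
     PU = (\<lambda>X. id2 (PsAlg S) (forget_alg S \<phi> X) (forget_alg S \<phi> X)
        (forget_mor S \<phi> (psmor_id T X)))\<rparr>"

end

theory Submission
  imports Defs
begin

text \<open>
  The left biadjoint is built from universal arrows.  For a pseudo \<open>S\<close>-algebra \<open>X\<close>, the objects of
  the free pseudo \<open>T\<close>-algebra \<open>F X\<close> are the formal terms built from objects of \<open>X\<close> with words of \<open>T\<close>.
  Its arrows are formal expressions in the arrows of \<open>X\<close>, the coherence isomorphisms and the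
  isomorphisms that turn \<open>\<eta> : X \<rightarrow> U (F X)\<close> into a morphism.  Two parallel expressions are identified
  when they have the same value in every model, a model being a morphism from \<open>X\<close> to \<open>U A\<close>, so that
  each axiom of a pseudo algebra holds in \<open>F X\<close> because it holds in every \<open>A\<close>.

  Evaluation extends a model to a morphism \<open>F X \<rightarrow> A\<close> whose isomorphisms \<open>\<rho>\<close> are identities, and it is
  the only such strict extension.  A 2-cell between restrictions along \<open>\<eta>\<close> lifts uniquely by
  recursion on terms, since a 2-cell is determined at \<open>w(t\<^sub>1, \<dots>, t\<^sub>n)\<close> by its components at the
  \<open>t\<^sub>i\<close>.  Hence restriction along \<open>\<eta>\<close> is an equivalence which is surjective on objects, and choosing
  the strict extensions as inverse images makes \<open>F\<close> a strict 2-functor.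
\<close>

text \<open>The obstacle is size. Objects and arrows of a small algebra are elements of the single
  type \<open>'u\<close>, and there must be strictly fewer of them than elements of
  \<open>'u\<close>; so the free algebra has to be coded back into \<open>'u\<close>. Terms and
  expressions are finite trees, and there are at most as many of them as elements of any infinite
  set into which the labels of their nodes inject. Such a set is assembled from a countable set, the
  objects and arrows of \<open>X\<close> and the words of both theories. Uncountability of
  \<open>'u\<close> makes the countable part small, and finitely many sets smaller than an infinite
  set have a union smaller than it.

  Distinct terms may have the same value in a model. Therefore parallelism of two expressions is a
  condition on their sources and targets as terms, kept apart from equality of values.

  Arbitrary extensions along \<eta> are unique up to isomorphism only. Strict morphisms contain the
  identities and are closed under composition, so both candidates for the value of \<open>F\<close>
  on a composite are strict with one and the same restriction, hence equal.\<close>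

lemma hom_Ar: "f \<in> hom C x y ==> f \<in> Ar C"
  and hom_Dom: "f \<in> hom C x y ==> Dom C f = x"
  and hom_Cod: "f \<in> hom C x y ==> Cod C f = y" by (simp_all add: hom_def)

lemma Ar_hom: "f \<in> Ar C ==> f \<in> hom C (Dom C f) (Cod C f)" by (simp add: hom_def)

lemma cat_Dom: "category C ==> f \<in> Ar C ==> Dom C f \<in> Ob C"
  and cat_Cod: "category C ==> f \<in> Ar C ==> Cod C f \<in> Ob C" by (simp_all add: category_def)

lemma hom_Ob_Dom: "category C ==> f \<in> hom C x y ==> x \<in> Ob C"
  and hom_Ob_Cod: "category C ==> f \<in> hom C x y ==> y \<in> Ob C" by (auto simp: category_def hom_def)

lemma cat_id: "category C ==> x \<in> Ob C ==> Idt C x \<in> hom C x x" by (simp add: category_def)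

lemma cat_comp:
  assumes "category C" "f \<in> hom C x y" "g \<in> hom C y z"
  shows "Comp C g f \<in> hom C x z" using assms by (auto simp: category_def hom_def)

lemma cat_assoc:
  assumes "category C" "f \<in> hom C a b" "g \<in> hom C b c" "h \<in> hom C c d"
  shows "Comp C h (Comp C g f) = Comp C (Comp C h g) f" using assms by (simp add: category_def hom_def)

lemma cat_idr: "category C ==> f \<in> hom C x y ==> Comp C f (Idt C x) = f"
  and cat_idl: "category C ==> f \<in> hom C x y ==> Comp C (Idt C y) f = f" by (auto simp: category_def hom_def)

lemma categoryI:
  assumes "\<And>f. f \<in> Ar C ==> Dom C f \<in> Ob C \<and> Cod C f \<in> Ob C"
    and "\<And>x. x \<in> Ob C ==> Idt C x \<in> hom C x x"
    and "\<And>f g x y z. f \<in> hom C x y ==> g \<in> hom C y z ==> Comp C g f \<in> hom C x z"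
    and "\<And>f x y. f \<in> hom C x y ==> Comp C f (Idt C x) = f"
    and "\<And>f x y. f \<in> hom C x y ==> Comp C (Idt C y) f = f"
    and "\<And>f g h a b c d. f \<in> hom C a b ==> g \<in> hom C b c ==> h \<in> hom C c d ==>
      Comp C h (Comp C g f) = Comp C (Comp C h g) f"
  shows "category C" using assms unfolding category_def by (auto simp: hom_def)

section \<open>Isomorphisms and chosen inverses\<close>

lemma isoI:
  assumes "f \<in> hom C x y" "g \<in> hom C y x" "Comp C g f = Idt C x" "Comp C f g = Idt C y"
  shows "iso C f" using assms by (auto simp: iso_def hom_def)

lemma isoE:
  assumes "iso C f" "f \<in> hom C x y"
  obtains g where "g \<in> hom C y x" "Comp C g f = Idt C x" "Comp C f g = Idt C y" using assms by (auto simp: iso_def hom_def)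

lemma iso_id: "category C ==> x \<in> Ob C ==> iso C (Idt C x)" by (rule isoI[of _ _ x x]) (auto intro: cat_id cat_idl)

lemma iso_comp:
  assumes C: "category C" and f: "f \<in> hom C x y" and g: "g \<in> hom C y z"
    and "iso C f" "iso C g"
  shows "iso C (Comp C g f)"
proof -
  obtain f' where f': "f' \<in> hom C y x" "Comp C f' f = Idt C x" "Comp C f f' = Idt C y" using isoE[OF \<open>iso C f\<close> f] .
  obtain g' where g': "g' \<in> hom C z y" "Comp C g' g = Idt C y" "Comp C g g' = Idt C z" using isoE[OF \<open>iso C g\<close> g] .
  have "Comp C (Comp C f' g') (Comp C g f) = Comp C f' (Comp C (Comp C g' g) f)"
    using cat_assoc[OF C cat_comp[OF C f g] g'(1) f'(1)] cat_assoc[OF C f g g'(1)] by simp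
  then have 1: "Comp C (Comp C f' g') (Comp C g f) = Idt C x" using f' g' cat_idl[OF C f] by simp
  have "Comp C (Comp C g f) (Comp C f' g') = Comp C g (Comp C (Comp C f f') g')"
    using cat_assoc[OF C cat_comp[OF C g'(1) f'(1)] f g] cat_assoc[OF C g'(1) f'(1) f] by simp
  then have 2: "Comp C (Comp C g f) (Comp C f' g') = Idt C z" using f' g' cat_idl[OF C g'(1)] by simp
  show ?thesis by (rule isoI[OF cat_comp[OF C f g] cat_comp[OF C g'(1) f'(1)] 1 2])
qed

text \<open>This is how invertibility of the structure 2-cells is exploited later: an equation
  between arrows into an object \<open>y\<close> is proved after composing with an invertible arrow
  out of \<open>y\<close>, usually a component of \<open>Rho\<close>.\<close>

lemma iso_cancel:
  assumes C: "category C" and h: "h \<in> hom C y z" "iso C h"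
    and f: "f \<in> hom C x y" "g \<in> hom C x y" and eq: "Comp C h f = Comp C h g"
  shows "f = g"
proof -
  obtain h' where h': "h' \<in> hom C z y" "Comp C h' h = Idt C y" using isoE[OF h(2,1)] by metis
  have "f = Comp C h' (Comp C h f)" using cat_assoc[OF C f(1) h(1) h'(1)] h' cat_idl[OF C f(1)] by simp
  also have "\<dots> = g" unfolding eq using cat_assoc[OF C f(2) h(1) h'(1)] h' cat_idl[OF C f(2)] by simp
  finally show ?thesis .
qed

text \<open>The inverse is chosen as a function of the arrow, so that \<open>ia\<close> can
  interpret the formal inverse \<open>Gi\<close> and \<open>al\<close> can be defined by recursion
  on terms.\<close>

definition inverse_ar :: "('o, 'a, 'z) cat_scheme => 'a => 'a" where
  "inverse_ar C f = (SOME g. g \<in> hom C (Cod C f) (Dom C f) \<and> Comp C g f = Idt C (Dom C f) \<and> Comp C f g = Idt C (Cod C f))"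

lemma inverse_ar:
  assumes "iso C f" "f \<in> hom C x y"
  shows "inverse_ar C f \<in> hom C y x" "Comp C (inverse_ar C f) f = Idt C x"
    "Comp C f (inverse_ar C f) = Idt C y"
proof -
  have "\<exists>g. g \<in> hom C (Cod C f) (Dom C f) \<and> Comp C g f = Idt C (Dom C f) \<and> Comp C f g = Idt C (Cod C f)"
    using assms by (auto simp: iso_def)
  from someI_ex[OF this] assms
  show "inverse_ar C f \<in> hom C y x" "Comp C (inverse_ar C f) f = Idt C x"
    "Comp C f (inverse_ar C f) = Idt C y" by (auto simp: inverse_ar_def hom_def)
qed

lemma inverse_ar_unique:
  assumes C: "category C" and f: "f \<in> hom C x y" and g: "g \<in> hom C y x"
    "Comp C g f = Idt C x" "Comp C f g = Idt C y"
  shows "g = inverse_ar C f"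
proof -
  have i: "iso C f" by (rule isoI[OF f g])
  show ?thesis by (rule iso_cancel[OF C f i g(1) inverse_ar(1)[OF i f]]) (simp add: g inverse_ar(3)[OF i f])
qed

text \<open>A naturality square at an isomorphism can be turned around into one at its inverse. The
  \<open>Gi\<close> case of \<open>al_natural\<close> is an instance.\<close>

lemma inverse_ar_square:
  assumes C: "category C" and h: "h \<in> hom C a b" "iso C h" and h': "h' \<in> hom C c d" "iso C h'"
    and g: "g \<in> hom C a c" and k: "k \<in> hom C b d" and eq: "Comp C h' g = Comp C k h"
  shows "Comp C g (inverse_ar C h) = Comp C (inverse_ar C h') k"
proof -
  note i = inverse_ar[OF h(2,1)] and i' = inverse_ar[OF h'(2,1)]
  have "Comp C h' (Comp C g (inverse_ar C h)) = Comp C (Comp C k h) (inverse_ar C h)" using cat_assoc[OF C i(1) g h'(1)] eq by simp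
  also have "\<dots> = k" using cat_assoc[OF C i(1) h(1) k] i(3) cat_idr[OF C k] by simp
  also have "\<dots> = Comp C h' (Comp C (inverse_ar C h') k)" using cat_assoc[OF C k i'(1) h'(1)] i'(3) cat_idl[OF C k] by simp
  finally show ?thesis by (rule iso_cancel[OF C h' cat_comp[OF C i(1) g] cat_comp[OF C k i'(1)]])
qed

section \<open>Functors and natural transformations, compared by their values\<close>

lemma is_functorI:
  assumes "category C" "category D"
    and "fob F \<in> extensional (Ob C)" "far F \<in> extensional (Ar C)"
    and "\<And>x. x \<in> Ob C ==> fob F x \<in> Ob D"
    and "\<And>f x y. f \<in> hom C x y ==> far F f \<in> hom D (fob F x) (fob F y)"
    and "\<And>x. x \<in> Ob C ==> far F (Idt C x) = Idt D (fob F x)"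
    and "\<And>f g x y z. f \<in> hom C x y ==> g \<in> hom C y z ==> far F (Comp C g f) = Comp D (far F g) (far F f)"
  shows "is_functor C D F" using assms unfolding is_functor_def by (auto simp: hom_def PiE_def)

lemma functor_cat: "is_functor C D F ==> category C" "is_functor C D F ==> category D" by (simp_all add: is_functor_def)

lemma functor_ext: "is_functor C D F ==> fob F \<in> extensional (Ob C)"
  "is_functor C D F ==> far F \<in> extensional (Ar C)" by (auto simp: is_functor_def PiE_def)

lemma functor_ob: "is_functor C D F ==> x \<in> Ob C ==> fob F x \<in> Ob D" by (auto simp: is_functor_def)

lemma functor_ar: "is_functor C D F ==> f \<in> Ar C ==> far F f \<in> Ar D" by (auto simp: is_functor_def)

lemma functor_hom: "is_functor C D F ==> f \<in> hom C x y ==> far F f \<in> hom D (fob F x) (fob F y)"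
  by (auto simp: is_functor_def hom_def)

lemma functor_id: "is_functor C D F ==> x \<in> Ob C ==> far F (Idt C x) = Idt D (fob F x)" by (auto simp: is_functor_def)

lemma functor_comp:
  "is_functor C D F ==> f \<in> hom C x y ==> g \<in> hom C y z ==> far F (Comp C g f) = Comp D (far F g) (far F f)"
  by (auto simp: is_functor_def hom_def)

lemma functor_iso:
  assumes F: "is_functor C D F" and f: "f \<in> hom C x y" "iso C f"
  shows "iso D (far F f)"
proof -
  note C = functor_cat(1)[OF F]
  obtain g where g: "g \<in> hom C y x" "Comp C g f = Idt C x" "Comp C f g = Idt C y" using isoE[OF f(2,1)] .
  show ?thesis by (rule isoI[OF functor_hom[OF F f(1)] functor_hom[OF F g(1)]])
      (use g f functor_comp[OF F f(1) g(1)] functor_comp[OF F g(1) f(1)] functor_id[OF F]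
         hom_Ob_Dom[OF C f(1)] hom_Ob_Cod[OF C f(1)] in auto)
qed

text \<open>Records of extensional functions are equal as soon as they agree where they are
  meaningful. Strict equations between 1-cells, on which strictness of the 2-functors rests, are
  proved in this way.\<close>

lemma functr_eqI:
  assumes "fob F \<in> extensional A" "fob G \<in> extensional A" "far F \<in> extensional B"
    "far G \<in> extensional B" "\<And>x. x \<in> A ==> fob F x = fob G x" "\<And>f. f \<in> B ==> far F f = far G f"
  shows "F = (G :: ('o, 'a, 'p, 'b) functr)"
proof -
  have "fob F = fob G" "far F = far G" using assms by (auto intro: extensionalityI)
  then show ?thesis by simp
qed

lemma functor_eqI:
  assumes "is_functor C D F" "is_functor C D' G" "\<And>x. x \<in> Ob C ==> fob F x = fob G x"
    "\<And>f. f \<in> Ar C ==> far F f = far G f"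
  shows "F = G" using assms by (intro functr_eqI[of F "Ob C" G "Ar C"]) (auto intro: functor_ext[OF assms(1)] functor_ext[OF assms(2)])

lemma fob_fcomp [simp]: "x \<in> Ob C ==> fob (fcomp C G F) x = fob G (fob F x)"
  and far_fcomp [simp]: "f \<in> Ar C ==> far (fcomp C G F) f = far G (far F f)" by (simp_all add: fcomp_def)

lemma fcomp_ext [simp]: "fob (fcomp C G F) \<in> extensional (Ob C)"
  "far (fcomp C G F) \<in> extensional (Ar C)" by (simp_all add: fcomp_def)

lemma functor_fcomp:
  assumes F: "is_functor C D F" and G: "is_functor D E G"
  shows "is_functor C E (fcomp C G F)"
proof (rule is_functorI)
  note C = functor_cat(1)[OF F]
  show "category C" "category E" by (fact C functor_cat(2)[OF G])+
  fix x assume x: "x \<in> Ob C"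
  then show "fob (fcomp C G F) x \<in> Ob E" by (simp add: functor_ob[OF F] functor_ob[OF G])
  show "far (fcomp C G F) (Idt C x) = Idt E (fob (fcomp C G F) x)" using x cat_id[OF C x, THEN hom_Ar]
    by (simp add: functor_id[OF F] functor_id[OF G] functor_ob[OF F])
next
  note C = functor_cat(1)[OF F]
  fix f x y assume f: "f \<in> hom C x y"
  show 1: "far (fcomp C G F) f \<in> hom E (fob (fcomp C G F) x) (fob (fcomp C G F) y)"
    using functor_hom[OF G functor_hom[OF F f]] hom_Ar[OF f] hom_Ob_Dom[OF C f] hom_Ob_Cod[OF C f] by simp
  fix g z assume g: "g \<in> hom C y z"
  show "far (fcomp C G F) (Comp C g f) = Comp E (far (fcomp C G F) g) (far (fcomp C G F) f)"
    using f g hom_Ar[OF f] hom_Ar[OF g] hom_Ar[OF cat_comp[OF C f g]]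
    by (simp add: functor_comp[OF F f g] functor_comp[OF G functor_hom[OF F f] functor_hom[OF F g]])
qed simp_all

lemma fob_id_fun [simp]: "x \<in> Ob C ==> fob (id_fun C) x = x"
  and far_id_fun [simp]: "f \<in> Ar C ==> far (id_fun C) f = f" by (simp_all add: id_fun_def)

lemma functor_id_fun: "category C ==> is_functor C C (id_fun C)" by (rule is_functorI)
    (auto simp: id_fun_def hom_Ob_Dom hom_Ob_Cod dest: hom_Ar cat_id cat_comp)

lemma is_natI:
  assumes "is_functor C D (nsrc \<alpha>)" "is_functor C D (ntgt \<alpha>)" "ncomp \<alpha> \<in> extensional (Ob C)"
    and "\<And>x. x \<in> Ob C ==> ncomp \<alpha> x \<in> hom D (fob (nsrc \<alpha>) x) (fob (ntgt \<alpha>) x)"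
    and "\<And>f x y. f \<in> hom C x y ==>
      Comp D (ncomp \<alpha> y) (far (nsrc \<alpha>) f) = Comp D (far (ntgt \<alpha>) f) (ncomp \<alpha> x)"
  shows "is_nat C D \<alpha>" using assms unfolding is_nat_def by (auto simp: hom_def)

lemma nat_functor: "is_nat C D \<alpha> ==> is_functor C D (nsrc \<alpha>)"
  "is_nat C D \<alpha> ==> is_functor C D (ntgt \<alpha>)" by (simp_all add: is_nat_def)

lemma nat_ext: "is_nat C D \<alpha> ==> ncomp \<alpha> \<in> extensional (Ob C)" by (simp add: is_nat_def)

lemma nat_hom:
  "is_nat C D \<alpha> ==> x \<in> Ob C ==> ncomp \<alpha> x \<in> hom D (fob (nsrc \<alpha>) x) (fob (ntgt \<alpha>) x)"
  by (simp add: is_nat_def)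

lemma nat_natural:
  "is_nat C D \<alpha> ==> f \<in> hom C x y ==>
     Comp D (ncomp \<alpha> y) (far (nsrc \<alpha>) f) = Comp D (far (ntgt \<alpha>) f) (ncomp \<alpha> x)"
  by (auto simp: is_nat_def hom_def)

lemma nattr_eqI:
  assumes "nsrc \<alpha> = nsrc \<beta>" "ntgt \<alpha> = ntgt \<beta>" "ncomp \<alpha> \<in> extensional A" "ncomp \<beta> \<in> extensional A"
    "\<And>x. x \<in> A ==> ncomp \<alpha> x = ncomp \<beta> x"
  shows "\<alpha> = (\<beta> :: ('o, 'a, 'p, 'b) nattr)"
proof -
  have "ncomp \<alpha> = ncomp \<beta>" using assms by (auto intro: extensionalityI)
  then show ?thesis using assms by simp
qed

lemma id_nat_simps [simp]:
  "nsrc (id_nat C D F) = F" "ntgt (id_nat C D F) = F"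
  "x \<in> Ob C ==> ncomp (id_nat C D F) x = Idt D (fob F x)"
  "ncomp (id_nat C D F) \<in> extensional (Ob C)" by (simp_all add: id_nat_def)

lemma vcomp_simps [simp]:
  "nsrc (vcomp C D \<beta> \<alpha>) = nsrc \<alpha>" "ntgt (vcomp C D \<beta> \<alpha>) = ntgt \<beta>"
  "x \<in> Ob C ==> ncomp (vcomp C D \<beta> \<alpha>) x = Comp D (ncomp \<beta> x) (ncomp \<alpha> x)"
  "ncomp (vcomp C D \<beta> \<alpha>) \<in> extensional (Ob C)" by (simp_all add: vcomp_def)

lemma hcomp_simps [simp]:
  "nsrc (hcomp C E \<beta> \<alpha>) = fcomp C (nsrc \<beta>) (nsrc \<alpha>)"
  "ntgt (hcomp C E \<beta> \<alpha>) = fcomp C (ntgt \<beta>) (ntgt \<alpha>)"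
  "x \<in> Ob C ==>
    ncomp (hcomp C E \<beta> \<alpha>) x = Comp E (ncomp \<beta> (fob (ntgt \<alpha>) x)) (far (nsrc \<beta>) (ncomp \<alpha> x))"
  "ncomp (hcomp C E \<beta> \<alpha>) \<in> extensional (Ob C)" by (simp_all add: hcomp_def)

lemma nat_id_nat: "is_functor C D F ==> is_nat C D (id_nat C D F)" by (rule is_natI)
    (auto simp: functor_ob functor_cat hom_Ob_Dom[of C] hom_Ob_Cod[of C] cat_idl cat_idr
       intro!: cat_id dest: functor_hom intro: functor_cat
       simp: cat_idl[OF functor_cat(2) functor_hom] cat_idr[OF functor_cat(2) functor_hom])

lemma nat_vcomp:
  assumes a: "is_nat C D \<alpha>" and b: "is_nat C D \<beta>" and eq: "nsrc \<beta> = ntgt \<alpha>"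
  shows "is_nat C D (vcomp C D \<beta> \<alpha>)"
proof (rule is_natI)
  note D = functor_cat(2)[OF nat_functor(1)[OF a]] and C = functor_cat(1)[OF nat_functor(1)[OF a]]
  fix x assume "x \<in> Ob C"
  then show "ncomp (vcomp C D \<beta> \<alpha>) x
      \<in> hom D (fob (nsrc (vcomp C D \<beta> \<alpha>)) x) (fob (ntgt (vcomp C D \<beta> \<alpha>)) x)"
    using cat_comp[OF D nat_hom[OF a] nat_hom[OF b, unfolded eq]] by simp
next
  note D = functor_cat(2)[OF nat_functor(1)[OF a]] and C = functor_cat(1)[OF nat_functor(1)[OF a]]
  fix f x y assume f: "f \<in> hom C x y"
  note x = hom_Ob_Dom[OF C f] and y = hom_Ob_Cod[OF C f]
  note ax = nat_hom[OF a x] and ay = nat_hom[OF a y] and bx = nat_hom[OF b x, unfolded eq]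
    and by' = nat_hom[OF b y, unfolded eq]
  note F = functor_hom[OF nat_functor(1)[OF a] f] and G = functor_hom[OF nat_functor(2)[OF a] f]
    and H = functor_hom[OF nat_functor(2)[OF b] f]
  show "Comp D (ncomp (vcomp C D \<beta> \<alpha>) y) (far (nsrc (vcomp C D \<beta> \<alpha>)) f)
      = Comp D (far (ntgt (vcomp C D \<beta> \<alpha>)) f) (ncomp (vcomp C D \<beta> \<alpha>) x)"
    using x y cat_assoc[OF D F ay by'] cat_assoc[OF D ax G by'] cat_assoc[OF D ax bx H]
      nat_natural[OF a f] nat_natural[OF b f] eq by simp
qed (use assms nat_functor in auto)

lemma nat_hcomp:
  assumes a: "is_nat C D \<alpha>" and b: "is_nat D E \<beta>"
  shows "is_nat C E (hcomp C E \<beta> \<alpha>)"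
proof (rule is_natI)
  note F = nat_functor[OF a] and G = nat_functor[OF b]
  note C = functor_cat(1)[OF F(1)] and D = functor_cat(2)[OF F(1)] and E = functor_cat(2)[OF G(1)]
  let ?h = "hcomp C E \<beta> \<alpha>"
  show "is_functor C E (nsrc ?h)" "is_functor C E (ntgt ?h)" using F G by (auto intro: functor_fcomp)
  have H: "Comp E (ncomp \<beta> (fob (ntgt \<alpha>) x)) (far (nsrc \<beta>) (ncomp \<alpha> x))
      \<in> hom E (fob (nsrc \<beta>) (fob (nsrc \<alpha>) x)) (fob (ntgt \<beta>) (fob (ntgt \<alpha>) x))" if "x \<in> Ob C" for x
    using cat_comp[OF E functor_hom[OF G(1) nat_hom[OF a that]]
        nat_hom[OF b functor_ob[OF F(2) that]]] .
  then show "ncomp ?h x \<in> hom E (fob (nsrc ?h) x) (fob (ntgt ?h) x)" if "x \<in> Ob C" for x using that by simp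
  fix f x y assume f: "f \<in> hom C x y"
  note x = hom_Ob_Dom[OF C f] and y = hom_Ob_Cod[OF C f]
  note Ff = functor_hom[OF F(1) f] and Ff' = functor_hom[OF F(2) f]
  note ax = nat_hom[OF a x] and ay = nat_hom[OF a y]
  note bx = nat_hom[OF b functor_ob[OF F(2) x]] and by' = nat_hom[OF b functor_ob[OF F(2) y]]
  \<comment> \<open>The arrow \<open>f\<close> is moved through \<alpha> first, inside
    \<open>nsrc \<beta>\<close>, and then through \<beta>.\<close>
  have "Comp E (Comp E (ncomp \<beta> (fob (ntgt \<alpha>) y)) (far (nsrc \<beta>) (ncomp \<alpha> y)))
         (far (nsrc \<beta>) (far (nsrc \<alpha>) f))
      = Comp E (ncomp \<beta> (fob (ntgt \<alpha>) y)) (far (nsrc \<beta>) (Comp D (ncomp \<alpha> y) (far (nsrc \<alpha>) f)))"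
    using cat_assoc[OF E functor_hom[OF G(1) Ff] functor_hom[OF G(1) ay] by'] by (simp add: functor_comp[OF G(1) Ff ay])
  also have "\<dots> = Comp E (ncomp \<beta> (fob (ntgt \<alpha>) y))
      (Comp E (far (nsrc \<beta>) (far (ntgt \<alpha>) f)) (far (nsrc \<beta>) (ncomp \<alpha> x)))"
    by (simp add: nat_natural[OF a f] functor_comp[OF G(1) ax Ff'])
  also have "\<dots> = Comp E (Comp E (far (ntgt \<beta>) (far (ntgt \<alpha>) f)) (ncomp \<beta> (fob (ntgt \<alpha>) x)))
      (far (nsrc \<beta>) (ncomp \<alpha> x))" using cat_assoc[OF E functor_hom[OF G(1) ax] functor_hom[OF G(1) Ff'] by']
      nat_natural[OF b Ff'] by simp
  also have "\<dots> = Comp E (far (ntgt \<beta>) (far (ntgt \<alpha>) f))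
      (Comp E (ncomp \<beta> (fob (ntgt \<alpha>) x)) (far (nsrc \<beta>) (ncomp \<alpha> x)))"
    using cat_assoc[OF E functor_hom[OF G(1) ax] bx functor_hom[OF G(2) Ff']] by simp
  finally show "Comp E (ncomp ?h y) (far (nsrc ?h) f) = Comp E (far (ntgt ?h) f) (ncomp ?h x)" using x y hom_Ar[OF f] by simp
qed simp

lemma nat_isoI:
  assumes "is_nat C D \<alpha>" "nsrc \<alpha> = F" "ntgt \<alpha> = G" "\<And>x. x \<in> Ob C ==> iso D (ncomp \<alpha> x)"
  shows "nat_iso C D \<alpha> F G" using assms by (simp add: nat_iso_def)

lemma nat_isoD:
  assumes "nat_iso C D \<alpha> F G"
  shows "is_nat C D \<alpha>" "nsrc \<alpha> = F" "ntgt \<alpha> = G" "x \<in> Ob C ==> iso D (ncomp \<alpha> x)"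
  using assms by (simp_all add: nat_iso_def)

lemma nat_iso_id: "is_functor C D F ==> nat_iso C D (id_nat C D F) F F"
  by (rule nat_isoI) (auto intro: nat_id_nat iso_id functor_cat functor_ob)

lemma category_fun_cat:
  assumes C: "category C" and D: "category D"
  shows "category (fun_cat C D)"
proof -
  have hom: "f \<in> hom (fun_cat C D) F G \<longleftrightarrow> is_nat C D f \<and> nsrc f = F \<and> ntgt f = G" for f F G
    by (auto simp: hom_def fun_cat_def)
  have simps: "Ob (fun_cat C D) = {F. is_functor C D F}" "Ar (fun_cat C D) = {\<alpha>. is_nat C D \<alpha>}"
    "Dom (fun_cat C D) = nsrc" "Cod (fun_cat C D) = ntgt" "Idt (fun_cat C D) = id_nat C D"
    "Comp (fun_cat C D) = vcomp C D" by (simp_all add: fun_cat_def)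
  show ?thesis
  proof (rule categoryI, unfold hom simps, goal_cases)
    case 1 then show ?case by (auto intro: nat_functor)
  next
    case 2 then show ?case by (auto intro: nat_id_nat)
  next
    case 3 then show ?case by (auto intro: nat_vcomp)
  next
    case (4 f x y)
    then show ?case by (intro nattr_eqI[of _ _ "Ob C"]) (auto simp: nat_ext intro!: cat_idr[OF D] dest: nat_hom)
  next
    case (5 f x y)
    then show ?case by (intro nattr_eqI[of _ _ "Ob C"]) (auto simp: nat_ext intro!: cat_idl[OF D] dest: nat_hom)
  next
    case (6 f g h)
    then show ?case by (intro nattr_eqI[of _ _ "Ob C"]) (auto intro!: cat_assoc[OF D] dest: nat_hom)
  qed
qed

lemma category_prod_cat:
  assumes C: "category C" and D: "category D"
  shows "category (prod_cat C D)" using assms unfolding category_def prod_cat_def by (auto simp: hom_def)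

lemma hom_prod_cat:
  "p \<in> hom (prod_cat C D) x y \<longleftrightarrow> fst p \<in> hom C (fst x) (fst y) \<and> snd p \<in> hom D (snd x) (snd y)"
  by (cases p; cases x; cases y) (auto simp: hom_def prod_cat_def)

text \<open>A fully faithful functor with a section \<open>s\<close> on objects has an inverse that
  is \<open>s\<close> on objects and the unique lift on arrows. The criterion asks for an equality
  \<open>fob E (s x) = x\<close>, which is what restriction along a universal arrow provides when
  every morphism has an extension with exactly that restriction.\<close>

lemma equivalenceI:
  assumes E: "is_functor C D E"
    and s: "\<And>x. x \<in> Ob D ==> s x \<in> Ob C \<and> fob E (s x) = x"
    and ff: "\<And>x y \<beta>. x \<in> Ob C ==> y \<in> Ob C ==> \<beta> \<in> hom D (fob E x) (fob E y) ==>
      \<exists>!\<alpha>. \<alpha> \<in> hom C x y \<and> far E \<alpha> = \<beta>"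
  shows "equivalence C D E"
proof -
  note C = functor_cat(1)[OF E] and D = functor_cat(2)[OF E]
  define l where "l x y \<beta> = (THE \<alpha>. \<alpha> \<in> hom C x y \<and> far E \<alpha> = \<beta>)" for x y \<beta>
  have l: "l x y \<beta> \<in> hom C x y" "far E (l x y \<beta>) = \<beta>"
    if "x \<in> Ob C" "y \<in> Ob C" "\<beta> \<in> hom D (fob E x) (fob E y)" for x y \<beta>
    using theI'[OF ff[OF that]] by (auto simp: l_def)
  have faith: "\<alpha> = \<alpha>'" if "\<alpha> \<in> hom C x y" "\<alpha>' \<in> hom C x y" "far E \<alpha> = far E \<alpha>'" for \<alpha> \<alpha>' x y
    using ff[of x y "far E \<alpha>"] that functor_hom[OF E that(1)] hom_Ob_Dom[OF C that(1)]
      hom_Ob_Cod[OF C that(1)] by metis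
  define E' where "E' = \<lparr>fob = (\<lambda>x\<in>Ob D. s x), far = (\<lambda>f\<in>Ar D. l (s (Dom D f)) (s (Cod D f)) f)\<rparr>"
  have sl: "l (s x) (s y) f \<in> hom C (s x) (s y)" "far E (l (s x) (s y) f) = f"
    if "f \<in> hom D x y" for f x y using l[of "s x" "s y" f] s[OF hom_Ob_Dom[OF D that]] s[OF hom_Ob_Cod[OF D that]] that by auto
  have E'f: "far E' f = l (s x) (s y) f" if "f \<in> hom D x y" for f x y using that by (simp add: E'_def hom_def)
  have E'o: "fob E' x = s x" if "x \<in> Ob D" for x using that by (simp add: E'_def)
  have E': "is_functor D C E'"
  proof (rule is_functorI[OF D C])
    show "fob E' \<in> extensional (Ob D)" "far E' \<in> extensional (Ar D)" by (simp_all add: E'_def)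
    show "fob E' x \<in> Ob C" if "x \<in> Ob D" for x using that s by (simp add: E'o)
    show "far E' f \<in> hom C (fob E' x) (fob E' y)" if "f \<in> hom D x y" for f x y
      using sl[OF that] hom_Ob_Dom[OF D that] hom_Ob_Cod[OF D that] by (simp add: E'f[OF that] E'o)
    show "far E' (Idt D x) = Idt C (fob E' x)" if x: "x \<in> Ob D" for x unfolding E'f[OF cat_id[OF D x]] E'o[OF x]
      by (rule faith[OF sl(1)[OF cat_id[OF D x]] cat_id[OF C]])
        (use sl(2)[OF cat_id[OF D x]] s[OF x] functor_id[OF E] in auto)
    show "far E' (Comp D g f) = Comp C (far E' g) (far E' f)"
      if f: "f \<in> hom D x y" and g: "g \<in> hom D y z" for f g x y z unfolding E'f[OF cat_comp[OF D f g]] E'f[OF f] E'f[OF g]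
      by (rule faith[OF sl(1)[OF cat_comp[OF D f g]] cat_comp[OF C sl(1)[OF f] sl(1)[OF g]]])
        (simp add: functor_comp[OF E sl(1)[OF f] sl(1)[OF g]] sl(2)[OF f] sl(2)[OF g]
          sl(2)[OF cat_comp[OF D f g]])
  qed
  \<comment> \<open>The component at \<open>x\<close> is the unique lift of the identity of
    \<open>E x\<close>; naturality and invertibility follow from faithfulness, since all images
    under \<open>E\<close> are identities or equal to \<open>far E f\<close>.\<close>
  define \<eta> where "\<eta> = \<lparr>nsrc = id_fun C, ntgt = fcomp C E' E,
    ncomp = (\<lambda>x\<in>Ob C. l x (s (fob E x)) (Idt D (fob E x)))\<rparr>"
  have eh: "l x (s (fob E x)) (Idt D (fob E x)) \<in> hom C x (s (fob E x))"
    "far E (l x (s (fob E x)) (Idt D (fob E x))) = Idt D (fob E x)" if "x \<in> Ob C" for x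
    using l[of x "s (fob E x)" "Idt D (fob E x)"] that s[OF functor_ob[OF E that]]
      cat_id[OF D functor_ob[OF E that]] by auto
  have eh': "l (s (fob E x)) x (Idt D (fob E x)) \<in> hom C (s (fob E x)) x"
    "far E (l (s (fob E x)) x (Idt D (fob E x))) = Idt D (fob E x)" if "x \<in> Ob C" for x
    using l[of "s (fob E x)" x "Idt D (fob E x)"] that s[OF functor_ob[OF E that]]
      cat_id[OF D functor_ob[OF E that]] by auto
  have \<eta>: "nat_iso C C \<eta> (id_fun C) (fcomp C E' E)"
  proof (rule nat_isoI)
    show "is_nat C C \<eta>"
    proof (rule is_natI)
      show "is_functor C C (nsrc \<eta>)" "is_functor C C (ntgt \<eta>)"
        using functor_id_fun[OF C] functor_fcomp[OF E E'] by (simp_all add: \<eta>_def)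
      show "ncomp \<eta> \<in> extensional (Ob C)" by (simp add: \<eta>_def)
      show "ncomp \<eta> x \<in> hom C (fob (nsrc \<eta>) x) (fob (ntgt \<eta>) x)" if "x \<in> Ob C" for x
        using eh[OF that] that by (simp add: \<eta>_def E'o functor_ob[OF E])
      fix f x y assume f: "f \<in> hom C x y"
      note x = hom_Ob_Dom[OF C f] and y = hom_Ob_Cod[OF C f]
      note Ef = functor_hom[OF E f]
      have "Comp C (l y (s (fob E y)) (Idt D (fob E y))) f
        = Comp C (l (s (fob E x)) (s (fob E y)) (far E f)) (l x (s (fob E x)) (Idt D (fob E x)))"
        by (rule faith[OF cat_comp[OF C f eh(1)[OF y]] cat_comp[OF C eh(1)[OF x] sl(1)[OF Ef]]])
          (simp add: functor_comp[OF E f eh(1)[OF y]] functor_comp[OF E eh(1)[OF x] sl(1)[OF Ef]]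
             eh[OF x] eh[OF y] sl(2)[OF Ef] cat_idl[OF D Ef] cat_idr[OF D Ef])
      then show "Comp C (ncomp \<eta> y) (far (nsrc \<eta>) f) = Comp C (far (ntgt \<eta>) f) (ncomp \<eta> x)"
        using x y hom_Ar[OF f] by (simp add: \<eta>_def E'f[OF Ef])
    qed
    show "iso C (ncomp \<eta> x)" if x: "x \<in> Ob C" for x
    proof (rule isoI)
      have "Comp C (l (s (fob E x)) x (Idt D (fob E x))) (l x (s (fob E x)) (Idt D (fob E x))) = Idt C x"
        by (rule faith[OF cat_comp[OF C eh(1)[OF x] eh'(1)[OF x]] cat_id[OF C x]])
          (simp add: functor_comp[OF E eh(1)[OF x] eh'(1)[OF x]] eh(2)[OF x] eh'(2)[OF x]
            functor_id[OF E x] cat_idl[OF D cat_id[OF D functor_ob[OF E x]]])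
      then show "Comp C (l (s (fob E x)) x (Idt D (fob E x))) (ncomp \<eta> x) = Idt C x" using x by (simp add: \<eta>_def)
      have "Comp C (l x (s (fob E x)) (Idt D (fob E x))) (l (s (fob E x)) x (Idt D (fob E x))) = Idt C (s (fob E x))"
        by (rule faith[OF cat_comp[OF C eh'(1)[OF x] eh(1)[OF x]] cat_id[OF C]])
          (use s[OF functor_ob[OF E x]] in \<open>simp_all add: functor_comp[OF E eh'(1)[OF x] eh(1)[OF x]]
            eh(2)[OF x] eh'(2)[OF x] functor_id[OF E] cat_idl[OF D cat_id[OF D functor_ob[OF E x]]]\<close>)
      then show "Comp C (ncomp \<eta> x) (l (s (fob E x)) x (Idt D (fob E x))) = Idt C (s (fob E x))" using x by (simp add: \<eta>_def)
    qed (use eh[OF x] eh'[OF x] x in \<open>auto simp: \<eta>_def\<close>)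
  qed (simp_all add: \<eta>_def)
  \<comment> \<open>On this side the composite is the identity functor itself, so the counit is an
    identity transformation.\<close>
  have "fcomp D E E' = id_fun D" by (rule functor_eqI[OF functor_fcomp[OF E' E] functor_id_fun[OF D]])
      (auto simp: E'o s E'f[OF Ar_hom] sl(2)[OF Ar_hom])
  then have "nat_iso D D (id_nat D D (id_fun D)) (fcomp D E E') (id_fun D)" using nat_iso_id[OF functor_id_fun[OF D]] by simp
  with \<eta> E E' show ?thesis unfolding equivalence_def by blast
qed

section \<open>Biadjunctions from universal arrows\<close>

lemma tc_cat: "two_category K ==> X \<in> Obj K ==> Y \<in> Obj K ==> category (HomC K X Y)" by (simp add: two_category_def)

lemma tc_id1: "two_category K ==> X \<in> Obj K ==> Id1 K X \<in> Ob (HomC K X X)" by (simp add: two_category_def)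

lemma tc_cmp:
  "two_category K ==> X \<in> Obj K ==> Y \<in> Obj K ==> Z \<in> Obj K ==>
    is_functor (prod_cat (HomC K Y Z) (HomC K X Y)) (HomC K X Z) (Cmp K X Y Z)" by (simp add: two_category_def)

lemma cmp1_Ob:
  assumes "two_category K" "X \<in> Obj K" "Y \<in> Obj K" "Z \<in> Obj K"
    "f \<in> Ob (HomC K X Y)" "g \<in> Ob (HomC K Y Z)"
  shows "cmp1 K X Y Z g f \<in> Ob (HomC K X Z)" using functor_ob[OF tc_cmp[OF assms(1-4)], of "(g, f)"] assms(5,6)
  by (simp add: prod_cat_def cmp1_def)

lemma cmp2_hom:
  assumes "two_category K" "X \<in> Obj K" "Y \<in> Obj K" "Z \<in> Obj K"
    "\<alpha> \<in> hom (HomC K X Y) f f'" "\<beta> \<in> hom (HomC K Y Z) g g'"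
  shows "cmp2 K X Y Z \<beta> \<alpha> \<in> hom (HomC K X Z) (cmp1 K X Y Z g f) (cmp1 K X Y Z g' f')"
  using functor_hom[OF tc_cmp[OF assms(1-4)], of "(\<beta>, \<alpha>)" "(g, f)" "(g', f')"] assms(5,6)
  by (simp add: hom_prod_cat cmp1_def cmp2_def)

lemma cmp2_id2:
  assumes "two_category K" "X \<in> Obj K" "Y \<in> Obj K" "Z \<in> Obj K"
    "f \<in> Ob (HomC K X Y)" "g \<in> Ob (HomC K Y Z)"
  shows "cmp2 K X Y Z (id2 K Y Z g) (id2 K X Y f) = id2 K X Z (cmp1 K X Y Z g f)"
  using functor_id[OF tc_cmp[OF assms(1-4)], of "(g, f)"] assms(5,6) by (simp add: prod_cat_def cmp1_def cmp2_def id2_def)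

text \<open>The interchange law: composition is a functor on the product of the hom-categories, and
  it therefore respects composition there.\<close>

lemma cmp2_Comp:
  assumes "two_category K" "X \<in> Obj K" "Y \<in> Obj K" "Z \<in> Obj K"
    "\<alpha> \<in> hom (HomC K X Y) f f'" "\<alpha>' \<in> hom (HomC K X Y) f' f''"
    "\<beta> \<in> hom (HomC K Y Z) g g'" "\<beta>' \<in> hom (HomC K Y Z) g' g''"
  shows "cmp2 K X Y Z (Comp (HomC K Y Z) \<beta>' \<beta>) (Comp (HomC K X Y) \<alpha>' \<alpha>)
    = Comp (HomC K X Z) (cmp2 K X Y Z \<beta>' \<alpha>') (cmp2 K X Y Z \<beta> \<alpha>)"
  using functor_comp[OF tc_cmp[OF assms(1-4)], of "(\<beta>, \<alpha>)" "(g, f)" "(g', f')" "(\<beta>', \<alpha>')" "(g'', f'')"] assms(5-8)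
  by (simp add: hom_prod_cat cmp2_def) (simp add: prod_cat_def)

lemma cmp1_unit:
  assumes "two_category K" "X \<in> Obj K" "Y \<in> Obj K" "f \<in> Ob (HomC K X Y)"
  shows "cmp1 K X X Y f (Id1 K X) = f" "cmp1 K X Y Y (Id1 K Y) f = f" using assms by (simp_all add: two_category_def)

lemma cmp2_unit:
  assumes "two_category K" "X \<in> Obj K" "Y \<in> Obj K" "\<alpha> \<in> Ar (HomC K X Y)"
  shows "cmp2 K X X Y \<alpha> (id2 K X X (Id1 K X)) = \<alpha>" "cmp2 K X Y Y (id2 K Y Y (Id1 K Y)) \<alpha> = \<alpha>"
  using assms by (simp_all add: two_category_def)

lemma cmp1_assoc:
  assumes "two_category K" "W \<in> Obj K" "X \<in> Obj K" "Y \<in> Obj K" "Z \<in> Obj K"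
    "f \<in> Ob (HomC K W X)" "g \<in> Ob (HomC K X Y)" "h \<in> Ob (HomC K Y Z)"
  shows "cmp1 K W Y Z h (cmp1 K W X Y g f) = cmp1 K W X Z (cmp1 K X Y Z h g) f" using assms by (simp add: two_category_def)

lemma cmp2_assoc:
  assumes "two_category K" "W \<in> Obj K" "X \<in> Obj K" "Y \<in> Obj K" "Z \<in> Obj K"
    "\<alpha> \<in> Ar (HomC K W X)" "\<beta> \<in> Ar (HomC K X Y)" "\<gamma> \<in> Ar (HomC K Y Z)"
  shows "cmp2 K W Y Z \<gamma> (cmp2 K W X Y \<beta> \<alpha>) = cmp2 K W X Z (cmp2 K X Y Z \<gamma> \<beta>) \<alpha>"
  using assms by (simp add: two_category_def)

lemma id2_hom:
  "two_category K ==> X \<in> Obj K ==> Y \<in> Obj K ==> f \<in> Ob (HomC K X Y) ==> id2 K X Y f \<in> hom (HomC K X Y) f f"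
  unfolding id2_def by (rule cat_id[OF tc_cat])

lemma id2_Ar:
  "two_category K ==> X \<in> Obj K ==> Y \<in> Obj K ==> f \<in> Ob (HomC K X Y) ==> id2 K X Y f \<in> Ar (HomC K X Y)"
  by (rule hom_Ar[OF id2_hom])

lemma op2_simps [simp]: "Obj (op2 K) = Obj K" "HomC (op2 K) X Y = HomC K Y X" "Id1 (op2 K) = Id1 K"
  "cmp1 (op2 K) X Y Z g f = cmp1 K Z Y X f g" "cmp2 (op2 K) X Y Z \<beta> \<alpha> = cmp2 K Z Y X \<alpha> \<beta>"
  "id2 (op2 K) X Y f = id2 K Y X f" by (simp_all add: op2_def cmp1_def cmp2_def id2_def)

text \<open>Reversing 1-cells exchanges the two factors of the product category on which composition
  is defined. Its functoriality is transported along the swap; the remaining laws are those of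
  \<open>K\<close> with left and right interchanged.\<close>

lemma two_category_op2:
  assumes K: "two_category K"
  shows "two_category (op2 K)"
proof -
  have "is_functor (prod_cat (HomC K Z Y) (HomC K Y X)) (HomC K Z X) (Cmp (op2 K) X Y Z)"
    if X: "X \<in> Obj K" and Y: "Y \<in> Obj K" and Z: "Z \<in> Obj K" for X Y Z
  proof -
    let ?F = "Cmp (op2 K) X Y Z"
    let ?P = "prod_cat (HomC K Z Y) (HomC K Y X)"
    note F = tc_cmp[OF K Z Y X]
    have F1: "fob ?F = (\<lambda>(g, f). fob (Cmp K Z Y X) (f, g))"
      and F2: "far ?F = (\<lambda>(g, f). far (Cmp K Z Y X) (f, g))" by (simp_all add: op2_def)
    note C = tc_cat[OF K Z Y] tc_cat[OF K Y X]
    show ?thesis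
    proof (rule is_functorI)
      show "category ?P" "category (HomC K Z X)" using C tc_cat[OF K Z X] by (auto intro: category_prod_cat)
      show "fob ?F \<in> extensional (Ob ?P)" using functor_ext(1)[OF F] unfolding F1 by (auto simp: extensional_def prod_cat_def)
      show "far ?F \<in> extensional (Ar ?P)" using functor_ext(2)[OF F] unfolding F2 by (auto simp: extensional_def prod_cat_def)
      fix x assume "x \<in> Ob ?P"
      then show "fob ?F x \<in> Ob (HomC K Z X)" using functor_ob[OF F, of "(snd x, fst x)"] unfolding F1
        by (cases x) (auto simp: prod_cat_def)
    next
      fix p x y assume p: "p \<in> hom ?P x y"
      then show "far ?F p \<in> hom (HomC K Z X) (fob ?F x) (fob ?F y)"
        using functor_hom[OF F, of "(snd p, fst p)" "(snd x, fst x)" "(snd y, fst y)"]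
        unfolding F1 F2 by (cases p; cases x; cases y) (auto simp: hom_prod_cat)
    next
      fix x assume "x \<in> Ob ?P"
      then show "far ?F (Idt ?P x) = Idt (HomC K Z X) (fob ?F x)" using functor_id[OF F, of "(snd x, fst x)"] unfolding F1 F2
        by (cases x) (auto simp: prod_cat_def)
    next
      fix p q x y z assume "p \<in> hom ?P x y"
        "q \<in> hom ?P y z"
      then show "far ?F (Comp ?P q p) = Comp (HomC K Z X) (far ?F q) (far ?F p)"
        using functor_comp[OF F, of "(snd p, fst p)" "(snd x, fst x)" "(snd y, fst y)"
            "(snd q, fst q)" "(snd z, fst z)"] unfolding F2 by (cases p; cases q) (auto simp: hom_prod_cat, auto simp: prod_cat_def)
    qed
  qed
  then show ?thesis unfolding two_category_def op2_simps
    by (auto simp: tc_cat[OF K] tc_id1[OF K] cmp1_unit[OF K] cmp2_unit[OF K] cmp1_assoc[OF K]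
        cmp2_assoc[OF K])
qed

section \<open>Strict 2-functors\<close>

lemma strict_2functorD:
  assumes "strict_2functor K L G"
  shows "pseudo_functor K L G" "two_category K" "two_category L"
    and "X \<in> Obj K ==> P0 G X \<in> Obj L"
    and "X \<in> Obj K ==> Y \<in> Obj K ==> is_functor (HomC K X Y) (HomC L (P0 G X) (P0 G Y)) (P1 G X Y)"
    and "X \<in> Obj K ==> fob (P1 G X X) (Id1 K X) = Id1 L (P0 G X)"
    and "X \<in> Obj K ==> PU G X = id2 L (P0 G X) (P0 G X) (Id1 L (P0 G X))"
    and "X \<in> Obj K ==> Y \<in> Obj K ==> Z \<in> Obj K ==> f \<in> Ob (HomC K X Y) ==>
      g \<in> Ob (HomC K Y Z) ==> fob (P1 G X Z) (cmp1 K X Y Z g f)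
        = cmp1 L (P0 G X) (P0 G Y) (P0 G Z) (fob (P1 G Y Z) g) (fob (P1 G X Y) f)"
    and "X \<in> Obj K ==> Y \<in> Obj K ==> Z \<in> Obj K ==> f \<in> Ob (HomC K X Y) ==> g \<in> Ob (HomC K Y Z) ==>
      PC G X Y Z g f = id2 L (P0 G X) (P0 G Z) (fob (P1 G X Z) (cmp1 K X Y Z g f))"
proof -
  show pf: "pseudo_functor K L G" using assms by (simp add: strict_2functor_def)
  then have "two_category K \<and> two_category L \<and> (\<forall>X\<in>Obj K. P0 G X \<in> Obj L) \<and>
      (\<forall>X\<in>Obj K. \<forall>Y\<in>Obj K. is_functor (HomC K X Y) (HomC L (P0 G X) (P0 G Y)) (P1 G X Y))"
    unfolding pseudo_functor_def by (elim conjE) (intro conjI; assumption)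
  then show "two_category K" "two_category L"
    "X \<in> Obj K ==> P0 G X \<in> Obj L"
    "X \<in> Obj K ==> Y \<in> Obj K ==> is_functor (HomC K X Y) (HomC L (P0 G X) (P0 G Y)) (P1 G X Y)" by auto
qed (use assms in \<open>simp_all add: strict_2functor_def\<close>)

lemma strict_2functor_id2:
  assumes G: "strict_2functor K L G" and X: "X \<in> Obj K" "Y \<in> Obj K" and f: "f \<in> Ob (HomC K X Y)"
  shows "far (P1 G X Y) (id2 K X Y f) = id2 L (P0 G X) (P0 G Y) (fob (P1 G X Y) f)"
  using functor_id[OF strict_2functorD(5)[OF G X] f] by (simp add: id2_def)

text \<open>In the naturality square of the coherence cells \<open>PC\<close>, two sides become
  identities when the 2-functor is strict; what is left is preservation of horizontal
  composition.\<close>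

lemma strict_2functor_cmp2:
  assumes G: "strict_2functor K L G" and X: "X \<in> Obj K" "Y \<in> Obj K" "Z \<in> Obj K"
    and a: "\<alpha> \<in> hom (HomC K X Y) f f'" and b: "\<beta> \<in> hom (HomC K Y Z) g g'"
  shows "far (P1 G X Z) (cmp2 K X Y Z \<beta> \<alpha>)
    = cmp2 L (P0 G X) (P0 G Y) (P0 G Z) (far (P1 G Y Z) \<beta>) (far (P1 G X Y) \<alpha>)"
proof -
  note D = strict_2functorD[OF G]
  note K = D(2) and L = D(3)
  note GX = D(4)[OF X(1)] D(4)[OF X(2)] D(4)[OF X(3)]
  note ff' = hom_Ob_Dom[OF tc_cat[OF K X(1,2)] a] hom_Ob_Cod[OF tc_cat[OF K X(1,2)] a]
  note gg' = hom_Ob_Dom[OF tc_cat[OF K X(2,3)] b] hom_Ob_Cod[OF tc_cat[OF K X(2,3)] b]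
  have "Comp (HomC L (P0 G X) (P0 G Z)) (PC G X Y Z g' f')
      (cmp2 L (P0 G X) (P0 G Y) (P0 G Z) (far (P1 G Y Z) \<beta>) (far (P1 G X Y) \<alpha>))
    = Comp (HomC L (P0 G X) (P0 G Z)) (far (P1 G X Z) (cmp2 K X Y Z \<beta> \<alpha>)) (PC G X Y Z g f)"
    using D(1) X a b unfolding pseudo_functor_def by (auto simp: hom_def)
  moreover have "far (P1 G X Z) (cmp2 K X Y Z \<beta> \<alpha>) \<in> hom (HomC L (P0 G X) (P0 G Z))
      (fob (P1 G X Z) (cmp1 K X Y Z g f)) (fob (P1 G X Z) (cmp1 K X Y Z g' f'))"
    by (rule functor_hom[OF D(5)[OF X(1,3)] cmp2_hom[OF K X a b]])
  moreover have "cmp2 L (P0 G X) (P0 G Y) (P0 G Z) (far (P1 G Y Z) \<beta>) (far (P1 G X Y) \<alpha>) \<in> hom (HomC L (P0 G X) (P0 G Z))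
      (fob (P1 G X Z) (cmp1 K X Y Z g f)) (fob (P1 G X Z) (cmp1 K X Y Z g' f'))"
    using cmp2_hom[OF L GX functor_hom[OF D(5)[OF X(1,2)] a] functor_hom[OF D(5)[OF X(2,3)] b]] by (simp add: D(8)[OF X] ff' gg')
  ultimately show ?thesis using cat_idl[OF tc_cat[OF L GX(1,3)]] cat_idr[OF tc_cat[OF L GX(1,3)]] by (simp add: D(9)[OF X] ff' gg' id2_def)
qed

text \<open>With identity coherence cells the associativity and unit axioms of a pseudo functor
  equate identity 2-cells, and naturality of the coherence cells turns into the assumption
  \<open>c2\<close>. The equations \<open>u\<close> and \<open>c\<close> between 1-cells are what
  gives the identity cells the source and target that are prescribed.\<close>

lemma strict_2functorI:
  assumes K: "two_category K" and L: "two_category L"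
    and ob: "\<And>X. X \<in> Obj K ==> P0 G X \<in> Obj L"
    and fn: "\<And>X Y. X \<in> Obj K ==> Y \<in> Obj K ==> is_functor (HomC K X Y) (HomC L (P0 G X) (P0 G Y)) (P1 G X Y)"
    and u: "\<And>X. X \<in> Obj K ==> fob (P1 G X X) (Id1 K X) = Id1 L (P0 G X)"
    and U: "\<And>X. X \<in> Obj K ==> PU G X = id2 L (P0 G X) (P0 G X) (Id1 L (P0 G X))"
    and c: "\<And>X Y Z f g. X \<in> Obj K ==> Y \<in> Obj K ==> Z \<in> Obj K ==> f \<in> Ob (HomC K X Y) ==>
      g \<in> Ob (HomC K Y Z) ==> fob (P1 G X Z) (cmp1 K X Y Z g f)
        = cmp1 L (P0 G X) (P0 G Y) (P0 G Z) (fob (P1 G Y Z) g) (fob (P1 G X Y) f)"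
    and C: "\<And>X Y Z f g. X \<in> Obj K ==> Y \<in> Obj K ==> Z \<in> Obj K ==> f \<in> Ob (HomC K X Y) ==> g \<in> Ob (HomC K Y Z) ==>
      PC G X Y Z g f = id2 L (P0 G X) (P0 G Z) (fob (P1 G X Z) (cmp1 K X Y Z g f))"
    and c2: "\<And>X Y Z \<alpha> \<beta> f f' g g'. X \<in> Obj K ==> Y \<in> Obj K ==> Z \<in> Obj K ==>
      \<alpha> \<in> hom (HomC K X Y) f f' ==> \<beta> \<in> hom (HomC K Y Z) g g' ==> far (P1 G X Z) (cmp2 K X Y Z \<beta> \<alpha>)
        = cmp2 L (P0 G X) (P0 G Y) (P0 G Z) (far (P1 G Y Z) \<beta>) (far (P1 G X Y) \<alpha>)"
  shows "strict_2functor K L G"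
proof -
  have fo: "fob (P1 G X Y) f \<in> Ob (HomC L (P0 G X) (P0 G Y))"
    if "X \<in> Obj K" "Y \<in> Obj K" "f \<in> Ob (HomC K X Y)" for X Y f using functor_ob[OF fn] that by blast
  note cm = cmp1_Ob[OF K]
  have isoid: "iso (HomC L X Y) (id2 L X Y f)" if "X \<in> Obj L" "Y \<in> Obj L" "f \<in> Ob (HomC L X Y)" for X Y f
    using iso_id[OF tc_cat[OF L that(1,2)] that(3)] by (simp add: id2_def)
  have "pseudo_functor K L G" unfolding pseudo_functor_def
  proof (intro conjI ballI, goal_cases)
    case 5 then show ?case by (simp add: U isoid ob tc_id1[OF L])
  next
    case 6 then show ?case by (simp add: U u id2_hom[OF L] ob tc_id1[OF L])
  next
    case 7 then show ?case by (simp add: C isoid ob fo cm)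
  next
    case (8 X Y Z f g)
    then have "id2 L (P0 G X) (P0 G Z) (fob (P1 G X Z) (cmp1 K X Y Z g f))
      \<in> hom (HomC L (P0 G X) (P0 G Z)) (fob (P1 G X Z) (cmp1 K X Y Z g f)) (fob (P1 G X Z) (cmp1 K X Y Z g f))"
      by (intro id2_hom[OF L] ob fo cm)
    with 8 show ?case by (simp add: C c)
  next
    case (9 X Y Z \<alpha> \<beta>)
    note KC = tc_cat[OF K 9(1,2)] tc_cat[OF K 9(2,3)]
    have "cmp2 K X Y Z \<beta> \<alpha> \<in> hom (HomC K X Z) (cmp1 K X Y Z (Dom (HomC K Y Z) \<beta>) (Dom (HomC K X Y) \<alpha>))
      (cmp1 K X Y Z (Cod (HomC K Y Z) \<beta>) (Cod (HomC K X Y) \<alpha>))" using 9 by (intro cmp2_hom[OF K] Ar_hom)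
    note h = functor_hom[OF fn[OF 9(1,3)] this]
    note LC = tc_cat[OF L ob[OF 9(1)] ob[OF 9(3)]]
    show ?case using cat_idl[OF LC h] cat_idr[OF LC h] c2[OF 9(1-3) Ar_hom[OF 9(4)] Ar_hom[OF 9(5)]]
      by (simp add: C[OF 9(1-3) cat_Dom[OF KC(1) 9(4)] cat_Dom[OF KC(2) 9(5)]]
          C[OF 9(1-3) cat_Cod[OF KC(1) 9(4)] cat_Cod[OF KC(2) 9(5)]] id2_def)
  next
    case (10 W X Y Z f g h)
    note O = 10(1-4) ob[OF 10(1)] ob[OF 10(2)] ob[OF 10(3)] ob[OF 10(4)]
    show ?case using 10 O by (simp add: C c fo cm cmp2_id2[OF L] cmp1_Ob[OF L] cmp1_assoc[OF L])
  next
    case (11 X Y f)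
    note O = 11(1,2) ob[OF 11(1)] ob[OF 11(2)]
    have "id2 L (P0 G X) (P0 G Y) (fob (P1 G X Y) f) \<in> hom (HomC L (P0 G X) (P0 G Y)) (fob (P1 G X Y) f) (fob (P1 G X Y) f)"
      by (intro id2_hom[OF L] O fo 11)
    then show ?case using 11 O using cat_idl[OF tc_cat[OF L O(3,4)]]
      by (simp add: C c u U tc_id1[OF K] tc_id1[OF L] cmp1_unit[OF K] cmp1_unit[OF L] cmp2_id2[OF L] fo)
         (simp add: id2_def)
  next
    case (12 X Y f)
    note O = 12(1,2) ob[OF 12(1)] ob[OF 12(2)]
    have "id2 L (P0 G X) (P0 G Y) (fob (P1 G X Y) f) \<in> hom (HomC L (P0 G X) (P0 G Y)) (fob (P1 G X Y) f) (fob (P1 G X Y) f)"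
      by (intro id2_hom[OF L] O fo 12)
    then show ?case using 12 O using cat_idl[OF tc_cat[OF L O(3,4)]]
      by (simp add: C c u U tc_id1[OF K] tc_id1[OF L] cmp1_unit[OF K] cmp1_unit[OF L] cmp2_id2[OF L] fo)
         (simp add: id2_def)
  qed (use K L ob fn in auto)
  then show ?thesis unfolding strict_2functor_def using u U c C by auto
qed

lemma strict_2functor_op:
  assumes G: "strict_2functor K L G"
  shows "strict_2functor (op2 K) (op2 L) (op_psfun G)"
proof -
  note D = strict_2functorD[OF G]
  show ?thesis
  proof (rule strict_2functorI, goal_cases)
    case (9 X Y Z \<alpha> \<beta> f f' g g')
    then show ?case using strict_2functor_cmp2[OF G, of Z Y X \<beta> g g' \<alpha> f f'] by (simp add: op_psfun_def)
  qed (use D in \<open>auto simp: op_psfun_def two_category_op2\<close>)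
qed

text \<open>
  The strict \<open>Cat\<close>-valued 2-functors; \<open>Cat2\<close> itself enters only through its hom-categories, so
  that it need not be shown to be a 2-category.
\<close>

definition strict_cat_valued :: "('o, 'm, 'c) twocat
    => ('o, 'm, 'c, ('x, 'a) cat, ('x, 'a, 'x, 'a) functr, ('x, 'a, 'x, 'a) nattr) psfun => bool" where
  "strict_cat_valued K P \<longleftrightarrow>
     (\<forall>X\<in>Obj K. \<forall>Y\<in>Obj K. is_functor (HomC K X Y) (fun_cat (P0 P X) (P0 P Y)) (P1 P X Y)) \<and>
     (\<forall>X\<in>Obj K. fob (P1 P X X) (Id1 K X) = id_fun (P0 P X) \<and> PU P X = id_nat (P0 P X) (P0 P X) (id_fun (P0 P X))) \<and>
     (\<forall>X\<in>Obj K. \<forall>Y\<in>Obj K. \<forall>Z\<in>Obj K. \<forall>f\<in>Ob (HomC K X Y). \<forall>g\<in>Ob (HomC K Y Z).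
        fob (P1 P X Z) (cmp1 K X Y Z g f) = fcomp (P0 P X) (fob (P1 P Y Z) g) (fob (P1 P X Y) f) \<and>
        PC P X Y Z g f = id_nat (P0 P X) (P0 P Z) (fob (P1 P X Z) (cmp1 K X Y Z g f)))"

lemma fun_cat_simps: "Ob (fun_cat C D) = {F. is_functor C D F}" "Ar (fun_cat C D) = {\<alpha>. is_nat C D \<alpha>}"
    "Dom (fun_cat C D) = nsrc" "Cod (fun_cat C D) = ntgt" "Idt (fun_cat C D) = id_nat C D"
    "Comp (fun_cat C D) = vcomp C D" by (simp_all add: fun_cat_def)

lemma strict_cat_valuedD:
  assumes "strict_cat_valued K P" "X \<in> Obj K" "Y \<in> Obj K"
  shows "f \<in> Ob (HomC K X Y) ==> is_functor (P0 P X) (P0 P Y) (fob (P1 P X Y) f)"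
    and "\<alpha> \<in> hom (HomC K X Y) f f' ==> is_nat (P0 P X) (P0 P Y) (far (P1 P X Y) \<alpha>) \<and>
      nsrc (far (P1 P X Y) \<alpha>) = fob (P1 P X Y) f \<and> ntgt (far (P1 P X Y) \<alpha>) = fob (P1 P X Y) f'"
proof -
  have F: "is_functor (HomC K X Y) (fun_cat (P0 P X) (P0 P Y)) (P1 P X Y)" using assms by (simp add: strict_cat_valued_def)
  show "f \<in> Ob (HomC K X Y) ==> is_functor (P0 P X) (P0 P Y) (fob (P1 P X Y) f)" using functor_ob[OF F] by (simp add: fun_cat_simps)
  show "\<alpha> \<in> hom (HomC K X Y) f f' ==> is_nat (P0 P X) (P0 P Y) (far (P1 P X Y) \<alpha>) \<and>
      nsrc (far (P1 P X Y) \<alpha>) = fob (P1 P X Y) f \<and> ntgt (far (P1 P X Y) \<alpha>) = fob (P1 P X Y) f'"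
    using functor_hom[OF F] by (simp add: fun_cat_simps hom_def)
qed

text \<open>When the squares with \<open>E\<close> commute on objects and arrows, the comparison
  2-cells can be identities. Compatibility with a 2-cell \<alpha> then reduces to \<open>e2\<close>,
  and the other axioms compare composites of identities.\<close>

lemma pseudo_natural_strictI:
  assumes K: "two_category K" and P: "strict_cat_valued K P" and Q: "strict_cat_valued K Q"
    and E: "\<And>X. X \<in> Obj K ==> is_functor (P0 P X) (P0 Q X) (E X)"
    and e0: "\<And>X Y f x. X \<in> Obj K ==> Y \<in> Obj K ==> f \<in> Ob (HomC K X Y) ==> x \<in> Ob (P0 P X) ==>
      fob (fob (P1 Q X Y) f) (fob (E X) x) = fob (E Y) (fob (fob (P1 P X Y) f) x)"
    and e1: "\<And>X Y f x. X \<in> Obj K ==> Y \<in> Obj K ==> f \<in> Ob (HomC K X Y) ==> x \<in> Ar (P0 P X) ==>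
      far (fob (P1 Q X Y) f) (far (E X) x) = far (E Y) (far (fob (P1 P X Y) f) x)"
    and e2: "\<And>X Y \<alpha> x. X \<in> Obj K ==> Y \<in> Obj K ==> \<alpha> \<in> Ar (HomC K X Y) ==> x \<in> Ob (P0 P X) ==>
      ncomp (far (P1 Q X Y) \<alpha>) (fob (E X) x) = far (E Y) (ncomp (far (P1 P X Y) \<alpha>) x)"
  shows "\<exists>\<tau>. pseudo_natural K P Q E \<tau>"
proof -
  \<comment> \<open>The identity is taken on the functor that has to be the target;
    \<open>fe\<close> below shows that the prescribed source is the same functor.\<close>
  define \<tau> where "\<tau> X Y f = id_nat (P0 P X) (P0 Q Y) (fcomp (P0 P X) (E Y) (fob (P1 P X Y) f))"
    for X Y f
  note Pd = strict_cat_valuedD[OF P] and Qd = strict_cat_valuedD[OF Q]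
  have fc: "is_functor (P0 P X) (P0 Q Y) (fcomp (P0 P X) (E Y) (fob (P1 P X Y) f))"
    if "X \<in> Obj K" "Y \<in> Obj K" "f \<in> Ob (HomC K X Y)" for X Y f using functor_fcomp[OF Pd(1)[OF that] E[OF that(2)]] .
  have fe: "fcomp (P0 P X) (fob (P1 Q X Y) f) (E X) = fcomp (P0 P X) (E Y) (fob (P1 P X Y) f)"
    if "X \<in> Obj K" "Y \<in> Obj K" "f \<in> Ob (HomC K X Y)" for X Y f
    using that by (intro functor_eqI[OF functor_fcomp[OF E Qd(1)] fc]) (auto simp: e0 e1)
  have PC: "PC P X Y Z g f = id_nat (P0 P X) (P0 P Z) (fob (P1 P X Z) (cmp1 K X Y Z g f))"
      "PC Q X Y Z g f = id_nat (P0 Q X) (P0 Q Z) (fob (P1 Q X Z) (cmp1 K X Y Z g f))"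
      "fob (P1 P X Z) (cmp1 K X Y Z g f) = fcomp (P0 P X) (fob (P1 P Y Z) g) (fob (P1 P X Y) f)"
      "fob (P1 Q X Z) (cmp1 K X Y Z g f) = fcomp (P0 Q X) (fob (P1 Q Y Z) g) (fob (P1 Q X Y) f)"
    if "X \<in> Obj K" "Y \<in> Obj K" "Z \<in> Obj K" "f \<in> Ob (HomC K X Y)" "g \<in> Ob (HomC K Y Z)" for X Y Z f g
    using that P Q by (simp_all add: strict_cat_valued_def)
  have PU: "fob (P1 P X X) (Id1 K X) = id_fun (P0 P X)" "fob (P1 Q X X) (Id1 K X) = id_fun (P0 Q X)"
      "PU P X = id_nat (P0 P X) (P0 P X) (id_fun (P0 P X))"
      "PU Q X = id_nat (P0 Q X) (P0 Q X) (id_fun (P0 Q X))" if "X \<in> Obj K" for X using that P Q by (simp_all add: strict_cat_valued_def)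
  have "pseudo_natural K P Q E \<tau>" unfolding pseudo_natural_def
  proof (intro conjI ballI, goal_cases)
    case 1 then show ?case by (rule E)
  next
    case (2 X Y f)
    then show ?case unfolding \<tau>_def fe[OF 2] by (rule nat_iso_id[OF fc])
  next
    case (3 X Y \<alpha>)
    obtain f f' where a: "\<alpha> \<in> hom (HomC K X Y) f f'" using Ar_hom[OF 3(3)] by blast
    note KC = tc_cat[OF K 3(1,2)]
    have f: "f \<in> Ob (HomC K X Y)" "f' \<in> Ob (HomC K X Y)" using hom_Ob_Dom[OF KC a] hom_Ob_Cod[OF KC a] .
    note Pa = conjunct1[OF Pd(2)[OF 3(1,2) a]] conjunct2[OF Pd(2)[OF 3(1,2) a]]
    note Qa = conjunct1[OF Qd(2)[OF 3(1,2) a]] conjunct2[OF Qd(2)[OF 3(1,2) a]]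
    note EX = E[OF 3(1)] and EY = E[OF 3(2)]
    note D = functor_cat(2)[OF EY]
    note DC = hom_Dom[OF a] hom_Cod[OF a]
    show ?case unfolding \<tau>_def DC
    proof (rule nattr_eqI[of _ _ "Ob (P0 P X)"], goal_cases)
      case x: (5 x)
      note Px = functor_ob[OF Pd(1)[OF 3(1,2) f(1)] x] functor_ob[OF Pd(1)[OF 3(1,2) f(2)] x]
      note Ex = functor_ob[OF EX x]
      have h: "far (E Y) (ncomp (far (P1 P X Y) \<alpha>) x) \<in> hom (P0 Q Y)
        (fob (E Y) (fob (fob (P1 P X Y) f) x)) (fob (E Y) (fob (fob (P1 P X Y) f') x))"
        using functor_hom[OF EY nat_hom[OF Pa(1) x]] Pa(2) by simp
      show ?case using x Px Ex f Pa(2) Qa(2) e0[OF 3(1,2) f(1) x] h cat_idl[OF D h] cat_idr[OF D h]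
        by (simp add: functor_id[OF Qd(1)[OF 3(1,2) f(1)]] e2[OF 3(1,2) hom_Ar[OF a]])
    qed (use Pa Qa fe 3 f in auto)
  next
    case (4 X Y Z f g)
    note gf = cmp1_Ob[OF K 4]
    note D = functor_cat(2)[OF E[OF 4(3)]]
    note Pf = Pd(1)[OF 4(1,2,4)] and Pg = Pd(1)[OF 4(2,3,5)] and Qf = Qd(1)[OF 4(1,2,4)]
      and Qg = Qd(1)[OF 4(2,3,5)]
    note EX = E[OF 4(1)] and EY = E[OF 4(2)] and EZ = E[OF 4(3)]
    have fe1: "fcomp (P0 P X) (fcomp (P0 Q X) (fob (P1 Q Y Z) g) (fob (P1 Q X Y) f)) (E X)
      = fcomp (P0 P X) (E Z) (fcomp (P0 P X) (fob (P1 P Y Z) g) (fob (P1 P X Y) f))" using fe[OF 4(1,3) gf] PC[OF 4] by simp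
    show ?case unfolding \<tau>_def PC[OF 4]
    proof (rule nattr_eqI[of _ _ "Ob (P0 P X)"], goal_cases)
      case 1 show ?case by (simp add: fe1 flip: fe[OF 4(1,2,4)])
           (rule functr_eqI[of _ "Ob (P0 P X)" _ "Ar (P0 P X)"],
            auto simp: e0 e1 4 functor_ob[OF Pf] functor_ar[OF Pf] functor_ob[OF EX] functor_ar[OF EX])
    next
      case x: (5 x)
      have o: "fob (fob (P1 Q X Y) f) (fob (E X) x) = fob (E Y) (fob (fob (P1 P X Y) f) x)" using e0[OF 4(1,2,4) x] .
      have o': "fob (fob (P1 Q Y Z) g) (fob (E Y) (fob (fob (P1 P X Y) f) x))
        = fob (E Z) (fob (fob (P1 P Y Z) g) (fob (fob (P1 P X Y) f) x))" using e0[OF 4(2,3,5) functor_ob[OF Pf x]] .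
      note Px = functor_ob[OF Pf x] functor_ob[OF Pg functor_ob[OF Pf x]] functor_ob[OF EX x]
        functor_ob[OF EY functor_ob[OF Pf x]] functor_ob[OF EZ functor_ob[OF Pg functor_ob[OF Pf x]]]
      show ?case using x o o' Px functor_ob[OF Qf] cat_idl[OF D cat_id[OF D]]
          cat_id[OF functor_cat(1)[OF Qf] Px(3), THEN hom_Ar]
          cat_id[OF functor_cat(1)[OF Pg] Px(1), THEN hom_Ar]
        by (simp add: functor_id[OF Qf] functor_id[OF Qg] functor_id[OF EZ] functor_id[OF EY]
            functor_id[OF Pf] functor_id[OF Pg])
    qed (auto simp: fe1)
  next
    case (5 X)
    note EX = E[OF 5] and D = functor_cat(2)[OF E[OF 5]] and C = functor_cat(1)[OF E[OF 5]]
    have f1: "fcomp (P0 P X) (id_fun (P0 Q X)) (E X) = E X" by (rule functor_eqI[OF functor_fcomp[OF EX functor_id_fun[OF D]] EX])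
        (auto simp: functor_ob[OF EX] functor_ar[OF EX])
    have f2: "fcomp (P0 P X) (E X) (id_fun (P0 P X)) = E X" by (rule functor_eqI[OF functor_fcomp[OF functor_id_fun[OF C] EX] EX]) auto
    show ?case unfolding \<tau>_def PU[OF 5] by (rule nattr_eqI[of _ _ "Ob (P0 P X)"])
        (auto simp: f1 f2 functor_ob[OF EX] functor_id[OF EX] cat_idl[OF D cat_id[OF D]]
           cat_id[OF D functor_ob[OF EX], THEN hom_Ar])
  qed
  then show ?thesis by (rule exI[of _ \<tau>])
qed

text \<open>A global name for the function \<open>post\<close> that is local to
  \<open>hom_psfun\<close>: whiskering with \<open>f\<close> as a functor between
  hom-categories.\<close>

definition postcomp :: "('o, 'm, 'c) twocat => 'o => 'o => 'o => 'm => ('m, 'c, 'm, 'c) functr" where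
  "postcomp K Z X Y f = \<lparr>fob = (\<lambda>h\<in>Ob (HomC K Z X). cmp1 K Z X Y f h),
     far = (\<lambda>\<theta>\<in>Ar (HomC K Z X). cmp2 K Z X Y (id2 K X Y f) \<theta>)\<rparr>"

lemma hom_psfun_simps:
  "P0 (hom_psfun K Z) X = HomC K Z X"
  "f \<in> Ob (HomC K X Y) ==> fob (P1 (hom_psfun K Z) X Y) f = postcomp K Z X Y f"
  "\<alpha> \<in> Ar (HomC K X Y) ==> far (P1 (hom_psfun K Z) X Y) \<alpha> = \<lparr>
     nsrc = postcomp K Z X Y (Dom (HomC K X Y) \<alpha>), ntgt = postcomp K Z X Y (Cod (HomC K X Y) \<alpha>),
     ncomp = (\<lambda>h\<in>Ob (HomC K Z X). cmp2 K Z X Y \<alpha> (id2 K Z X h))\<rparr>"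
  "PC (hom_psfun K Z) X Y W g f = id_nat (HomC K Z X) (HomC K Z W) (postcomp K Z X W (cmp1 K X Y W g f))"
  "PU (hom_psfun K Z) X = id_nat (HomC K Z X) (HomC K Z X) (postcomp K Z X X (Id1 K X))"
  by (simp_all add: hom_psfun_def Let_def postcomp_def)

lemma hom_psfun_ext: "fob (P1 (hom_psfun K Z) X Y) \<in> extensional (Ob (HomC K X Y))"
  "far (P1 (hom_psfun K Z) X Y) \<in> extensional (Ar (HomC K X Y))" by (simp_all add: hom_psfun_def Let_def)

lemma fob_postcomp: "h \<in> Ob (HomC K Z X) ==> fob (postcomp K Z X Y f) h = cmp1 K Z X Y f h"
  and far_postcomp: "\<theta> \<in> Ar (HomC K Z X) ==> far (postcomp K Z X Y f) \<theta> = cmp2 K Z X Y (id2 K X Y f) \<theta>"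
  by (simp_all add: postcomp_def)

lemma id2_idem:
  assumes "two_category K" "X \<in> Obj K" "Y \<in> Obj K" "f \<in> Ob (HomC K X Y)"
  shows "Comp (HomC K X Y) (id2 K X Y f) (id2 K X Y f) = id2 K X Y f"
  using cat_idl[OF tc_cat[OF assms(1-3)] id2_hom[OF assms]] by (simp add: id2_def)

lemma functor_postcomp:
  assumes K: "two_category K" and Z: "Z \<in> Obj K" "X \<in> Obj K" "Y \<in> Obj K" and f: "f \<in> Ob (HomC K X Y)"
  shows "is_functor (HomC K Z X) (HomC K Z Y) (postcomp K Z X Y f)"
proof (rule is_functorI)
  note C = tc_cat[OF K Z(1,2)]
  note i = id2_hom[OF K Z(2,3) f]
  show "category (HomC K Z X)" "category (HomC K Z Y)" by (fact C tc_cat[OF K Z(1,3)])+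
  show "fob (postcomp K Z X Y f) x \<in> Ob (HomC K Z Y)" if "x \<in> Ob (HomC K Z X)" for x
    using cmp1_Ob[OF K Z that f] that by (simp add: fob_postcomp)
  show "far (postcomp K Z X Y f) (Idt (HomC K Z X) x) = Idt (HomC K Z Y) (fob (postcomp K Z X Y f) x)"
    if "x \<in> Ob (HomC K Z X)" for x using cmp2_id2[OF K Z that f] that cat_id[OF C that]
    by (simp add: fob_postcomp far_postcomp hom_Ar id2_def)
  fix \<theta> x y assume t: "\<theta> \<in> hom (HomC K Z X) x y"
  show "far (postcomp K Z X Y f) \<theta> \<in> hom (HomC K Z Y) (fob (postcomp K Z X Y f) x) (fob (postcomp K Z X Y f) y)"
    using cmp2_hom[OF K Z t i] hom_Ob_Dom[OF C t] hom_Ob_Cod[OF C t] by (simp add: fob_postcomp far_postcomp hom_Ar[OF t])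
  fix \<theta>' z assume t': "\<theta>' \<in> hom (HomC K Z X) y z"
  show "far (postcomp K Z X Y f) (Comp (HomC K Z X) \<theta>' \<theta>)
      = Comp (HomC K Z Y) (far (postcomp K Z X Y f) \<theta>') (far (postcomp K Z X Y f) \<theta>)" using cmp2_Comp[OF K Z t t' i i]
    by (simp add: far_postcomp hom_Ar[OF t] hom_Ar[OF t'] hom_Ar[OF cat_comp[OF C t t']]
        id2_idem[OF K Z(2,3) f])
qed (simp_all add: postcomp_def)

text \<open>The unit and associativity laws of the 2-category, read as equations of functors, say
  that composing with 1-cells is strictly functorial. That a 2-cell acts by a natural transformation
  is the interchange law.\<close>

lemma strict_cat_valued_hom_psfun:
  assumes K: "two_category K" and Z: "Z \<in> Obj K"
  shows "strict_cat_valued K (hom_psfun K Z)"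
proof -
  note post = functor_postcomp[OF K Z]
  have F: "is_functor (HomC K X Y) (fun_cat (HomC K Z X) (HomC K Z Y)) (P1 (hom_psfun K Z) X Y)"
    if X: "X \<in> Obj K" and Y: "Y \<in> Obj K" for X Y
  proof (rule is_functorI)
    note C = tc_cat[OF K X Y] and ZX = tc_cat[OF K Z X] and ZY = tc_cat[OF K Z Y]
    let ?P = "P1 (hom_psfun K Z) X Y"
    let ?D = "fun_cat (HomC K Z X) (HomC K Z Y)"
    show "category (HomC K X Y)" "category ?D" by (fact C category_fun_cat[OF ZX ZY])+
    show "fob ?P f \<in> Ob ?D"
      if "f \<in> Ob (HomC K X Y)" for f using post[OF X Y that] that by (simp add: hom_psfun_simps fun_cat_simps)
    show "far ?P (Idt (HomC K X Y) f) = Idt ?D (fob ?P f)"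
      if f: "f \<in> Ob (HomC K X Y)" for f using f id2_hom[OF K X Y f] cmp2_id2[OF K Z X Y _ f]
      by (intro nattr_eqI[of _ _ "Ob (HomC K Z X)"])
        (auto simp: hom_psfun_simps fun_cat_simps id2_def fob_postcomp hom_def)
    show far: "far ?P \<alpha> \<in> hom ?D (fob ?P f) (fob ?P g)"
      if a: "\<alpha> \<in> hom (HomC K X Y) f g" for \<alpha> f g
    proof -
      note fO = hom_Ob_Dom[OF C a] and gO = hom_Ob_Cod[OF C a]
      have "is_nat (HomC K Z X) (HomC K Z Y) (far ?P \<alpha>)"
      proof (rule is_natI)
        show "is_functor (HomC K Z X) (HomC K Z Y) (nsrc (far ?P \<alpha>))"
          "is_functor (HomC K Z X) (HomC K Z Y) (ntgt (far ?P \<alpha>))"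
          using post[OF X Y fO] post[OF X Y gO] a by (simp_all add: hom_psfun_simps hom_def)
        show "ncomp (far ?P \<alpha>) \<in> extensional (Ob (HomC K Z X))" using a by (simp_all add: hom_psfun_simps hom_def)
        show "ncomp (far ?P \<alpha>) h \<in> hom (HomC K Z Y) (fob (nsrc (far ?P \<alpha>)) h) (fob (ntgt (far ?P \<alpha>)) h)"
          if "h \<in> Ob (HomC K Z X)" for h using cmp2_hom[OF K Z X Y id2_hom[OF K Z X that] a] that
          by (simp add: hom_psfun_simps hom_Ar[OF a] hom_Dom[OF a] hom_Cod[OF a] fob_postcomp)
        fix \<theta> h k assume t: "\<theta> \<in> hom (HomC K Z X) h k"
        \<comment> \<open>Both sides are the horizontal composite of \<alpha> and \<theta>, with
          identities inserted on opposite sides. Interchange splits them into the two paths of the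
          naturality square.\<close>
        have "cmp2 K Z X Y (Comp (HomC K X Y) \<alpha> (id2 K X Y f)) (Comp (HomC K Z X) (id2 K Z X k) \<theta>)
          = cmp2 K Z X Y (Comp (HomC K X Y) (id2 K X Y g) \<alpha>) (Comp (HomC K Z X) \<theta> (id2 K Z X h))"
          by (simp add: id2_def cat_idl[OF C a] cat_idr[OF C a] cat_idl[OF ZX t] cat_idr[OF ZX t])
        then show "Comp (HomC K Z Y) (ncomp (far ?P \<alpha>) k) (far (nsrc (far ?P \<alpha>)) \<theta>)
          = Comp (HomC K Z Y) (far (ntgt (far ?P \<alpha>)) \<theta>) (ncomp (far ?P \<alpha>) h)"
          using hom_Ob_Dom[OF ZX t] hom_Ob_Cod[OF ZX t]
          by (simp add: hom_psfun_simps hom_Ar[OF a] hom_Dom[OF a] hom_Cod[OF a] far_postcomp hom_Ar[OF t]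
              cmp2_Comp[OF K Z X Y t id2_hom[OF K Z X] id2_hom[OF K X Y fO] a]
              cmp2_Comp[OF K Z X Y id2_hom[OF K Z X] t a id2_hom[OF K X Y gO]])
      qed
      then show ?thesis using a fO gO by (simp add: hom_def fun_cat_simps hom_psfun_simps)
    qed
    fix \<alpha> \<beta> f g h assume a: "\<alpha> \<in> hom (HomC K X Y) f g" and b: "\<beta> \<in> hom (HomC K X Y) g h"
    note ba = cat_comp[OF C a b]
    show "far ?P (Comp (HomC K X Y) \<beta> \<alpha>) = Comp ?D (far ?P \<beta>) (far ?P \<alpha>)"
    proof (rule nattr_eqI[of _ _ "Ob (HomC K Z X)"])
      fix k assume k: "k \<in> Ob (HomC K Z X)"
      show "ncomp (far ?P (Comp (HomC K X Y) \<beta> \<alpha>)) k = ncomp (Comp ?D (far ?P \<beta>) (far ?P \<alpha>)) k"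
        using k cmp2_Comp[OF K Z X Y id2_hom[OF K Z X k] id2_hom[OF K Z X k] a b]
        by (simp add: fun_cat_simps hom_psfun_simps hom_Ar[OF a] hom_Ar[OF b] hom_Ar[OF ba]
            id2_idem[OF K Z X k])
    qed (use a b ba in \<open>simp_all add: fun_cat_simps hom_psfun_simps hom_def\<close>)
  qed (simp_all add: hom_psfun_ext)
  have u: "postcomp K Z X X (Id1 K X) = id_fun (HomC K Z X)" if X: "X \<in> Obj K" for X
    by (rule functor_eqI[OF post[OF X X tc_id1[OF K X]] functor_id_fun[OF tc_cat[OF K Z X]]])
      (auto simp: fob_postcomp far_postcomp cmp1_unit[OF K Z X] cmp2_unit[OF K Z X])
  have c: "postcomp K Z X W (cmp1 K X Y W g f) = fcomp (HomC K Z X) (postcomp K Z Y W g) (postcomp K Z X Y f)"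
    if X: "X \<in> Obj K" "Y \<in> Obj K" "W \<in> Obj K" and f: "f \<in> Ob (HomC K X Y)" "g \<in> Ob (HomC K Y W)"
    for X Y W f g
  proof (rule functor_eqI[OF post[OF X(1,3) cmp1_Ob[OF K X f]]
        functor_fcomp[OF post[OF X(1,2) f(1)] post[OF X(2,3) f(2)]]])
    show "fob (postcomp K Z X W (cmp1 K X Y W g f)) h = fob (fcomp (HomC K Z X) (postcomp K Z Y W g) (postcomp K Z X Y f)) h"
      if h: "h \<in> Ob (HomC K Z X)" for h using h cmp1_Ob[OF K Z X(1,2) h f(1)] cmp1_assoc[OF K Z X h f] by (simp add: fob_postcomp)
    show "far (postcomp K Z X W (cmp1 K X Y W g f)) \<theta> = far (fcomp (HomC K Z X) (postcomp K Z Y W g) (postcomp K Z X Y f)) \<theta>"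
      if t: "\<theta> \<in> Ar (HomC K Z X)" for \<theta> using t functor_ar[OF post[OF X(1,2) f(1)] t]
        cmp2_assoc[OF K Z X t id2_Ar[OF K X(1,2) f(1)] id2_Ar[OF K X(2,3) f(2)]] by (simp add: far_postcomp cmp2_id2[OF K X f])
  qed
  show ?thesis unfolding strict_cat_valued_def by (auto simp: F hom_psfun_simps u c tc_id1[OF K] cmp1_Ob[OF K])
qed

lemma Comp_HomC_Cat2: "Comp (HomC Cat2 C D) = vcomp C D" by (simp add: Cat2_def fun_cat_simps)

text \<open>Each coherence cell of a composite is a vertical composite of two coherence cells. Here
  both are identities on the same functor, and \<open>vv\<close> collapses them.\<close>

lemma strict_cat_valued_psfun_comp:
  assumes G: "strict_2functor K L G" and R: "strict_cat_valued L R"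
  shows "strict_cat_valued K (psfun_comp K Cat2 R G)"
proof -
  note D = strict_2functorD[OF G]
  have RF: "is_functor (HomC L X Y) (fun_cat (P0 R X) (P0 R Y)) (P1 R X Y)"
    if "X \<in> Obj L" "Y \<in> Obj L" for X Y using R that by (simp add: strict_cat_valued_def)
  have Ru: "fob (P1 R X X) (Id1 L X) = id_fun (P0 R X)" "PU R X = id_nat (P0 R X) (P0 R X) (id_fun (P0 R X))"
    if "X \<in> Obj L" for X using R that by (simp_all add: strict_cat_valued_def)
  have Rc: "fob (P1 R X Z) (cmp1 L X Y Z g f) = fcomp (P0 R X) (fob (P1 R Y Z) g) (fob (P1 R X Y) f)"
      "PC R X Y Z g f = id_nat (P0 R X) (P0 R Z) (fob (P1 R X Z) (cmp1 L X Y Z g f))"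
    if "X \<in> Obj L" "Y \<in> Obj L" "Z \<in> Obj L" "f \<in> Ob (HomC L X Y)" "g \<in> Ob (HomC L Y Z)" for X Y Z f g
    using R that by (simp_all add: strict_cat_valued_def)
  have Rid: "far (P1 R X Y) (id2 L X Y f) = id_nat (P0 R X) (P0 R Y) (fob (P1 R X Y) f)"
    if "X \<in> Obj L" "Y \<in> Obj L" "f \<in> Ob (HomC L X Y)" for X Y f
    using functor_id[OF RF[OF that(1,2)] that(3)] by (simp add: id2_def fun_cat_simps)
  have vv: "vcomp (P0 R X) (P0 R Y) (id_nat (P0 R X) (P0 R Y) F) (id_nat (P0 R X) (P0 R Y) F)
      = id_nat (P0 R X) (P0 R Y) F" if F: "is_functor (P0 R X) (P0 R Y) F" for X Y F by (rule nattr_eqI[of _ _ "Ob (P0 R X)"])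
      (auto intro!: cat_idl[OF functor_cat(2)[OF F]] cat_id[OF functor_cat(2)[OF F]] functor_ob[OF F])
  have RO: "is_functor (P0 R X) (P0 R Y) (fob (P1 R X Y) f)"
    if "X \<in> Obj L" "Y \<in> Obj L" "f \<in> Ob (HomC L X Y)" for X Y f
    using functor_ob[OF RF[OF that(1,2)] that(3)] by (simp add: fun_cat_simps)
  show ?thesis unfolding strict_cat_valued_def
  proof (intro conjI ballI, goal_cases)
    case (1 X Y)
    then show ?case using functor_fcomp[OF D(5)[OF 1] RF[OF D(4)[OF 1(1)] D(4)[OF 1(2)]]] by (simp add: psfun_comp_def)
  next
    case (2 X)
    then show ?case using D(2) by (simp add: psfun_comp_def D(6) Ru D(4) tc_id1)
  next
    case (3 X)
    then have "id2 L (P0 G X) (P0 G X) (Id1 L (P0 G X)) = PU G X" by (simp add: D(7))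
    with 3 show ?case using tc_id1[OF D(3) D(4)[OF 3]] RO[OF D(4)[OF 3] D(4)[OF 3] tc_id1[OF D(3) D(4)[OF 3]]]
      by (simp add: psfun_comp_def Comp_HomC_Cat2 D(7)[OF 3] Rid D(4) Ru vv)
  next
    case (4 X Y Z f g)
    then show ?case using functor_ob[OF D(5)[OF 4(1,2) ] 4(4)] functor_ob[OF D(5)[OF 4(2,3)] 4(5)]
      by (simp add: psfun_comp_def D(8) Rc(1) D(4) cmp1_Ob[OF D(2)])
  next
    case (5 X Y Z f g)
    note gf = cmp1_Ob[OF D(2) 5]
    note O = D(4)[OF 5(1)] D(4)[OF 5(2)] D(4)[OF 5(3)]
    note f' = functor_ob[OF D(5)[OF 5(1,2) ] 5(4)] and g' = functor_ob[OF D(5)[OF 5(2,3)] 5(5)]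
    have "fob (P1 G X Z) (cmp1 K X Y Z g f) \<in> Ob (HomC L (P0 G X) (P0 G Z))" using functor_ob[OF D(5)[OF 5(1,3)] gf] .
    note RR = RO[OF O(1,3) this]
    show ?case using RR by (simp add: psfun_comp_def Comp_HomC_Cat2 D(9)[OF 5] Rid[OF O(1,3) functor_ob[OF D(5)[OF 5(1,3)] gf]]
          Rc(2)[OF O f' g'] gf vv flip: D(8)[OF 5])
  qed
qed

text \<open>The hypothesis \<open>lift\<close> says that restriction along \<eta> is fully faithful,
  so an extension of a given 1-cell is determined up to isomorphism. The class \<open>st\<close>
  makes it determined outright: it contains identities, is closed under composition, and has exactly
  one extension for each 1-cell. Hence two 1-cells built by composing chosen extensions are equal as
  soon as their restrictions are, which is where strictness of the left biadjoint comes
  from.\<close>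

theorem left_biadjoint_of_universal_arrows:
  fixes K :: "('o, 'm, 'c) twocat" and L :: "('p, 'n, 'd) twocat"
    and F0 :: "'o => 'p" and \<eta> :: "'o => 'm" and st :: "'p => 'p => 'n set"
  assumes G: "strict_2functor L K G"
    and F0: "\<And>X. X \<in> Obj K ==> F0 X \<in> Obj L"
    and \<eta>: "\<And>X. X \<in> Obj K ==> \<eta> X \<in> Ob (HomC K X (P0 G (F0 X)))"
    and st: "\<And>A B h. A \<in> Obj L ==> B \<in> Obj L ==> h \<in> st A B ==> h \<in> Ob (HomC L A B)"
    and st_id: "\<And>A. A \<in> Obj L ==> Id1 L A \<in> st A A"
    and st_comp: "\<And>A B C h k. A \<in> Obj L ==> B \<in> Obj L ==> C \<in> Obj L ==> h \<in> st A B ==>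
      k \<in> st B C ==> cmp1 L A B C k h \<in> st A C"
    and ext: "\<And>X A f. X \<in> Obj K ==> A \<in> Obj L ==> f \<in> Ob (HomC K X (P0 G A)) ==>
      \<exists>h\<in>st (F0 X) A. cmp1 K X (P0 G (F0 X)) (P0 G A) (fob (P1 G (F0 X) A) h) (\<eta> X) = f"
    and ext_unique: "\<And>X A h h'. X \<in> Obj K ==> A \<in> Obj L ==> h \<in> st (F0 X) A ==> h' \<in> st (F0 X) A ==>
      cmp1 K X (P0 G (F0 X)) (P0 G A) (fob (P1 G (F0 X) A) h) (\<eta> X)
        = cmp1 K X (P0 G (F0 X)) (P0 G A) (fob (P1 G (F0 X) A) h') (\<eta> X) ==> h = h'"
    and lift: "\<And>X A g h \<beta>. X \<in> Obj K ==> A \<in> Obj L ==> g \<in> Ob (HomC L (F0 X) A) ==>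
      h \<in> Ob (HomC L (F0 X) A) ==> \<beta> \<in> hom (HomC K X (P0 G A))
        (cmp1 K X (P0 G (F0 X)) (P0 G A) (fob (P1 G (F0 X) A) g) (\<eta> X))
        (cmp1 K X (P0 G (F0 X)) (P0 G A) (fob (P1 G (F0 X) A) h) (\<eta> X)) ==>
      \<exists>!\<alpha>. \<alpha> \<in> hom (HomC L (F0 X) A) g h \<and>
        cmp2 K X (P0 G (F0 X)) (P0 G A) (far (P1 G (F0 X) A) \<alpha>) (id2 K X (P0 G (F0 X)) (\<eta> X)) = \<beta>"
  shows "\<exists>F. left_biadjoint K L G F \<and> strict_2functor K L F"
proof -
  note D = strict_2functorD[OF G]
  note L = D(2) and K = D(3)
  note GO = D(4) and GF = D(5)
  \<comment> \<open>\<open>E1\<close> and \<open>E2\<close> are restriction along \<eta> on 1-cells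
    and on 2-cells; \<open>E\<close> collects them into the functor that will be the
    equivalence.\<close>
  define E1 where "E1 X A h = cmp1 K X (P0 G (F0 X)) (P0 G A) (fob (P1 G (F0 X) A) h) (\<eta> X)" for X A h
  define E2 where "E2 X A \<alpha> = cmp2 K X (P0 G (F0 X)) (P0 G A) (far (P1 G (F0 X) A) \<alpha>)
    (id2 K X (P0 G (F0 X)) (\<eta> X))" for X A \<alpha>
  define E where "E X A = \<lparr>fob = (\<lambda>h\<in>Ob (HomC L (F0 X) A). E1 X A h),
    far = (\<lambda>\<alpha>\<in>Ar (HomC L (F0 X) A). E2 X A \<alpha>)\<rparr>" for X A
  have i\<eta>: "id2 K X (P0 G (F0 X)) (\<eta> X) \<in> hom (HomC K X (P0 G (F0 X))) (\<eta> X) (\<eta> X)" if "X \<in> Obj K" for X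
    using id2_hom[OF K that GO[OF F0[OF that]] \<eta>[OF that]] .
  have E1_Ob: "E1 X A h \<in> Ob (HomC K X (P0 G A))"
    if "X \<in> Obj K" "A \<in> Obj L" "h \<in> Ob (HomC L (F0 X) A)" for X A h
    unfolding E1_def using that by (intro cmp1_Ob[OF K] GO F0 \<eta> functor_ob[OF GF]) auto
  have E2_hom: "E2 X A \<alpha> \<in> hom (HomC K X (P0 G A)) (E1 X A g) (E1 X A h)"
    if "X \<in> Obj K" "A \<in> Obj L" "\<alpha> \<in> hom (HomC L (F0 X) A) g h" for X A \<alpha> g h
    unfolding E1_def E2_def using that by (intro cmp2_hom[OF K] GO F0 i\<eta> functor_hom[OF GF]) auto
  have E2_id: "E2 X A (id2 L (F0 X) A h) = id2 K X (P0 G A) (E1 X A h)"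
    if X: "X \<in> Obj K" "A \<in> Obj L" "h \<in> Ob (HomC L (F0 X) A)" for X A h unfolding E1_def E2_def
    by (simp add: strict_2functor_id2[OF G F0[OF X(1)] X(2,3)] cmp2_id2[OF K X(1) GO[OF F0[OF X(1)]]
        GO[OF X(2)] \<eta>[OF X(1)] functor_ob[OF GF[OF F0[OF X(1)] X(2)] X(3)]])
  have E2_Comp: "E2 X A (Comp (HomC L (F0 X) A) \<beta> \<alpha>) = Comp (HomC K X (P0 G A)) (E2 X A \<beta>) (E2 X A \<alpha>)"
    if X: "X \<in> Obj K" "A \<in> Obj L" "\<alpha> \<in> hom (HomC L (F0 X) A) g h" "\<beta> \<in> hom (HomC L (F0 X) A) h k"
    for X A \<alpha> \<beta> g h k using cmp2_Comp[OF K X(1) GO[OF F0[OF X(1)]] GO[OF X(2)] i\<eta>[OF X(1)] i\<eta>[OF X(1)]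
        functor_hom[OF GF[OF F0[OF X(1)] X(2)] X(3)] functor_hom[OF GF[OF F0[OF X(1)] X(2)] X(4)]]
    by (simp add: E2_def id2_idem[OF K X(1) GO[OF F0[OF X(1)]] \<eta>[OF X(1)]]
      functor_comp[OF GF[OF F0[OF X(1)] X(2)] X(3,4)])
  have EF: "is_functor (HomC L (F0 X) A) (HomC K X (P0 G A)) (E X A)" if X: "X \<in> Obj K" "A \<in> Obj L" for X A
  proof (rule is_functorI)
    note C = tc_cat[OF L F0[OF X(1)] X(2)]
    show "category (HomC L (F0 X) A)" "category (HomC K X (P0 G A))" by (fact C tc_cat[OF K X(1) GO[OF X(2)]])+
    show "fob (E X A) x \<in> Ob (HomC K X (P0 G A))" if "x \<in> Ob (HomC L (F0 X) A)" for x
      using E1_Ob[OF X that] that by (simp add: E_def)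
    show "far (E X A) (Idt (HomC L (F0 X) A) x) = Idt (HomC K X (P0 G A)) (fob (E X A) x)"
      if "x \<in> Ob (HomC L (F0 X) A)" for x using E2_id[OF X that] that cat_id[OF C that] by (simp add: E_def id2_def hom_Ar)
    show "far (E X A) \<alpha> \<in> hom (HomC K X (P0 G A)) (fob (E X A) x) (fob (E X A) y)"
      if "\<alpha> \<in> hom (HomC L (F0 X) A) x y" for \<alpha> x y
      using E2_hom[OF X that] hom_Ob_Dom[OF C that] hom_Ob_Cod[OF C that] hom_Ar[OF that] by (simp add: E_def)
    show "far (E X A) (Comp (HomC L (F0 X) A) \<beta> \<alpha>) = Comp (HomC K X (P0 G A)) (far (E X A) \<beta>) (far (E X A) \<alpha>)"
      if "\<alpha> \<in> hom (HomC L (F0 X) A) x y" "\<beta> \<in> hom (HomC L (F0 X) A) y z" for \<alpha> \<beta> x y z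
      using E2_Comp[OF X that] hom_Ar[OF that(1)] hom_Ar[OF that(2)] hom_Ar[OF cat_comp[OF C that]] by (simp add: E_def)
  qed (simp_all add: E_def)
  \<comment> \<open>The extension in \<open>st\<close>. It serves twice: as the section on objects
    that makes \<open>E\<close> an equivalence, and as the value of \<open>F\<close> on
    1-cells.\<close>
  define ex where "ex X A f = (THE h. h \<in> st (F0 X) A \<and> E1 X A h = f)" for X A f
  have ex: "ex X A f \<in> st (F0 X) A" "E1 X A (ex X A f) = f" "ex X A f \<in> Ob (HomC L (F0 X) A)"
    if X: "X \<in> Obj K" "A \<in> Obj L" "f \<in> Ob (HomC K X (P0 G A))" for X A f
  proof -
    have "\<exists>!h. h \<in> st (F0 X) A \<and> E1 X A h = f" using ext[OF X] ext_unique[OF X(1,2)] by (auto simp: E1_def)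
    from theI'[OF this, folded ex_def] show "ex X A f \<in> st (F0 X) A" "E1 X A (ex X A f) = f" by auto
    then show "ex X A f \<in> Ob (HomC L (F0 X) A)" using st[OF F0[OF X(1)] X(2)] by blast
  qed
  have ex_eq: "h = h'" if "X \<in> Obj K" "A \<in> Obj L" "h \<in> st (F0 X) A" "h' \<in> st (F0 X) A" "E1 X A h = E1 X A h'"
    for X A h h' using ext_unique that by (simp add: E1_def)
  have lift': "\<exists>!\<alpha>. \<alpha> \<in> hom (HomC L (F0 X) A) g h \<and> E2 X A \<alpha> = \<beta>"
    if "X \<in> Obj K" "A \<in> Obj L" "g \<in> Ob (HomC L (F0 X) A)" "h \<in> Ob (HomC L (F0 X) A)"
      "\<beta> \<in> hom (HomC K X (P0 G A)) (E1 X A g) (E1 X A h)" for X A g h \<beta>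
    using lift[of X A g h \<beta>] that by (simp add: E1_def E2_def)
  define l where "l X A g h \<beta> = (THE \<alpha>. \<alpha> \<in> hom (HomC L (F0 X) A) g h \<and> E2 X A \<alpha> = \<beta>)" for X A g h \<beta>
  have l: "l X A g h \<beta> \<in> hom (HomC L (F0 X) A) g h" "E2 X A (l X A g h \<beta>) = \<beta>"
    if "X \<in> Obj K" "A \<in> Obj L" "g \<in> Ob (HomC L (F0 X) A)" "h \<in> Ob (HomC L (F0 X) A)"
      "\<beta> \<in> hom (HomC K X (P0 G A)) (E1 X A g) (E1 X A h)" for X A g h \<beta> using theI'[OF lift'[OF that]] by (auto simp: l_def)
  have faith: "\<alpha> = \<alpha>'" if X: "X \<in> Obj K" "A \<in> Obj L" and a: "\<alpha> \<in> hom (HomC L (F0 X) A) g h"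
      "\<alpha>' \<in> hom (HomC L (F0 X) A) g h" "E2 X A \<alpha> = E2 X A \<alpha>'" for X A g h \<alpha> \<alpha>'
  proof -
    note C = tc_cat[OF L F0[OF X(1)] X(2)]
    show ?thesis using lift'[OF X hom_Ob_Dom[OF C a(1)] hom_Ob_Cod[OF C a(1)] E2_hom[OF X a(1)]] a by metis
  qed
  have Eeq: "equivalence (HomC L (F0 X) A) (HomC K X (P0 G A)) (E X A)" if X: "X \<in> Obj K" "A \<in> Obj L" for X A
  proof (rule equivalenceI[OF EF[OF X], where s = "ex X A"])
    show "ex X A x \<in> Ob (HomC L (F0 X) A) \<and> fob (E X A) (ex X A x) = x"
      if "x \<in> Ob (HomC K X (P0 G A))" for x using ex[OF X that] by (simp add: E_def)
    fix x y \<beta> assume xy: "x \<in> Ob (HomC L (F0 X) A)" "y \<in> Ob (HomC L (F0 X) A)"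
      "\<beta> \<in> hom (HomC K X (P0 G A)) (fob (E X A) x) (fob (E X A) y)"
    then have "\<exists>!\<alpha>. \<alpha> \<in> hom (HomC L (F0 X) A) x y \<and> E2 X A \<alpha> = \<beta>"
      by (intro lift'[OF X]) (simp_all add: E_def)
    then show "\<exists>!\<alpha>. \<alpha> \<in> hom (HomC L (F0 X) A) x y \<and> far (E X A) \<alpha> = \<beta>"
      by (simp add: E_def hom_def cong: conj_cong)
  qed

  \<comment> \<open>\<open>F\<close> is defined by the requirement that \<eta> be strictly natural:
    \<open>F1 X Y f\<close> is the extension in \<open>st\<close> of \<eta> after \<open>f\<close>,
    and \<open>F2\<close> is the lift of a 2-cell whiskered with \<eta>.\<close>
  define F1 where "F1 X Y f = ex X (F0 Y) (cmp1 K X Y (P0 G (F0 Y)) (\<eta> Y) f)" for X Y f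
  define F2 where "F2 X Y \<alpha> = l X (F0 Y) (F1 X Y (Dom (HomC K X Y) \<alpha>)) (F1 X Y (Cod (HomC K X Y) \<alpha>))
    (cmp2 K X Y (P0 G (F0 Y)) (id2 K Y (P0 G (F0 Y)) (\<eta> Y)) \<alpha>)" for X Y \<alpha>
  have cf: "cmp1 K X Y (P0 G (F0 Y)) (\<eta> Y) f \<in> Ob (HomC K X (P0 G (F0 Y)))"
    if "X \<in> Obj K" "Y \<in> Obj K" "f \<in> Ob (HomC K X Y)" for X Y f using that by (intro cmp1_Ob[OF K] GO F0 \<eta>)
  have F1: "F1 X Y f \<in> st (F0 X) (F0 Y)" "E1 X (F0 Y) (F1 X Y f) = cmp1 K X Y (P0 G (F0 Y)) (\<eta> Y) f"
      "F1 X Y f \<in> Ob (HomC L (F0 X) (F0 Y))"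
    if X: "X \<in> Obj K" "Y \<in> Obj K" "f \<in> Ob (HomC K X Y)" for X Y f
    using ex[OF X(1) F0[OF X(2)] cf[OF X]] by (simp_all add: F1_def)
  have F2: "F2 X Y \<alpha> \<in> hom (HomC L (F0 X) (F0 Y)) (F1 X Y f) (F1 X Y g)"
      "E2 X (F0 Y) (F2 X Y \<alpha>) = cmp2 K X Y (P0 G (F0 Y)) (id2 K Y (P0 G (F0 Y)) (\<eta> Y)) \<alpha>"
    if X: "X \<in> Obj K" "Y \<in> Obj K" and a: "\<alpha> \<in> hom (HomC K X Y) f g" for X Y \<alpha> f g
  proof -
    note C = tc_cat[OF K X]
    note f = hom_Ob_Dom[OF C a] and g = hom_Ob_Cod[OF C a]
    have "cmp2 K X Y (P0 G (F0 Y)) (id2 K Y (P0 G (F0 Y)) (\<eta> Y)) \<alpha> \<in> hom (HomC K X (P0 G (F0 Y)))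
      (E1 X (F0 Y) (F1 X Y f)) (E1 X (F0 Y) (F1 X Y g))"
      unfolding F1(2)[OF X f] F1(2)[OF X g] using X a by (intro cmp2_hom[OF K] GO F0 i\<eta>)
    from l[OF X(1) F0[OF X(2)] F1(3)[OF X f] F1(3)[OF X g] this]
    show "F2 X Y \<alpha> \<in> hom (HomC L (F0 X) (F0 Y)) (F1 X Y f) (F1 X Y g)"
      "E2 X (F0 Y) (F2 X Y \<alpha>) = cmp2 K X Y (P0 G (F0 Y)) (id2 K Y (P0 G (F0 Y)) (\<eta> Y)) \<alpha>"
      using a by (simp_all add: F2_def hom_def)
  qed
  \<comment> \<open>Restriction is strictly natural in the algebra because \<eta> is composed on the
    other side; this is associativity after \<open>G\<close> has been moved through the
    composite.\<close>
  have E1_cmp: "E1 X B (cmp1 L (F0 X) A B k h) = cmp1 K X (P0 G A) (P0 G B) (fob (P1 G A B) k) (E1 X A h)"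
    if X: "X \<in> Obj K" "A \<in> Obj L" "B \<in> Obj L" "h \<in> Ob (HomC L (F0 X) A)" "k \<in> Ob (HomC L A B)" for X A B h k
    unfolding E1_def D(8)[OF F0[OF X(1)] X(2-5)] by (rule cmp1_assoc[OF K X(1) GO[OF F0[OF X(1)]] GO[OF X(2)] GO[OF X(3)] \<eta>[OF X(1)]
        functor_ob[OF GF[OF F0[OF X(1)] X(2)] X(4)] functor_ob[OF GF[OF X(2,3)] X(5)], symmetric])
  have E2_cmp: "E2 X B (cmp2 L (F0 X) A B \<beta> \<alpha>) = cmp2 K X (P0 G A) (P0 G B) (far (P1 G A B) \<beta>) (E2 X A \<alpha>)"
    if X: "X \<in> Obj K" "A \<in> Obj L" "B \<in> Obj L" "\<alpha> \<in> Ar (HomC L (F0 X) A)" "\<beta> \<in> Ar (HomC L A B)" for X A B \<alpha> \<beta>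
    unfolding E2_def strict_2functor_cmp2[OF G F0[OF X(1)] X(2,3) Ar_hom[OF X(4)] Ar_hom[OF X(5)]]
    by (rule cmp2_assoc[OF K X(1) GO[OF F0[OF X(1)]] GO[OF X(2)] GO[OF X(3)]
        hom_Ar[OF i\<eta>[OF X(1)]] functor_ar[OF GF[OF F0[OF X(1)] X(2)] X(4)]
        functor_ar[OF GF[OF X(2,3)] X(5)], symmetric])
  text \<open>The arrows \<open>\<eta>\<close> are strictly natural, so that whiskering with them commutes with \<open>F\<close>.\<close>
  have E1_F: "E1 X B (cmp1 L (F0 X) (F0 Y) B k (F1 X Y f)) = cmp1 K X Y (P0 G B) (E1 Y B k) f"
    if X: "X \<in> Obj K" "Y \<in> Obj K" "B \<in> Obj L" "f \<in> Ob (HomC K X Y)" "k \<in> Ob (HomC L (F0 Y) B)" for X Y B f k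
    unfolding E1_cmp[OF X(1) F0[OF X(2)] X(3) F1(3)[OF X(1,2,4)] X(5)] F1(2)[OF X(1,2,4)] unfolding E1_def
    by (rule cmp1_assoc[OF K X(1,2) GO[OF F0[OF X(2)]] GO[OF X(3)] X(4) \<eta>[OF X(2)]
        functor_ob[OF GF[OF F0[OF X(2)] X(3)] X(5)]])
  have E2_F: "E2 X B (cmp2 L (F0 X) (F0 Y) B \<beta> (F2 X Y \<alpha>)) = cmp2 K X Y (P0 G B) (E2 Y B \<beta>) \<alpha>"
    if X: "X \<in> Obj K" "Y \<in> Obj K" "B \<in> Obj L" "\<alpha> \<in> Ar (HomC K X Y)" "\<beta> \<in> Ar (HomC L (F0 Y) B)" for X Y B \<alpha> \<beta>
    unfolding E2_cmp[OF X(1) F0[OF X(2)] X(3) hom_Ar[OF F2(1)[OF X(1,2) Ar_hom[OF X(4)]]] X(5)]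
      F2(2)[OF X(1,2) Ar_hom[OF X(4)]] unfolding E2_def
    by (rule cmp2_assoc[OF K X(1,2) GO[OF F0[OF X(2)]] GO[OF X(3)] X(4) hom_Ar[OF i\<eta>[OF X(2)]]
        functor_ar[OF GF[OF F0[OF X(2)] X(3)] X(5)]])
  have F1_id: "F1 X X (Id1 K X) = Id1 L (F0 X)" if X: "X \<in> Obj K" for X
  proof (rule ex_eq[OF X F0[OF X] F1(1)[OF X X tc_id1[OF K X]] st_id[OF F0[OF X]]])
    show "E1 X (F0 X) (F1 X X (Id1 K X)) = E1 X (F0 X) (Id1 L (F0 X))" unfolding F1(2)[OF X X tc_id1[OF K X]]
      by (simp add: E1_def D(6)[OF F0[OF X]] cmp1_unit[OF K X GO[OF F0[OF X]] \<eta>[OF X]])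
  qed
  have F1_cmp: "F1 X Z (cmp1 K X Y Z g f) = cmp1 L (F0 X) (F0 Y) (F0 Z) (F1 Y Z g) (F1 X Y f)"
    if X: "X \<in> Obj K" "Y \<in> Obj K" "Z \<in> Obj K" "f \<in> Ob (HomC K X Y)" "g \<in> Ob (HomC K Y Z)" for X Y Z f g
  proof (rule ex_eq[OF X(1) F0[OF X(3)] F1(1)[OF X(1,3) cmp1_Ob[OF K X]]])
    show "cmp1 L (F0 X) (F0 Y) (F0 Z) (F1 Y Z g) (F1 X Y f) \<in> st (F0 X) (F0 Z)" using X by (intro st_comp F0 F1) auto
    show "E1 X (F0 Z) (F1 X Z (cmp1 K X Y Z g f)) = E1 X (F0 Z) (cmp1 L (F0 X) (F0 Y) (F0 Z) (F1 Y Z g) (F1 X Y f))"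
      unfolding E1_F[OF X(1,2) F0[OF X(3)] X(4) F1(3)[OF X(2,3,5)]] F1(2)[OF X(1,3) cmp1_Ob[OF K X]]
        F1(2)[OF X(2,3,5)] by (rule cmp1_assoc[OF K X(1-3) GO[OF F0[OF X(3)]] X(4,5) \<eta>[OF X(3)]])
  qed
  \<comment> \<open>The equations \<open>F1_id\<close> and \<open>F1_cmp\<close> give identity
    2-cells the source and target required of coherence cells.\<close>
  define F where "F = \<lparr>P0 = F0,
    P1 = (\<lambda>X Y. \<lparr>fob = (\<lambda>f\<in>Ob (HomC K X Y). F1 X Y f), far = (\<lambda>\<alpha>\<in>Ar (HomC K X Y). F2 X Y \<alpha>)\<rparr>),
    PC = (\<lambda>X Y Z g f. id2 L (F0 X) (F0 Z) (F1 X Z (cmp1 K X Y Z g f))),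
    PU = (\<lambda>X. id2 L (F0 X) (F0 X) (Id1 L (F0 X)))\<rparr>"
  have Fs: "P0 F = F0" "f \<in> Ob (HomC K X Y) ==> fob (P1 F X Y) f = F1 X Y f"
    "\<alpha> \<in> Ar (HomC K X Y) ==> far (P1 F X Y) \<alpha> = F2 X Y \<alpha>" for X Y f \<alpha> by (simp_all add: F_def)
  have FF: "is_functor (HomC K X Y) (HomC L (F0 X) (F0 Y)) (P1 F X Y)" if X: "X \<in> Obj K" "Y \<in> Obj K" for X Y
  proof (rule is_functorI)
    note C = tc_cat[OF K X] and C' = tc_cat[OF L F0[OF X(1)] F0[OF X(2)]]
    note Y' = GO[OF F0[OF X(2)]]
    show "category (HomC K X Y)" "category (HomC L (F0 X) (F0 Y))" by (fact C C')+
    show "fob (P1 F X Y) f \<in> Ob (HomC L (F0 X) (F0 Y))" if "f \<in> Ob (HomC K X Y)" for f using F1(3)[OF X that] that by (simp add: Fs)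
    show "far (P1 F X Y) \<alpha> \<in> hom (HomC L (F0 X) (F0 Y)) (fob (P1 F X Y) f) (fob (P1 F X Y) g)"
      if a: "\<alpha> \<in> hom (HomC K X Y) f g" for \<alpha> f g
      using F2(1)[OF X a] hom_Ob_Dom[OF C a] hom_Ob_Cod[OF C a] hom_Ar[OF a] by (simp add: Fs)
    show "far (P1 F X Y) (Idt (HomC K X Y) f) = Idt (HomC L (F0 X) (F0 Y)) (fob (P1 F X Y) f)"
      if f: "f \<in> Ob (HomC K X Y)" for f
    proof -
      \<comment> \<open>The laws for \<open>F2\<close> are all obtained from faithfulness of
        restriction: both sides have the same ends and, after whiskering with \<eta>, the same
        value.\<close>
      have "F2 X Y (id2 K X Y f) = id2 L (F0 X) (F0 Y) (F1 X Y f)" by (rule faith[OF X(1) F0[OF X(2)] F2(1)[OF X id2_hom[OF K X f]]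
            id2_hom[OF L F0[OF X(1)] F0[OF X(2)] F1(3)[OF X f]]])
          (simp add: F2(2)[OF X id2_hom[OF K X f]] E2_id[OF X(1) F0[OF X(2)] F1(3)[OF X f]]
            F1(2)[OF X f] cmp2_id2[OF K X Y' f \<eta>[OF X(2)]])
      then show ?thesis using f cat_id[OF C f, THEN hom_Ar] by (simp add: Fs id2_def)
    qed
    show "far (P1 F X Y) (Comp (HomC K X Y) \<beta> \<alpha>)
        = Comp (HomC L (F0 X) (F0 Y)) (far (P1 F X Y) \<beta>) (far (P1 F X Y) \<alpha>)"
      if a: "\<alpha> \<in> hom (HomC K X Y) f g" and b: "\<beta> \<in> hom (HomC K X Y) g h" for \<alpha> \<beta> f g h
    proof -
      note ba = cat_comp[OF C a b]
      have "F2 X Y (Comp (HomC K X Y) \<beta> \<alpha>) = Comp (HomC L (F0 X) (F0 Y)) (F2 X Y \<beta>) (F2 X Y \<alpha>)"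
        by (rule faith[OF X(1) F0[OF X(2)] F2(1)[OF X ba] cat_comp[OF C' F2(1)[OF X a] F2(1)[OF X b]]])
          (use cmp2_Comp[OF K X Y' a b i\<eta>[OF X(2)] i\<eta>[OF X(2)]] in
            \<open>simp add: F2(2)[OF X ba] E2_Comp[OF X(1) F0[OF X(2)] F2(1)[OF X a] F2(1)[OF X b]]
              F2(2)[OF X a] F2(2)[OF X b] id2_idem[OF K X(2) Y' \<eta>[OF X(2)]]\<close>)
      then show ?thesis using hom_Ar[OF a] hom_Ar[OF b] hom_Ar[OF ba] by (simp add: Fs)
    qed
  qed (simp_all add: F_def)
  have F: "strict_2functor K L F"
  proof (rule strict_2functorI[OF K L])
    fix X Y Z \<alpha> \<beta> f f' g g'
    assume X: "X \<in> Obj K" "Y \<in> Obj K" "Z \<in> Obj K" and a: "\<alpha> \<in> hom (HomC K X Y) f f'"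
      and b: "\<beta> \<in> hom (HomC K Y Z) g g'"
    note C = tc_cat[OF K X(1,2)] tc_cat[OF K X(2,3)]
    note O = hom_Ob_Dom[OF C(1) a] hom_Ob_Cod[OF C(1) a] hom_Ob_Dom[OF C(2) b] hom_Ob_Cod[OF C(2) b]
    note ba = cmp2_hom[OF K X a b]
    have "F2 X Z (cmp2 K X Y Z \<beta> \<alpha>) = cmp2 L (F0 X) (F0 Y) (F0 Z) (F2 Y Z \<beta>) (F2 X Y \<alpha>)"
    proof (rule faith[OF X(1) F0[OF X(3)] F2(1)[OF X(1,3) ba]])
      show "cmp2 L (F0 X) (F0 Y) (F0 Z) (F2 Y Z \<beta>) (F2 X Y \<alpha>) \<in> hom (HomC L (F0 X) (F0 Z))
        (F1 X Z (cmp1 K X Y Z g f)) (F1 X Z (cmp1 K X Y Z g' f'))" unfolding F1_cmp[OF X O(1,3)] F1_cmp[OF X O(2,4)]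
        by (rule cmp2_hom[OF L F0[OF X(1)] F0[OF X(2)] F0[OF X(3)] F2(1)[OF X(1,2) a] F2(1)[OF X(2,3) b]])
      show "E2 X (F0 Z) (F2 X Z (cmp2 K X Y Z \<beta> \<alpha>)) =
        E2 X (F0 Z) (cmp2 L (F0 X) (F0 Y) (F0 Z) (F2 Y Z \<beta>) (F2 X Y \<alpha>))"
        unfolding E2_F[OF X(1,2) F0[OF X(3)] hom_Ar[OF a] hom_Ar[OF F2(1)[OF X(2,3) b]]]
          F2(2)[OF X(1,3) ba] F2(2)[OF X(2,3) b]
        by (rule cmp2_assoc[OF K X(1-3) GO[OF F0[OF X(3)]] hom_Ar[OF a] hom_Ar[OF b] hom_Ar[OF i\<eta>[OF X(3)]]])
    qed
    then show "far (P1 F X Z) (cmp2 K X Y Z \<beta> \<alpha>)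
      = cmp2 L (P0 F X) (P0 F Y) (P0 F Z) (far (P1 F Y Z) \<beta>) (far (P1 F X Y) \<alpha>)"
      by (simp add: Fs hom_Ar[OF a] hom_Ar[OF b] hom_Ar[OF ba])
  qed (simp_all add: FF Fs F0 F1_id F1_cmp tc_id1[OF K] cmp1_Ob[OF K], simp_all add: F_def cmp1_Ob[OF K] F1_cmp)
  \<comment> \<open>Naturality in the algebra comes from \<open>E1_cmp\<close> and
    \<open>E2_cmp\<close>.\<close>
  have nat1: "\<exists>\<tau>. pseudo_natural L (hom_psfun L (F0 X)) (psfun_comp L Cat2 (hom_psfun K X) G) (\<lambda>A. E X A) \<tau>"
    if X: "X \<in> Obj K" for X
  proof (rule pseudo_natural_strictI[OF L strict_cat_valued_hom_psfun[OF L F0[OF X]]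
        strict_cat_valued_psfun_comp[OF G strict_cat_valued_hom_psfun[OF K X]]], goal_cases)
    case (1 A) then show ?case using EF[OF X] by (simp add: hom_psfun_simps psfun_comp_def)
  next
    case (2 A B f x)
    then have x: "x \<in> Ob (HomC L (F0 X) A)" by (simp add: hom_psfun_simps)
    show ?case using x 2 functor_ob[OF GF 2(3)] E1_cmp[OF X 2(1,2) x 2(3)] E1_Ob[OF X 2(1) x]
        cmp1_Ob[OF L F0[OF X] 2(1,2) x 2(3)] by (simp add: hom_psfun_simps psfun_comp_def fob_postcomp) (simp add: E_def fob_postcomp)
  next
    case (3 A B f x)
    then have x: "x \<in> Ar (HomC L (F0 X) A)" by (simp add: hom_psfun_simps)
    note f2 = id2_hom[OF L 3(1-3)]
    show ?case using x 3 functor_ob[OF GF 3(3)] E2_cmp[OF X 3(1,2) x hom_Ar[OF f2]]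
        E2_hom[OF X 3(1) Ar_hom[OF x], THEN hom_Ar] strict_2functor_id2[OF G 3(1-3)]
        cmp2_hom[OF L F0[OF X] 3(1,2) Ar_hom[OF x] f2, THEN hom_Ar]
      by (simp add: hom_psfun_simps psfun_comp_def far_postcomp) (simp add: E_def far_postcomp)
  next
    case (4 A B \<alpha> x)
    then have x: "x \<in> Ob (HomC L (F0 X) A)" by (simp add: hom_psfun_simps)
    note x2 = id2_hom[OF L F0[OF X] 4(1) x]
    show ?case using x 4 functor_ar[OF GF 4(3)] E2_cmp[OF X 4(1,2) hom_Ar[OF x2] 4(3)]
        E1_Ob[OF X 4(1) x] E2_id[OF X 4(1) x]
        cmp2_hom[OF L F0[OF X] 4(1,2) x2 Ar_hom[OF 4(3)], THEN hom_Ar] by (simp add: hom_psfun_simps psfun_comp_def) (simp add: E_def)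
  qed
  have nat2: "\<exists>\<sigma>. pseudo_natural (op2 K) (psfun_comp (op2 K) Cat2 (hom_psfun (op2 L) A) (op_psfun F))
      (hom_psfun (op2 K) (P0 G A)) (\<lambda>X. E X A) \<sigma>" if A: "A \<in> Obj L" for A
  proof (rule pseudo_natural_strictI[OF two_category_op2[OF K]
        strict_cat_valued_psfun_comp[OF strict_2functor_op[OF F] strict_cat_valued_hom_psfun]
        strict_cat_valued_hom_psfun], goal_cases)
    case 1 show ?case by (rule two_category_op2[OF L])
  next
    case 2 show ?case using A by simp
  next
    case 3 show ?case by (rule two_category_op2[OF K])
  next
    case 4 show ?case using GO[OF A] by simp
  next
    case (5 X) then show ?case using EF[OF _ A] by (simp add: hom_psfun_simps psfun_comp_def op_psfun_def Fs)
  next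
    \<comment> \<open>A 1-cell from \<open>Y\<close> to \<open>X\<close> in \<open>op2 K\<close> is
      one from \<open>X\<close> to \<open>Y\<close> in \<open>K\<close>, hence the order of the
      names. Naturality in this variable is \<open>E1_F\<close> and \<open>E2_F\<close>, that is,
      strict naturality of \<eta>.\<close>
    case (6 Y X f x)
    then have X: "X \<in> Obj K" "Y \<in> Obj K" "f \<in> Ob (HomC K X Y)" and x: "x \<in> Ob (HomC L (F0 Y) A)"
      by (simp_all add: hom_psfun_simps psfun_comp_def op_psfun_def Fs)
    show ?case using x X F1(3)[OF X] E1_F[OF X(1,2) A X(3) x] E1_Ob[OF X(2) A x]
        cmp1_Ob[OF L F0[OF X(1)] F0[OF X(2)] A F1(3)[OF X] x]
      by (simp add: hom_psfun_simps psfun_comp_def op_psfun_def Fs fob_postcomp) (simp add: E_def fob_postcomp)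
  next
    case (7 Y X f x)
    then have X: "X \<in> Obj K" "Y \<in> Obj K" "f \<in> Ob (HomC K X Y)" and x: "x \<in> Ar (HomC L (F0 Y) A)"
      by (simp_all add: hom_psfun_simps psfun_comp_def op_psfun_def Fs)
    note f2 = id2_hom[OF K X]
    have F2f: "F2 X Y (id2 K X Y f) = id2 L (F0 X) (F0 Y) (F1 X Y f)" using strict_2functor_id2[OF F X] hom_Ar[OF f2] X by (simp add: Fs)
    show ?case using x X F1(3)[OF X] E2_F[OF X(1,2) A hom_Ar[OF f2] x] F2f
        E2_hom[OF X(2) A Ar_hom[OF x], THEN hom_Ar]
        cmp2_hom[OF L F0[OF X(1)] F0[OF X(2)] A F2(1)[OF X(1,2) f2] Ar_hom[OF x], THEN hom_Ar]
      by (simp add: hom_psfun_simps psfun_comp_def op_psfun_def Fs far_postcomp) (simp add: E_def far_postcomp)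
  next
    case (8 Y X \<alpha> x)
    then have X: "X \<in> Obj K" "Y \<in> Obj K" "\<alpha> \<in> Ar (HomC K X Y)" and x: "x \<in> Ob (HomC L (F0 Y) A)"
      by (simp_all add: hom_psfun_simps psfun_comp_def op_psfun_def Fs)
    note x2 = id2_hom[OF L F0[OF X(2)] A x]
    note F2a = F2(1)[OF X(1,2) Ar_hom[OF X(3)]]
    show ?case using x X hom_Ar[OF F2a] E2_F[OF X(1,2) A X(3) hom_Ar[OF x2]] E1_Ob[OF X(2) A x]
        E2_id[OF X(2) A x] cmp2_hom[OF L F0[OF X(1)] F0[OF X(2)] A F2a x2, THEN hom_Ar]
      by (simp add: hom_psfun_simps psfun_comp_def op_psfun_def Fs) (simp add: E_def)
  qed
  have "left_biadjoint K L G F" unfolding left_biadjoint_def Fs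
    by (intro conjI exI[of _ E] ballI D(1) strict_2functorD(1)[OF F] Eeq nat1 nat2)
  with F show ?thesis by blast
qed

section \<open>Blocks of lists\<close>

text \<open>Arity one occurs as the numeral \<open>1\<close> in \<open>pow_cat C 1\<close>,
  \<open>unit_word\<close> and \<open>replicate k 1\<close>. Rewriting it to \<open>Suc 0\<close>
  would keep facts about these from matching; the rule is supplied by hand where a list of length
  one is taken apart.\<close>

declare One_nat_def [simp del]

lemma length_blocks [simp]: "length (blocks ns xs) = length ns" by (induction ns arbitrary: xs) auto

lemma blocks_map: "blocks ns (map f xs) = map (map f) (blocks ns xs)" by (induction ns arbitrary: xs) (auto simp: take_map drop_map)

lemma blocks_append: "blocks (ns @ ms) xs = blocks ns (take (sum_list ns) xs) @ blocks ms (drop (sum_list ns) xs)"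
  by (induction ns arbitrary: xs) (simp_all add: drop_take add.commute)

lemma blocks_concat: "blocks (map length xss) (concat xss) = xss" by (induction xss) auto

lemma map_length_blocks: "length xs = sum_list ns ==> map length (blocks ns xs) = ns" by (induction ns arbitrary: xs) auto

lemma length_blocks_nth: "length xs = sum_list ns ==> i < length ns ==> length (blocks ns xs ! i) = ns ! i"
  using map_length_blocks[of xs ns] by (metis length_blocks nth_map)

lemma set_blocks: "i < length ns ==> set (blocks ns xs ! i) \<subseteq> set xs"
proof (induction ns arbitrary: xs i)
  case (Cons n ns)
  show ?case
  proof (cases i)
    case (Suc j)
    then show ?thesis using Cons.IH[of j "drop n xs"] Cons.prems set_drop_subset[of n xs] by auto
  qed (auto dest: in_set_takeD)
qed simp

lemma nth_blocks:
  "length xs = sum_list ns ==> i < length ns ==> blocks ns xs ! i = map ((!) xs) (block ns i)"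
proof (induction ns arbitrary: xs i)
  case (Cons n ns)
  show ?case
  proof (cases i)
    case 0
    then show ?thesis using Cons.prems by (auto simp: block_def intro: nth_equalityI)
  next
    case (Suc j)
    then have "blocks (n # ns) xs ! i = map ((!) (drop n xs)) (block ns j)" using Cons.IH[of "drop n xs" j] Cons.prems by simp
    also have "\<dots> = map ((!) xs) (block (n # ns) i)" using Cons.prems Suc by (auto simp: block_def add.assoc intro!: nth_equalityI)
    finally show ?thesis .
  qed
qed simp

lemma block_bound: "i < length ns ==> j \<in> set (block ns i) ==> j < sum_list ns"
proof -
  assume i: "i < length ns" and j: "j \<in> set (block ns i)"
  have "sum_list ns = sum_list (take i ns) + sum_list (drop i ns)" by (metis append_take_drop_id sum_list_append)
  also have "drop i ns = ns ! i # drop (Suc i) ns" using i by (simp add: Cons_nth_drop_Suc)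
  finally show ?thesis using j by (simp add: block_def)
qed

lemma length_block [simp]: "length (block ns i) = ns ! i" by (simp add: block_def)

text \<open>Cutting at a refined list of sizes can be done in two stages. This is the combinatorial
  content of associativity of \<gamma>.\<close>

lemma blocks_concat_concat:
  "blocks (concat nss) xs = concat (map2 blocks nss (blocks (map sum_list nss) xs))"
  by (induction nss arbitrary: xs) (auto simp: blocks_append)

lemma map2_concat:
  "length ass = length bss ==> (\<And>j. j < length ass ==> length (ass ! j) = length (bss ! j)) ==>
    map2 f (concat ass) (concat bss) = concat (map2 (map2 f) ass bss)"
proof (induction ass bss rule: list_induct2)
  case (Cons a ass b bss)
  have "length a = length b" using Cons.prems[of 0] by simp
  moreover have "\<And>j. j < length ass ==> length (ass ! j) = length (bss ! j)" using Cons.prems[of "Suc j" for j] by simp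
  ultimately show ?case using Cons.IH by simp
qed simp

lemma map2_eq_nth: "length as = length bs ==> map2 f as bs = map (\<lambda>j. f (as ! j) (bs ! j)) [0..<length as]"
  by (auto intro: nth_equalityI)

text \<open>The identities below hold for the action of words on lists, be it by composition in a theory,
  by the functors of an algebra, or by formation of terms.\<close>

lemma blocks_assoc:
  assumes "length wss = length ws" "\<And>j. j < length ws ==> length (wss ! j) = ar (ws ! j)"
    "length xs = sum_list (map ar (concat wss))"
  shows "blocks (map ar ws) (map2 f (concat wss) (blocks (map ar (concat wss)) xs))
    = map2 (\<lambda>vs b. map2 f vs (blocks (map ar vs) b)) wss (blocks (map (\<lambda>vs. sum_list (map ar vs)) wss) xs)"
proof -
  define bs where "bs = blocks (map (\<lambda>vs. sum_list (map ar vs)) wss) xs"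
  have lb: "length bs = length wss" by (simp add: bs_def)
  have 1: "blocks (map ar (concat wss)) xs = concat (map2 blocks (map (map ar) wss) bs)"
    unfolding bs_def map_concat blocks_concat_concat by (simp add: comp_def)
  have 2: "map2 f (concat wss) (blocks (map ar (concat wss)) xs) = concat (map2 (map2 f) wss (map2 blocks (map (map ar) wss) bs))"
    unfolding 1 by (rule map2_concat) (auto simp: lb)
  \<comment> \<open>The words in \<open>wss ! j\<close> produce \<open>ar (ws ! j)\<close> results,
    so cutting the concatenation of all results at these sizes recovers the lists that were
    concatenated.\<close>
  have 3: "map ar ws = map length (map2 (map2 f) wss (map2 blocks (map (map ar) wss) bs))" by (rule nth_equalityI) (auto simp: lb assms)
  show ?thesis unfolding 2 unfolding 3 blocks_concat by (rule nth_equalityI) (auto simp: lb bs_def[symmetric])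
qed

lemma blocks_replicate_1: "length xs = k ==> blocks (replicate k 1) xs = map (\<lambda>x. [x]) xs"
proof (induction k arbitrary: xs)
  case (Suc k)
  then show ?case by (cases xs) (auto simp: One_nat_def)
qed simp

text \<open>Combinatorial core of axiom (4): \<open>block_map\<close> copies whole blocks, so the
  reindexed list is a concatenation of blocks of \<open>xs\<close>, and cutting it returns these
  blocks in the order given by \<open>f\<close>.\<close>

lemma blocks_block_map:
  assumes f: "set f \<subseteq> {..<length ns}" and xs: "length xs = sum_list ns"
  shows "blocks (map ((!) ns) f) (map ((!) xs) (block_map ns f)) = map ((!) (blocks ns xs)) f"
proof -
  have "map ((!) xs) (block_map ns f) = concat (map ((!) (blocks ns xs)) f)" unfolding block_map_def map_concat map_map using f
    by (intro arg_cong[of _ _ concat] map_cong) (auto simp: nth_blocks[OF xs])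
  moreover have "map ((!) ns) f = map length (map ((!) (blocks ns xs)) f)" using f by (auto simp: length_blocks_nth[OF xs])
  ultimately show ?thesis by (simp only: blocks_concat)
qed

lemma length_block_map: "set f \<subseteq> {..<length ns} ==> length (block_map ns f) = sum_list (map ((!) ns) f)"
  by (simp add: block_map_def length_concat comp_def)

lemma set_block_map: "set f \<subseteq> {..<length ns} ==> set (block_map ns f) \<subseteq> {..<sum_list ns}"
  by (auto simp: block_map_def dest: block_bound)

lemma map2_nth_reindex:
  assumes "set f \<subseteq> {..<length ws}" "length bs = length ws"
  shows "map2 h (map ((!) ws) f) (map ((!) bs) f) = map ((!) (map2 h ws bs)) f" using assms by (auto intro!: nth_equalityI simp: subset_iff)

lemma nth_block_sum_aux:
  assumes xs: "length xs = sum_list ns" and i: "i < length ns" and j: "j < ns ! i"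
  shows "xs ! (sum_list (take i ns) + j) = blocks ns xs ! i ! j" using j by (simp add: nth_blocks[OF xs i]) (simp add: block_def)

text \<open>Combinatorial core of axiom (5): a block sum reindexes inside each block separately, and
  the lengths of the \<open>gs ! j\<close> are the sizes of the resulting blocks.\<close>

lemma blocks_block_sum:
  assumes l: "length gs = length ns'" and g: "\<And>j. j < length ns' ==> set (gs ! j) \<subseteq> {..<ns' ! j}"
    and xs: "length xs = sum_list ns'"
  shows "blocks (map length gs) (map ((!) xs) (block_sum ns' gs))
    = map (\<lambda>j. map ((!) (blocks ns' xs ! j)) (gs ! j)) [0..<length gs]"
proof -
  have "map ((!) xs) (block_sum ns' gs) = concat (map (\<lambda>j. map ((!) (blocks ns' xs ! j)) (gs ! j)) [0..<length gs])"
    unfolding block_sum_def map_concat map_map using l g by (intro arg_cong[of _ _ concat] map_cong)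
      (auto simp: nth_block_sum_aux[OF xs] subset_iff)
  moreover have "map length gs = map length (map (\<lambda>j. map ((!) (blocks ns' xs ! j)) (gs ! j)) [0..<length gs])"
    by (rule nth_equalityI) auto
  ultimately show ?thesis by (simp only: blocks_concat)
qed

lemma length_block_sum: "length (block_sum ns' gs) = sum_list (map length gs)"
proof -
  have "map (\<lambda>i. length (gs ! i)) [0..<length gs] = map length gs" by (rule nth_equalityI) auto
  then show ?thesis by (simp add: block_sum_def length_concat comp_def)
qed

lemma set_block_sum:
  assumes l: "length gs = length ns'" and g: "\<And>j. j < length ns' ==> set (gs ! j) \<subseteq> {..<ns' ! j}"
  shows "set (block_sum ns' gs) \<subseteq> {..<sum_list ns'}"
proof
  fix x assume "x \<in> set (block_sum ns' gs)"
  then obtain i j where i: "i < length gs" and j: "j \<in> set (gs ! i)" and x: "x = sum_list (take i ns') + j"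
    by (auto simp: block_sum_def)
  have "x \<in> set (block ns' i)" using g[of i] i l j x by (auto simp: block_def)
  then show "x \<in> {..<sum_list ns'}" using block_bound[of i ns' x] i l by auto
qed

lemma map_nth_map_nth: "set f \<subseteq> {..<length g} ==> map ((!) (map ((!) xs) g)) f = map ((!) xs) (map ((!) g) f)"
  by (auto simp: subset_iff)

section \<open>Words of a theory\<close>

lemma theoryD:
  assumes "is_theory T"
  shows "category T" "Ob T = UNIV" "i < n ==> Pr T n i \<in> hom T n 1" using assms by (auto simp: is_theory_def)

lemma tuple:
  assumes T: "is_theory T" and vs: "set vs \<subseteq> hom T m 1"
  shows "tuple T m vs \<in> hom T m (length vs)"
    "i < length vs ==> Comp T (Pr T (length vs) i) (tuple T m vs) = vs ! i"
    "u \<in> hom T m (length vs) ==> (\<And>i. i < length vs ==> Comp T (Pr T (length vs) i) u = vs ! i) ==> u = tuple T m vs"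
proof -
  have ex: "\<exists>!u. u \<in> hom T m (length vs) \<and> (\<forall>i<length vs. Comp T (Pr T (length vs) i) u = vs ! i)"
    using T vs unfolding is_theory_def by blast
  from theI'[OF ex] show "tuple T m vs \<in> hom T m (length vs)"
    "i < length vs ==> Comp T (Pr T (length vs) i) (tuple T m vs) = vs ! i" by (auto simp: tuple_def)
  show "u \<in> hom T m (length vs) ==> (\<And>i. i < length vs ==> Comp T (Pr T (length vs) i) u = vs ! i) ==> u = tuple T m vs"
    using the1_equality[OF ex, of u] by (auto simp: tuple_def)
qed

text \<open>Composition with a tuple, read as \<open>w\<close> acting on lists of morphisms from
  \<open>m\<close> to \<open>1\<close>. In this form a theory acts on lists just as an algebra does,
  and the identities on blocks apply to both.\<close>

definition act :: "'t thry => nat => 't => 't list => 't" where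
  "act T m w vs = Comp T w (tuple T m vs)"

lemma words_hom: "w \<in> words T \<longleftrightarrow> w \<in> hom T (Dom T w) 1" by (auto simp: words_def hom_def)

lemma hom_words: "w \<in> hom T n 1 ==> w \<in> words T \<and> Dom T w = n" by (auto simp: words_def hom_def)

lemma act_hom:
  assumes "is_theory T" "w \<in> hom T n 1" "set vs \<subseteq> hom T m 1" "length vs = n"
  shows "act T m w vs \<in> hom T m 1" unfolding act_def using assms tuple(1)[of T vs m] by (intro cat_comp[OF theoryD(1)]) auto

text \<open>A Yoneda argument: the tuple of all projections is the identity, so acting on the
  projections returns the word itself. Equations between words are proved below by acting on an
  arbitrary list.\<close>

lemma act_cong:
  assumes T: "is_theory T" and w: "w \<in> hom T n 1" "w' \<in> hom T n 1"
    and eq: "\<And>vs. set vs \<subseteq> hom T n 1 ==> length vs = n ==> act T n w vs = act T n w' vs"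
  shows "w = w'"
proof -
  let ?vs = "map (Pr T n) [0..<n]"
  have vs: "set ?vs \<subseteq> hom T n 1" using theoryD(3)[OF T] by auto
  have i: "Idt T n \<in> hom T n n" using theoryD(1,2)[OF T] by (intro cat_id) auto
  have "Idt T n = tuple T n ?vs" using i theoryD(3)[OF T] by (intro tuple(3)[OF T vs]) (auto intro!: cat_idr[OF theoryD(1)[OF T]])
  with eq[OF vs] show ?thesis using cat_idr[OF theoryD(1)[OF T] w(1)] cat_idr[OF theoryD(1)[OF T] w(2)] by (simp add: act_def)
qed

lemma tuple_comp:
  assumes T: "is_theory T" and us: "set us \<subseteq> hom T n 1" and vs: "set vs \<subseteq> hom T m 1" "length vs = n"
  shows "Comp T (tuple T n us) (tuple T m vs) = tuple T m (map (\<lambda>u. act T m u vs) us)"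
proof -
  note C = theoryD(1)[OF T]
  have v: "tuple T m vs \<in> hom T m n" using tuple(1)[OF T vs(1)] vs(2) by simp
  have a: "set (map (\<lambda>u. act T m u vs) us) \<subseteq> hom T m 1" using us act_hom[OF T _ vs] by auto
  have "Comp T (tuple T n us) (tuple T m vs) \<in> hom T m (length us)" by (rule cat_comp[OF C v tuple(1)[OF T us]])
  moreover have "Comp T (Pr T (length us) i) (Comp T (tuple T n us) (tuple T m vs)) = act T m (us ! i) vs"
    if "i < length us" for i using cat_assoc[OF C v tuple(1)[OF T us] theoryD(3)[OF T that]] tuple(2)[OF T us that] by (simp add: act_def)
  ultimately show ?thesis by (intro tuple(3)[OF T a, simplified]) simp_all
qed

lemma act_Pr:
  "is_theory T ==> set vs \<subseteq> hom T m 1 ==> length vs = n ==> i < n ==> act T m (Pr T n i) vs = vs ! i"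
  using tuple(2) by (fastforce simp: act_def)

lemma act_Comp:
  assumes T: "is_theory T" and w: "w \<in> hom T k 1" and us: "set us \<subseteq> hom T n 1" "length us = k"
    and vs: "set vs \<subseteq> hom T m 1" "length vs = n"
  shows "act T m (Comp T w (tuple T n us)) vs = act T m w (map (\<lambda>u. act T m u vs) us)"
proof -
  have "tuple T m vs \<in> hom T m n" "tuple T n us \<in> hom T n k" using tuple(1)[OF T vs(1)] tuple(1)[OF T us(1)] vs us by simp_all
  from cat_assoc[OF theoryD(1)[OF T] this w] show ?thesis by (simp add: act_def tuple_comp[OF T us(1) vs])
qed

lemma swordsD: "(w, l, f) \<in> swords T ==> w \<in> hom T (length f) 1 \<and> w \<in> words T \<and> Dom T w = length f \<and> set f \<subseteq> {..<l}"
  by (auto simp: swords_def words_def hom_def)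

lemma swordsI: "w \<in> words T ==> length f = Dom T w ==> set f \<subseteq> {..<l} ==> (w, l, f) \<in> swords T" by (simp add: swords_def)

lemma cwordsD: "(w, ws) \<in> cwords T ==> w \<in> hom T (length ws) 1 \<and> w \<in> words T \<and> Dom T w = length ws \<and> set ws \<subseteq> words T"
  by (auto simp: cwords_def words_def hom_def)

lemma cwords_words: "(w, ws) \<in> cwords T ==> w \<in> words T" "(w, ws) \<in> cwords T ==> Dom T w = length ws"
  "(w, ws) \<in> cwords T ==> set ws \<subseteq> words T"
  and swords_words: "(w, l, f) \<in> swords T ==> w \<in> words T" "(w, l, f) \<in> swords T ==> Dom T w = length f"
  "(w, l, f) \<in> swords T ==> set f \<subseteq> {..<l}" by (simp_all add: cwords_def swords_def)

lemma cwordsI: "w \<in> words T ==> length ws = Dom T w ==> set ws \<subseteq> words T ==> (w, ws) \<in> cwords T" by (simp add: cwords_def)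

lemma map_Pr_hom: "is_theory T ==> set f \<subseteq> {..<l} ==> set (map (Pr T l) f) \<subseteq> hom T l 1"
  by (auto simp: subset_iff intro!: theoryD(3))

lemma subst_word_hom:
  assumes T: "is_theory T" and w: "(w, l, f) \<in> swords T"
  shows "subst_word T w l f \<in> hom T l 1" using act_hom[OF T conjunct1[OF swordsD[OF w]] map_Pr_hom[OF T]] swordsD[OF w]
  by (simp add: subst_word_def act_def)

lemma act_subst_word:
  assumes T: "is_theory T" and w: "(w, l, f) \<in> swords T" and vs: "set vs \<subseteq> hom T m 1" "length vs = l"
  shows "act T m (subst_word T w l f) vs = act T m w (map ((!) vs) f)"
proof -
  have "map (\<lambda>u. act T m u vs) (map (Pr T l) f) = map ((!) vs) f" using swordsD[OF w] act_Pr[OF T vs] by auto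
  then show ?thesis using act_Comp[OF T conjunct1[OF swordsD[OF w]] map_Pr_hom[OF T, of f l] _ vs] swordsD[OF w]
    by (simp add: subst_word_def del: map_map)
qed

lemma gamma_word_tuple:
  assumes T: "is_theory T" and w: "(w, ws) \<in> cwords T"
  defines "ns \<equiv> map (Dom T) ws"
  defines "us \<equiv> map (\<lambda>i. subst_word T (ws ! i) (sum_list ns) (block ns i)) [0..<length ws]"
  shows "gamma_word T w ws = Comp T w (tuple T (sum_list ns) us)" "set us \<subseteq> hom T (sum_list ns) 1"
    "length us = length ws"
    "i < length ws ==> (ws ! i, sum_list ns, block ns i) \<in> swords T"
proof -
  show *: "(ws ! i, sum_list ns, block ns i) \<in> swords T" if "i < length ws" for i
    using that cwordsD[OF w] block_bound[of i ns] by (intro swordsI) (auto simp: ns_def)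
  show "set us \<subseteq> hom T (sum_list ns) 1" using subst_word_hom[OF T *] by (auto simp: us_def)
qed (simp_all add: gamma_word_def us_def ns_def Let_def)

lemma gamma_word_hom:
  assumes T: "is_theory T" and w: "(w, ws) \<in> cwords T"
  shows "gamma_word T w ws \<in> hom T (sum_list (map (Dom T) ws)) 1"
  using act_hom[OF T conjunct1[OF cwordsD[OF w]] gamma_word_tuple(2)[OF T w]] by (simp add: gamma_word_tuple(1)[OF T w] act_def)

text \<open>The inclusion of the \<open>i\<close>-th block, substituted into a word, makes that word
  act on the \<open>i\<close>-th block only. With \<open>act_cong\<close> this reduces equations
  about \<open>gamma_word\<close> to equations about cut lists.\<close>

lemma act_gamma_word:
  assumes T: "is_theory T" and w: "(w, ws) \<in> cwords T"
    and vs: "set vs \<subseteq> hom T m 1" "length vs = sum_list (map (Dom T) ws)"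
  shows "act T m (gamma_word T w ws) vs = act T m w (map2 (act T m) ws (blocks (map (Dom T) ws) vs))"
proof -
  note g = gamma_word_tuple[OF T w]
  show ?thesis unfolding g(1) act_Comp[OF T conjunct1[OF cwordsD[OF w]] g(2,3) vs]
    by (rule arg_cong[of _ _ "act T m w"], rule nth_equalityI)
      (auto simp: act_subst_word[OF T g(4) vs] nth_blocks[OF vs(2)])
qed

lemma unit_word_hom: "is_theory T ==> unit_word T \<in> hom T 1 1" by (simp add: unit_word_def theoryD(3))

lemma act_unit_word: "is_theory T ==> v \<in> hom T m 1 ==> act T m (unit_word T) [v] = v"
  using act_Pr[of T "[v]" m 1 0] by (simp add: unit_word_def)

lemma gamma_words: assumes "is_theory T" "(w, ws) \<in> cwords T"
  shows "gamma_word T w ws \<in> words T" "Dom T (gamma_word T w ws) = sum_list (map (Dom T) ws)"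
  using hom_words[OF gamma_word_hom[OF assms]] by auto

lemma subst_words: assumes "is_theory T" "(w, l, f) \<in> swords T"
  shows "subst_word T w l f \<in> words T" "Dom T (subst_word T w l f) = l" using hom_words[OF subst_word_hom[OF assms]] by auto

lemma unit_words: assumes "is_theory T" shows "unit_word T \<in> words T" "Dom T (unit_word T) = 1"
  using hom_words[OF unit_word_hom[OF assms]] by auto

text \<open>Both composite words act by letting the innermost words act on small blocks and
  collecting the results, so \<open>blocks_assoc\<close> identifies them. Equality of the words is
  what makes the two sides of axiom (1) start at the same functor; the first three claims supply the
  typing of that axiom.\<close>

lemma gamma_word_assoc:
  assumes T: "is_theory T" and w: "(w, ws) \<in> cwords T" and l: "length wss = length ws"
    and ws: "\<And>j. j < length ws ==> (ws ! j, wss ! j) \<in> cwords T"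
  shows "(gamma_word T w ws, concat wss) \<in> cwords T" "(w, map2 (gamma_word T) ws wss) \<in> cwords T"
    "map (Dom T) (map2 (gamma_word T) ws wss) = map (\<lambda>vs. sum_list (map (Dom T) vs)) wss"
    "gamma_word T (gamma_word T w ws) (concat wss) = gamma_word T w (map2 (gamma_word T) ws wss)"
proof -
let ?ws = "map2 (gamma_word T) ws wss"
let ?ns = "map (Dom T) (concat wss)"
let ?ms = "map (\<lambda>vs. sum_list (map (Dom T) vs)) wss"
  have lj: "length (wss ! j) = Dom T (ws ! j)" "set (wss ! j) \<subseteq> words T" if "j < length ws" for j
    using cwordsD[OF ws[OF that]] by simp_all
  have lc: "length (concat wss) = sum_list (map (Dom T) ws)"
    unfolding length_concat by (rule arg_cong[of _ _ sum_list], rule nth_equalityI) (auto simp: l lj)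
  have sc: "set (concat wss) \<subseteq> words T" using lj(2) l by (auto simp: set_conv_nth[of wss] subset_iff)
  show c1: "(gamma_word T w ws, concat wss) \<in> cwords T" using hom_words[OF gamma_word_hom[OF T w]] lc sc by (intro cwordsI) auto
  show c2: "(w, ?ws) \<in> cwords T" using hom_words[OF gamma_word_hom[OF T ws]] cwordsD[OF w] l by (intro cwordsI) (auto simp: set_zip)
  show d: "map (Dom T) ?ws = ?ms" using hom_words[OF gamma_word_hom[OF T ws]] l by (auto intro!: nth_equalityI)
  have s: "sum_list ?ns = sum_list ?ms" by (induction wss) auto
  show "gamma_word T (gamma_word T w ws) (concat wss) = gamma_word T w ?ws"
  proof (rule act_cong[OF T gamma_word_hom[OF T c1]])
    let ?m = "sum_list ?ns"
    show "gamma_word T w ?ws \<in> hom T ?m 1" using gamma_word_hom[OF T c2] unfolding d s .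
    fix vs assume vs: "set vs \<subseteq> hom T ?m 1" "length vs = ?m"
    let ?bs = "blocks ?ms vs"
    let ?us = "map2 (act T ?m) (concat wss) (blocks ?ns vs)"
    let ?vs = "map2 (\<lambda>vs b. map2 (act T ?m) vs (blocks (map (Dom T) vs) b)) wss ?bs"
    have vs': "length vs = sum_list (map (Dom T) ?ws)" unfolding d s[symmetric] by (rule vs(2))
    have "set ?us \<subseteq> hom T ?m 1"
    proof
      fix a assume "a \<in> set ?us"
      then obtain k where k: "k < length (concat wss)"
        and a: "a = act T ?m (concat wss ! k) (blocks ?ns vs ! k)" by (auto simp: set_zip)
      have "concat wss ! k \<in> words T" using sc k by (meson nth_mem subsetD)
      then show "a \<in> hom T ?m 1" using set_blocks[of k "?ns" vs] length_blocks_nth[OF vs(2)] vs k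
        unfolding a by (intro act_hom[OF T]) (auto simp: words_hom[symmetric])
    qed
    then have "act T ?m (gamma_word T (gamma_word T w ws) (concat wss)) vs = act T ?m w (map2 (act T ?m) ws (blocks (map (Dom T) ws) ?us))"
      using lc by (simp add: act_gamma_word[OF T c1 vs] act_gamma_word[OF T w])
    also have "\<dots> = act T ?m w (map2 (act T ?m) ws ?vs)" using lj l vs by (subst blocks_assoc) auto
    also have "\<dots> = act T ?m w (map2 (act T ?m) ?ws ?bs)"
    proof (rule arg_cong[of _ _ "act T ?m w"], rule nth_equalityI)
      fix j assume "j < length (map2 (act T ?m) ws ?vs)"
      then have j: "j < length ws" by simp
      have "set (?bs ! j) \<subseteq> hom T ?m 1" "length (?bs ! j) = sum_list (map (Dom T) (wss ! j))"
        using set_blocks[of j "?ms" vs] j l vs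
          length_blocks_nth[of vs "?ms" j] by (auto simp: s)
      from act_gamma_word[OF T ws[OF j] this] show "map2 (act T ?m) ws ?vs ! j = map2 (act T ?m) ?ws ?bs ! j" using j l by simp
    qed (simp add: l)
    also have "\<dots> = act T ?m (gamma_word T w ?ws) vs" unfolding act_gamma_word[OF T c2 vs(1) vs'] d ..
    finally show "act T ?m (gamma_word T (gamma_word T w ws) (concat wss)) vs = act T ?m (gamma_word T w ?ws) vs" .
  qed
qed

lemma cwords_unit_right: "is_theory T ==> w \<in> words T ==> (w, replicate (Dom T w) (unit_word T)) \<in> cwords T"
  by (intro cwordsI) (auto dest: hom_words[OF unit_word_hom])

lemma cwords_unit_left: "is_theory T ==> w \<in> words T ==> (unit_word T, [w]) \<in> cwords T"
  by (intro cwordsI) (auto dest: hom_words[OF unit_word_hom])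

lemma Dom_unit_word: "is_theory T ==> Dom T (unit_word T) = 1" by (simp add: hom_words[OF unit_word_hom])

lemma gamma_word_unit_right:
  assumes T: "is_theory T" and w: "w \<in> words T"
  shows "gamma_word T w (replicate (Dom T w) (unit_word T)) = w"
proof -
  let ?k = "Dom T w"
  note c = cwords_unit_right[OF T w]
  have d: "map (Dom T) (replicate ?k (unit_word T)) = replicate ?k 1" by (simp add: Dom_unit_word[OF T])
  have s: "sum_list (replicate ?k 1) = ?k" by (simp add: sum_list_replicate)
  show ?thesis
  proof (rule act_cong[OF T])
    show "gamma_word T w (replicate ?k (unit_word T)) \<in> hom T ?k 1" using gamma_word_hom[OF T c] unfolding d s .
    show "w \<in> hom T ?k 1" using w by (simp add: words_hom)
    fix vs assume vs: "set vs \<subseteq> hom T ?k 1" "length vs = ?k"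
    then have "map2 (act T ?k) (replicate ?k (unit_word T)) (map (\<lambda>x. [x]) vs) = vs"
      by (intro nth_equalityI) (auto simp: act_unit_word[OF T] subset_iff)
    then show "act T ?k (gamma_word T w (replicate ?k (unit_word T))) vs = act T ?k w vs"
      using vs by (subst act_gamma_word[OF T c]) (simp_all only: d s blocks_replicate_1)
  qed
qed

lemma gamma_word_unit_left:
  assumes T: "is_theory T" and w: "w \<in> words T"
  shows "gamma_word T (unit_word T) [w] = w"
proof (rule act_cong[OF T])
  note c = cwords_unit_left[OF T w]
  show "gamma_word T (unit_word T) [w] \<in> hom T (Dom T w) 1" using gamma_word_hom[OF T c] by simp
  show w': "w \<in> hom T (Dom T w) 1" using w by (simp add: words_hom)
  fix vs assume "set vs \<subseteq> hom T (Dom T w) 1" "length vs = Dom T w"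
  then show "act T (Dom T w) (gamma_word T (unit_word T) [w]) vs = act T (Dom T w) w vs"
    by (subst act_gamma_word[OF T c]) (simp_all add: act_unit_word[OF T] act_hom[OF T w'])
qed

text \<open>The bookkeeping for axiom (4): the words at which its coherence isomorphisms are taken
  are well typed, and the two composites start at the same functor because the last two words agree.
  They agree since substitution along \<open>block_map\<close> only copies blocks.\<close>

lemma gamma_word_subst:
  assumes T: "is_theory T" and w: "(w, l, f) \<in> swords T" and l: "length ws = l" and ws: "set ws \<subseteq> words T"
  defines "ns \<equiv> map (Dom T) ws"
  shows "(w, map ((!) ws) f) \<in> cwords T" "(subst_word T w l f, ws) \<in> cwords T"
    "map (Dom T) (map ((!) ws) f) = map ((!) ns) f" "set f \<subseteq> {..<length ns}"
    "(gamma_word T w (map ((!) ws) f), sum_list ns, block_map ns f) \<in> swords T"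
    "subst_word T (gamma_word T w (map ((!) ws) f)) (sum_list ns) (block_map ns f) = gamma_word T (subst_word T w l f) ws"
proof -
  note wD = swordsD[OF w]
  show c1: "(w, map ((!) ws) f) \<in> cwords T" using wD ws l by (intro cwordsI) (auto simp: subset_iff)
  show c2: "(subst_word T w l f, ws) \<in> cwords T" using hom_words[OF subst_word_hom[OF T w]] ws l by (intro cwordsI) auto
  show d: "map (Dom T) (map ((!) ws) f) = map ((!) ns) f" using wD l by (auto simp: ns_def)
  show f: "set f \<subseteq> {..<length ns}" using wD l by (simp add: ns_def)
  show s: "(gamma_word T w (map ((!) ws) f), sum_list ns, block_map ns f) \<in> swords T"
    using hom_words[OF gamma_word_hom[OF T c1]] set_block_map[OF f] by (intro swordsI) (simp_all add: d length_block_map[OF f] del: map_map)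
  show "subst_word T (gamma_word T w (map ((!) ws) f)) (sum_list ns) (block_map ns f) = gamma_word T (subst_word T w l f) ws"
  proof (rule act_cong[OF T subst_word_hom[OF T s]])
    show "gamma_word T (subst_word T w l f) ws \<in> hom T (sum_list ns) 1" using gamma_word_hom[OF T c2] by (simp add: ns_def)
    fix vs assume vs: "set vs \<subseteq> hom T (sum_list ns) 1" "length vs = sum_list ns"
    let ?m = "sum_list ns"
    have 1: "set (map ((!) vs) (block_map ns f)) \<subseteq> hom T ?m 1" using set_block_map[OF f] vs by (fastforce simp: subset_iff)
    have 2: "length (map ((!) vs) (block_map ns f)) = sum_list (map (Dom T) (map ((!) ws) f))"
      by (simp add: d length_block_map[OF f] del: map_map)
    have 3: "set (map2 (act T ?m) ws (blocks ns vs)) \<subseteq> hom T ?m 1"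
    proof
      fix a assume "a \<in> set (map2 (act T ?m) ws (blocks ns vs))"
      then obtain k where k: "k < length ws" and a: "a = act T ?m (ws ! k) (blocks ns vs ! k)" by (auto simp: set_zip)
      have "ws ! k \<in> words T" using ws k by (meson nth_mem subsetD)
      then show "a \<in> hom T ?m 1" using set_blocks[of k ns vs] length_blocks_nth[OF vs(2)] vs k
        unfolding a by (intro act_hom[OF T]) (auto simp: words_hom[symmetric] ns_def)
    qed
    have "act T ?m (subst_word T (gamma_word T w (map ((!) ws) f)) ?m (block_map ns f)) vs
      = act T ?m w (map2 (act T ?m) (map ((!) ws) f) (map ((!) (blocks ns vs)) f))"
      unfolding act_subst_word[OF T s vs] act_gamma_word[OF T c1 1 2] d blocks_block_map[OF f vs(2)] ..
    also have "\<dots> = act T ?m w (map ((!) (map2 (act T ?m) ws (blocks ns vs))) f)"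
      using wD l by (subst map2_nth_reindex) (auto simp: ns_def)
    also have "\<dots> = act T ?m (gamma_word T (subst_word T w l f) ws) vs"
      unfolding act_gamma_word[OF T c2 vs[unfolded ns_def], folded ns_def] using l by (subst act_subst_word[OF T w 3]) (auto simp: ns_def)
    finally show "act T ?m (subst_word T (gamma_word T w (map ((!) ws) f)) ?m (block_map ns f)) vs
      = act T ?m (gamma_word T (subst_word T w l f) ws) vs" .
  qed
qed

text \<open>The same bookkeeping for axiom (5), resting on \<open>blocks_block_sum\<close>.\<close>

lemma gamma_word_block_sum:
  assumes T: "is_theory T" and w: "(w, ws) \<in> cwords T" and l: "length ns' = length ws" "length gs = length ws"
    and g: "\<And>j. j < length ws ==> (ws ! j, ns' ! j, gs ! j) \<in> swords T"
  defines "ws' \<equiv> map (\<lambda>j. subst_word T (ws ! j) (ns' ! j) (gs ! j)) [0..<length ws]"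
  shows "(w, ws') \<in> cwords T" "map (Dom T) ws' = ns'" "map (Dom T) ws = map length gs"
    "(gamma_word T w ws, sum_list ns', block_sum ns' gs) \<in> swords T"
    "subst_word T (gamma_word T w ws) (sum_list ns') (block_sum ns' gs) = gamma_word T w ws'"
proof -
  note gD = swordsD[OF g]
  have gb: "set (gs ! j) \<subseteq> {..<ns' ! j}" if "j < length ns'" for j using gD that l by simp
  have lg: "length gs = length ns'" using l by simp
  note hs = hom_words[OF subst_word_hom[OF T g]]
  show c: "(w, ws') \<in> cwords T" using cwordsD[OF w] hs by (intro cwordsI) (auto simp: ws'_def)
  show d: "map (Dom T) ws' = ns'" using hs l by (auto simp: ws'_def intro!: nth_equalityI)
  show d': "map (Dom T) ws = map length gs" using gD l by (auto intro!: nth_equalityI)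
  show s: "(gamma_word T w ws, sum_list ns', block_sum ns' gs) \<in> swords T"
    using hom_words[OF gamma_word_hom[OF T w]] set_block_sum[OF lg gb] by (intro swordsI) (simp_all add: length_block_sum d')
  show "subst_word T (gamma_word T w ws) (sum_list ns') (block_sum ns' gs) = gamma_word T w ws'"
  proof (rule act_cong[OF T subst_word_hom[OF T s]])
    show "gamma_word T w ws' \<in> hom T (sum_list ns') 1" using gamma_word_hom[OF T c] by (simp add: d)
    fix vs assume vs: "set vs \<subseteq> hom T (sum_list ns') 1" "length vs = sum_list ns'"
    let ?m = "sum_list ns'"
    have 1: "set (map ((!) vs) (block_sum ns' gs)) \<subseteq> hom T ?m 1" using set_block_sum[OF lg gb] vs by (fastforce simp: subset_iff)
    have 2: "length (map ((!) vs) (block_sum ns' gs)) = sum_list (map (Dom T) ws)" by (simp add: d' length_block_sum)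
    have "act T ?m (subst_word T (gamma_word T w ws) ?m (block_sum ns' gs)) vs
      = act T ?m w (map2 (act T ?m) ws (map (\<lambda>j. map ((!) (blocks ns' vs ! j)) (gs ! j)) [0..<length gs]))"
      unfolding act_subst_word[OF T s vs] act_gamma_word[OF T w 1 2] d' by (subst blocks_block_sum[OF lg gb vs(2)]) simp_all
    also have "map2 (act T ?m) ws (map (\<lambda>j. map ((!) (blocks ns' vs ! j)) (gs ! j)) [0..<length gs])
      = map2 (act T ?m) ws' (blocks ns' vs)"
    proof (rule nth_equalityI)
      fix j assume "j < length (map2 (act T ?m) ws (map (\<lambda>j. map ((!) (blocks ns' vs ! j)) (gs ! j)) [0..<length gs]))"
      then have j: "j < length ws" by simp
      have "set (blocks ns' vs ! j) \<subseteq> hom T ?m 1" "length (blocks ns' vs ! j) = ns' ! j"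
        using set_blocks[of j ns' vs] j l vs length_blocks_nth[OF vs(2)] by auto
      from act_subst_word[OF T g[OF j] this]
      show "map2 (act T ?m) ws (map (\<lambda>j. map ((!) (blocks ns' vs ! j)) (gs ! j)) [0..<length gs]) ! j
        = map2 (act T ?m) ws' (blocks ns' vs) ! j" using j l by (simp add: ws'_def)
    qed (simp add: l ws'_def)
    also have "act T ?m w \<dots> = act T ?m (gamma_word T w ws') vs" using vs by (subst act_gamma_word[OF T c]) (simp_all add: d)
    finally show "act T ?m (subst_word T (gamma_word T w ws) ?m (block_sum ns' gs)) vs = act T ?m (gamma_word T w ws') vs" .
  qed
qed

lemma subst_word_subst:
  assumes T: "is_theory T" and w: "(w, l, f) \<in> swords T" and g: "length g = l" "set g \<subseteq> {..<m}"
  shows "(subst_word T w l f, m, g) \<in> swords T" "(w, m, map ((!) g) f) \<in> swords T"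
    "subst_word T (subst_word T w l f) m g = subst_word T w m (map ((!) g) f)"
proof -
  note wD = swordsD[OF w]
  show s1: "(subst_word T w l f, m, g) \<in> swords T" using hom_words[OF subst_word_hom[OF T w]] g by (intro swordsI) auto
  show s2: "(w, m, map ((!) g) f) \<in> swords T" using wD g by (intro swordsI) (auto simp: subset_iff)
  show "subst_word T (subst_word T w l f) m g = subst_word T w m (map ((!) g) f)"
  proof (rule act_cong[OF T subst_word_hom[OF T s1] subst_word_hom[OF T s2]])
    fix vs assume vs: "set vs \<subseteq> hom T m 1" "length vs = m"
    then have "set (map ((!) vs) g) \<subseteq> hom T m 1" using g by (auto simp: subset_iff)
    then show "act T m (subst_word T (subst_word T w l f) m g) vs = act T m (subst_word T w m (map ((!) g) f)) vs"
      using map_nth_map_nth[of f g vs] wD g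
      by (simp add: act_subst_word[OF T s1 vs] act_subst_word[OF T w] act_subst_word[OF T s2 vs] del: map_map)
  qed
qed

lemma swords_id: "w \<in> words T ==> (w, Dom T w, [0..<Dom T w]) \<in> swords T" by (intro swordsI) auto

lemma subst_word_id:
  assumes T: "is_theory T" and w: "w \<in> words T"
  shows "subst_word T w (Dom T w) [0..<Dom T w] = w"
proof (rule act_cong[OF T subst_word_hom[OF T swords_id[OF w]]])
  show "w \<in> hom T (Dom T w) 1" using w by (simp add: words_hom)
  fix vs assume vs: "set vs \<subseteq> hom T (Dom T w) 1" "length vs = Dom T w"
  then show "act T (Dom T w) (subst_word T w (Dom T w) [0..<Dom T w]) vs = act T (Dom T w) w vs"
    using map_nth[of vs] by (simp add: act_subst_word[OF T swords_id[OF w]])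
qed

section \<open>Morphisms of theories\<close>

lemma theory_morphismD:
  assumes "theory_morphism S T \<phi>"
  shows "is_functor S T \<phi>" "fob \<phi> n = n" "i < n ==> far \<phi> (Pr S n i) = Pr T n i"
  using assms by (auto simp: theory_morphism_def)

lemma morphism_hom: "theory_morphism S T \<phi> ==> w \<in> hom S m n ==> far \<phi> w \<in> hom T m n"
  using functor_hom[OF theory_morphismD(1), of S T \<phi> w m n] by (simp add: theory_morphismD(2))

lemma morphism_words: "theory_morphism S T \<phi> ==> w \<in> words S ==> far \<phi> w \<in> words T \<and> Dom T (far \<phi> w) = Dom S w"
  using morphism_hom[of S T \<phi> w "Dom S w" 1] hom_words by (fastforce simp: words_hom)

lemma morphism_cwords:
  "theory_morphism S T \<phi> ==> (w, ws) \<in> cwords S ==> (far \<phi> w, map (far \<phi>) ws) \<in> cwords T"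
  using cwordsD[of w ws S] morphism_words[of S T \<phi>] by (intro cwordsI) (auto simp: subset_iff)

lemma morphism_swords:
  "theory_morphism S T \<phi> ==> (w, l, f) \<in> swords S ==> (far \<phi> w, l, f) \<in> swords T"
  using swordsD[of w l f S] morphism_words[of S T \<phi>] by (intro swordsI) auto

lemma morphism_Dom: "theory_morphism S T \<phi> ==> set ws \<subseteq> words S ==> map (Dom T) (map (far \<phi>) ws) = map (Dom S) ws"
  using morphism_words[of S T \<phi>] by (auto simp: subset_iff)

text \<open>A morphism of theories preserves projections, and tuples are characterised by their
  projections. Preservation of \<open>subst_word\<close> and \<open>gamma_word\<close> follows from
  this.\<close>

lemma morphism_tuple:
  assumes S: "is_theory S" and T: "is_theory T" and \<phi>: "theory_morphism S T \<phi>" and vs: "set vs \<subseteq> hom S m 1"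
  shows "far \<phi> (tuple S m vs) = tuple T m (map (far \<phi>) vs)"
proof -
  have v': "set (map (far \<phi>) vs) \<subseteq> hom T m 1" using vs morphism_hom[OF \<phi>] by auto
  note t = tuple[OF S vs]
  have "Comp T (Pr T (length vs) i) (far \<phi> (tuple S m vs)) = far \<phi> (vs ! i)" if i: "i < length vs" for i
    using functor_comp[OF theory_morphismD(1)[OF \<phi>] t(1) theoryD(3)[OF S i]] t(2)[OF i] by (simp add: theory_morphismD(3)[OF \<phi> i])
  then show ?thesis using morphism_hom[OF \<phi> t(1)] by (intro tuple(3)[OF T v']) simp_all
qed

lemma morphism_subst_word:
  assumes S: "is_theory S" and T: "is_theory T" and \<phi>: "theory_morphism S T \<phi>" and w: "(w, l, f) \<in> swords S"
  shows "far \<phi> (subst_word S w l f) = subst_word T (far \<phi> w) l f"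
proof -
  note wD = swordsD[OF w]
  have v: "set (map (Pr S l) f) \<subseteq> hom S l 1" using map_Pr_hom[OF S] wD by blast
  have "far \<phi> (subst_word S w l f) = Comp T (far \<phi> w) (tuple T l (map (far \<phi>) (map (Pr S l) f)))"
    using functor_comp[OF theory_morphismD(1)[OF \<phi>] tuple(1)[OF S v], of w 1] wD
    by (simp add: subst_word_def morphism_tuple[OF S T \<phi> v])
  also have "map (far \<phi>) (map (Pr S l) f) = map (Pr T l) f" using wD by (auto simp: theory_morphismD(3)[OF \<phi>])
  finally show ?thesis by (simp add: subst_word_def)
qed

lemma morphism_gamma_word:
  assumes S: "is_theory S" and T: "is_theory T" and \<phi>: "theory_morphism S T \<phi>" and w: "(w, ws) \<in> cwords S"
  shows "far \<phi> (gamma_word S w ws) = gamma_word T (far \<phi> w) (map (far \<phi>) ws)"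
proof -
  note g = gamma_word_tuple[OF S w] and g' = gamma_word_tuple[OF T morphism_cwords[OF \<phi> w]]
  have d: "map (Dom T) (map (far \<phi>) ws) = map (Dom S) ws" using morphism_Dom[OF \<phi>] cwordsD[OF w] by blast
  show ?thesis unfolding g(1) g'(1) d using functor_comp[OF theory_morphismD(1)[OF \<phi>] tuple(1)[OF S g(2)], of w 1] cwordsD[OF w]
    by (simp add: morphism_tuple[OF S T \<phi> g(2)] comp_def)
      (intro arg_cong[of _ _ "Comp T (far \<phi> w)"] arg_cong[of _ _ "tuple T (sum_list (map (Dom S) ws))"]
        map_cong refl, simp add: morphism_subst_word[OF S T \<phi> g(4)])
qed

lemma morphism_unit_word: "theory_morphism S T \<phi> ==> far \<phi> (unit_word S) = unit_word T"
  by (simp add: unit_word_def theory_morphismD(3))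

section \<open>Functors and transformations between powers\<close>

lemma pow_simps [simp]: "Dom (pow_cat C n) = map (Dom C)" "Cod (pow_cat C n) = map (Cod C)"
  "Idt (pow_cat C n) = map (Idt C)" "Comp (pow_cat C n) = map2 (Comp C)" by (simp_all add: pow_cat_def)

lemma Ob_pow: "xs \<in> Ob (pow_cat C n) \<longleftrightarrow> length xs = n \<and> set xs \<subseteq> Ob C"
  and Ar_pow: "fs \<in> Ar (pow_cat C n) \<longleftrightarrow> length fs = n \<and> set fs \<subseteq> Ar C" by (simp_all add: pow_cat_def)

lemma Ob_pow_nth: "xs \<in> Ob (pow_cat C n) \<longleftrightarrow> length xs = n \<and> (\<forall>i<n. xs ! i \<in> Ob C)"
  and Ar_pow_nth: "fs \<in> Ar (pow_cat C n) \<longleftrightarrow> length fs = n \<and> (\<forall>i<n. fs ! i \<in> Ar C)"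
  by (auto simp: pow_cat_def set_conv_nth)

lemma hom_pow: "fs \<in> hom (pow_cat C n) xs ys \<longleftrightarrow> length fs = n \<and> length xs = n \<and> length ys = n \<and>
    (\<forall>i<n. fs ! i \<in> hom C (xs ! i) (ys ! i))"
proof -
  have "map (Dom C) fs = xs \<longleftrightarrow> length xs = length fs \<and> (\<forall>i<length fs. Dom C (fs ! i) = xs ! i)" for xs
    by (auto simp: list_eq_iff_nth_eq)
  moreover have "map (Cod C) fs = ys \<longleftrightarrow> length ys = length fs \<and> (\<forall>i<length fs. Cod C (fs ! i) = ys ! i)" for ys
    by (auto simp: list_eq_iff_nth_eq)
  moreover have "set fs \<subseteq> Ar C \<longleftrightarrow> (\<forall>i<length fs. fs ! i \<in> Ar C)" by (auto simp: set_conv_nth)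
  ultimately show ?thesis by (auto simp: hom_def Ar_pow)
qed

lemma hom_powI: "length fs = n ==> length xs = n ==> length ys = n ==>
    (\<And>i. i < n ==> fs ! i \<in> hom C (xs ! i) (ys ! i)) ==> fs \<in> hom (pow_cat C n) xs ys" by (simp add: hom_pow)

lemma category_pow: "category C ==> category (pow_cat C n)"
proof (rule categoryI, goal_cases)
  case (1 f)
  then show ?case using cat_Dom[of C] cat_Cod[of C] by (auto simp: Ob_pow Ar_pow)
next
  case (2 x)
  then show ?case using cat_id[of C] by (auto simp: hom_pow Ob_pow_nth)
next
  case (3 f g x y z)
  then show ?case using cat_comp[of C] by (auto simp: hom_pow)
next
  case (4 f x y)
  then show ?case using cat_idr[of C] by (auto simp: hom_pow intro!: nth_equalityI)
next
  case (5 f x y)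
  then show ?case using cat_idl[of C] by (auto simp: hom_pow intro!: nth_equalityI)
next
  case (6 f g h a b c d)
  then show ?case using cat_assoc[of C "f ! i" "a ! i" "b ! i" "g ! i" "c ! i" "h ! i" "d ! i" for i]
    by (auto simp: hom_pow intro!: nth_equalityI)
qed

lemma iso_pow:
  assumes "category C" "length fs = n" "\<And>i. i < n ==> iso C (fs ! i)"
  shows "iso (pow_cat C n) fs"
proof -
  have h: "fs ! i \<in> hom C (Dom C (fs ! i)) (Cod C (fs ! i))" if "i < n" for i using assms(3)[OF that] by (auto simp: iso_def hom_def)
  show ?thesis by (rule isoI[of _ _ "map (Dom C) fs" "map (Cod C) fs" "map (inverse_ar C) fs"])
      (use assms h inverse_ar[OF assms(3) h] in \<open>auto simp: hom_pow intro!: nth_equalityI\<close>)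
qed

lemma blocks_hom:
  assumes "fs \<in> hom (pow_cat C (sum_list ns)) xs ys" "i < length ns"
  shows "blocks ns fs ! i \<in> hom (pow_cat C (ns ! i)) (blocks ns xs ! i) (blocks ns ys ! i)"
  using assms block_bound[of i ns] length_blocks_nth[of fs ns i] length_blocks_nth[of xs ns i]
    length_blocks_nth[of ys ns i] by (auto simp: hom_pow nth_blocks)

lemma blocks_Ob:
  assumes "xs \<in> Ob (pow_cat C (sum_list ns))" "i < length ns"
  shows "blocks ns xs ! i \<in> Ob (pow_cat C (ns ! i))" using assms set_blocks[of i ns xs] by (auto simp: Ob_pow length_blocks_nth)

lemma blocks_Ar:
  assumes "xs \<in> Ar (pow_cat C (sum_list ns))" "i < length ns"
  shows "blocks ns xs ! i \<in> Ar (pow_cat C (ns ! i))" using assms set_blocks[of i ns xs] by (auto simp: Ar_pow length_blocks_nth)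

lemma blocks_map2:
  "length xs = length ys ==> blocks ns (map2 f xs ys) = map2 (map2 f) (blocks ns xs) (blocks ns ys)"
  by (induction ns arbitrary: xs ys) (auto simp: take_zip drop_zip take_map drop_map)

lemma functor_pow_fun:
  assumes F: "is_functor C D F"
  shows "is_functor (pow_cat C n) (pow_cat D n) (pow_fun C n F)"
proof (rule is_functorI, goal_cases)
  case 5 then show ?case using functor_ob[OF F] by (auto simp: pow_fun_def Ob_pow)
next
  case (6 f x y)
  note P = category_pow[OF functor_cat(1)[OF F], of n]
  show ?case using 6 hom_Ar[OF 6] hom_Ob_Dom[OF P 6] hom_Ob_Cod[OF P 6] functor_hom[OF F] by (auto simp: pow_fun_def hom_pow)
next
  case (7 x)
  then show ?case using functor_id[OF F] cat_id[OF functor_cat(1)[OF F], THEN hom_Ar] by (auto simp: pow_fun_def Ob_pow Ar_pow)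
next
  case (8 f g x y z)
  note P = category_pow[OF functor_cat(1)[OF F], of n]
  show ?case using 8 hom_Ar[OF 8(1)] hom_Ar[OF 8(2)] hom_Ar[OF cat_comp[OF P 8]]
      functor_comp[OF F, of "f ! i" "x ! i" "y ! i" "g ! i" "z ! i" for i] by (auto simp: pow_fun_def hom_pow intro!: nth_equalityI)
qed (auto simp: pow_fun_def intro: category_pow functor_cat[OF F])

lemma functor_prod_fun:
  assumes C: "category C" "category D" and l: "length Fs = length ns"
    and F: "\<And>i. i < length ns ==> is_functor (pow_cat C (ns ! i)) D (Fs ! i)"
  shows "is_functor (pow_cat C (sum_list ns)) (pow_cat D (length ns)) (prod_fun C ns Fs)"
proof (rule is_functorI, goal_cases)
  case (5 x)
  then show ?case using functor_ob[OF F blocks_Ob[OF 5]] l by (auto simp: prod_fun_def Ob_pow_nth)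
next
  case (6 f x y)
  note P = category_pow[OF C(1), of "sum_list ns"]
  show ?case using hom_Ar[OF 6] hom_Ob_Dom[OF P 6] hom_Ob_Cod[OF P 6] functor_hom[OF F blocks_hom[OF 6]] l
    by (auto simp: prod_fun_def hom_pow[where C = D])
next
  case (7 x)
  note P = category_pow[OF C(1), of "sum_list ns"]
  show ?case using 7 functor_id[OF F blocks_Ob[OF 7]] cat_id[OF P 7, THEN hom_Ar] l
    by (auto simp: prod_fun_def blocks_map intro!: nth_equalityI)
next
  case (8 f g x y z)
  note P = category_pow[OF C(1), of "sum_list ns"]
  have "length f = length g" using 8 by (simp add: hom_pow)
  then show ?case using hom_Ar[OF 8(1)] hom_Ar[OF 8(2)] hom_Ar[OF cat_comp[OF P 8]] l
      functor_comp[OF F blocks_hom[OF 8(1)] blocks_hom[OF 8(2)]] by (auto simp: prod_fun_def blocks_map2 intro!: nth_equalityI)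
qed (auto simp: prod_fun_def intro: category_pow C)

lemma functor_reindex_fun:
  assumes C: "category C" and f: "set f \<subseteq> {..<l}"
  shows "is_functor (pow_cat C l) (pow_cat C (length f)) (reindex_fun C l f)"
proof (rule is_functorI, goal_cases)
  case (5 x) then show ?case using f by (auto simp: reindex_fun_def Ob_pow subset_iff)
next
  case (6 g x y)
  note P = category_pow[OF C, of l]
  show ?case using 6 hom_Ar[OF 6] hom_Ob_Dom[OF P 6] hom_Ob_Cod[OF P 6] f by (auto simp: reindex_fun_def hom_pow subset_iff)
next
  case (7 x)
  note P = category_pow[OF C, of l]
  show ?case using 7 cat_id[OF P 7, THEN hom_Ar] f by (auto simp: reindex_fun_def Ob_pow subset_iff)
next
  case (8 f g x y z)
  note P = category_pow[OF C, of l]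
  show ?case using 8 hom_Ar[OF 8(1)] hom_Ar[OF 8(2)] hom_Ar[OF cat_comp[OF P 8]] \<open>set _ \<subseteq> {..<l}\<close>
    by (auto simp: reindex_fun_def hom_pow subset_iff intro!: nth_equalityI)
qed (auto simp: reindex_fun_def intro: category_pow C)

lemma functor_unit_fun:
  assumes C: "category C"
  shows "is_functor (pow_cat C 1) C (unit_fun C)"
proof (rule is_functorI, goal_cases)
  case (5 x) then show ?case by (cases x) (auto simp: unit_fun_def Ob_pow)
next
  case (6 f x y)
  note P = category_pow[OF C, of 1]
  show ?case using 6 hom_Ar[OF 6] hom_Ob_Dom[OF P 6] hom_Ob_Cod[OF P 6] by (cases f; cases x; cases y) (auto simp: unit_fun_def hom_pow)
next
  case (7 x)
  note P = category_pow[OF C, of 1]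
  show ?case using 7 cat_id[OF P 7, THEN hom_Ar] by (cases x) (auto simp: unit_fun_def Ob_pow)
next
  case (8 f g x y z)
  note P = category_pow[OF C, of 1]
  show ?case using 8 hom_Ar[OF 8(1)] hom_Ar[OF 8(2)] hom_Ar[OF cat_comp[OF P 8]] by (cases f; cases g) (auto simp: unit_fun_def hom_pow)
qed (auto simp: unit_fun_def intro: category_pow C)

lemma functor_gamma_fun:
  assumes "category C" "length Fs = length ns" "is_functor (pow_cat C (length ns)) C F"
    "\<And>i. i < length ns ==> is_functor (pow_cat C (ns ! i)) C (Fs ! i)"
  shows "is_functor (pow_cat C (sum_list ns)) C (gamma_fun C ns F Fs)"
  unfolding gamma_fun_def using functor_fcomp[OF functor_prod_fun assms(3)] assms by blast

lemma functor_subst_fun: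
  assumes "is_functor (pow_cat C (length f)) D F" "category C" "set f \<subseteq> {..<l}"
  shows "is_functor (pow_cat C l) D (subst_fun C F l f)"
  unfolding subst_fun_def using functor_fcomp[OF functor_reindex_fun assms(1)] assms by blast

lemma pow_fun_simps [simp]:
  "xs \<in> Ob (pow_cat C n) ==> fob (pow_fun C n F) xs = map (fob F) xs"
  "fs \<in> Ar (pow_cat C n) ==> far (pow_fun C n F) fs = map (far F) fs" by (simp_all add: pow_fun_def)

lemma prod_fun_simps [simp]:
  "xs \<in> Ob (pow_cat C (sum_list ns)) ==> fob (prod_fun C ns Fs) xs = map2 fob Fs (blocks ns xs)"
  "fs \<in> Ar (pow_cat C (sum_list ns)) ==> far (prod_fun C ns Fs) fs = map2 far Fs (blocks ns fs)" by (simp_all add: prod_fun_def)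

lemma gamma_fun_simps [simp]:
  "xs \<in> Ob (pow_cat C (sum_list ns)) ==> fob (gamma_fun C ns F Fs) xs = fob F (map2 fob Fs (blocks ns xs))"
  "fs \<in> Ar (pow_cat C (sum_list ns)) ==> far (gamma_fun C ns F Fs) fs = far F (map2 far Fs (blocks ns fs))"
  by (simp_all add: gamma_fun_def)

lemma reindex_fun_simps [simp]:
  "xs \<in> Ob (pow_cat C l) ==> fob (reindex_fun C l f) xs = map ((!) xs) f"
  "fs \<in> Ar (pow_cat C l) ==> far (reindex_fun C l f) fs = map ((!) fs) f" by (simp_all add: reindex_fun_def)

lemma subst_fun_simps [simp]:
  "xs \<in> Ob (pow_cat C l) ==> fob (subst_fun C F l f) xs = fob F (map ((!) xs) f)"
  "fs \<in> Ar (pow_cat C l) ==> far (subst_fun C F l f) fs = far F (map ((!) fs) f)" by (simp_all add: subst_fun_def)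

lemma unit_fun_simps [simp]:
  "xs \<in> Ob (pow_cat C 1) ==> fob (unit_fun C) xs = hd xs"
  "fs \<in> Ar (pow_cat C 1) ==> far (unit_fun C) fs = hd fs" by (simp_all add: unit_fun_def)

lemma fun_exts [simp]:
  "fob (gamma_fun C ns F Fs) \<in> extensional (Ob (pow_cat C (sum_list ns)))"
  "far (gamma_fun C ns F Fs) \<in> extensional (Ar (pow_cat C (sum_list ns)))"
  "fob (subst_fun C G l f) \<in> extensional (Ob (pow_cat C l))"
  "far (subst_fun C G l f) \<in> extensional (Ar (pow_cat C l))" by (simp_all add: gamma_fun_def subst_fun_def)

lemma reindex_Ob: "xs \<in> Ob (pow_cat C l) ==> set f \<subseteq> {..<l} ==> map ((!) xs) f \<in> Ob (pow_cat C (length f))"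
  and reindex_Ar: "fs \<in> Ar (pow_cat C l) ==> set f \<subseteq> {..<l} ==> map ((!) fs) f \<in> Ar (pow_cat C (length f))"
  by (auto simp: Ob_pow Ar_pow subset_iff)

lemma map2_map1: "map2 f (map g xs) ys = map2 (\<lambda>x. f (g x)) xs ys" by (simp add: zip_map1 case_prod_beta comp_def)

lemma nattr_eq_iff:
  assumes "nsrc \<alpha> = nsrc \<beta>" "ntgt \<alpha> = ntgt \<beta>" "ncomp \<alpha> \<in> extensional A" "ncomp \<beta> \<in> extensional A"
  shows "\<alpha> = (\<beta> :: ('o, 'a, 'p, 'b) nattr) \<longleftrightarrow> (\<forall>x\<in>A. ncomp \<alpha> x = ncomp \<beta> x)"
  using nattr_eqI[OF assms] by auto

lemma hcomp_id_left:
  assumes a: "is_nat C D \<alpha>" and F: "is_functor D E F" and x: "x \<in> Ob C"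
  shows "ncomp (hcomp C E (id_nat D E F) \<alpha>) x = far F (ncomp \<alpha> x)"
  using x functor_ob[OF nat_functor(2)[OF a] x] functor_hom[OF F nat_hom[OF a x]] by (simp add: cat_idl[OF functor_cat(2)[OF F]])

lemma hcomp_id_right:
  assumes F: "is_functor C D F" and b: "is_nat D E \<beta>" and x: "x \<in> Ob C"
  shows "ncomp (hcomp C E \<beta> (id_nat C D F)) x = ncomp \<beta> (fob F x)" using x functor_ob[OF F x] nat_hom[OF b functor_ob[OF F x]]
  by (simp add: functor_id[OF nat_functor(1)[OF b]] cat_idr[OF functor_cat(2)[OF nat_functor(1)[OF b]]])

lemma nat_prod_nat:
  assumes C: "category C" "category D" and l: "length \<alpha>s = length ns"
    and a: "\<And>i. i < length ns ==> is_nat (pow_cat C (ns ! i)) D (\<alpha>s ! i)"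
  shows "is_nat (pow_cat C (sum_list ns)) (pow_cat D (length ns)) (prod_nat C ns \<alpha>s)"
proof (rule is_natI, goal_cases)
  case 1 show ?case unfolding prod_nat_def by (auto intro!: functor_prod_fun C l nat_functor a simp: l)
next
  case 2 show ?case unfolding prod_nat_def by (auto intro!: functor_prod_fun C l nat_functor a simp: l)
next
  case (4 x)
  then show ?case using nat_hom[OF a blocks_Ob[OF 4]] l by (auto simp: prod_nat_def hom_pow)
next
  case (5 f x y)
  note P = category_pow[OF C(1), of "sum_list ns"]
  show ?case using hom_Ob_Dom[OF P 5] hom_Ob_Cod[OF P 5] hom_Ar[OF 5] nat_natural[OF a blocks_hom[OF 5]] l
    by (auto simp: prod_nat_def intro!: nth_equalityI)
qed (auto simp: prod_nat_def)

lemma nat_pow_nat: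
  assumes a: "is_nat C D \<alpha>"
  shows "is_nat (pow_cat C n) (pow_cat D n) (pow_nat C n \<alpha>)"
proof (rule is_natI, goal_cases)
  case 1 show ?case unfolding pow_nat_def by (simp add: functor_pow_fun[OF nat_functor(1)[OF a]])
next
  case 2 show ?case unfolding pow_nat_def by (simp add: functor_pow_fun[OF nat_functor(2)[OF a]])
next
  case (4 x)
  then show ?case using nat_hom[OF a] by (auto simp: pow_nat_def hom_pow Ob_pow_nth)
next
  case (5 f x y)
  note P = category_pow[OF functor_cat(1)[OF nat_functor(1)[OF a]], of n]
  show ?case using 5 hom_Ob_Dom[OF P 5] hom_Ob_Cod[OF P 5] hom_Ar[OF 5] nat_natural[OF a]
    by (auto simp: pow_nat_def hom_pow intro!: nth_equalityI)
qed (auto simp: pow_nat_def)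

lemma pow_nat_simps [simp]: "nsrc (pow_nat C n \<alpha>) = pow_fun C n (nsrc \<alpha>)"
  "ntgt (pow_nat C n \<alpha>) = pow_fun C n (ntgt \<alpha>)"
  "xs \<in> Ob (pow_cat C n) ==> ncomp (pow_nat C n \<alpha>) xs = map (ncomp \<alpha>) xs" by (simp_all add: pow_nat_def)

lemma prod_nat_simps [simp]: "nsrc (prod_nat C ns \<alpha>s) = prod_fun C ns (map nsrc \<alpha>s)"
  "ntgt (prod_nat C ns \<alpha>s) = prod_fun C ns (map ntgt \<alpha>s)"
  "xs \<in> Ob (pow_cat C (sum_list ns)) ==> ncomp (prod_nat C ns \<alpha>s) xs = map2 ncomp \<alpha>s (blocks ns xs)"
  by (simp_all add: prod_nat_def)

lemma gamma_nat_simps [simp]: "nsrc (gamma_nat C ns \<alpha> \<alpha>s) = gamma_fun C ns (nsrc \<alpha>) (map nsrc \<alpha>s)"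
  "ntgt (gamma_nat C ns \<alpha> \<alpha>s) = gamma_fun C ns (ntgt \<alpha>) (map ntgt \<alpha>s)"
  by (simp_all add: gamma_nat_def gamma_fun_def)

lemma subst_nat_simps [simp]: "nsrc (subst_nat C D \<alpha> l f) = subst_fun C (nsrc \<alpha>) l f"
  "ntgt (subst_nat C D \<alpha> l f) = subst_fun C (ntgt \<alpha>) l f" by (simp_all add: subst_nat_def subst_fun_def)

text \<open>With identities in the inner places, \<gamma> is whiskering on the right, and its
  component is a component of the outer transformation. This and the next lemma evaluate every
  2-cell that occurs in the axioms of a pseudo algebra.\<close>

lemma ncomp_gamma_nat_ids:
  assumes a: "is_nat (pow_cat C (length vs)) C \<alpha>"
    and F: "\<And>v. v \<in> set vs ==> is_functor (pow_cat C (n v)) C (F v)"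
    and xs: "xs \<in> Ob (pow_cat C (sum_list (map n vs)))"
  shows "ncomp (gamma_nat C (map n vs) \<alpha> (map (\<lambda>v. id_nat (pow_cat C (n v)) C (F v)) vs)) xs
    = ncomp \<alpha> (map2 (\<lambda>v. fob (F v)) vs (blocks (map n vs) xs))"
proof -
  let ?Fs = "map F vs"
  have C: "category C" using functor_cat[OF nat_functor(1)[OF a]] by simp
  have P: "is_functor (pow_cat C (sum_list (map n vs))) (pow_cat C (length vs)) (prod_fun C (map n vs) ?Fs)"
    using functor_prod_fun[OF C C, of ?Fs "map n vs"] F by simp
  \<comment> \<open>A product of identity transformations is the identity of the product functor,
    which brings the claim into the form of \<open>hcomp_id_right\<close>.\<close>
  have "prod_nat C (map n vs) (map (\<lambda>v. id_nat (pow_cat C (n v)) C (F v)) vs)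
    = id_nat (pow_cat C (sum_list (map n vs))) (pow_cat C (length vs)) (prod_fun C (map n vs) ?Fs)"
  proof (rule nattr_eqI)
    fix ys assume ys: "ys \<in> Ob (pow_cat C (sum_list (map n vs)))"
    show "ncomp (prod_nat C (map n vs) (map (\<lambda>v. id_nat (pow_cat C (n v)) C (F v)) vs)) ys =
      ncomp (id_nat (pow_cat C (sum_list (map n vs))) (pow_cat C (length vs)) (prod_fun C (map n vs) ?Fs)) ys"
      using ys blocks_Ob[OF ys] by (auto intro!: nth_equalityI)
  qed (auto simp: comp_def prod_nat_def)
  then show ?thesis unfolding gamma_nat_def using hcomp_id_right[OF P a xs] xs by (simp add: map2_map1)
qed

text \<open>Whiskering on the left: with the identity of \<open>F\<close> outside, the components of
  the inner transformations are collected into a tuple and \<open>F\<close> is applied to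
  it.\<close>

lemma ncomp_gamma_nat_id_left:
  assumes F: "is_functor (pow_cat C k) C F" and l: "length \<alpha>s = k" "length ns = k"
    and a: "\<And>i. i < k ==> is_nat (pow_cat C (ns ! i)) C (\<alpha>s ! i)"
    and xs: "xs \<in> Ob (pow_cat C (sum_list ns))"
  shows "ncomp (gamma_nat C ns (id_nat (pow_cat C k) C F) \<alpha>s) xs
    = far F (map (\<lambda>j. ncomp (\<alpha>s ! j) (blocks ns xs ! j)) [0..<k])"
proof -
  have C: "category C" using functor_cat[OF F] by simp
  have P: "is_nat (pow_cat C (sum_list ns)) (pow_cat C k) (prod_nat C ns \<alpha>s)" using nat_prod_nat[OF C C, of \<alpha>s ns] a l by simp
  show ?thesis unfolding gamma_nat_def using hcomp_id_left[OF P F xs] xs l by (simp add: map2_eq_nth)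
qed

lemma ncomp_subst_nat:
  assumes a: "is_nat (pow_cat C (length f)) D \<alpha>" and C: "category C" and f: "set f \<subseteq> {..<l}"
    and xs: "xs \<in> Ob (pow_cat C l)"
  shows "ncomp (subst_nat C D \<alpha> l f) xs = ncomp \<alpha> (map ((!) xs) f)"
  unfolding subst_nat_def using hcomp_id_right[OF functor_reindex_fun[OF C f] a xs] xs by simp

lemma map2_nth_Ob:
  assumes "xs \<in> Ob (pow_cat C (sum_list ns))" "length Fs = length ns"
    "\<And>i. i < length ns ==> is_functor (pow_cat C (ns ! i)) D (Fs ! i)"
  shows "map2 fob Fs (blocks ns xs) \<in> Ob (pow_cat D (length ns))"
  using assms functor_ob[OF assms(3) blocks_Ob[OF assms(1)]] by (auto simp: Ob_pow_nth)

lemma map2_nth_Ar: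
  assumes "xs \<in> Ar (pow_cat C (sum_list ns))" "length Fs = length ns"
    "\<And>i. i < length ns ==> is_functor (pow_cat C (ns ! i)) D (Fs ! i)"
  shows "map2 far Fs (blocks ns xs) \<in> Ar (pow_cat D (length ns))"
  using assms functor_ar[OF assms(3) blocks_Ar[OF assms(1)]] by (auto simp: Ar_pow_nth)

lemma sum_list_concat: "sum_list (map n (concat wss)) = sum_list (map (\<lambda>vs. sum_list (map n vs)) wss)" by (induction wss) auto

text \<open>Strict associativity of \<gamma> in the theory of endofunctors. It gives the two sides
  of axiom (1) a common target, as \<open>gamma_word_assoc\<close> gives them a common
  source.\<close>

lemma gamma_fun_assoc:
  assumes l: "length wss = length ws" "\<And>j. j < length ws ==> length (wss ! j) = n (ws ! j)"
    and F: "\<And>v. v \<in> set (concat wss) ==> is_functor (pow_cat C (n v)) C (\<Phi> v)"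
  shows "gamma_fun C (map n (concat wss)) (gamma_fun C (map n ws) F (map \<Phi> ws)) (map \<Phi> (concat wss))
    = gamma_fun C (map (\<lambda>vs. sum_list (map n vs)) wss) F
        (map2 (\<lambda>v vs. gamma_fun C (map n vs) (\<Phi> v) (map \<Phi> vs)) ws wss)" (is "?L = ?R")
proof -
  let ?N = "pow_cat C (sum_list (map n (concat wss)))" and ?ms = "map (\<lambda>vs. sum_list (map n vs)) wss"
  have N: "?N = pow_cat C (sum_list ?ms)" by (simp add: sum_list_concat)
  have lc: "length (concat wss) = sum_list (map n ws)"
    unfolding length_concat using l by (intro arg_cong[of _ _ sum_list] nth_equalityI) auto
  have Fi: "is_functor (pow_cat C (map n (concat wss) ! i)) C (map \<Phi> (concat wss) ! i)"
    if "i < length (map n (concat wss))" for i using F[OF nth_mem, of i] that by simp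
  note assoc = blocks_assoc[of wss ws n _ "\<lambda>v. fob (\<Phi> v)", OF l] blocks_assoc[of wss ws n _ "\<lambda>v. far (\<Phi> v)", OF l]
  show ?thesis
  proof (rule functr_eqI[of _ "Ob ?N" _ "Ar ?N"])
    fix xs assume xs: "xs \<in> Ob ?N"
    have o: "map2 fob (map \<Phi> (concat wss)) (blocks (map n (concat wss)) xs) \<in> Ob (pow_cat C (sum_list (map n ws)))"
      using map2_nth_Ob[OF xs _ Fi] by (simp add: lc)
    have b: "map2 (\<lambda>v. fob (\<Phi> v)) ws (map2 (\<lambda>vs b. map2 (\<lambda>v. fob (\<Phi> v)) vs (blocks (map n vs) b)) wss (blocks ?ms xs))
      = map2 fob (map2 (\<lambda>v vs. gamma_fun C (map n vs) (\<Phi> v) (map \<Phi> vs)) ws wss) (blocks ?ms xs)"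
      using l blocks_Ob[OF xs[unfolded N]] by (intro nth_equalityI) (auto simp: map2_map1)
    have x: "length xs = sum_list (map n (concat wss))" using xs by (simp add: Ob_pow)
    show "fob ?L xs = fob ?R xs" using xs xs[unfolded N] o assoc(1)[OF _ x] b by (simp add: map2_map1)
  next
    fix xs assume xs: "xs \<in> Ar ?N"
    have o: "map2 far (map \<Phi> (concat wss)) (blocks (map n (concat wss)) xs) \<in> Ar (pow_cat C (sum_list (map n ws)))"
      using map2_nth_Ar[OF xs _ Fi] by (simp add: lc)
    have b: "map2 (\<lambda>v. far (\<Phi> v)) ws (map2 (\<lambda>vs b. map2 (\<lambda>v. far (\<Phi> v)) vs (blocks (map n vs) b)) wss (blocks ?ms xs))
      = map2 far (map2 (\<lambda>v vs. gamma_fun C (map n vs) (\<Phi> v) (map \<Phi> vs)) ws wss) (blocks ?ms xs)"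
      using l blocks_Ar[OF xs[unfolded N]] by (intro nth_equalityI) (auto simp: map2_map1)
    have x: "length xs = sum_list (map n (concat wss))" using xs by (simp add: Ar_pow)
    show "far ?L xs = far ?R xs" using xs xs[unfolded N] o assoc(2)[OF _ x] b by (simp add: map2_map1)
  next
    show "fob ?R \<in> extensional (Ob ?N)" "far ?R \<in> extensional (Ar ?N)" unfolding N by (rule fun_exts)+
  qed (rule fun_exts)+
qed

lemma gamma_fun_unit_right:
  assumes F: "is_functor (pow_cat C k) C F"
  shows "gamma_fun C (replicate k 1) F (replicate k (unit_fun C)) = F"
proof -
  have s: "sum_list (replicate k 1) = k" by (simp add: sum_list_replicate)
  have h: "map2 fob (replicate k (unit_fun C)) (blocks (replicate k 1) xs) = xs"
    if "xs \<in> Ob (pow_cat C k)" for xs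
    using that unfolding Ob_pow by (intro nth_equalityI) (auto simp: blocks_replicate_1 Ob_pow subset_iff)
  have h': "map2 far (replicate k (unit_fun C)) (blocks (replicate k 1) xs) = xs"
    if "xs \<in> Ar (pow_cat C k)" for xs
    using that unfolding Ar_pow by (intro nth_equalityI) (auto simp: blocks_replicate_1 Ar_pow subset_iff)
  show ?thesis
  proof (rule functr_eqI[of _ "Ob (pow_cat C k)" _ "Ar (pow_cat C k)"])
    show "fob (gamma_fun C (replicate k 1) F (replicate k (unit_fun C))) \<in> extensional (Ob (pow_cat C k))"
      "far (gamma_fun C (replicate k 1) F (replicate k (unit_fun C))) \<in> extensional (Ar (pow_cat C k))"
      using fun_exts(1,2)[of C "replicate k 1"] unfolding s by blast+
  qed (use h h' gamma_fun_simps[of _ C "replicate k 1", unfolded s] functor_ext[OF F] in auto)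
qed

lemma gamma_fun_unit_left:
  assumes F: "is_functor (pow_cat C n) C F"
  shows "gamma_fun C [n] (unit_fun C) [F] = F"
proof (rule functor_eqI[OF _ F])
  show "is_functor (pow_cat C n) C (gamma_fun C [n] (unit_fun C) [F])"
    using functor_gamma_fun[of C "[F]" "[n]" "unit_fun C"] functor_unit_fun[OF functor_cat(2)[OF F]] F
      functor_cat(2)[OF F] by (auto simp: One_nat_def)
  fix xs assume xs: "xs \<in> Ob (pow_cat C n)"
  show "fob (gamma_fun C [n] (unit_fun C) [F]) xs = fob F xs"
    using xs functor_ob[OF F xs] gamma_fun_simps(1)[of xs C "[n]"] by (simp add: Ob_pow)
next
  fix xs assume xs: "xs \<in> Ar (pow_cat C n)"
  show "far (gamma_fun C [n] (unit_fun C) [F]) xs = far F xs"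
    using xs functor_ar[OF F xs] gamma_fun_simps(2)[of xs C "[n]"] by (simp add: Ar_pow)
qed

text \<open>The analogue of \<open>gamma_word_subst\<close> for functors. It identifies the targets
  of the two sides of axiom (4); \<open>subst_fun_block_sum\<close> does so for axiom (5).\<close>

lemma subst_fun_gamma:
  assumes f: "set f \<subseteq> {..<length ws}"
    and F: "\<And>v. v \<in> set ws ==> is_functor (pow_cat C (n v)) C (\<Phi> v)"
  shows "subst_fun C (gamma_fun C (map n (map ((!) ws) f)) F (map \<Phi> (map ((!) ws) f))) (sum_list (map n ws)) (block_map (map n ws) f)
    = gamma_fun C (map n ws) (subst_fun C F (length ws) f) (map \<Phi> ws)" (is "?L = ?R")
proof -
  let ?N = "pow_cat C (sum_list (map n ws))"
  have f': "set f \<subseteq> {..<length (map n ws)}" using f by simp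
  have nf: "map n (map ((!) ws) f) = map ((!) (map n ws)) f" using f by auto
  have pf: "map \<Phi> (map ((!) ws) f) = map ((!) (map \<Phi> ws)) f" using f by auto
  show ?thesis unfolding nf pf
  proof (rule functr_eqI[of _ "Ob ?N" _ "Ar ?N"])
    fix xs assume xs: "xs \<in> Ob ?N"
    have x: "length xs = sum_list (map n ws)" using xs by (simp add: Ob_pow)
    have 1: "map ((!) xs) (block_map (map n ws) f) \<in> Ob (pow_cat C (sum_list (map ((!) (map n ws)) f)))"
      using reindex_Ob[OF xs set_block_map[OF f']] by (simp add: length_block_map[OF f'] del: map_map)
    have 2: "map2 fob (map \<Phi> ws) (blocks (map n ws) xs) \<in> Ob (pow_cat C (length ws))"
      using map2_nth_Ob[OF xs, of "map \<Phi> ws" C] F by simp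
    show "fob (subst_fun C (gamma_fun C (map ((!) (map n ws)) f) F (map ((!) (map \<Phi> ws)) f))
      (sum_list (map n ws)) (block_map (map n ws) f)) xs = fob ?R xs" using xs 1 2 f
      by (simp add: blocks_block_map[OF f' x] map2_nth_reindex del: map_map)
  next
    fix xs assume xs: "xs \<in> Ar ?N"
    have x: "length xs = sum_list (map n ws)" using xs by (simp add: Ar_pow)
    have 1: "map ((!) xs) (block_map (map n ws) f) \<in> Ar (pow_cat C (sum_list (map ((!) (map n ws)) f)))"
      using reindex_Ar[OF xs set_block_map[OF f']] by (simp add: length_block_map[OF f'] del: map_map)
    have 2: "map2 far (map \<Phi> ws) (blocks (map n ws) xs) \<in> Ar (pow_cat C (length ws))"
      using map2_nth_Ar[OF xs, of "map \<Phi> ws" C] F by simp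
    show "far (subst_fun C (gamma_fun C (map ((!) (map n ws)) f) F (map ((!) (map \<Phi> ws)) f))
      (sum_list (map n ws)) (block_map (map n ws) f)) xs = far ?R xs" using xs 1 2 f
      by (simp add: blocks_block_map[OF f' x] map2_nth_reindex del: map_map)
  qed (rule fun_exts)+
qed

lemma subst_fun_block_sum:
  assumes l: "length gs = length ns'" "length Fs = length ns'"
    and g: "\<And>j. j < length ns' ==> set (gs ! j) \<subseteq> {..<ns' ! j}"
  shows "subst_fun C (gamma_fun C (map length gs) F Fs) (sum_list ns') (block_sum ns' gs)
    = gamma_fun C ns' F (map (\<lambda>j. subst_fun C (Fs ! j) (ns' ! j) (gs ! j)) [0..<length ns'])" (is "?L = ?R")
proof -
  let ?N = "pow_cat C (sum_list ns')"
  have b: "set (block_sum ns' gs) \<subseteq> {..<sum_list ns'}" by (rule set_block_sum[OF l(1) g])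
  have bb: "blocks (map length gs) (map ((!) xs) (block_sum ns' gs))
    = map (\<lambda>j. map ((!) (blocks ns' xs ! j)) (gs ! j)) [0..<length gs]"
    if "length xs = sum_list ns'" for xs :: "'c list" by (rule blocks_block_sum[OF l(1) g that])
  have bb': "blocks (map length gs) (map ((!) xs) (block_sum ns' gs))
    = map (\<lambda>j. map ((!) (blocks ns' xs ! j)) (gs ! j)) [0..<length gs]"
    if "length xs = sum_list ns'" for xs :: "'d list" by (rule blocks_block_sum[OF l(1) g that])
  show ?thesis
  proof (rule functr_eqI[of _ "Ob ?N" _ "Ar ?N"])
    fix xs assume xs: "xs \<in> Ob ?N"
    have x: "length xs = sum_list ns'" using xs by (simp add: Ob_pow)
    have 1: "map ((!) xs) (block_sum ns' gs) \<in> Ob (pow_cat C (sum_list (map length gs)))"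
      using reindex_Ob[OF xs b] by (simp add: length_block_sum)
    have "map2 fob Fs (map (\<lambda>j. map ((!) (blocks ns' xs ! j)) (gs ! j)) [0..<length gs])
      = map2 fob (map (\<lambda>j. subst_fun C (Fs ! j) (ns' ! j) (gs ! j)) [0..<length ns']) (blocks ns' xs)"
      using l blocks_Ob[OF xs] by (intro nth_equalityI) auto
    then show "fob ?L xs = fob ?R xs" using xs 1 by (simp add: blocks_block_sum[OF l(1) g x])
  next
    fix xs assume xs: "xs \<in> Ar ?N"
    have x: "length xs = sum_list ns'" using xs by (simp add: Ar_pow)
    have 1: "map ((!) xs) (block_sum ns' gs) \<in> Ar (pow_cat C (sum_list (map length gs)))"
      using reindex_Ar[OF xs b] by (simp add: length_block_sum)
    have "map2 far Fs (map (\<lambda>j. map ((!) (blocks ns' xs ! j)) (gs ! j)) [0..<length gs])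
      = map2 far (map (\<lambda>j. subst_fun C (Fs ! j) (ns' ! j) (gs ! j)) [0..<length ns']) (blocks ns' xs)"
      using l blocks_Ar[OF xs] by (intro nth_equalityI) auto
    then show "far ?L xs = far ?R xs" using xs 1 by (simp add: blocks_block_sum[OF l(1) g x])
  qed (rule fun_exts)+
qed

lemma subst_fun_subst:
  assumes "set f \<subseteq> {..<length g}" "set g \<subseteq> {..<m}"
  shows "subst_fun C (subst_fun C F (length g) f) m g = subst_fun C F m (map ((!) g) f)"
  using assms reindex_Ob[of _ C m g] reindex_Ar[of _ C m g] by (intro functr_eqI[of _ "Ob (pow_cat C m)" _ "Ar (pow_cat C m)"])
    (auto simp: map_nth_map_nth simp del: map_map)

lemma subst_fun_id:
  assumes F: "is_functor (pow_cat C n) D F"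
  shows "subst_fun C F n [0..<n] = F"
proof -
  show ?thesis using functor_ext[OF F] Ob_pow[of _ C n] Ar_pow[of _ C n]
    by (intro functr_eqI[of _ "Ob (pow_cat C n)" _ "Ar (pow_cat C n)"]) (auto simp: map_nth)
qed

section \<open>Pointwise form of the algebra axioms\<close>

abbreviation tup where "tup X n \<equiv> Ob (pow_cat (Car X) n)"

text \<open>The clauses of \<open>is_psalg\<close> that give the structure its types. They are
  separated from the equations because an equation of transformations can be read componentwise only
  once its constituents are known to be natural transformations with the right ends.\<close>

definition alg_data :: "'t thry => ('t, 'o, 'a) psalg => bool" where
  "alg_data T X \<longleftrightarrow> category (Car X) \<and> extensional_cat (Car X) \<and> Phi X \<in> extensional (words T) \<and>
     (\<forall>w\<in>words T. is_functor (pow_cat (Car X) (Dom T w)) (Car X) (Phi X w)) \<and> CC X \<in> extensional (cwords T) \<and>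
     (\<forall>(w, ws)\<in>cwords T. nat_iso (pow_cat (Car X) (sum_list (map (Dom T) ws))) (Car X) (CC X (w, ws))
        (Phi X (gamma_word T w ws)) (gamma_fun (Car X) (map (Dom T) ws) (Phi X w) (map (Phi X) ws))) \<and>
     nat_iso (pow_cat (Car X) 1) (Car X) (II X) (Phi X (unit_word T)) (unit_fun (Car X)) \<and> SS X \<in> extensional (swords T) \<and>
     (\<forall>(w, l, f)\<in>swords T. nat_iso (pow_cat (Car X) l) (Car X) (SS X (w, l, f))
        (Phi X (subst_word T w l f)) (subst_fun (Car X) (Phi X w) l f))"

lemma alg_dataD:
  assumes "alg_data T X"
  shows "category (Car X)"
    "w \<in> words T ==> is_functor (pow_cat (Car X) (Dom T w)) (Car X) (Phi X w)"
    "(w, ws) \<in> cwords T ==> nat_iso (pow_cat (Car X) (sum_list (map (Dom T) ws))) (Car X) (CC X (w, ws))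
        (Phi X (gamma_word T w ws)) (gamma_fun (Car X) (map (Dom T) ws) (Phi X w) (map (Phi X) ws))"
    "nat_iso (pow_cat (Car X) 1) (Car X) (II X) (Phi X (unit_word T)) (unit_fun (Car X))"
    "(w, l, f) \<in> swords T ==> nat_iso (pow_cat (Car X) l) (Car X) (SS X (w, l, f))
        (Phi X (subst_word T w l f)) (subst_fun (Car X) (Phi X w) l f)" using assms by (auto simp: alg_data_def)

abbreviation po :: "('t, 'o, 'a) psalg => 't => 'o list => 'o" where "po X w \<equiv> fob (Phi X w)"
abbreviation pa :: "('t, 'o, 'a) psalg => 't => 'a list => 'a" where "pa X w \<equiv> far (Phi X w)"
abbreviation pc :: "('t, 'o, 'a) psalg => 't => 't list => 'o list => 'a" where
  "pc X w ws \<equiv> ncomp (CC X (w, ws))"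
abbreviation ps :: "('t, 'o, 'a) psalg => 't => nat => nat list => 'o list => 'a" where
  "ps X w l f \<equiv> ncomp (SS X (w, l, f))"

text \<open>This abbreviation and the five after it are axioms (1) to (6) at a tuple
  \<open>xs\<close> of objects. Axiom (7) is written out in \<open>alg_eqs\<close>.\<close>

abbreviation assoc_eq where
  "assoc_eq T X w ws wss xs \<equiv> Comp (Car X) (pc X w ws (map2 (po X) (concat wss) (blocks (map (Dom T) (concat wss)) xs)))
      (pc X (gamma_word T w ws) (concat wss) xs) = Comp (Car X)
      (pa X w (map (\<lambda>j. pc X (ws ! j) (wss ! j) (blocks (map (\<lambda>vs. sum_list (map (Dom T) vs)) wss) xs ! j))
      [0..<length ws])) (pc X w (map2 (gamma_word T) ws wss) xs)"

abbreviation unit_right_eq where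
  "unit_right_eq T X w xs \<equiv> Comp (Car X) (pa X w (map (\<lambda>x. ncomp (II X) [x]) xs))
      (pc X w (replicate (Dom T w) (unit_word T)) xs) = Idt (Car X) (po X w xs)"

abbreviation unit_left_eq where
  "unit_left_eq T X w xs \<equiv> Comp (Car X) (ncomp (II X) [po X w xs]) (pc X (unit_word T) [w] xs) = Idt (Car X) (po X w xs)"

abbreviation subst_gamma_eq where
  "subst_gamma_eq T X w l f ws xs \<equiv> Comp (Car X) (pc X w (map ((!) ws) f) (map ((!) xs) (block_map (map (Dom T) ws) f)))
      (ps X (gamma_word T w (map ((!) ws) f)) (sum_list (map (Dom T) ws)) (block_map (map (Dom T) ws) f) xs)
      = Comp (Car X) (ps X w l f (map2 (po X) ws (blocks (map (Dom T) ws) xs))) (pc X (subst_word T w l f) ws xs)"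

abbreviation gamma_subst_eq where
  "gamma_subst_eq T X w ws ns' gs xs \<equiv> Comp (Car X) (pc X w ws (map ((!) xs) (block_sum ns' gs)))
      (ps X (gamma_word T w ws) (sum_list ns') (block_sum ns' gs) xs) = Comp (Car X)
      (pa X w (map (\<lambda>j. ps X (ws ! j) (ns' ! j) (gs ! j) (blocks ns' xs ! j)) [0..<length ws]))
      (pc X w (map (\<lambda>j. subst_word T (ws ! j) (ns' ! j) (gs ! j)) [0..<length ws]) xs)"

abbreviation subst_subst_eq where
  "subst_subst_eq T X w l f m g xs \<equiv> Comp (Car X) (ps X w l f (map ((!) xs) g)) (ps X (subst_word T w l f) m g xs)
      = ps X w m (map ((!) g) f) xs"

definition alg_eqs :: "'t thry => ('t, 'o, 'a) psalg => bool" where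
  "alg_eqs T X \<longleftrightarrow>
     (\<forall>(w, ws)\<in>cwords T. \<forall>wss. length wss = length ws \<and> (\<forall>j<length ws. (ws ! j, wss ! j) \<in> cwords T) \<longrightarrow>
       (\<forall>xs\<in>Ob (pow_cat (Car X) (sum_list (map (Dom T) (concat wss)))). assoc_eq T X w ws wss xs)) \<and>
     (\<forall>w\<in>words T. \<forall>xs\<in>tup X (Dom T w). unit_right_eq T X w xs) \<and>
     (\<forall>w\<in>words T. \<forall>xs\<in>tup X (Dom T w). unit_left_eq T X w xs) \<and>
     (\<forall>(w, l, f)\<in>swords T. \<forall>ws. length ws = l \<and> set ws \<subseteq> words T \<longrightarrow>
       (\<forall>xs\<in>Ob (pow_cat (Car X) (sum_list (map (Dom T) ws))). subst_gamma_eq T X w l f ws xs)) \<and>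
     (\<forall>(w, ws)\<in>cwords T. \<forall>ns' gs. length ns' = length ws \<and> length gs = length ws \<and>
          (\<forall>j<length ws. (ws ! j, ns' ! j, gs ! j) \<in> swords T) \<longrightarrow> (\<forall>xs\<in>tup X (sum_list ns').
         gamma_subst_eq T X w ws ns' gs xs)) \<and>
     (\<forall>(w, l, f)\<in>swords T. \<forall>m g. length g = l \<and> set g \<subseteq> {..<m} \<longrightarrow>
       (\<forall>xs\<in>tup X m. subst_subst_eq T X w l f m g xs)) \<and> (\<forall>w\<in>words T. \<forall>xs\<in>tup X (Dom T w).
       ps X w (Dom T w) [0..<Dom T w] xs = Idt (Car X) (po X w xs))"

context
  fixes T :: "'t thry" and X :: "('t, 'o, 'a) psalg"
  assumes T: "is_theory T" and D: "alg_data T X"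
begin

lemmas dD = alg_dataD[OF D]

lemma nat_CC:
  assumes "(w, ws) \<in> cwords T"
  shows "is_nat (pow_cat (Car X) (sum_list (map (Dom T) ws))) (Car X) (CC X (w, ws))"
    "nsrc (CC X (w, ws)) = Phi X (gamma_word T w ws)"
    "ntgt (CC X (w, ws)) = gamma_fun (Car X) (map (Dom T) ws) (Phi X w) (map (Phi X) ws)" using nat_isoD[OF dD(3)[OF assms]] by auto

lemma nat_SS:
  assumes "(w, l, f) \<in> swords T"
  shows "is_nat (pow_cat (Car X) l) (Car X) (SS X (w, l, f))"
    "nsrc (SS X (w, l, f)) = Phi X (subst_word T w l f)"
    "ntgt (SS X (w, l, f)) = subst_fun (Car X) (Phi X w) l f" using nat_isoD[OF dD(5)[OF assms]] by auto

lemmas nat_II = nat_isoD(1-3)[OF dD(4)]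

text \<open>The two composites always have equal sources and equal targets, so their equality
  amounts to equality of components. The further lemmas ending in \<open>_eq_iff\<close> follow the
  same pattern.\<close>

lemma assoc_eq_iff:
  assumes w: "(w, ws) \<in> cwords T" and l: "length wss = length ws"
    and j: "\<forall>j<length ws. (ws ! j, wss ! j) \<in> cwords T"
  shows "vcomp (pow_cat (Car X) (sum_list (map (Dom T) (concat wss)))) (Car X)
      (gamma_nat (Car X) (map (Dom T) (concat wss)) (CC X (w, ws)) (map (i_Phi T X) (concat wss))) (CC X (gamma_word T w ws, concat wss))
    = vcomp (pow_cat (Car X) (sum_list (map (Dom T) (concat wss)))) (Car X)
      (gamma_nat (Car X) (map (\<lambda>vs. sum_list (map (Dom T) vs)) wss) (i_Phi T X w) (map2 (\<lambda>v vs. CC X (v, vs)) ws wss))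
      (CC X (w, map2 (gamma_word T) ws wss)) \<longleftrightarrow>
    (\<forall>xs\<in>Ob (pow_cat (Car X) (sum_list (map (Dom T) (concat wss)))). assoc_eq T X w ws wss xs)"
proof -
  let ?N = "pow_cat (Car X) (sum_list (map (Dom T) (concat wss)))"
  let ?ms = "map (\<lambda>vs. sum_list (map (Dom T) vs)) wss"
  have j': "\<And>j. j < length ws ==> (ws ! j, wss ! j) \<in> cwords T" using j by blast
  note A = gamma_word_assoc[OF T w l j']
  note wD = cwords_words[OF w]
  have N: "?N = pow_cat (Car X) (sum_list ?ms)" by (simp add: sum_list_concat)
  have lj: "length (wss ! j) = Dom T (ws ! j)" if "j < length ws" for j using cwordsD[OF j'[OF that]] by auto
  have cl: "length (concat wss) = sum_list (map (Dom T) ws)" using cwordsD[OF A(1)] hom_words[OF gamma_word_hom[OF T w]] by simp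
  have F: "\<And>v. v \<in> set (concat wss) ==> is_functor (pow_cat (Car X) (Dom T v)) (Car X) (Phi X v)"
    using dD(2) cwordsD[OF A(1)] by blast
  have mm: "map ntgt (map2 (\<lambda>v vs. CC X (v, vs)) ws wss)
    = map2 (\<lambda>v vs. gamma_fun (Car X) (map (Dom T) vs) (Phi X v) (map (Phi X) vs)) ws wss"
    using nat_CC(3)[OF j'] l by (intro nth_equalityI) auto
  show ?thesis
  \<comment> \<open>Case 1 compares the sources by associativity of \<open>gamma_word\<close>, case
    2 the targets by associativity of \<open>gamma_fun\<close>, and case 5 the components; the rest
    is extensionality.\<close>
  proof (subst nattr_eq_iff[where A = "Ob ?N"], goal_cases)
    case 1 show ?case by (simp add: nat_CC[OF A(1)] nat_CC[OF A(2)] A(4))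
  next
    case 2 show ?case using gamma_fun_assoc[OF l lj F, where F = "Phi X w"] unfolding vcomp_simps gamma_nat_simps mm
      by (simp add: nat_CC[OF w] comp_def)
  next
    case 5
    show ?case
    proof (rule ball_cong[OF refl], goal_cases)
      case xs: (1 xs)
      have a: "is_nat (pow_cat (Car X) (length (concat wss))) (Car X) (CC X (w, ws))" using nat_CC(1)[OF w] by (simp add: cl)
      have "ncomp (gamma_nat (Car X) (map (Dom T) (concat wss)) (CC X (w, ws)) (map (i_Phi T X) (concat wss))) xs
        = pc X w ws (map2 (po X) (concat wss) (blocks (map (Dom T) (concat wss)) xs))" by (rule ncomp_gamma_nat_ids[OF a F xs])
      moreover have "ncomp (gamma_nat (Car X) ?ms (i_Phi T X w) (map2 (\<lambda>v vs. CC X (v, vs)) ws wss)) xs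
        = pa X w (map (\<lambda>j. ncomp ((map2 (\<lambda>v vs. CC X (v, vs)) ws wss) ! j) (blocks ?ms xs ! j)) [0..<Dom T w])"
        using nat_CC(1)[OF j'] l by (intro ncomp_gamma_nat_id_left[OF dD(2)[OF wD(1)]] xs[unfolded N]) (auto simp: wD)
      moreover have "map (\<lambda>j. ncomp ((map2 (\<lambda>v vs. CC X (v, vs)) ws wss) ! j) (blocks ?ms xs ! j)) [0..<Dom T w]
        = map (\<lambda>j. pc X (ws ! j) (wss ! j) (blocks ?ms xs ! j)) [0..<length ws]" using l by (auto simp: wD)
      ultimately show ?case using xs by simp
    qed
  qed simp_all
qed

lemma unit_right_eq_iff:
  assumes w: "w \<in> words T"
  shows "vcomp (pow_cat (Car X) (Dom T w)) (Car X) (gamma_nat (Car X) (replicate (Dom T w) 1) (i_Phi T X w) (replicate (Dom T w) (II X)))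
      (CC X (w, replicate (Dom T w) (unit_word T))) = i_Phi T X w \<longleftrightarrow> (\<forall>xs\<in>tup X (Dom T w).
       unit_right_eq T X w xs)"
proof -
  let ?k = "Dom T w"
  note c = cwords_unit_right[OF T w] and F = dD(2)[OF w]
  have s: "sum_list (replicate ?k 1) = ?k" by (simp add: sum_list_replicate)
  show ?thesis
  proof (subst nattr_eq_iff[where A = "tup X ?k"], goal_cases)
    case 1 show ?case by (simp add: nat_CC[OF c] gamma_word_unit_right[OF T w])
  next
    case 2 show ?case by (simp add: nat_II gamma_fun_unit_right[OF F])
  next
    case 5
    show ?case
    proof (rule ball_cong[OF refl], goal_cases)
      case xs: (1 xs)
      then have "length xs = ?k" by (simp add: Ob_pow)
      moreover have "ncomp (gamma_nat (Car X) (replicate ?k 1) (i_Phi T X w) (replicate ?k (II X))) xs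
        = pa X w (map (\<lambda>j. ncomp (replicate ?k (II X) ! j) (blocks (replicate ?k 1) xs ! j)) [0..<?k])"
        using nat_II xs by (intro ncomp_gamma_nat_id_left[OF F]) (auto simp: s)
      moreover have "map (\<lambda>j. ncomp (replicate ?k (II X) ! j) (blocks (replicate ?k 1) xs ! j)) [0..<?k]
        = map (\<lambda>x. ncomp (II X) [x]) xs"
        using \<open>length xs = ?k\<close> by (intro nth_equalityI) (auto simp: blocks_replicate_1)
      ultimately show ?case using xs by simp
    qed
  qed simp_all
qed

lemma unit_left_eq_iff:
  assumes w: "w \<in> words T"
  shows "vcomp (pow_cat (Car X) (Dom T w)) (Car X)
      (gamma_nat (Car X) [Dom T w] (II X) [i_Phi T X w]) (CC X (unit_word T, [w])) = i_Phi T X w \<longleftrightarrow>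
    (\<forall>xs\<in>tup X (Dom T w). unit_left_eq T X w xs)"
proof -
  let ?k = "Dom T w"
  note c = cwords_unit_left[OF T w] and F = dD(2)[OF w]
  show ?thesis
  proof (subst nattr_eq_iff[where A = "tup X ?k"], goal_cases)
    case 1 show ?case by (simp add: nat_CC[OF c] gamma_word_unit_left[OF T w])
  next
    case 2 show ?case by (simp add: nat_II gamma_fun_unit_left[OF F])
  next
    case 5
    show ?case
    proof (rule ball_cong[OF refl], goal_cases)
      case xs: (1 xs)
      then have "take ?k xs = xs" by (simp add: Ob_pow)
      moreover have "ncomp (gamma_nat (Car X) (map (Dom T) [w]) (II X) (map (i_Phi T X) [w])) xs
        = ncomp (II X) (map2 (po X) [w] (blocks (map (Dom T) [w]) xs))"
        using nat_II xs F by (intro ncomp_gamma_nat_ids) (auto simp: One_nat_def)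
      ultimately show ?case using xs by simp
    qed
  qed simp_all
qed

lemma subst_gamma_eq_iff:
  assumes w: "(w, l, f) \<in> swords T" and l: "length ws = l" and ws: "set ws \<subseteq> words T"
  shows "vcomp (pow_cat (Car X) (sum_list (map (Dom T) ws))) (Car X)
      (subst_nat (Car X) (Car X) (CC X (w, map ((!) ws) f)) (sum_list (map (Dom T) ws)) (block_map (map (Dom T) ws) f))
      (SS X (gamma_word T w (map ((!) ws) f), sum_list (map (Dom T) ws), block_map (map (Dom T) ws) f))
    = vcomp (pow_cat (Car X) (sum_list (map (Dom T) ws))) (Car X) (gamma_nat (Car X) (map (Dom T) ws) (SS X (w, l, f)) (map (i_Phi T X) ws))
      (CC X (subst_word T w l f, ws)) \<longleftrightarrow> (\<forall>xs\<in>Ob (pow_cat (Car X) (sum_list (map (Dom T) ws))).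
         subst_gamma_eq T X w l f ws xs)"
proof -
  let ?n = "sum_list (map (Dom T) ws)" and ?fb = "block_map (map (Dom T) ws) f"
  let ?N = "pow_cat (Car X) ?n"
  note A = gamma_word_subst[OF T w l ws]
  have F: "\<And>v. v \<in> set ws ==> is_functor (pow_cat (Car X) (Dom T v)) (Car X) (Phi X v)" using dD(2) ws by blast
  have f: "set f \<subseteq> {..<length ws}" using A(4) by simp
  show ?thesis
  proof (subst nattr_eq_iff[where A = "Ob ?N"], goal_cases)
    case 1 show ?case by (simp add: nat_CC[OF A(2)] nat_SS[OF A(5)] A(6))
  next
    case 2 show ?case using subst_fun_gamma[OF f F, where F = "Phi X w"] l by (simp add: nat_CC[OF A(1)] nat_SS[OF w] comp_def)
  next
    case 5
    show ?case
    proof (rule ball_cong[OF refl], goal_cases)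
      case xs: (1 xs)
      have a: "is_nat (pow_cat (Car X) (length ws)) (Car X) (SS X (w, l, f))" using nat_SS(1)[OF w] by (simp add: l)
      have "is_nat (pow_cat (Car X) (length ?fb)) (Car X) (CC X (w, map ((!) ws) f))"
        using nat_CC(1)[OF A(1)] unfolding A(3) by (simp only: length_block_map[OF A(4)])
      from ncomp_subst_nat[OF this dD(1) set_block_map[OF A(4)] xs]
        ncomp_gamma_nat_ids[OF a F xs] xs
      show ?case by simp
    qed
  qed simp_all
qed

lemma gamma_subst_eq_iff:
  assumes w: "(w, ws) \<in> cwords T" and l: "length ns' = length ws" "length gs = length ws"
    and g: "\<forall>j<length ws. (ws ! j, ns' ! j, gs ! j) \<in> swords T"
  shows "vcomp (pow_cat (Car X) (sum_list ns')) (Car X) (subst_nat (Car X) (Car X) (CC X (w, ws)) (sum_list ns') (block_sum ns' gs))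
      (SS X (gamma_word T w ws, sum_list ns', block_sum ns' gs)) = vcomp (pow_cat (Car X) (sum_list ns')) (Car X)
      (gamma_nat (Car X) ns' (i_Phi T X w) (map (\<lambda>j. SS X (ws ! j, ns' ! j, gs ! j)) [0..<length ws]))
      (CC X (w, map (\<lambda>j. subst_word T (ws ! j) (ns' ! j) (gs ! j)) [0..<length ws])) \<longleftrightarrow>
    (\<forall>xs\<in>tup X (sum_list ns'). gamma_subst_eq T X w ws ns' gs xs)"
proof -
  let ?N = "pow_cat (Car X) (sum_list ns')"
  have g': "\<And>j. j < length ws ==> (ws ! j, ns' ! j, gs ! j) \<in> swords T" using g by blast
  note A = gamma_word_block_sum[OF T w l g']
  note wD = cwords_words[OF w]
  have lg: "length gs = length ns'" "length (map (Phi X) ws) = length ns'" using l by simp_all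
  have gb: "set (gs ! j) \<subseteq> {..<ns' ! j}" if "j < length ns'" for j using swordsD[OF g'] that l by simp
  note sb = set_block_sum[OF lg(1) gb]
  show ?thesis
  proof (subst nattr_eq_iff[where A = "Ob ?N"], goal_cases)
    case 1 show ?case by (simp add: nat_CC[OF A(1)] nat_SS[OF A(4)] A(5))
  next
    case 2
    have "map ntgt (map (\<lambda>j. SS X (ws ! j, ns' ! j, gs ! j)) [0..<length ws])
      = map (\<lambda>j. subst_fun (Car X) (map (Phi X) ws ! j) (ns' ! j) (gs ! j)) [0..<length ns']"
      using l by (auto simp: nat_SS(3)[OF g'])
    then show ?case using subst_fun_block_sum[OF lg gb, of "Car X" "Phi X w"]
      unfolding vcomp_simps gamma_nat_simps subst_nat_simps nat_CC(3)[OF w] id_nat_simps by (simp add: A(3))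
  next
    case 5
    show ?case
    proof (rule ball_cong[OF refl], goal_cases)
      case xs: (1 xs)
      have "ncomp (subst_nat (Car X) (Car X) (CC X (w, ws)) (sum_list ns') (block_sum ns' gs)) xs
        = pc X w ws (map ((!) xs) (block_sum ns' gs))"
        using nat_CC(1)[OF w] sb xs by (intro ncomp_subst_nat dD(1)) (simp_all add: length_block_sum A(3))
      moreover have "ncomp (gamma_nat (Car X) ns' (i_Phi T X w) (map (\<lambda>j. SS X (ws ! j, ns' ! j, gs ! j)) [0..<length ws])) xs
        = pa X w (map (\<lambda>j. ncomp (map (\<lambda>j. SS X (ws ! j, ns' ! j, gs ! j)) [0..<length ws] ! j) (blocks ns' xs ! j)) [0..<Dom T w])"
        using nat_SS(1)[OF g'] l by (intro ncomp_gamma_nat_id_left[OF dD(2)[OF wD(1)]] xs) (auto simp: wD)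
      moreover have "map (\<lambda>j. ncomp (map (\<lambda>j. SS X (ws ! j, ns' ! j, gs ! j)) [0..<length ws] ! j) (blocks ns' xs ! j)) [0..<Dom T w]
        = map (\<lambda>j. ps X (ws ! j) (ns' ! j) (gs ! j) (blocks ns' xs ! j)) [0..<length ws]" by (auto simp: wD)
      ultimately show ?case using xs by simp
    qed
  qed simp_all
qed

lemma subst_subst_eq_iff:
  assumes w: "(w, l, f) \<in> swords T" and g: "length g = l" "set g \<subseteq> {..<m}"
  shows "vcomp (pow_cat (Car X) m) (Car X) (subst_nat (Car X) (Car X) (SS X (w, l, f)) m g)
      (SS X (subst_word T w l f, m, g)) = SS X (w, m, map ((!) g) f) \<longleftrightarrow> (\<forall>xs\<in>tup X m.
         subst_subst_eq T X w l f m g xs)"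
proof -
  note A = subst_word_subst[OF T w g]
  have f: "set f \<subseteq> {..<length g}" using swordsD[OF w] g by simp
  have a: "is_nat (pow_cat (Car X) (length g)) (Car X) (SS X (w, l, f))" using nat_SS[OF w] g by simp
  show ?thesis
  proof (subst nattr_eq_iff[where A = "tup X m"], goal_cases)
    case 1 show ?case by (simp add: nat_SS[OF A(1)] nat_SS[OF A(2)] A(3))
  next
    case 2 show ?case using subst_fun_subst[OF f g(2), of "Car X" "Phi X w"] g by (simp add: nat_SS[OF A(2)] nat_SS[OF w])
  next
    case 5 show ?case by (rule ball_cong[OF refl]) (simp add: ncomp_subst_nat[OF a dD(1) g(2)])
  qed (simp_all add: nat_ext[OF nat_SS(1)[OF A(2)]])
qed

lemma subst_id_eq_iff:
  assumes w: "w \<in> words T"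
  shows "SS X (w, Dom T w, [0..<Dom T w]) = i_Phi T X w \<longleftrightarrow> (\<forall>xs\<in>tup X (Dom T w).
       ps X w (Dom T w) [0..<Dom T w] xs = Idt (Car X) (po X w xs))"
proof -
  note s = swords_id[OF w]
  show ?thesis
  proof (subst nattr_eq_iff[where A = "tup X (Dom T w)"], goal_cases)
    case 1 show ?case by (simp add: nat_SS[OF s] subst_word_id[OF T w])
  next
    case 2 show ?case by (simp add: nat_SS[OF s] subst_fun_id[OF dD(2)[OF w]])
  qed (simp_all add: nat_ext[OF nat_SS(1)[OF s]])
qed

end

lemma ball_case_cong: "(\<And>w ws. (w, ws) \<in> S ==> Q w ws = R w ws) ==>
    (\<forall>(w, ws)\<in>S. Q w ws) = (\<forall>(w, ws)\<in>S. R w ws)"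
  and ball_case_cong3: "(\<And>w l f. (w, l, f) \<in> S' ==> Q' w l f = R' w l f) ==>
    (\<forall>(w, l, f)\<in>S'. Q' w l f) = (\<forall>(w, l, f)\<in>S'. R' w l f)"
  and all_eqI: "(\<And>x. P x = P' x) ==> (\<forall>x. P x) = (\<forall>x. P' x)" by auto

text \<open>Given \<open>alg_data\<close>, the axioms match the pointwise equations one by one;
  without it both sides are false. From here on algebras are handled through arrows of the
  carrier.\<close>

lemma is_psalg_iff:
  assumes T: "is_theory T"
  shows "is_psalg T X \<longleftrightarrow> alg_data T X \<and> alg_eqs T X"
proof (cases "alg_data T X")
  case True
  note D = True
  show ?thesis unfolding is_psalg_def Let_def alg_data_def alg_eqs_def conj_assoc
    apply (intro conj_cong refl)
          apply (rule ball_case_cong, rule all_cong, elim conjE, rule assoc_eq_iff[OF T D]; assumption)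
         apply (rule ball_cong[OF refl], rule unit_right_eq_iff[OF T D], assumption)
        apply (rule ball_cong[OF refl], rule unit_left_eq_iff[OF T D], assumption)
       apply (rule ball_case_cong3, rule all_cong, elim conjE, rule subst_gamma_eq_iff[OF T D]; assumption)
      apply (rule ball_case_cong, rule all_eqI, rule all_cong, elim conjE, rule gamma_subst_eq_iff[OF T D]; assumption)
     apply (rule ball_case_cong3, rule all_eqI, rule all_cong, elim conjE, rule subst_subst_eq_iff[OF T D]; assumption)
    apply (rule ball_cong[OF refl], rule subst_id_eq_iff[OF T D], assumption)
    done
next
  case False
  then have "\<not> is_psalg T X" unfolding is_psalg_def Let_def alg_data_def by blast
  with False show ?thesis by simp
qed

section \<open>Structure maps of a pseudo algebra at tuples of objects\<close>

locale psalgebra =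
  fixes T :: "'t thry" and X :: "('t, 'o, 'a) psalg"
  assumes T: "is_theory T" and X: "is_psalg T X"
begin

lemma data: "alg_data T X" and eqs: "alg_eqs T X" using X is_psalg_iff[OF T] by auto

lemmas C = alg_dataD(1)[OF data] and Fun = alg_dataD(2)[OF data]

lemma ext: "extensional_cat (Car X)" "Phi X \<in> extensional (words T)" "CC X \<in> extensional (cwords T)"
  "SS X \<in> extensional (swords T)" using data by (auto simp: alg_data_def)

lemma po_Ob: "w \<in> words T ==> xs \<in> tup X (Dom T w) ==> po X w xs \<in> Ob (Car X)" using functor_ob[OF Fun] by blast

lemma pa_hom: "w \<in> words T ==> fs \<in> hom (pow_cat (Car X) (Dom T w)) xs ys ==> pa X w fs \<in> hom (Car X) (po X w xs) (po X w ys)"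
  using functor_hom[OF Fun] by blast

lemma map2_po_Ob:
  assumes ws: "set ws \<subseteq> words T" and xs: "xs \<in> Ob (pow_cat (Car X) (sum_list (map (Dom T) ws)))"
  shows "map2 (po X) ws (blocks (map (Dom T) ws) xs) \<in> tup X (length ws)"
proof -
  have F: "is_functor (pow_cat (Car X) (map (Dom T) ws ! i)) (Car X) (map (Phi X) ws ! i)"
    if "i < length (map (Dom T) ws)" for i using Fun[of "ws ! i"] ws that by (simp add: subset_iff)
  show ?thesis using map2_nth_Ob[OF xs _ F] by (simp add: map2_map1)
qed

lemma pc_hom:
  assumes w: "(w, ws) \<in> cwords T" and xs: "xs \<in> Ob (pow_cat (Car X) (sum_list (map (Dom T) ws)))"
  shows "pc X w ws xs \<in> hom (Car X) (po X (gamma_word T w ws) xs)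
      (po X w (map2 (po X) ws (blocks (map (Dom T) ws) xs)))" "iso (Car X) (pc X w ws xs)"
  using nat_hom[OF nat_CC(1)[OF T data w] xs] nat_isoD(4)[OF alg_dataD(3)[OF data w] xs] xs by (simp_all add: nat_CC[OF T data w] map2_map1)

lemma pc_natural:
  assumes w: "(w, ws) \<in> cwords T" and f: "fs \<in> hom (pow_cat (Car X) (sum_list (map (Dom T) ws))) xs ys"
  shows "Comp (Car X) (pc X w ws ys) (pa X (gamma_word T w ws) fs)
    = Comp (Car X) (pa X w (map2 (pa X) ws (blocks (map (Dom T) ws) fs))) (pc X w ws xs)"
  using nat_natural[OF nat_CC(1)[OF T data w] f] hom_Ar[OF f] by (simp add: nat_CC[OF T data w] map2_map1)

lemma pI_hom:
  assumes x: "x \<in> Ob (Car X)"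
  shows "ncomp (II X) [x] \<in> hom (Car X) (po X (unit_word T) [x]) x" "iso (Car X) (ncomp (II X) [x])"
proof -
  have xs: "[x] \<in> tup X 1" using x by (simp add: Ob_pow One_nat_def)
  show "ncomp (II X) [x] \<in> hom (Car X) (po X (unit_word T) [x]) x" "iso (Car X) (ncomp (II X) [x])"
    using nat_hom[OF nat_II(1)[OF T data] xs] nat_isoD(4)[OF alg_dataD(4)[OF data] xs] xs by (simp_all add: nat_II[OF T data])
qed

lemma pI_natural:
  assumes f: "f \<in> hom (Car X) x y"
  shows "Comp (Car X) (ncomp (II X) [y]) (pa X (unit_word T) [f]) = Comp (Car X) f (ncomp (II X) [x])"
proof -
  have fs: "[f] \<in> hom (pow_cat (Car X) 1) [x] [y]" using f by (simp add: hom_pow One_nat_def)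
  show ?thesis using nat_natural[OF nat_II(1)[OF T data] fs] hom_Ar[OF fs] by (simp add: nat_II[OF T data])
qed

lemma ps_hom:
  assumes w: "(w, l, f) \<in> swords T" and xs: "xs \<in> tup X l"
  shows "ps X w l f xs \<in> hom (Car X) (po X (subst_word T w l f) xs) (po X w (map ((!) xs) f))"
    "iso (Car X) (ps X w l f xs)" using nat_hom[OF nat_SS(1)[OF T data w] xs] nat_isoD(4)[OF alg_dataD(5)[OF data w] xs] xs
  by (simp_all add: nat_SS[OF T data w])

lemma ps_natural:
  assumes w: "(w, l, f) \<in> swords T" and g: "fs \<in> hom (pow_cat (Car X) l) xs ys"
  shows "Comp (Car X) (ps X w l f ys) (pa X (subst_word T w l f) fs) = Comp (Car X) (pa X w (map ((!) fs) f)) (ps X w l f xs)"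
  using nat_natural[OF nat_SS(1)[OF T data w] g] hom_Ar[OF g] by (simp add: nat_SS[OF T data w])

end

section \<open>Morphisms and 2-cells pointwise\<close>

abbreviation pr :: "('t, 'o, 'a, 'p, 'b) psmor => 't => 'o list => 'b" where "pr H w \<equiv> ncomp (Rho H w)"

definition mor_data :: "'t thry => ('t, 'o, 'a) psalg => ('t, 'p, 'b) psalg => ('t, 'o, 'a, 'p, 'b) psmor => bool" where
  "mor_data T X Y H \<longleftrightarrow> is_functor (Car X) (Car Y) (Fn H) \<and> Rho H \<in> extensional (words T) \<and>
     (\<forall>w\<in>words T. nat_iso (pow_cat (Car X) (Dom T w)) (Car Y) (Rho H w) (fcomp (pow_cat (Car X) (Dom T w)) (Fn H) (Phi X w))
        (fcomp (pow_cat (Car X) (Dom T w)) (Phi Y w) (pow_fun (Car X) (Dom T w) (Fn H))))"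

abbreviation mor_gamma_eq where
  "mor_gamma_eq T X Y H w ws xs \<equiv> Comp (Car Y) (pc Y w ws (map (fob (Fn H)) xs)) (pr H (gamma_word T w ws) xs)
      = Comp (Car Y) (pa Y w (map (\<lambda>j. pr H (ws ! j) (blocks (map (Dom T) ws) xs ! j)) [0..<length ws]))
      (Comp (Car Y) (pr H w (map2 (po X) ws (blocks (map (Dom T) ws) xs))) (far (Fn H) (pc X w ws xs)))"

abbreviation mor_unit_eq where
  "mor_unit_eq T X Y H xs \<equiv> Comp (Car Y) (ncomp (II Y) (map (fob (Fn H)) xs)) (pr H (unit_word T) xs) = far (Fn H) (ncomp (II X) xs)"

abbreviation mor_subst_eq where
  "mor_subst_eq T X Y H w l f xs \<equiv> Comp (Car Y) (ps Y w l f (map (fob (Fn H)) xs)) (pr H (subst_word T w l f) xs)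
      = Comp (Car Y) (pr H w (map ((!) xs) f)) (far (Fn H) (ps X w l f xs))"

definition mor_eqs :: "'t thry => ('t, 'o, 'a) psalg => ('t, 'p, 'b) psalg => ('t, 'o, 'a, 'p, 'b) psmor => bool" where
  "mor_eqs T X Y H \<longleftrightarrow> (\<forall>(w, ws)\<in>cwords T. \<forall>xs\<in>Ob (pow_cat (Car X) (sum_list (map (Dom T) ws))).
        mor_gamma_eq T X Y H w ws xs) \<and> (\<forall>xs\<in>tup X 1. mor_unit_eq T X Y H xs) \<and>
     (\<forall>(w, l, f)\<in>swords T. \<forall>xs\<in>tup X l. mor_subst_eq T X Y H w l f xs)"

context
  fixes T :: "'t thry" and X :: "('t, 'o, 'a) psalg" and Y :: "('t, 'p, 'b) psalg"
    and H :: "('t, 'o, 'a, 'p, 'b) psmor"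
  assumes T: "is_theory T" and X: "is_psalg T X" and Y: "is_psalg T Y" and M: "mor_data T X Y H"
begin

interpretation X: psalgebra T X using T X by unfold_locales
interpretation Y: psalgebra T Y using T Y by unfold_locales

lemma mFn: "is_functor (Car X) (Car Y) (Fn H)"
  and mRho: "w \<in> words T ==> nat_iso (pow_cat (Car X) (Dom T w)) (Car Y) (Rho H w) (fcomp (pow_cat (Car X) (Dom T w)) (Fn H) (Phi X w))
        (fcomp (pow_cat (Car X) (Dom T w)) (Phi Y w) (pow_fun (Car X) (Dom T w) (Fn H)))" using M by (auto simp: mor_data_def)

lemma nat_Rho:
  assumes "w \<in> words T"
  shows "is_nat (pow_cat (Car X) (Dom T w)) (Car Y) (Rho H w)"
    "nsrc (Rho H w) = fcomp (pow_cat (Car X) (Dom T w)) (Fn H) (Phi X w)"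
    "ntgt (Rho H w) = fcomp (pow_cat (Car X) (Dom T w)) (Phi Y w) (pow_fun (Car X) (Dom T w) (Fn H))"
  using nat_isoD[OF mRho[OF assms]] by auto

lemma map_Fn_Ob: "xs \<in> tup X n ==> map (fob (Fn H)) xs \<in> tup Y n" using functor_ob[OF mFn] by (auto simp: Ob_pow)

lemma map_Fn_Ar: "xs \<in> Ar (pow_cat (Car X) n) ==> map (far (Fn H)) xs \<in> Ar (pow_cat (Car Y) n)"
  using functor_ar[OF mFn] by (auto simp: Ar_pow)

lemma mor_gamma_eq_iff:
  fixes w ws N defines "N \<equiv> pow_cat (Car X) (sum_list (map (Dom T) ws))"
  assumes w: "(w, ws) \<in> cwords T"
  shows "vcomp N (Car Y) (hcomp N (Car Y) (CC Y (w, ws)) (id_nat N (pow_cat (Car Y) (sum_list (map (Dom T) ws)))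
          (pow_fun (Car X) (sum_list (map (Dom T) ws)) (Fn H)))) (Rho H (gamma_word T w ws)) = vcomp N (Car Y)
      (hcomp N (Car Y) (i_Phi T Y w) (prod_nat (Car X) (map (Dom T) ws) (map (Rho H) ws))) (vcomp N (Car Y) (hcomp N (Car Y) (Rho H w)
          (id_nat N (pow_cat (Car X) (length ws)) (prod_fun (Car X) (map (Dom T) ws) (map (Phi X) ws))))
        (hcomp N (Car Y) (id_nat (Car X) (Car Y) (Fn H)) (CC X (w, ws)))) \<longleftrightarrow> (\<forall>xs\<in>Ob N.
        mor_gamma_eq T X Y H w ws xs)"
proof -
  let ?ns = "map (Dom T) ws"
  let ?N = "pow_cat (Car X) (sum_list ?ns)"
  note w' = cwords_words[OF w] and g = gamma_words[OF T w]
  have wi: "ws ! i \<in> words T" if "i < length ws" for i using that w'(3) by (simp add: subset_iff)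
  have P: "is_functor ?N (pow_cat (Car X) (length ws)) (prod_fun (Car X) ?ns (map (Phi X) ws))"
    using functor_prod_fun[OF X.C X.C, of "map (Phi X) ws" ?ns] X.Fun[OF wi] by simp
  have Q: "is_nat ?N (pow_cat (Car Y) (length ws)) (prod_nat (Car X) ?ns (map (Rho H) ws))"
    using nat_prod_nat[OF X.C Y.C, of "map (Rho H) ws" ?ns] nat_Rho(1)[OF wi] by simp
  have YF: "is_functor (pow_cat (Car Y) (length ws)) (Car Y) (Phi Y w)" using Y.Fun[OF w'(1)] w'(2) by simp
  have rw: "is_nat (pow_cat (Car X) (length ws)) (Car Y) (Rho H w)" using nat_Rho(1)[OF w'(1)] w'(2) by simp
  note cY = nat_CC[OF T Y.data w] and cX = nat_CC[OF T X.data w]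
  note pF = functor_pow_fun[OF mFn]
  have blo: "blocks ?ns xs ! i \<in> tup X (Dom T (ws ! i))" if "xs \<in> Ob ?N" "i < length ws" for xs i
    using blocks_Ob[OF that(1)] that(2) by simp
  have bla: "blocks ?ns xs ! i \<in> Ar (pow_cat (Car X) (Dom T (ws ! i)))" if "xs \<in> Ar ?N" "i < length ws" for xs i
    using blocks_Ar[OF that(1)] that(2) by simp
  show ?thesis unfolding N_def
  proof (subst nattr_eq_iff[where A = "Ob ?N"], goal_cases)
    case 1 show ?case by (simp add: nat_Rho[OF g(1)] cX g(2))
  next
    case 2
    \<comment> \<open>The two targets agree because applying the functor to every entry commutes
      with cutting a list into blocks.\<close>
    have "fcomp ?N (gamma_fun (Car Y) ?ns (Phi Y w) (map (Phi Y) ws)) (pow_fun (Car X) (sum_list ?ns) (Fn H))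
      = fcomp ?N (Phi Y w) (prod_fun (Car X) ?ns (map ntgt (map (Rho H) ws)))"
    proof (rule functr_eqI[OF fcomp_ext(1) fcomp_ext(1) fcomp_ext(2) fcomp_ext(2)], goal_cases)
      case xs: (1 xs)
      have "map2 fob (map (Phi Y) ws) (blocks ?ns (map (fob (Fn H)) xs)) = map2 fob (map ntgt (map (Rho H) ws)) (blocks ?ns xs)"
        using blo[OF xs] by (intro nth_equalityI) (auto simp: blocks_map nat_Rho(3)[OF wi])
      then show ?case using xs map_Fn_Ob[OF xs] by simp
    next
      case xs: (2 xs)
      have "map2 far (map (Phi Y) ws) (blocks ?ns (map (far (Fn H)) xs)) = map2 far (map ntgt (map (Rho H) ws)) (blocks ?ns xs)"
        using bla[OF xs] by (intro nth_equalityI) (auto simp: blocks_map nat_Rho(3)[OF wi])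
      then show ?case using xs map_Fn_Ar[OF xs] by simp
    qed
    then show ?case by (simp add: cY)
  next
    case 5
    show ?case
    proof (rule ball_cong[OF refl], goal_cases)
      case xs: (1 xs)
      have 3: "map2 (pr H) ws (blocks ?ns xs) = map (\<lambda>j. pr H (ws ! j) (blocks ?ns xs ! j)) [0..<length ws]"
        by (intro nth_equalityI) auto
      show ?case unfolding vcomp_simps(3)[OF xs] hcomp_id_right[OF pF cY(1) xs]
          hcomp_id_left[OF Q YF xs, folded w'(2)] hcomp_id_right[OF P rw xs] hcomp_id_left[OF cX(1) mFn xs]
        using xs by (simp add: 3 map2_map1 del: map_map)
    qed
  qed simp_all
qed

lemma mor_unit_eq_iff:
  "vcomp (pow_cat (Car X) 1) (Car Y) (hcomp (pow_cat (Car X) 1) (Car Y) (II Y)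
        (id_nat (pow_cat (Car X) 1) (pow_cat (Car Y) 1) (pow_fun (Car X) 1 (Fn H)))) (Rho H (unit_word T))
    = hcomp (pow_cat (Car X) 1) (Car Y) (id_nat (Car X) (Car Y) (Fn H)) (II X) \<longleftrightarrow> (\<forall>xs\<in>tup X 1.
        mor_unit_eq T X Y H xs)"
proof -
  note u' = unit_words[OF T]
  note iX = nat_II[OF T X.data] and iY = nat_II[OF T Y.data]
  show ?thesis
  proof (subst nattr_eq_iff[where A = "tup X 1"], goal_cases)
    case 1 show ?case by (simp add: nat_Rho[OF u'(1)] u'(2) iX)
  next
    case 2
    have "fcomp (pow_cat (Car X) 1) (unit_fun (Car Y)) (pow_fun (Car X) 1 (Fn H)) = fcomp (pow_cat (Car X) 1) (Fn H) (unit_fun (Car X))"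
      using map_Fn_Ob[of _ 1] map_Fn_Ar[of _ 1] by (intro functr_eqI[OF fcomp_ext(1) fcomp_ext(1) fcomp_ext(2) fcomp_ext(2)])
        (auto simp: hd_map Ob_pow Ar_pow One_nat_def length_Suc_conv)
    then show ?case by (simp add: iX iY)
  next
    case 5
    show ?case
    proof (rule ball_cong[OF refl], goal_cases)
      case xs: (1 xs)
      show ?case unfolding vcomp_simps(3)[OF xs] hcomp_id_right[OF functor_pow_fun[OF mFn] iY(1) xs]
          hcomp_id_left[OF iX(1) mFn xs] using xs by simp
    qed
  qed simp_all
qed

lemma mor_subst_eq_iff:
  assumes w: "(w, l, f) \<in> swords T"
  shows "vcomp (pow_cat (Car X) l) (Car Y) (hcomp (pow_cat (Car X) l) (Car Y) (SS Y (w, l, f))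
        (id_nat (pow_cat (Car X) l) (pow_cat (Car Y) l) (pow_fun (Car X) l (Fn H)))) (Rho H (subst_word T w l f))
    = vcomp (pow_cat (Car X) l) (Car Y) (subst_nat (Car X) (Car Y) (Rho H w) l f)
      (hcomp (pow_cat (Car X) l) (Car Y) (id_nat (Car X) (Car Y) (Fn H)) (SS X (w, l, f))) \<longleftrightarrow> (\<forall>xs\<in>tup X l.
        mor_subst_eq T X Y H w l f xs)"
proof -
  note w' = swords_words[OF w] and g = subst_words[OF T w]
  note sX = nat_SS[OF T X.data w] and sY = nat_SS[OF T Y.data w]
  have rw: "is_nat (pow_cat (Car X) (length f)) (Car Y) (Rho H w)" using nat_Rho(1)[OF w'(1)] w'(2) by simp
  show ?thesis
  proof (subst nattr_eq_iff[where A = "tup X l"], goal_cases)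
    case 1 show ?case by (simp add: nat_Rho[OF g(1)] g(2) sX)
  next
    case 2
    have m: "map ((!) (map h xs)) f = map h (map ((!) xs) f)" if "length xs = l" for h :: "'e => 'g" and xs
      using w'(3) that by (auto simp: subset_iff)
    have "fcomp (pow_cat (Car X) l) (subst_fun (Car Y) (Phi Y w) l f) (pow_fun (Car X) l (Fn H))
      = subst_fun (Car X) (fcomp (pow_cat (Car X) (length f)) (Phi Y w) (pow_fun (Car X) (length f) (Fn H))) l f"
      using w'(3) map_Fn_Ob[of _ l] map_Fn_Ar[of _ l] reindex_Ob[of _ "Car X" l f] reindex_Ar[of _ "Car X" l f]
      by (intro functr_eqI[OF fcomp_ext(1) fun_exts(3) fcomp_ext(2) fun_exts(4)])
         (auto simp: Ob_pow Ar_pow subset_iff intro!: arg_cong[of _ _ "po Y w"] arg_cong[of _ _ "pa Y w"])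
    then show ?case by (simp add: sY nat_Rho[OF w'(1)] w'(2))
  next
    case 5
    show ?case
    proof (rule ball_cong[OF refl], goal_cases)
      case xs: (1 xs)
      show ?case unfolding vcomp_simps(3)[OF xs] hcomp_id_right[OF functor_pow_fun[OF mFn] sY(1) xs]
          hcomp_id_left[OF sX(1) mFn xs] ncomp_subst_nat[OF rw X.C w'(3) xs] using xs by simp
    qed
  qed simp_all
qed

end

lemma is_psmor_iff:
  assumes T: "is_theory T" and X: "is_psalg T X" and Y: "is_psalg T Y"
  shows "is_psmor T X Y H \<longleftrightarrow> mor_data T X Y H \<and> mor_eqs T X Y H"
proof (cases "mor_data T X Y H")
  case True
  note D = T X Y True
  show ?thesis unfolding is_psmor_def Let_def mor_data_def mor_eqs_def conj_assoc
    apply (intro conj_cong refl)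
      apply (rule ball_case_cong, rule mor_gamma_eq_iff[OF D], assumption)
     apply (rule mor_unit_eq_iff[OF D])
    apply (rule ball_case_cong3, rule mor_subst_eq_iff[OF D], assumption)
    done
next
  case False
  then have "\<not> is_psmor T X Y H" unfolding is_psmor_def Let_def mor_data_def by blast
  with False show ?thesis by simp
qed

locale psmorphism = X: psalgebra T X + Y: psalgebra T Y
  for T :: "'t thry" and X :: "('t, 'o, 'a) psalg" and Y :: "('t, 'p, 'b) psalg" +
  fixes H :: "('t, 'o, 'a, 'p, 'b) psmor"
  assumes H: "is_psmor T X Y H"
begin

lemma mdata: "mor_data T X Y H" and meqs: "mor_eqs T X Y H" using H is_psmor_iff[OF X.T X.X Y.X] by auto

lemmas md = X.T X.X Y.X mdata
lemmas F = mFn[OF md] and Rho_nat = nat_Rho[OF md] and Rho_iso = mRho[OF md]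
  and F_Ob = map_Fn_Ob[OF md] and F_Ar = map_Fn_Ar[OF md]

lemma Rho_ext: "Rho H \<in> extensional (words T)" using mdata by (simp add: mor_data_def)

lemma pr_hom:
  assumes w: "w \<in> words T" and xs: "xs \<in> tup X (Dom T w)"
  shows "pr H w xs \<in> hom (Car Y) (fob (Fn H) (po X w xs)) (po Y w (map (fob (Fn H)) xs))"
    "iso (Car Y) (pr H w xs)" using nat_hom[OF Rho_nat(1)[OF w] xs] nat_isoD(4)[OF Rho_iso[OF w] xs] xs by (simp_all add: Rho_nat[OF w])

lemma pr_natural:
  assumes w: "w \<in> words T" and f: "fs \<in> hom (pow_cat (Car X) (Dom T w)) xs ys"
  shows "Comp (Car Y) (pr H w ys) (far (Fn H) (pa X w fs)) = Comp (Car Y) (pa Y w (map (far (Fn H)) fs)) (pr H w xs)"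
  using nat_natural[OF Rho_nat(1)[OF w] f] hom_Ar[OF f] by (simp add: Rho_nat[OF w])

lemma map_F_hom: "fs \<in> hom (pow_cat (Car X) n) xs ys ==>
    map (far (Fn H)) fs \<in> hom (pow_cat (Car Y) n) (map (fob (Fn H)) xs) (map (fob (Fn H)) ys)"
  using functor_hom[OF F] by (auto simp: hom_pow)

lemma pr_gamma:
  assumes "(w, ws) \<in> cwords T" "xs \<in> Ob (pow_cat (Car X) (sum_list (map (Dom T) ws)))"
  shows "mor_gamma_eq T X Y H w ws xs" using meqs assms by (auto simp: mor_eqs_def)

lemma pr_unit:
  assumes "x \<in> Ob (Car X)"
  shows "Comp (Car Y) (ncomp (II Y) [fob (Fn H) x]) (pr H (unit_word T) [x]) = far (Fn H) (ncomp (II X) [x])"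
proof -
  have "[x] \<in> tup X 1" using assms by (simp add: Ob_pow One_nat_def)
  then show ?thesis using meqs by (fastforce simp: mor_eqs_def)
qed

lemma pr_subst:
  assumes "(w, l, f) \<in> swords T" "xs \<in> tup X l"
  shows "mor_subst_eq T X Y H w l f xs" using meqs assms by (auto simp: mor_eqs_def)

lemma pr_blocks_hom:
  assumes "set ws \<subseteq> words T" "xs \<in> Ob (pow_cat (Car X) (sum_list (map (Dom T) ws)))"
  shows "map (\<lambda>j. pr H (ws ! j) (blocks (map (Dom T) ws) xs ! j)) [0..<length ws]
    \<in> hom (pow_cat (Car Y) (length ws)) (map (fob (Fn H)) (map2 (po X) ws (blocks (map (Dom T) ws) xs)))
      (map2 (po Y) ws (blocks (map (Dom T) ws) (map (fob (Fn H)) xs)))"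
proof (rule hom_powI)
  fix i assume i: "i < length ws"
  then have "ws ! i \<in> words T" "blocks (map (Dom T) ws) xs ! i \<in> tup X (Dom T (ws ! i))"
    using assms(1) blocks_Ob[OF assms(2), of i] by (auto simp: subset_iff)
  from pr_hom(1)[OF this] i show "map (\<lambda>j. pr H (ws ! j) (blocks (map (Dom T) ws) xs ! j)) [0..<length ws] ! i
      \<in> hom (Car Y) (map (fob (Fn H)) (map2 (po X) ws (blocks (map (Dom T) ws) xs)) ! i)
        (map2 (po Y) ws (blocks (map (Dom T) ws) (map (fob (Fn H)) xs)) ! i)" by (simp add: blocks_map)
qed simp_all

end

abbreviation cell_eq where
  "cell_eq X Y \<alpha> w xs \<equiv> Comp (Car Y) (pr (Tgt \<alpha>) w xs) (ncomp (Nt \<alpha>) (po X w xs)) = Comp (Car Y) (pa Y w (map (ncomp (Nt \<alpha>)) xs)) (pr (Src \<alpha>) w xs)"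

lemma is_pscell_iff:
  assumes T: "is_theory T" and X: "is_psalg T X" and Y: "is_psalg T Y"
  shows "is_pscell T X Y \<alpha> \<longleftrightarrow> is_psmor T X Y (Src \<alpha>) \<and> is_psmor T X Y (Tgt \<alpha>) \<and>
     is_nat (Car X) (Car Y) (Nt \<alpha>) \<and> nsrc (Nt \<alpha>) = Fn (Src \<alpha>) \<and> ntgt (Nt \<alpha>) = Fn (Tgt \<alpha>) \<and>
     (\<forall>w\<in>words T. \<forall>xs\<in>tup X (Dom T w). cell_eq X Y \<alpha> w xs)" unfolding is_pscell_def Let_def
proof (intro conj_cong refl ball_cong)
  fix w assume S: "is_psmor T X Y (Src \<alpha>)" and T': "is_psmor T X Y (Tgt \<alpha>)"
    and N: "is_nat (Car X) (Car Y) (Nt \<alpha>)" "nsrc (Nt \<alpha>) = Fn (Src \<alpha>)" "ntgt (Nt \<alpha>) = Fn (Tgt \<alpha>)"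
    and w: "w \<in> words T"
  interpret S: psmorphism T X Y "Src \<alpha>" using assms S by unfold_locales
  interpret T: psmorphism T X Y "Tgt \<alpha>" using assms T' by unfold_locales
  let ?N = "pow_cat (Car X) (Dom T w)"
  show "vcomp ?N (Car Y) (Rho (Tgt \<alpha>) w) (hcomp ?N (Car Y) (Nt \<alpha>) (i_Phi T X w))
      = vcomp ?N (Car Y) (hcomp ?N (Car Y) (i_Phi T Y w) (pow_nat (Car X) (Dom T w) (Nt \<alpha>))) (Rho (Src \<alpha>) w) \<longleftrightarrow>
    (\<forall>xs\<in>Ob ?N. cell_eq X Y \<alpha> w xs)"
  proof (subst nattr_eq_iff[where A = "Ob ?N"], goal_cases)
    case 1 show ?case by (simp add: N S.Rho_nat[OF w])
  next
    case 2 show ?case by (simp add: N T.Rho_nat[OF w])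
  next
    case 5
    show ?case
    proof (rule ball_cong[OF refl], goal_cases)
      case xs: (1 xs)
      show ?case unfolding vcomp_simps(3)[OF xs] hcomp_id_right[OF S.X.Fun[OF w] N(1) xs]
          hcomp_id_left[OF nat_pow_nat[OF N(1)] S.Y.Fun[OF w] xs] using xs by simp
    qed
  qed simp_all
qed

section \<open>Composition of morphisms and 2-cells\<close>

lemma pr_psmor_comp:
  assumes "psmorphism T X Y G" "psmorphism T Y Z H" "w \<in> words T" "xs \<in> tup X (Dom T w)"
  shows "pr (psmor_comp T X Y Z H G) w xs = Comp (Car Z) (pr H w (map (fob (Fn G)) xs)) (far (Fn H) (pr G w xs))"
proof -
  interpret G: psmorphism T X Y G by fact
  interpret H: psmorphism T Y Z H by fact
  show ?thesis unfolding psmor_comp_def Let_def using assms(3,4)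
      hcomp_id_right[OF functor_pow_fun[OF G.F] H.Rho_nat(1)[OF assms(3)] assms(4)]
      hcomp_id_left[OF G.Rho_nat(1)[OF assms(3)] H.F assms(4)] by simp
qed

lemma Fn_psmor_comp [simp]: "Fn (psmor_comp T X Y Z H G) = fcomp (Car X) (Fn H) (Fn G)" by (simp add: psmor_comp_def)

text \<open>Each axiom for the composite is pasted from the axiom for \<open>H\<close> at the image
  of the tuple under \<open>G\<close> and the image under \<open>H\<close> of the axiom for
  \<open>G\<close>. In the axiom for \<gamma> the two pieces are interleaved, and naturality of
  \<rho> for \<open>H\<close> is needed to separate them.\<close>

lemma is_psmor_comp:
  assumes "psmorphism T X Y G" "psmorphism T Y Z H"
  shows "is_psmor T X Z (psmor_comp T X Y Z H G)"
proof -
  interpret G: psmorphism T X Y G by fact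
  interpret H: psmorphism T Y Z H by fact
  let ?HG = "psmor_comp T X Y Z H G"
  note Z = H.Y.C
  note prc = pr_psmor_comp[OF assms]
  have mfx: "map (fob (Fn ?HG)) xs = map (fob (Fn H)) (map (fob (Fn G)) xs)" if "xs \<in> tup X n" for xs n
    using that by (auto simp: Ob_pow)
  have data: "mor_data T X Z ?HG" unfolding mor_data_def
  proof (intro conjI ballI)
    show "is_functor (Car X) (Car Z) (Fn ?HG)" using functor_fcomp[OF G.F H.F] by simp
    show "Rho ?HG \<in> extensional (words T)" by (simp add: psmor_comp_def)
    fix w assume w: "w \<in> words T"
    let ?n = "Dom T w" let ?N = "pow_cat (Car X) ?n"
    note hG = nat_hcomp[OF G.Rho_nat(1)[OF w] nat_id_nat[OF H.F]]
    note hH = nat_hcomp[OF nat_id_nat[OF functor_pow_fun[OF G.F]] H.Rho_nat(1)[OF w]]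
    have R: "Rho ?HG w = vcomp ?N (Car Z) (hcomp ?N (Car Z) (Rho H w) (id_nat ?N (pow_cat (Car Y) ?n) (pow_fun (Car X) ?n (Fn G))))
         (hcomp ?N (Car Z) (id_nat (Car Y) (Car Z) (Fn H)) (Rho G w))" using w by (simp add: psmor_comp_def Let_def)
    show "nat_iso ?N (Car Z) (Rho ?HG w) (fcomp ?N (Fn ?HG) (Phi X w)) (fcomp ?N (Phi Z w) (pow_fun (Car X) ?n (Fn ?HG)))"
    proof (rule nat_isoI)
      show "is_nat ?N (Car Z) (Rho ?HG w)" unfolding R
      proof (rule nat_vcomp[OF hG hH])
        show "nsrc (hcomp ?N (Car Z) (Rho H w) (id_nat ?N (pow_cat (Car Y) ?n) (pow_fun (Car X) ?n (Fn G)))) =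
          ntgt (hcomp ?N (Car Z) (id_nat (Car Y) (Car Z) (Fn H)) (Rho G w))" using G.F_Ob[of _ ?n] G.F_Ar[of _ ?n]
          by (intro functr_eqI[of _ "Ob ?N" _ "Ar ?N"]) (auto simp: G.Rho_nat[OF w] H.Rho_nat[OF w])
      qed
      show "nsrc (Rho ?HG w) = fcomp ?N (Fn ?HG) (Phi X w)" unfolding R using functor_ob[OF G.X.Fun[OF w]] functor_ar[OF G.X.Fun[OF w]]
        by (intro functr_eqI[of _ "Ob ?N" _ "Ar ?N"]) (auto simp: G.Rho_nat[OF w])
      show "ntgt (Rho ?HG w) = fcomp ?N (Phi Z w) (pow_fun (Car X) ?n (Fn ?HG))" unfolding R using G.F_Ob[of _ ?n] G.F_Ar[of _ ?n]
        by (intro functr_eqI[of _ "Ob ?N" _ "Ar ?N"])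
          (auto simp: H.Rho_nat[OF w] Ob_pow Ar_pow comp_def subset_iff
            intro!: arg_cong[of _ _ "po Z w"] arg_cong[of _ _ "pa Z w"])
      fix xs assume xs: "xs \<in> Ob ?N"
      note g = G.pr_hom[OF w xs] and h = H.pr_hom[OF w G.F_Ob[OF xs]]
      show "iso (Car Z) (pr ?HG w xs)"
        unfolding prc[OF w xs] by (rule iso_comp[OF Z functor_hom[OF H.F g(1)] h(1) functor_iso[OF H.F g] h(2)])
    qed
  qed
  have "mor_eqs T X Z ?HG" unfolding mor_eqs_def
  proof (intro conjI ballI, safe, goal_cases)
    case (1 w ws xs)
    note w = 1(1) and xs = 1(2)
    let ?ns = "map (Dom T) ws"
    note w' = cwords_words[OF w] and g = gamma_words[OF G.X.T w]
    have xsg: "xs \<in> tup X (Dom T (gamma_word T w ws))" using xs g by simp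
    let ?Gx = "map (fob (Fn G)) xs"
    note Gxs = G.F_Ob[OF xs] and Gxsg = G.F_Ob[OF xsg]
    let ?ys = "map2 (po X) ws (blocks ?ns xs)"
    have ys: "?ys \<in> tup X (Dom T w)" using G.X.map2_po_Ob[OF w'(3) xs] w' by simp
    let ?zs = "map2 (po Y) ws (blocks ?ns ?Gx)"
    have zs: "?zs \<in> tup Y (Dom T w)" using G.Y.map2_po_Ob[OF w'(3) Gxs] w' by simp
    let ?rG = "map (\<lambda>j. pr G (ws ! j) (blocks ?ns xs ! j)) [0..<length ws]"
    let ?rH = "map (\<lambda>j. pr H (ws ! j) (blocks ?ns ?Gx ! j)) [0..<length ws]"
    have rG: "?rG \<in> hom (pow_cat (Car Y) (Dom T w)) (map (fob (Fn G)) ?ys) ?zs" using G.pr_blocks_hom[OF w'(3) xs] w' by simp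
    have rH: "?rH \<in> hom (pow_cat (Car Z) (Dom T w)) (map (fob (Fn H)) ?zs) (map2 (po Z) ws (blocks ?ns (map (fob (Fn H)) ?Gx)))"
      using H.pr_blocks_hom[OF w'(3) Gxs] w' by simp
    \<comment> \<open>At the inner words, \<rho> of the composite consists of the part from
      \<open>H\<close> after the image of the part from \<open>G\<close>. The chain below produces
      these two layers one after the other under \<open>pa Z w\<close>.\<close>
    have comb: "map (\<lambda>j. pr ?HG (ws ! j) (blocks ?ns xs ! j)) [0..<length ws] = map2 (Comp (Car Z)) ?rH (map (far (Fn H)) ?rG)"
    proof (rule nth_equalityI)
      fix i assume "i < length (map (\<lambda>j. pr ?HG (ws ! j) (blocks ?ns xs ! j)) [0..<length ws])"
      then have i: "i < length ws" by simp
      then have "ws ! i \<in> words T" "blocks ?ns xs ! i \<in> tup X (Dom T (ws ! i))"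
        using w'(3) blocks_Ob[OF xs, of i] by (auto simp: subset_iff)
      from prc[OF this] i show "map (\<lambda>j. pr ?HG (ws ! j) (blocks ?ns xs ! j)) [0..<length ws] ! i
          = map2 (Comp (Car Z)) ?rH (map (far (Fn H)) ?rG) ! i" by (simp add: blocks_map)
    qed simp
    note HrG = H.map_F_hom[OF rG]
    note h1 = H.Y.pc_hom(1)[OF w H.F_Ob[OF Gxs]] and h2 = H.pr_hom(1)[OF g(1) Gxsg]
      and h3 = functor_hom[OF H.F G.pr_hom(1)[OF g(1) xsg]]
      and h4 = H.Y.pa_hom[OF w'(1) rH] and h5 = H.pr_hom(1)[OF w'(1) zs]
      and h6 = functor_hom[OF H.F G.Y.pc_hom(1)[OF w Gxs]]
      and h7 = functor_hom[OF H.F G.Y.pa_hom[OF w'(1) rG]]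
      and h8 = functor_hom[OF H.F G.pr_hom(1)[OF w'(1) ys]]
      and h9 = functor_hom[OF H.F functor_hom[OF G.F G.X.pc_hom(1)[OF w xs]]]
      and h10 = H.Y.pa_hom[OF w'(1) HrG] and h11 = H.pr_hom(1)[OF w'(1) G.F_Ob[OF ys]]
    let ?c = "Comp (Car Z)"
    have "?c (pc Z w ws (map (fob (Fn ?HG)) xs)) (pr ?HG (gamma_word T w ws) xs)
      = ?c (?c (pc Z w ws (map (fob (Fn H)) ?Gx)) (pr H (gamma_word T w ws) ?Gx)) (far (Fn H) (pr G (gamma_word T w ws) xs))"
      unfolding mfx[OF xs] prc[OF g(1) xsg] by (rule cat_assoc[OF Z h3 h2 h1])
    also have "\<dots> = ?c (pa Z w ?rH) (?c (pr H w ?zs) (?c (far (Fn H) (pc Y w ws ?Gx)) (far (Fn H) (pr G (gamma_word T w ws) xs))))"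
      unfolding H.pr_gamma[OF w Gxs] using cat_assoc[OF Z h3 cat_comp[OF Z h6 h5] h4] cat_assoc[OF Z h3 h6 h5] by simp
    also have "?c (far (Fn H) (pc Y w ws ?Gx)) (far (Fn H) (pr G (gamma_word T w ws) xs))
      = far (Fn H) (Comp (Car Y) (pc Y w ws ?Gx) (pr G (gamma_word T w ws) xs))"
      by (rule functor_comp[OF H.F G.pr_hom(1)[OF g(1) xsg] G.Y.pc_hom(1)[OF w Gxs], symmetric])
    also have "\<dots> = ?c (far (Fn H) (pa Y w ?rG)) (?c (far (Fn H) (pr G w ?ys)) (far (Fn H) (far (Fn G) (pc X w ws xs))))"
      unfolding G.pr_gamma[OF w xs]
      using functor_comp[OF H.F cat_comp[OF G.Y.C functor_hom[OF G.F G.X.pc_hom(1)[OF w xs]] G.pr_hom(1)[OF w'(1) ys]]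
          G.Y.pa_hom[OF w'(1) rG]]
        functor_comp[OF H.F functor_hom[OF G.F G.X.pc_hom(1)[OF w xs]] G.pr_hom(1)[OF w'(1) ys]] by simp
    also have "?c (pr H w ?zs) \<dots> = ?c (?c (pr H w ?zs) (far (Fn H) (pa Y w ?rG)))
        (?c (far (Fn H) (pr G w ?ys)) (far (Fn H) (far (Fn G) (pc X w ws xs))))" by (rule cat_assoc[OF Z cat_comp[OF Z h9 h8] h7 h5])
    \<comment> \<open>Naturality of \<rho> for \<open>H\<close> at the list of components of \<rho>
      for \<open>G\<close> moves that list next to the corresponding one for \<open>H\<close>, with
      which it is then merged by functoriality of \<open>w\<close> in \<open>Z\<close>.\<close>
    also have "?c (pr H w ?zs) (far (Fn H) (pa Y w ?rG)) = ?c (pa Z w (map (far (Fn H)) ?rG)) (pr H w (map (fob (Fn G)) ?ys))"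
      by (rule H.pr_natural[OF w'(1) rG])
    also have "?c (pa Z w ?rH) (?c (?c (pa Z w (map (far (Fn H)) ?rG)) (pr H w (map (fob (Fn G)) ?ys)))
        (?c (far (Fn H) (pr G w ?ys)) (far (Fn H) (far (Fn G) (pc X w ws xs))))) = ?c (?c (pa Z w ?rH) (pa Z w (map (far (Fn H)) ?rG)))
        (?c (?c (pr H w (map (fob (Fn G)) ?ys)) (far (Fn H) (pr G w ?ys))) (far (Fn H) (far (Fn G) (pc X w ws xs))))"
      using cat_assoc[OF Z h9 h8 h11] cat_assoc[OF Z cat_comp[OF Z h9 h8] h11 h10]
        cat_assoc[OF Z cat_comp[OF Z cat_comp[OF Z h9 h8] h11] h10 h4] by simp
    also have "?c (pa Z w ?rH) (pa Z w (map (far (Fn H)) ?rG)) = pa Z w (map2 (Comp (Car Z)) ?rH (map (far (Fn H)) ?rG))"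
      using functor_comp[OF H.Y.Fun[OF w'(1)] HrG rH] by simp
    finally show ?case unfolding comb prc[OF w'(1) ys] using G.X.pc_hom(1)[OF w xs] by (simp add: hom_Ar)
  next
    case xs: (2 xs)
    then obtain x where x: "xs = [x]" "x \<in> Ob (Car X)" by (cases xs) (auto simp: Ob_pow One_nat_def)
    note u = unit_words[OF G.X.T]
    have xs': "[x] \<in> tup X (Dom T (unit_word T))" using xs u x by simp
    note Gx = functor_ob[OF G.F x(2)]
    note h1 = functor_hom[OF H.F G.pr_hom(1)[OF u(1) xs']]
      and h2 = H.pr_hom(1)[OF u(1) G.F_Ob[OF xs']] and h3 = H.Y.pI_hom(1)[OF functor_ob[OF H.F Gx]]
    show ?case
      using cat_assoc[OF Z h1, of "pr H (unit_word T) [fob (Fn G) x]" _ "ncomp (II Z) [fob (Fn H) (fob (Fn G) x)]"] h2 h3 H.pr_unit[OF Gx]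
        functor_comp[OF H.F G.pr_hom(1)[OF u(1) xs'], of "ncomp (II Y) [fob (Fn G) x]"] G.Y.pI_hom(1)[OF Gx]
        G.pr_unit[OF x(2)] G.X.pI_hom(1)[OF x(2)] x by (simp add: prc[OF u(1) xs'] hom_Ar)
  next
    case (3 w l f xs)
    note w = 3(1) and xs = 3(2)
    note w' = swords_words[OF w] and g = subst_words[OF G.X.T w]
    have xsg: "xs \<in> tup X (Dom T (subst_word T w l f))" using xs g by simp
    let ?Gx = "map (fob (Fn G)) xs" and ?xf = "map ((!) xs) f"
    note Gxs = G.F_Ob[OF xs] and Gxsg = G.F_Ob[OF xsg]
    have xf: "?xf \<in> tup X (Dom T w)" using reindex_Ob[OF xs w'(3)] w' by simp
    have Gf: "map ((!) ?Gx) f = map (fob (Fn G)) ?xf" using w'(3) xs by (auto simp: Ob_pow subset_iff)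
    note h1 = functor_hom[OF H.F G.pr_hom(1)[OF g(1) xsg]] and h2 = H.pr_hom(1)[OF g(1) Gxsg]
      and h3 = H.Y.ps_hom(1)[OF w H.F_Ob[OF Gxs]] and h4 = functor_hom[OF H.F G.Y.ps_hom(1)[OF w Gxs], unfolded Gf]
      and h5 = H.pr_hom(1)[OF w'(1) G.F_Ob[OF xf]] and h6 = functor_hom[OF H.F G.pr_hom(1)[OF w'(1) xf]]
      and h7 = functor_hom[OF H.F functor_hom[OF G.F G.X.ps_hom(1)[OF w xs]]]
    let ?c = "Comp (Car Z)"
    have "?c (ps Z w l f (map (fob (Fn ?HG)) xs)) (pr ?HG (subst_word T w l f) xs)
      = ?c (?c (ps Z w l f (map (fob (Fn H)) ?Gx)) (pr H (subst_word T w l f) ?Gx)) (far (Fn H) (pr G (subst_word T w l f) xs))"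
      unfolding mfx[OF xs] prc[OF g(1) xsg] by (rule cat_assoc[OF Z h1 h2 h3])
    also have "\<dots> = ?c (pr H w (map (fob (Fn G)) ?xf)) (?c (far (Fn H) (ps Y w l f ?Gx)) (far (Fn H) (pr G (subst_word T w l f) xs)))"
      unfolding H.pr_subst[OF w Gxs] Gf by (rule cat_assoc[OF Z h1 h4 h5, symmetric])
    also have "?c (far (Fn H) (ps Y w l f ?Gx)) (far (Fn H) (pr G (subst_word T w l f) xs))
      = far (Fn H) (Comp (Car Y) (ps Y w l f ?Gx) (pr G (subst_word T w l f) xs))"
      by (rule functor_comp[OF H.F G.pr_hom(1)[OF g(1) xsg] G.Y.ps_hom(1)[OF w Gxs], symmetric])
    also have "\<dots> = ?c (far (Fn H) (pr G w ?xf)) (far (Fn H) (far (Fn G) (ps X w l f xs)))" unfolding G.pr_subst[OF w xs]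
      by (rule functor_comp[OF H.F functor_hom[OF G.F G.X.ps_hom(1)[OF w xs]] G.pr_hom(1)[OF w'(1) xf]])
    also have "?c (pr H w (map (fob (Fn G)) ?xf)) \<dots>
      = ?c (?c (pr H w (map (fob (Fn G)) ?xf)) (far (Fn H) (pr G w ?xf))) (far (Fn H) (far (Fn G) (ps X w l f xs)))"
      by (rule cat_assoc[OF Z h7 h6 h5])
    finally show ?case unfolding prc[OF w'(1) xf] using G.X.ps_hom(1)[OF w xs] by (simp add: hom_Ar)
  qed
  with data show ?thesis using is_psmor_iff[OF G.X.T G.X.X H.Y.X] by simp
qed

section \<open>The 2-category of pseudo algebras\<close>

lemma fcomp_id_right: "is_functor C D F ==> fcomp C F (id_fun C) = F"
  by (rule functor_eqI[OF functor_fcomp[OF functor_id_fun]]) (auto simp: functor_cat)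

lemma fcomp_id_left: "is_functor C D F ==> fcomp C (id_fun D) F = F" by (rule functor_eqI[OF functor_fcomp[OF _ functor_id_fun]])
    (auto simp: functor_cat functor_ob functor_ar)

lemma fcomp_assoc: "is_functor C D F ==> fcomp C H (fcomp C G F) = fcomp C (fcomp D H G) F"
  by (rule functr_eqI[of _ "Ob C" _ "Ar C"]) (auto simp: functor_ob functor_ar)

lemma hcomp_id_nat:
  assumes F: "is_functor C D F" and G: "is_functor D E G"
  shows "hcomp C E (id_nat D E G) (id_nat C D F) = id_nat C E (fcomp C G F)" by (rule nattr_eqI[of _ _ "Ob C"])
    (auto simp: functor_ob[OF F] functor_id[OF G] cat_idl[OF functor_cat(2)[OF G] cat_id[OF functor_cat(2)[OF G]]]
      functor_ob[OF G])

lemma hcomp_unit_right: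
  assumes a: "is_nat C D \<alpha>"
  shows "hcomp C D \<alpha> (id_nat C C (id_fun C)) = \<alpha>"
  using hcomp_id_right[OF functor_id_fun[OF functor_cat(1)[OF nat_functor(1)[OF a]]] a]
  by (intro nattr_eqI[of _ _ "Ob C"]) (auto simp: fcomp_id_right nat_functor[OF a] nat_ext[OF a]
      fcomp_id_right[OF nat_functor(1)[OF a]] fcomp_id_right[OF nat_functor(2)[OF a]])

lemma hcomp_unit_left:
  assumes a: "is_nat C D \<alpha>"
  shows "hcomp C D (id_nat D D (id_fun D)) \<alpha> = \<alpha>"
proof (rule nattr_eqI[of _ _ "Ob C"])
  fix x assume x: "x \<in> Ob C"
  show "ncomp (hcomp C D (id_nat D D (id_fun D)) \<alpha>) x = ncomp \<alpha> x"
    using hcomp_id_left[OF a functor_id_fun[OF functor_cat(2)[OF nat_functor(1)[OF a]]] x]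
      nat_hom[OF a x, THEN hom_Ar] by simp
qed (auto simp: nat_ext[OF a] fcomp_id_left[OF nat_functor(1)[OF a]] fcomp_id_left[OF nat_functor(2)[OF a]])

text \<open>The interchange law for natural transformations. The one exchange that is needed is
  naturality of \<beta> at the component of \<open>\<alpha>'\<close>.\<close>

lemma hcomp_vcomp:
  assumes a: "is_nat C D \<alpha>" and a': "is_nat C D \<alpha>'" and aa: "nsrc \<alpha>' = ntgt \<alpha>"
    and b: "is_nat D E \<beta>" and b': "is_nat D E \<beta>'" and bb: "nsrc \<beta>' = ntgt \<beta>"
  shows "hcomp C E (vcomp D E \<beta>' \<beta>) (vcomp C D \<alpha>' \<alpha>) = vcomp C E (hcomp C E \<beta>' \<alpha>') (hcomp C E \<beta> \<alpha>)"
proof (rule nattr_eqI[of _ _ "Ob C"])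
  fix x assume x: "x \<in> Ob C"
  note E = functor_cat(2)[OF nat_functor(1)[OF b]]
  note y = functor_ob[OF nat_functor(2)[OF a] x] and z = functor_ob[OF nat_functor(2)[OF a'] x]
  note h1 = nat_hom[OF a x] and h2 = nat_hom[OF a' x, unfolded aa]
  note g1 = functor_hom[OF nat_functor(1)[OF b] h1] and g2 = functor_hom[OF nat_functor(1)[OF b] h2]
  note k1 = nat_hom[OF b z] and k2 = nat_hom[OF b' z, unfolded bb]
    and k3 = nat_hom[OF b y] and k4 = functor_hom[OF nat_functor(2)[OF b] h2]
  have "Comp E (Comp E (ncomp \<beta>' (fob (ntgt \<alpha>') x)) (ncomp \<beta> (fob (ntgt \<alpha>') x)))
      (far (nsrc \<beta>) (Comp D (ncomp \<alpha>' x) (ncomp \<alpha> x)))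
    = Comp E (ncomp \<beta>' (fob (ntgt \<alpha>') x)) (Comp E (Comp E (ncomp \<beta> (fob (ntgt \<alpha>') x))
        (far (nsrc \<beta>) (ncomp \<alpha>' x))) (far (nsrc \<beta>) (ncomp \<alpha> x)))"
    using functor_comp[OF nat_functor(1)[OF b] h1 h2] cat_assoc[OF E g1 g2 k1]
      cat_assoc[OF E cat_comp[OF E g1 g2] k1 k2] by simp
  also have "Comp E (ncomp \<beta> (fob (ntgt \<alpha>') x)) (far (nsrc \<beta>) (ncomp \<alpha>' x))
    = Comp E (far (ntgt \<beta>) (ncomp \<alpha>' x)) (ncomp \<beta> (fob (ntgt \<alpha>) x))" by (rule nat_natural[OF b h2])
  also have "Comp E (ncomp \<beta>' (fob (ntgt \<alpha>') x)) (Comp E (Comp E (far (ntgt \<beta>) (ncomp \<alpha>' x)) (ncomp \<beta> (fob (ntgt \<alpha>) x)))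
      (far (nsrc \<beta>) (ncomp \<alpha> x)))
    = Comp E (Comp E (ncomp \<beta>' (fob (ntgt \<alpha>') x)) (far (ntgt \<beta>) (ncomp \<alpha>' x)))
      (Comp E (ncomp \<beta> (fob (ntgt \<alpha>) x)) (far (nsrc \<beta>) (ncomp \<alpha> x)))"
    using cat_assoc[OF E g1 k3 k4] cat_assoc[OF E cat_comp[OF E g1 k3] k4 k2] by simp
  finally show "ncomp (hcomp C E (vcomp D E \<beta>' \<beta>) (vcomp C D \<alpha>' \<alpha>)) x
    = ncomp (vcomp C E (hcomp C E \<beta>' \<alpha>') (hcomp C E \<beta> \<alpha>)) x" using x y z by (simp add: bb)
qed simp_all

lemma hcomp_assoc:
  assumes a: "is_nat B C \<alpha>" and b: "is_nat C D \<beta>" and c: "is_nat D E \<gamma>"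
  shows "hcomp B E \<gamma> (hcomp B D \<beta> \<alpha>) = hcomp B E (hcomp C E \<gamma> \<beta>) \<alpha>"
proof (rule nattr_eqI[of _ _ "Ob B"])
  fix x assume x: "x \<in> Ob B"
  note E = functor_cat(2)[OF nat_functor(1)[OF c]]
  note y = functor_ob[OF nat_functor(2)[OF a] x]
  note z = functor_ob[OF nat_functor(2)[OF b] y]
  note h1 = functor_hom[OF nat_functor(1)[OF b] nat_hom[OF a x]] and h2 = nat_hom[OF b y]
  show "ncomp (hcomp B E \<gamma> (hcomp B D \<beta> \<alpha>)) x = ncomp (hcomp B E (hcomp C E \<gamma> \<beta>) \<alpha>) x"
    using x y nat_hom[OF a x, THEN hom_Ar] functor_comp[OF nat_functor(1)[OF c] h1 h2]
      cat_assoc[OF E functor_hom[OF nat_functor(1)[OF c] h1] functor_hom[OF nat_functor(1)[OF c] h2] nat_hom[OF c z]] by simp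
qed (auto simp: fcomp_assoc[OF nat_functor(1)[OF a]] fcomp_assoc[OF nat_functor(2)[OF a]])

lemma psmor_eqI:
  assumes "psmorphism T X Y H" "psmorphism T X Y H'" "Fn H = Fn H'"
    "\<And>w xs. w \<in> words T ==> xs \<in> tup X (Dom T w) ==> pr H w xs = pr H' w xs"
  shows "H = H'"
proof -
  interpret H: psmorphism T X Y H by fact
  interpret H': psmorphism T X Y H' by fact
  have "Rho H w = Rho H' w" if w: "w \<in> words T" for w using assms(3,4) w nat_ext[OF H.Rho_nat(1)[OF w]] nat_ext[OF H'.Rho_nat(1)[OF w]]
    by (intro nattr_eqI[of _ _ "tup X (Dom T w)"]) (auto simp: H.Rho_nat[OF w] H'.Rho_nat[OF w])
  then have "Rho H = Rho H'" by (rule extensionalityI[OF H.Rho_ext H'.Rho_ext])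
  with assms(3) show ?thesis by simp
qed

lemma pr_psmor_id:
  assumes "psalgebra T X" "w \<in> words T" "xs \<in> tup X (Dom T w)"
  shows "pr (psmor_id T X) w xs = Idt (Car X) (po X w xs)" using assms by (simp add: psmor_id_def)

lemma Fn_psmor_id [simp]: "Fn (psmor_id T X) = id_fun (Car X)" by (simp add: psmor_id_def)

lemma is_psmor_id:
  assumes "psalgebra T X"
  shows "is_psmor T X X (psmor_id T X)"
proof -
  interpret X: psalgebra T X by fact
  note C = X.C
  have mid: "map (fob (id_fun (Car X))) xs = xs" if "xs \<in> tup X n" for xs n
    using that by (intro nth_equalityI) (auto simp: Ob_pow subset_iff)
  have mid': "map (far (id_fun (Car X))) xs = xs" if "xs \<in> Ar (pow_cat (Car X) n)" for xs n
    using that by (intro nth_equalityI) (auto simp: Ar_pow subset_iff)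
  have "pow_fun (Car X) n (id_fun (Car X)) = id_fun (pow_cat (Car X) n)" for n
    by (rule functor_eqI[OF functor_pow_fun[OF functor_id_fun[OF C]] functor_id_fun[OF category_pow[OF C]]])
      (simp_all add: mid mid')
  then have "mor_data T X X (psmor_id T X)" unfolding mor_data_def
    by (auto simp: functor_id_fun[OF C] psmor_id_def fcomp_id_left[OF X.Fun] fcomp_id_right[OF X.Fun]
        intro!: nat_iso_id X.Fun)
  moreover have "mor_eqs T X X (psmor_id T X)" unfolding mor_eqs_def
  proof (intro conjI ballI, safe, goal_cases)
    case (1 w ws xs)
    note w = 1(1) and xs = 1(2)
    let ?ns = "map (Dom T) ws"
    let ?r = "\<lambda>j. pr (psmor_id T X) (ws ! j) (blocks ?ns xs ! j)"
    note w' = cwords_words[OF w] and g = gamma_words[OF X.T w]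
    have ys: "map2 (po X) ws (blocks ?ns xs) \<in> tup X (Dom T w)" using X.map2_po_Ob[OF w'(3) xs] w'(2) by simp
    have bl: "pr (psmor_id T X) (ws ! j) (blocks ?ns xs ! j) = Idt (Car X) (po X (ws ! j) (blocks ?ns xs ! j))"
      if "j < length ws" for j using that w'(3) blocks_Ob[OF xs, of j] by (intro pr_psmor_id[OF assms]) (auto simp: subset_iff)
    have "map ?r [0..<length ws] = map (Idt (Car X)) (map2 (po X) ws (blocks ?ns xs))" by (rule nth_equalityI) (auto simp: bl)
    then have 1: "pa X w (map ?r [0..<length ws]) = Idt (Car X) (po X w (map2 (po X) ws (blocks ?ns xs)))"
      using functor_id[OF X.Fun[OF w'(1)] ys] by simp
    note h = X.pc_hom(1)[OF w xs]
    show ?case unfolding 1 using pr_psmor_id[OF assms g(1), of xs] g(2) xs ys h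
      by (simp add: mid[OF xs] pr_psmor_id[OF assms w'(1)] hom_Ar cat_idl[OF C h] cat_idr[OF C h])
  next
    case xs: (2 xs)
    then obtain x where x: "xs = [x]" "x \<in> Ob (Car X)" by (cases xs) (auto simp: Ob_pow One_nat_def)
    note u = unit_words[OF X.T]
    note h = X.pI_hom(1)[OF x(2)]
    show ?case using pr_psmor_id[OF assms u(1), of xs] u(2) xs h x by (simp add: hom_Ar cat_idr[OF C h])
  next
    case (3 w l f xs)
    note w = 3(1) and xs = 3(2)
    note w' = swords_words[OF w] and g = subst_words[OF X.T w]
    note h = X.ps_hom(1)[OF w xs]
    show ?case using pr_psmor_id[OF assms g(1), of xs] g(2) xs h pr_psmor_id[OF assms w'(1), of "map ((!) xs) f"]
        reindex_Ob[OF xs w'(3)] w'(2) by (simp add: mid[OF xs] hom_Ar cat_idr[OF C h] cat_idl[OF C h])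
  qed
  ultimately show ?thesis using is_psmor_iff[OF X.T X.X X.X] by simp
qed

lemma psalg_hom_simps: "Ob (psalg_hom T X Y) = {H. is_psmor T X Y H}"
  "Ar (psalg_hom T X Y) = {\<alpha>. is_pscell T X Y \<alpha>}" "Dom (psalg_hom T X Y) = Src" "Cod (psalg_hom T X Y) = Tgt"
  "Idt (psalg_hom T X Y) H = \<lparr>Src = H, Tgt = H, Nt = id_nat (Car X) (Car Y) (Fn H)\<rparr>"
  "Comp (psalg_hom T X Y) \<beta> \<alpha> = \<lparr>Src = Src \<alpha>, Tgt = Tgt \<beta>, Nt = vcomp (Car X) (Car Y) (Nt \<beta>) (Nt \<alpha>)\<rparr>"
  by (simp_all add: psalg_hom_def)

lemma hom_psalg_hom: "\<alpha> \<in> hom (psalg_hom T X Y) G H \<longleftrightarrow> is_pscell T X Y \<alpha> \<and> Src \<alpha> = G \<and> Tgt \<alpha> = H"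
  by (simp add: hom_def psalg_hom_simps)

lemma pscellD:
  assumes "psalgebra T X" "psalgebra T Y" "is_pscell T X Y \<alpha>"
  shows "psmorphism T X Y (Src \<alpha>)" "psmorphism T X Y (Tgt \<alpha>)" "is_nat (Car X) (Car Y) (Nt \<alpha>)"
    "nsrc (Nt \<alpha>) = Fn (Src \<alpha>)" "ntgt (Nt \<alpha>) = Fn (Tgt \<alpha>)"
    "w \<in> words T ==> xs \<in> tup X (Dom T w) ==> cell_eq X Y \<alpha> w xs"
proof -
  interpret X: psalgebra T X by fact
  interpret Y: psalgebra T Y by fact
  note D = assms(3)[unfolded is_pscell_iff[OF X.T X.X Y.X]]
  show "psmorphism T X Y (Src \<alpha>)" "psmorphism T X Y (Tgt \<alpha>)" using D by unfold_locales auto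
  show "is_nat (Car X) (Car Y) (Nt \<alpha>)"
    "nsrc (Nt \<alpha>) = Fn (Src \<alpha>)" "ntgt (Nt \<alpha>) = Fn (Tgt \<alpha>)"
    "w \<in> words T ==> xs \<in> tup X (Dom T w) ==> cell_eq X Y \<alpha> w xs" using D by auto
qed

lemma pscellI:
  assumes "psmorphism T X Y (Src \<alpha>)" "psmorphism T X Y (Tgt \<alpha>)" "is_nat (Car X) (Car Y) (Nt \<alpha>)"
    "nsrc (Nt \<alpha>) = Fn (Src \<alpha>)" "ntgt (Nt \<alpha>) = Fn (Tgt \<alpha>)"
    "\<And>w xs. w \<in> words T ==> xs \<in> tup X (Dom T w) ==> cell_eq X Y \<alpha> w xs"
  shows "is_pscell T X Y \<alpha>"
proof -
  interpret S: psmorphism T X Y "Src \<alpha>" by fact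
  interpret T: psmorphism T X Y "Tgt \<alpha>" by fact
  show ?thesis using assms(3-6) S.H T.H by (simp add: is_pscell_iff[OF S.X.T S.X.X S.Y.X])
qed

lemma map_ncomp_hom:
  assumes "is_nat C D \<alpha>" "xs \<in> Ob (pow_cat C n)"
  shows "map (ncomp \<alpha>) xs \<in> hom (pow_cat D n) (map (fob (nsrc \<alpha>)) xs) (map (fob (ntgt \<alpha>)) xs)"
  using assms(2) nat_hom[OF assms(1)] by (auto simp: hom_pow Ob_pow_nth)

lemma is_pscell_id:
  assumes "psmorphism T X Y H"
  shows "is_pscell T X Y \<lparr>Src = H, Tgt = H, Nt = id_nat (Car X) (Car Y) (Fn H)\<rparr>"
proof -
  interpret H: psmorphism T X Y H by fact
  show ?thesis
  proof (rule pscellI, simp_all add: assms nat_id_nat[OF H.F])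
    fix w xs assume w: "w \<in> words T" and xs: "xs \<in> tup X (Dom T w)"
    have m: "map (ncomp (id_nat (Car X) (Car Y) (Fn H))) xs = map (Idt (Car Y)) (map (fob (Fn H)) xs)" using xs by (auto simp: Ob_pow)
    show "Comp (Car Y) (pr H w xs) (ncomp (id_nat (Car X) (Car Y) (Fn H)) (po X w xs)) =
       Comp (Car Y) (pa Y w (map (ncomp (id_nat (Car X) (Car Y) (Fn H))) xs)) (pr H w xs)"
      unfolding m using functor_id[OF H.Y.Fun[OF w] H.F_Ob[OF xs]] H.X.po_Ob[OF w xs] H.pr_hom(1)[OF w xs]
      by (simp add: cat_idl[OF H.Y.C] cat_idr[OF H.Y.C])
  qed
qed

lemma is_pscell_vcomp:
  assumes X: "psalgebra T X" and Y: "psalgebra T Y" and a: "is_pscell T X Y \<alpha>" and b: "is_pscell T X Y \<beta>"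
    and eq: "Src \<beta> = Tgt \<alpha>"
  shows "is_pscell T X Y \<lparr>Src = Src \<alpha>, Tgt = Tgt \<beta>, Nt = vcomp (Car X) (Car Y) (Nt \<beta>) (Nt \<alpha>)\<rparr>"
proof -
let ?v = "vcomp (Car X) (Car Y) (Nt \<beta>) (Nt \<alpha>)"
  interpret Y: psalgebra T Y by fact
  interpret X: psalgebra T X by fact
  note A = pscellD[OF X Y a] and B = pscellD[OF X Y b]
  interpret S: psmorphism T X Y "Src \<alpha>" by (rule A)
  interpret M: psmorphism T X Y "Tgt \<alpha>" by (rule A)
  interpret R: psmorphism T X Y "Tgt \<beta>" by (rule B)
  have nn: "nsrc (Nt \<beta>) = ntgt (Nt \<alpha>)" using A(5) B(4) eq by simp
  show ?thesis
  proof (rule pscellI, simp_all add: A(1,4) B(2,5) nat_vcomp[OF A(3) B(3) nn])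
    fix w xs assume w: "w \<in> words T" and xs: "xs \<in> tup X (Dom T w)"
    note C = Y.C
    note ow = X.po_Ob[OF w xs]
    note h1 = nat_hom[OF A(3) ow, unfolded A(4,5)] and h2 = nat_hom[OF B(3) ow, unfolded B(4,5) eq]
      and h3 = R.pr_hom(1)[OF w xs] and h4 = M.pr_hom(1)[OF w xs] and h5 = S.pr_hom(1)[OF w xs]
      and g1 = map_ncomp_hom[OF A(3) xs, unfolded A(4,5)] and g2 = map_ncomp_hom[OF B(3) xs, unfolded B(4,5) eq]
    note k1 = Y.pa_hom[OF w g1] and k2 = Y.pa_hom[OF w g2]
    have "map (ncomp ?v) xs = map2 (Comp (Car Y)) (map (ncomp (Nt \<beta>)) xs) (map (ncomp (Nt \<alpha>)) xs)"
      using xs by (intro nth_equalityI) (auto simp: Ob_pow_nth)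
    then have m: "pa Y w (map (ncomp ?v) xs) = Comp (Car Y) (pa Y w (map (ncomp (Nt \<beta>)) xs)) (pa Y w (map (ncomp (Nt \<alpha>)) xs))"
      using functor_comp[OF Y.Fun[OF w] g1 g2] by simp
    show "Comp (Car Y) (pr (Tgt \<beta>) w xs) (ncomp ?v (po X w xs)) = Comp (Car Y) (pa Y w (map (ncomp ?v) xs)) (pr (Src \<alpha>) w xs)"
      unfolding m using ow cat_assoc[OF C h1 h2 h3] cat_assoc[OF C h1 h4 k2] cat_assoc[OF C h5 k1 k2]
        A(6)[OF w xs] B(6)[OF w xs] by (simp add: eq)
  qed
qed

lemma category_psalg_hom:
  assumes X: "psalgebra T X" and Y: "psalgebra T Y"
  shows "category (psalg_hom T X Y)"
proof -
  interpret X: psalgebra T X by fact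
  interpret Y: psalgebra T Y by fact
  have mor: "psmorphism T X Y H" if "is_psmor T X Y H" for H using that by unfold_locales
  note C = pscellD[OF X Y]
  show ?thesis
  proof (rule categoryI, unfold hom_psalg_hom psalg_hom_simps, goal_cases)
    case (1 f)
    then show ?case by (simp add: is_pscell_def)
  next
    case (2 H)
    then show ?case using is_pscell_id[OF mor] by simp
  next
    case (3 f g x y z)
    then show ?case using is_pscell_vcomp[OF X Y, of f g] by simp
  next
    case (4 f x y)
    note f = C[OF conjunct1[OF 4]]
    have "vcomp (Car X) (Car Y) (Nt f) (id_nat (Car X) (Car Y) (Fn x)) = Nt f" using 4 f(4) nat_hom[OF f(3)] nat_ext[OF f(3)]
      by (intro nattr_eqI[of _ _ "Ob (Car X)"]) (auto intro!: cat_idr[OF Y.C])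
    then show ?case using 4 by simp
  next
    case (5 f x y)
    note f = C[OF conjunct1[OF 5]]
    have "vcomp (Car X) (Car Y) (id_nat (Car X) (Car Y) (Fn y)) (Nt f) = Nt f" using 5 f(5) nat_hom[OF f(3)] nat_ext[OF f(3)]
      by (intro nattr_eqI[of _ _ "Ob (Car X)"]) (auto intro!: cat_idl[OF Y.C])
    then show ?case using 5 by simp
  next
    case (6 f g h a b c d)
    note f = C[OF conjunct1[OF 6(1)]] and g = C[OF conjunct1[OF 6(2)]] and h = C[OF conjunct1[OF 6(3)]]
    have "vcomp (Car X) (Car Y) (Nt h) (vcomp (Car X) (Car Y) (Nt g) (Nt f))
      = vcomp (Car X) (Car Y) (vcomp (Car X) (Car Y) (Nt h) (Nt g)) (Nt f)"
      using 6 nat_hom[OF f(3), unfolded f(4,5)] nat_hom[OF g(3), unfolded g(4,5)] nat_hom[OF h(3), unfolded h(4,5)]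
      by (intro nattr_eqI[of _ _ "Ob (Car X)"]) (auto intro!: cat_assoc[OF Y.C])
    then show ?case by simp
  qed
qed

text \<open>The value on 2-cells of the composition functor of \<open>PsAlg\<close>, under a name of
  its own.\<close>

definition pscell_hcomp :: "'t thry => ('t, 'o, 'a) psalg => ('t, 'p, 'b) psalg => ('t, 'q, 'c) psalg
    => ('t, 'p, 'b, 'q, 'c) pscell => ('t, 'o, 'a, 'p, 'b) pscell => ('t, 'o, 'a, 'q, 'c) pscell" where
  "pscell_hcomp T X Y Z \<beta> \<alpha> = \<lparr>Src = psmor_comp T X Y Z (Src \<beta>) (Src \<alpha>),
     Tgt = psmor_comp T X Y Z (Tgt \<beta>) (Tgt \<alpha>), Nt = hcomp (Car X) (Car Z) (Nt \<beta>) (Nt \<alpha>)\<rparr>"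

text \<open>The cell equation of \<beta> is pasted with the image under \<open>H\<close> of the cell
  equation of \<alpha>. They are brought together by naturality of \<beta> at the component of
  \<rho> for the target of \<alpha>, and afterwards by naturality of \<rho> for the source of
  \<beta> at the tuple of components of \<alpha>.\<close>

lemma is_pscell_hcomp:
  assumes X: "psalgebra T X" and Y: "psalgebra T Y" and Z: "psalgebra T Z"
    and a: "is_pscell T X Y \<alpha>" and b: "is_pscell T Y Z \<beta>"
  shows "is_pscell T X Z (pscell_hcomp T X Y Z \<beta> \<alpha>)"
proof -
  interpret X: psalgebra T X by fact
  interpret Y: psalgebra T Y by fact
  interpret Z: psalgebra T Z by fact
  note A = pscellD[OF X Y a] and B = pscellD[OF Y Z b]
  interpret G: psmorphism T X Y "Src \<alpha>" by (rule A)
  interpret G': psmorphism T X Y "Tgt \<alpha>" by (rule A)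
  interpret H: psmorphism T Y Z "Src \<beta>" by (rule B)
  interpret H': psmorphism T Y Z "Tgt \<beta>" by (rule B)
  let ?G = "Fn (Src \<alpha>)" and ?G' = "Fn (Tgt \<alpha>)" and ?H = "Fn (Src \<beta>)" and ?H' = "Fn (Tgt \<beta>)"
  let ?a = "ncomp (Nt \<alpha>)" and ?b = "ncomp (Nt \<beta>)" and ?c = "Comp (Car Z)"
  let ?h = "hcomp (Car X) (Car Z) (Nt \<beta>) (Nt \<alpha>)"
  let ?HS = "psmor_comp T X Y Z (Src \<beta>) (Src \<alpha>)"
  let ?HT = "psmor_comp T X Y Z (Tgt \<beta>) (Tgt \<alpha>)"
  have mS: "psmorphism T X Z ?HS" using is_psmor_comp[OF A(1) B(1)] by unfold_locales
  have mT: "psmorphism T X Z ?HT" using is_psmor_comp[OF A(2) B(2)] by unfold_locales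
  note C = Z.C
  show ?thesis unfolding pscell_hcomp_def
  proof (rule pscellI, simp_all add: mS mT A(4,5) B(4,5) nat_hcomp[OF A(3) B(3)])
    fix w xs assume w: "w \<in> words T" and xs: "xs \<in> tup X (Dom T w)"
    note ow = X.po_Ob[OF w xs]
    let ?Gx = "map (fob ?G) xs" and ?Gx' = "map (fob ?G') xs"
    let ?T = "pr (Tgt \<beta>) w ?Gx'"
    let ?Ht = "far ?H (pr (Tgt \<alpha>) w xs)"
    let ?Hs = "far ?H (pr (Src \<alpha>) w xs)"
    let ?Ha = "far ?H (?a (po X w xs))"
    let ?Zb = "pa Z w (map ?b ?Gx')"
    let ?Za = "pa Z w (map (far ?H) (map ?a xs))"
    note an = nat_hom[OF A(3), unfolded A(4,5)] and bn = nat_hom[OF B(3), unfolded B(4,5)]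
    note as = map_ncomp_hom[OF A(3) xs, unfolded A(4,5)]
    note bs = map_ncomp_hom[OF B(3) G'.F_Ob[OF xs], unfolded B(4,5)]
    have ab: "map (ncomp ?h) xs = map2 ?c (map ?b ?Gx') (map (far ?H) (map ?a xs))"
      using xs by (intro nth_equalityI) (auto simp: Ob_pow_nth A B)
    note Has = H.map_F_hom[OF as]
    note h1 = functor_hom[OF H.F an[OF ow]] and h2 = bn[OF functor_ob[OF G'.F ow]]
      and h3 = functor_hom[OF H'.F G'.pr_hom(1)[OF w xs]] and h4 = H'.pr_hom(1)[OF w G'.F_Ob[OF xs]]
      and h5 = functor_hom[OF H.F G'.pr_hom(1)[OF w xs]] and h6 = bn[OF Y.po_Ob[OF w G'.F_Ob[OF xs]]]
      and h7 = Z.pa_hom[OF w bs] and h8 = H.pr_hom(1)[OF w G'.F_Ob[OF xs]]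
      and h9 = functor_hom[OF H.F Y.pa_hom[OF w as]] and h10 = functor_hom[OF H.F G.pr_hom(1)[OF w xs]]
      and h11 = Z.pa_hom[OF w Has] and h12 = H.pr_hom(1)[OF w G.F_Ob[OF xs]]
    have "?c (pr ?HT w xs) (ncomp ?h (po X w xs)) = ?c (?c ?T (far ?H' (pr (Tgt \<alpha>) w xs))) (?c (?b (fob ?G' (po X w xs))) ?Ha)"
      using ow pr_psmor_comp[OF A(2) B(2) w xs] by (simp add: A B)
    also have "\<dots> = ?c ?T (?c (?c (far ?H' (pr (Tgt \<alpha>) w xs)) (?b (fob ?G' (po X w xs)))) ?Ha)"
      using cat_assoc[OF C h1 h2 h3] cat_assoc[OF C cat_comp[OF C h1 h2] h3 h4] by simp
    also have "?c (far ?H' (pr (Tgt \<alpha>) w xs)) (?b (fob ?G' (po X w xs))) = ?c (?b (po Y w ?Gx')) ?Ht"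
      using nat_natural[OF B(3) G'.pr_hom(1)[OF w xs]] by (simp add: B)
    also have "?c ?T (?c (?c (?b (po Y w ?Gx')) ?Ht) ?Ha) = ?c (?c ?T (?b (po Y w ?Gx'))) (?c ?Ht ?Ha)"
      using cat_assoc[OF C h1 h5 h6] cat_assoc[OF C cat_comp[OF C h1 h5] h6 h4] by simp
    also have "?c ?T (?b (po Y w ?Gx')) = ?c ?Zb (pr (Src \<beta>) w ?Gx')" by (rule B(6)[OF w G'.F_Ob[OF xs]])
    also have "?c ?Ht ?Ha = ?c (far ?H (pa Y w (map ?a xs))) ?Hs" using functor_comp[OF H.F an[OF ow] G'.pr_hom(1)[OF w xs]] A(6)[OF w xs]
        functor_comp[OF H.F G.pr_hom(1)[OF w xs] Y.pa_hom[OF w as]] by simp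
    also have "?c (?c ?Zb (pr (Src \<beta>) w ?Gx')) (?c (far ?H (pa Y w (map ?a xs))) ?Hs)
      = ?c ?Zb (?c (?c (pr (Src \<beta>) w ?Gx') (far ?H (pa Y w (map ?a xs)))) ?Hs)"
      using cat_assoc[OF C h10 h9 h8] cat_assoc[OF C cat_comp[OF C h10 h9] h8 h7] by simp
    also have "?c (pr (Src \<beta>) w ?Gx') (far ?H (pa Y w (map ?a xs))) = ?c ?Za (pr (Src \<beta>) w ?Gx)" by (rule H.pr_natural[OF w as])
    also have "?c ?Zb (?c (?c ?Za (pr (Src \<beta>) w ?Gx)) ?Hs) = ?c (?c ?Zb ?Za) (?c (pr (Src \<beta>) w ?Gx) ?Hs)"
      using cat_assoc[OF C h10 h12 h11] cat_assoc[OF C cat_comp[OF C h10 h12] h11 h7] by simp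
    also have "?c ?Zb ?Za = pa Z w (map (ncomp ?h) xs)" using functor_comp[OF Z.Fun[OF w] Has bs] unfolding ab by simp
    also have "?c (pr (Src \<beta>) w ?Gx) ?Hs = pr ?HS w xs" by (rule pr_psmor_comp[OF A(1) B(1) w xs, symmetric])
    finally show "?c (pr ?HT w xs) (ncomp ?h (po X w xs)) = ?c (pa Z w (map (ncomp ?h) xs)) (pr ?HS w xs)" .
  qed
qed

lemma psmor_comp_id:
  assumes "psmorphism T X Y H"
  shows "psmor_comp T X X Y H (psmor_id T X) = H" "psmor_comp T X Y Y (psmor_id T Y) H = H"
proof -
  interpret H: psmorphism T X Y H by fact
  have iX: "psmorphism T X X (psmor_id T X)" using is_psmor_id[OF H.X.psalgebra_axioms] by unfold_locales
  have iY: "psmorphism T Y Y (psmor_id T Y)" using is_psmor_id[OF H.Y.psalgebra_axioms] by unfold_locales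
  have mid: "map (fob (id_fun (Car X))) xs = xs" if "xs \<in> tup X n" for xs n
    using that by (intro nth_equalityI) (auto simp: Ob_pow subset_iff)
  show "psmor_comp T X X Y H (psmor_id T X) = H"
  proof (rule psmor_eqI[OF _ assms])
    show "psmorphism T X Y (psmor_comp T X X Y H (psmor_id T X))" using is_psmor_comp[OF iX assms] by unfold_locales
    fix w xs assume w: "w \<in> words T" and xs: "xs \<in> tup X (Dom T w)"
    show "pr (psmor_comp T X X Y H (psmor_id T X)) w xs = pr H w xs" using cat_idr[OF H.Y.C H.pr_hom(1)[OF w xs]]
      by (simp add: pr_psmor_comp[OF iX assms w xs] mid[OF xs] pr_psmor_id[OF H.X.psalgebra_axioms w xs]
          functor_id[OF H.F H.X.po_Ob[OF w xs]])
  qed (simp add: fcomp_id_right[OF H.F])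
  show "psmor_comp T X Y Y (psmor_id T Y) H = H"
  proof (rule psmor_eqI[OF _ assms])
    show "psmorphism T X Y (psmor_comp T X Y Y (psmor_id T Y) H)" using is_psmor_comp[OF assms iY] by unfold_locales
    fix w xs assume w: "w \<in> words T" and xs: "xs \<in> tup X (Dom T w)"
    show "pr (psmor_comp T X Y Y (psmor_id T Y) H) w xs = pr H w xs" using cat_idl[OF H.Y.C H.pr_hom(1)[OF w xs]]
      by (simp add: pr_psmor_comp[OF assms iY w xs] pr_psmor_id[OF H.Y.psalgebra_axioms w H.F_Ob[OF xs]]
          hom_Ar[OF H.pr_hom(1)[OF w xs]])
  qed (simp add: fcomp_id_left[OF H.F])
qed

lemma psmor_comp_assoc:
  assumes "psmorphism T W X F" "psmorphism T X Y G" "psmorphism T Y Z H"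
  shows "psmor_comp T W Y Z H (psmor_comp T W X Y G F) = psmor_comp T W X Z (psmor_comp T X Y Z H G) F"
proof -
  interpret F: psmorphism T W X F by fact
  interpret G: psmorphism T X Y G by fact
  interpret H: psmorphism T Y Z H by fact
  have GF: "psmorphism T W Y (psmor_comp T W X Y G F)" using is_psmor_comp[OF assms(1,2)] by unfold_locales
  have HG: "psmorphism T X Z (psmor_comp T X Y Z H G)" using is_psmor_comp[OF assms(2,3)] by unfold_locales
  show ?thesis
  proof (rule psmor_eqI)
    show "psmorphism T W Z (psmor_comp T W Y Z H (psmor_comp T W X Y G F))" using is_psmor_comp[OF GF assms(3)] by unfold_locales
    show "psmorphism T W Z (psmor_comp T W X Z (psmor_comp T X Y Z H G) F)" using is_psmor_comp[OF assms(1) HG] by unfold_locales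
    show "Fn (psmor_comp T W Y Z H (psmor_comp T W X Y G F)) = Fn (psmor_comp T W X Z (psmor_comp T X Y Z H G) F)"
      by (simp add: fcomp_assoc[OF F.F])
    fix w xs assume w: "w \<in> words T" and xs: "xs \<in> tup W (Dom T w)"
    have m: "map (fob (Fn (psmor_comp T W X Y G F))) xs = map (fob (Fn G)) (map (fob (Fn F)) xs)" using xs by (auto simp: Ob_pow)
    note h1 = F.pr_hom(1)[OF w xs] and Fx = F.F_Ob[OF xs]
    note h2 = G.pr_hom(1)[OF w Fx]
    note h3 = H.pr_hom(1)[OF w G.F_Ob[OF Fx]]
    show "pr (psmor_comp T W Y Z H (psmor_comp T W X Y G F)) w xs = pr (psmor_comp T W X Z (psmor_comp T X Y Z H G) F) w xs"
      unfolding pr_psmor_comp[OF GF assms(3) w xs] pr_psmor_comp[OF assms(1) HG w xs] m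
        pr_psmor_comp[OF assms(1,2) w xs] pr_psmor_comp[OF assms(2,3) w Fx]
      using functor_comp[OF H.F functor_hom[OF G.F h1] h2] hom_Ar[OF h1]
        cat_assoc[OF H.Y.C functor_hom[OF H.F functor_hom[OF G.F h1]] functor_hom[OF H.F h2] h3] by simp
  qed
qed

lemma PsAlg_simps:
  "HomC (PsAlg T) = psalg_hom T" "Id1 (PsAlg T) = psmor_id T"
  "is_psmor T Y Z H ==> is_psmor T X Y G ==> cmp1 (PsAlg T) X Y Z H G = psmor_comp T X Y Z H G"
  "is_pscell T Y Z \<beta> ==> is_pscell T X Y \<alpha> ==> cmp2 (PsAlg T) X Y Z \<beta> \<alpha> = pscell_hcomp T X Y Z \<beta> \<alpha>"
  "id2 (PsAlg T) X Y H = \<lparr>Src = H, Tgt = H, Nt = id_nat (Car X) (Car Y) (Fn H)\<rparr>"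
  by (simp_all add: PsAlg_def cmp1_def cmp2_def id2_def psalg_hom_simps pscell_hcomp_def)

lemma Obj_PsAlg: "(X :: ('t, 'u, 'u) psalg) \<in> Obj (PsAlg T) \<longleftrightarrow> is_psalg T X \<and>
    Ob (Car X) \<prec> (UNIV :: 'u set) \<and> Ar (Car X) \<prec> (UNIV :: 'u set)" by (simp add: PsAlg_def)

lemma psalgebraI: "is_theory T ==> X \<in> Obj (PsAlg T) ==> psalgebra T X" by (simp add: Obj_PsAlg psalgebra_def)

lemma psmorphismI: "psalgebra T X ==> psalgebra T Y ==> is_psmor T X Y H ==> psmorphism T X Y H"
  by (simp add: psmorphism_def psmorphism_axioms_def)

text \<open>All structure sits on underlying functors and transformations: the laws for 2-cells are
  those of categories, functors and transformations, while 1-cells require in addition that the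
  components of \<open>Rho\<close> agree.\<close>

lemma two_category_PsAlg:
  assumes T: "is_theory T"
  shows "two_category (PsAlg T :: (('t, 'u, 'u) psalg, _, _) twocat)"
proof -
  let ?K = "PsAlg T :: (('t, 'u, 'u) psalg, _, _) twocat"
  note alg = psalgebraI[OF T]
  have cat: "category (HomC ?K X Y)" if "X \<in> Obj ?K" "Y \<in> Obj ?K" for X Y
    using category_psalg_hom[OF alg[OF that(1)] alg[OF that(2)]] by (simp add: PsAlg_simps)
  have Cmp: "is_functor (prod_cat (HomC ?K Y Z) (HomC ?K X Y)) (HomC ?K X Z) (Cmp ?K X Y Z)"
    if O: "X \<in> Obj ?K" "Y \<in> Obj ?K" "Z \<in> Obj ?K" for X Y Z
  proof -
    note A = alg[OF O(1)] and B = alg[OF O(2)] and C = alg[OF O(3)]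
    let ?P = "prod_cat (HomC ?K Y Z) (HomC ?K X Y)"
    let ?F = "Cmp ?K X Y Z"
    have fo: "fob ?F (h, g) = psmor_comp T X Y Z h g" if "is_psmor T Y Z h" "is_psmor T X Y g" for h g
      using that by (simp add: PsAlg_def psalg_hom_simps)
    have fa: "far ?F (\<beta>, \<alpha>) = pscell_hcomp T X Y Z \<beta> \<alpha>" if "is_pscell T Y Z \<beta>" "is_pscell T X Y \<alpha>" for \<beta> \<alpha>
      using that by (simp add: PsAlg_def psalg_hom_simps pscell_hcomp_def)
    note mAB = psmorphismI[OF A B] and mBC = psmorphismI[OF B C]
    show ?thesis
    proof (rule is_functorI)
      show "category ?P" "category (HomC ?K X Z)" by (intro category_prod_cat cat O)+
      show "fob ?F \<in> extensional (Ob ?P)"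
        "far ?F \<in> extensional (Ar ?P)" by (simp_all add: PsAlg_def prod_cat_def)
    next
      fix p assume "p \<in> Ob ?P"
      then obtain h g where p: "p = (h, g)" and hg: "is_psmor T Y Z h" "is_psmor T X Y g"
        by (auto simp: prod_cat_def PsAlg_simps psalg_hom_simps)
      show "fob ?F p \<in> Ob (HomC ?K X Z)"
        using is_psmor_comp[OF mAB[OF hg(2)] mBC[OF hg(1)]] by (simp add: p fo[OF hg] PsAlg_simps psalg_hom_simps)
      interpret g: psmorphism T X Y g by (rule mAB[OF hg(2)])
      interpret h: psmorphism T Y Z h by (rule mBC[OF hg(1)])
      show "far ?F (Idt ?P p) = Idt (HomC ?K X Z) (fob ?F p)"
        using fa[OF is_pscell_id[OF mBC[OF hg(1)]] is_pscell_id[OF mAB[OF hg(2)]]] hcomp_id_nat[OF g.F h.F]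
        by (simp add: p fo[OF hg] prod_cat_def PsAlg_simps psalg_hom_simps pscell_hcomp_def)
    next
      fix p x y assume "p \<in> hom ?P x y"
      then obtain \<beta> \<alpha> where p: "p = (\<beta>, \<alpha>)" and c: "is_pscell T Y Z \<beta>" "is_pscell T X Y \<alpha>"
        and xy: "x = (Src \<beta>, Src \<alpha>)" "y = (Tgt \<beta>, Tgt \<alpha>)"
        by (cases p; cases x; cases y) (auto simp: hom_prod_cat PsAlg_simps hom_psalg_hom)
      have m: "is_psmor T Y Z (Src \<beta>)" "is_psmor T X Y (Src \<alpha>)" "is_psmor T Y Z (Tgt \<beta>)" "is_psmor T X Y (Tgt \<alpha>)"
        using c by (simp_all add: is_pscell_def)
      show "far ?F p \<in> hom (HomC ?K X Z) (fob ?F x) (fob ?F y)" using is_pscell_hcomp[OF A B C c(2,1)]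
        by (simp add: p xy fa[OF c] fo m PsAlg_simps hom_psalg_hom) (simp add: pscell_hcomp_def)
      fix q z assume "q \<in> hom ?P y z"
      then obtain \<beta>' \<alpha>' where q: "q = (\<beta>', \<alpha>')" and c': "is_pscell T Y Z \<beta>'" "is_pscell T X Y \<alpha>'"
        and yz: "Src \<beta>' = Tgt \<beta>" "Src \<alpha>' = Tgt \<alpha>"
        by (cases q; cases z) (auto simp: xy hom_prod_cat PsAlg_simps hom_psalg_hom)
      note n = pscellD[OF A B c(2)] pscellD[OF B C c(1)] pscellD[OF A B c'(2)] pscellD[OF B C c'(1)]
      have "far ?F (Comp ?P q p)
        = pscell_hcomp T X Y Z (Comp (psalg_hom T Y Z) \<beta>' \<beta>) (Comp (psalg_hom T X Y) \<alpha>' \<alpha>)"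
        using fa[OF is_pscell_vcomp[OF B C c(1) c'(1) yz(1)] is_pscell_vcomp[OF A B c(2) c'(2) yz(2)]]
        by (simp add: p q prod_cat_def PsAlg_simps psalg_hom_simps)
      also have "\<dots> = Comp (psalg_hom T X Z) (pscell_hcomp T X Y Z \<beta>' \<alpha>') (pscell_hcomp T X Y Z \<beta> \<alpha>)"
        using hcomp_vcomp[OF n(3) n(15) _ n(9) n(21)] n(5,16,11,22) yz by (simp add: pscell_hcomp_def psalg_hom_simps)
      finally show "far ?F (Comp ?P q p) = Comp (HomC ?K X Z) (far ?F q) (far ?F p)" by (simp add: p q fa c c' PsAlg_simps)
    qed
  qed
  have id: "is_psmor T X X (psmor_id T X)" if "X \<in> Obj ?K" for X using is_psmor_id[OF alg[OF that]] .
  note cid = is_pscell_id[OF psmorphismI]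
  show ?thesis unfolding two_category_def
  proof (intro conjI ballI, goal_cases)
    case (1 X Y) then show ?case by (rule cat)
  next
    case (2 X) then show ?case using id by (simp add: PsAlg_simps psalg_hom_simps)
  next
    case (3 X Y Z) then show ?case by (rule Cmp)
  next
    case (4 X Y f)
    then have f: "is_psmor T X Y f" by (simp add: PsAlg_simps psalg_hom_simps)
    show ?case using psmor_comp_id(1)[OF psmorphismI[OF alg[OF 4(1)] alg[OF 4(2)] f]] f id[OF 4(1)] by (simp add: PsAlg_simps)
  next
    case (5 X Y f)
    then have f: "is_psmor T X Y f" by (simp add: PsAlg_simps psalg_hom_simps)
    show ?case using psmor_comp_id(2)[OF psmorphismI[OF alg[OF 5(1)] alg[OF 5(2)] f]] f id[OF 5(2)] by (simp add: PsAlg_simps)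
  next
    case (6 X Y \<alpha>)
    then have a: "is_pscell T X Y \<alpha>" by (simp add: PsAlg_simps psalg_hom_simps)
    note A = alg[OF 6(1)] and B = alg[OF 6(2)]
    note D = pscellD[OF A B a]
    show ?case using a cid[OF A A id[OF 6(1)]] psmor_comp_id(1)[OF D(1)] psmor_comp_id(1)[OF D(2)] hcomp_unit_right[OF D(3)]
      by (simp add: PsAlg_simps pscell_hcomp_def)
  next
    case (7 X Y \<alpha>)
    then have a: "is_pscell T X Y \<alpha>" by (simp add: PsAlg_simps psalg_hom_simps)
    note A = alg[OF 7(1)] and B = alg[OF 7(2)]
    note D = pscellD[OF A B a]
    show ?case using a cid[OF B B id[OF 7(2)]] psmor_comp_id(2)[OF D(1)] psmor_comp_id(2)[OF D(2)] hcomp_unit_left[OF D(3)]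
      by (simp add: PsAlg_simps pscell_hcomp_def)
  next
    case (8 W X Y Z f g h)
    then have m: "psmorphism T W X f" "psmorphism T X Y g" "psmorphism T Y Z h"
      using alg by (auto simp: PsAlg_simps psalg_hom_simps intro: psmorphismI)
    have m': "is_psmor T W X f" "is_psmor T X Y g" "is_psmor T Y Z h" using 8 by (simp_all add: PsAlg_simps psalg_hom_simps)
    show ?case using psmor_comp_assoc[OF m] is_psmor_comp[OF m(1,2)] is_psmor_comp[OF m(2,3)] m' by (simp add: PsAlg_simps)
  next
    case (9 W X Y Z \<alpha> \<beta> \<gamma>)
    then have m: "is_pscell T W X \<alpha>" "is_pscell T X Y \<beta>" "is_pscell T Y Z \<gamma>"
      by (simp_all add: PsAlg_simps psalg_hom_simps)
    note A = alg[OF 9(1)] alg[OF 9(2)] alg[OF 9(3)] alg[OF 9(4)]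
    note D1 = pscellD[OF A(1,2) m(1)] and D2 = pscellD[OF A(2,3) m(2)] and D3 = pscellD[OF A(3,4) m(3)]
    show ?case using m is_pscell_hcomp[OF A(1,2,3) m(1,2)] is_pscell_hcomp[OF A(2,3,4) m(2,3)]
        psmor_comp_assoc[OF D1(1) D2(1) D3(1)] psmor_comp_assoc[OF D1(2) D2(2) D3(2)] hcomp_assoc[OF D1(3) D2(3) D3(3)]
      by (simp add: PsAlg_simps) (simp add: pscell_hcomp_def)
  qed
qed

context psalgebra
begin

lemma ax_assoc:
  assumes "(w, ws) \<in> cwords T" "length wss = length ws" "\<And>j. j < length ws ==> (ws ! j, wss ! j) \<in> cwords T"
    "xs \<in> Ob (pow_cat (Car X) (sum_list (map (Dom T) (concat wss))))"
  shows "assoc_eq T X w ws wss xs" using bspec[OF conjunct1[OF eqs[unfolded alg_eqs_def]] assms(1)] assms(2-4) by blast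

lemma ax_unit_right:
  assumes "w \<in> words T" "xs \<in> tup X (Dom T w)"
  shows "unit_right_eq T X w xs" by (rule bspec[OF bspec[OF conjunct1[OF conjunct2[OF eqs[unfolded alg_eqs_def]]] assms(1)] assms(2)])

lemma ax_unit_left:
  assumes "w \<in> words T" "xs \<in> tup X (Dom T w)"
  shows "unit_left_eq T X w xs"
  by (rule bspec[OF bspec[OF conjunct1[OF conjunct2[OF conjunct2[OF eqs[unfolded alg_eqs_def]]]] assms(1)] assms(2)])

lemma ax_subst_gamma:
  assumes "(w, l, f) \<in> swords T" "length ws = l" "set ws \<subseteq> words T"
    "xs \<in> Ob (pow_cat (Car X) (sum_list (map (Dom T) ws)))"
  shows "subst_gamma_eq T X w l f ws xs"
  using bspec[OF conjunct1[OF conjunct2[OF conjunct2[OF conjunct2[OF eqs[unfolded alg_eqs_def]]]]] assms(1)] assms(2-4) by blast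

lemma ax_gamma_subst:
  assumes "(w, ws) \<in> cwords T" "length ns' = length ws" "length gs = length ws"
    "\<And>j. j < length ws ==> (ws ! j, ns' ! j, gs ! j) \<in> swords T" "xs \<in> tup X (sum_list ns')"
  shows "gamma_subst_eq T X w ws ns' gs xs"
  using bspec[OF conjunct1[OF conjunct2[OF conjunct2[OF conjunct2[OF conjunct2[OF eqs[unfolded alg_eqs_def]]]]]] assms(1)]
    assms(2-5) by blast

lemma ax_subst_subst:
  assumes "(w, l, f) \<in> swords T" "length g = l" "set g \<subseteq> {..<m}" "xs \<in> tup X m"
  shows "subst_subst_eq T X w l f m g xs"
  using bspec[OF conjunct1[OF conjunct2[OF conjunct2[OF conjunct2[OF conjunct2[OF conjunct2[OF eqs[unfolded alg_eqs_def]]]]]]] assms(1)]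
    assms(2-4) by blast

lemma ax_subst_id:
  assumes "w \<in> words T" "xs \<in> tup X (Dom T w)"
  shows "ps X w (Dom T w) [0..<Dom T w] xs = Idt (Car X) (po X w xs)"
  by (rule bspec[OF bspec[OF conjunct2[OF conjunct2[OF conjunct2[OF conjunct2[OF conjunct2[OF conjunct2[OF eqs[unfolded alg_eqs_def]]]]]]] assms(1)] assms(2)])

end

section \<open>The forgetful 2-functor\<close>

lemma forget_alg_simps [simp]: "Car (forget_alg S \<phi> X) = Car X"
  "w \<in> words S ==> Phi (forget_alg S \<phi> X) w = Phi X (far \<phi> w)"
  "(w, ws) \<in> cwords S ==> CC (forget_alg S \<phi> X) (w, ws) = CC X (far \<phi> w, map (far \<phi>) ws)"
  "II (forget_alg S \<phi> X) = II X"
  "(w, l, f) \<in> swords S ==> SS (forget_alg S \<phi> X) (w, l, f) = SS X (far \<phi> w, l, f)" by (simp_all add: forget_alg_def)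

lemma forget_mor_simps [simp]: "Fn (forget_mor S \<phi> H) = Fn H"
  "w \<in> words S ==> Rho (forget_mor S \<phi> H) w = Rho H (far \<phi> w)" by (simp_all add: forget_mor_def)

locale theory_change =
  fixes S :: "'s thry" and T :: "'t thry" and \<phi> :: "(nat, 's, nat, 't) functr"
  assumes S: "is_theory S" and T: "is_theory T" and \<phi>: "theory_morphism S T \<phi>"
begin

abbreviation U where "U \<equiv> forget_alg S \<phi>"

lemmas m_words = morphism_words[OF \<phi>, THEN conjunct1] and m_Dom = morphism_words[OF \<phi>, THEN conjunct2]
  and m_cwords = morphism_cwords[OF \<phi>] and m_swords = morphism_swords[OF \<phi>]
  and m_gamma = morphism_gamma_word[OF S T \<phi>] and m_subst = morphism_subst_word[OF S T \<phi>]
  and m_unit = morphism_unit_word[OF \<phi>]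

lemma m_Doms: "set ws \<subseteq> words S ==> map (Dom T) (map (far \<phi>) ws) = map (Dom S) ws" by (rule morphism_Dom[OF \<phi>])

lemma map_po_U: "set ws \<subseteq> words S ==> map2 (po (U X)) ws bs = map2 (po X) (map (far \<phi>) ws) bs"
  by (auto simp: map2_map1 dest!: set_zip_leftD)

lemma map_Phi_U: "set ws \<subseteq> words S ==> map (Phi (U X)) ws = map (Phi X) (map (far \<phi>) ws)" by auto

lemmas gamma_word_words = gamma_words[OF S] and subst_word_words = subst_words[OF S] and unit_word_words = unit_words[OF S]

text \<open>Every axiom for \<open>U X\<close> is the same axiom for \<open>X\<close> at the images
  of the words, because \<phi> commutes with \<open>gamma_word\<close>, \<open>subst_word\<close>
  and \<open>unit_word\<close>. The work lies in moving \<phi> out of the lists of words.\<close>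

lemma is_psalg_forget:
  assumes X: "is_psalg T X"
  shows "is_psalg S (U X)"
proof -
  interpret X: psalgebra T X using T X by unfold_locales
  have ws: "set ws \<subseteq> words S" "w \<in> words S" "Dom S w = length ws" if "(w, ws) \<in> cwords S" for w ws
    using cwordsD[OF that] by auto
  have sw: "w \<in> words S" "Dom S w = length f" if "(w, l, f) \<in> swords S" for w l f using swordsD[OF that] by auto
  have data: "alg_data S (U X)" unfolding alg_data_def
  proof (intro conjI ballI, safe)
    show "category (Car (U X))" "extensional_cat (Car (U X))" using X.C X.ext by simp_all
    show "Phi (U X) \<in> extensional (words S)" "CC (U X) \<in> extensional (cwords S)" "SS (U X) \<in> extensional (swords S)"
      by (auto simp: forget_alg_def extensional_def)
    fix w assume w: "w \<in> words S"
    then show "is_functor (pow_cat (Car (U X)) (Dom S w)) (Car (U X)) (Phi (U X) w)"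
      using X.Fun[OF m_words[OF w]] by (simp add: m_Dom[OF w])
  next
    fix w ws assume w: "(w, ws) \<in> cwords S"
    show "nat_iso (pow_cat (Car (U X)) (sum_list (map (Dom S) ws))) (Car (U X)) (CC (U X) (w, ws))
        (Phi (U X) (gamma_word S w ws)) (gamma_fun (Car (U X)) (map (Dom S) ws) (Phi (U X) w) (map (Phi (U X)) ws))"
      using alg_dataD(3)[OF X.data m_cwords[OF w]] unfolding m_Doms[OF ws(1)[OF w]] map_Phi_U[OF ws(1)[OF w]]
      by (simp add: w ws(2)[OF w] gamma_word_words[OF w] m_gamma[OF w] del: map_map)
  next
    show "nat_iso (pow_cat (Car (U X)) 1) (Car (U X)) (II (U X)) (Phi (U X) (unit_word S)) (unit_fun (Car (U X)))"
      using alg_dataD(4)[OF X.data] by (simp add: unit_word_words m_unit)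
  next
    fix w l f assume w: "(w, l, f) \<in> swords S"
    show "nat_iso (pow_cat (Car (U X)) l) (Car (U X)) (SS (U X) (w, l, f))
        (Phi (U X) (subst_word S w l f)) (subst_fun (Car (U X)) (Phi (U X) w) l f)" using alg_dataD(5)[OF X.data m_swords[OF w]]
      by (simp add: w sw[OF w] subst_word_words[OF w] m_subst[OF w])
  qed
  have "alg_eqs S (U X)" unfolding alg_eqs_def
  proof (intro conjI ballI allI impI, safe, goal_cases)
    case (1 w ws wss xs)
    note w = 1(1) and xs = 1(2) and l = 1(3) and wj = 1(4)
    have wj': "\<And>j. j < length ws ==> (ws ! j, wss ! j) \<in> cwords S" using wj by blast
    note A = gamma_word_assoc[OF S w l wj']
    have sc: "set (concat wss) \<subseteq> words S" using ws(1)[OF A(1)] .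
    have cc: "concat (map (map (far \<phi>)) wss) = map (far \<phi>) (concat wss)" by (simp add: map_concat)
    have dd: "map (Dom T) (map (far \<phi>) (concat wss)) = map (Dom S) (concat wss)" by (rule m_Doms[OF sc])
    have sv: "set vs \<subseteq> words S" if "vs \<in> set wss" for vs using sc that by auto
    have sd: "sum_list (map (Dom T) (map (far \<phi>) vs)) = sum_list (map (Dom S) vs)" if "vs \<in> set wss" for vs
      by (simp only: m_Doms[OF sv[OF that]])
    have ms: "map (\<lambda>vs. sum_list (map (Dom T) vs)) (map (map (far \<phi>)) wss) = map (\<lambda>vs. sum_list (map (Dom S) vs)) wss"
      unfolding map_map[of "\<lambda>vs. sum_list (map (Dom T) vs)"] by (rule map_cong[OF refl]) (simp only: comp_def sd)
    have gg: "map2 (gamma_word T) (map (far \<phi>) ws) (map (map (far \<phi>)) wss) = map (far \<phi>) (map2 (gamma_word S) ws wss)"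
      using l m_gamma[OF wj'] by (intro nth_equalityI) auto
    have pj: "map (\<lambda>j. pc X (map (far \<phi>) ws ! j) (map (map (far \<phi>)) wss ! j) (bs ! j)) [0..<length (map (far \<phi>) ws)]
      = map (\<lambda>j. pc (U X) (ws ! j) (wss ! j) (bs ! j)) [0..<length ws]" for bs using l wj' by auto
    have "Comp (Car X) (pc X (far \<phi> w) (map (far \<phi>) ws) (map2 (po X) (map (far \<phi>) (concat wss)) (blocks (map (Dom S) (concat wss)) xs)))
       (pc X (gamma_word T (far \<phi> w) (map (far \<phi>) ws)) (map (far \<phi>) (concat wss)) xs) =
      Comp (Car X) (pa X (far \<phi> w) (map (\<lambda>j. pc (U X) (ws ! j) (wss ! j)
         (blocks (map (\<lambda>vs. sum_list (map (Dom S) vs)) wss) xs ! j)) [0..<length ws]))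
       (pc X (far \<phi> w) (map (far \<phi>) (map2 (gamma_word S) ws wss)) xs)"
      using X.ax_assoc[OF m_cwords[OF w], of "map (map (far \<phi>)) wss" xs] l m_cwords[OF wj'] xs unfolding cc dd ms gg pj by simp
    then show ?case unfolding map_po_U[OF sc] by (simp add: w A(1,2) ws(2)[OF w] m_gamma[OF w] del: map_map)
  next
    case (2 w xs)
    note w = 2(1) and xs = 2(2)
    show ?case using X.ax_unit_right[OF m_words[OF w], of xs] xs cwords_unit_right[OF S w] by (simp add: w m_Dom[OF w] m_unit map_replicate)
  next
    case (3 w xs)
    note w = 3(1) and xs = 3(2)
    show ?case using X.ax_unit_left[OF m_words[OF w], of xs] xs cwords_unit_left[OF S w] by (simp add: w m_Dom[OF w] m_unit)
  next
    case (4 w l f ws' xs)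
    note w = 4(1) and xs = 4(2) and ws' = 4(3)
    note A = gamma_word_subst[OF S w refl ws']
    note dd = m_Doms[OF ws']
    have mm: "map ((!) (map (far \<phi>) ws')) f = map (far \<phi>) (map ((!) ws') f)" using A(4) by (auto simp: subset_iff)
    show ?case using X.ax_subst_gamma[OF m_swords[OF w], of "map (far \<phi>) ws'" xs] xs ws' m_words unfolding dd mm map_po_U[OF ws']
      by (simp add: w A(1,2,5) m_gamma[OF A(1)] m_subst[OF w] subset_iff image_iff del: map_map) blast
  next
    case (5 w ws ns' gs xs)
    note w = 5(1) and xs = 5(2) and l = 5(3,4) and g = 5(5)
    have g': "\<And>j. j < length ws ==> (ws ! j, ns' ! j, gs ! j) \<in> swords S" using g by blast
    note A = gamma_word_block_sum[OF S w l g']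
    have ss: "map (\<lambda>j. subst_word T (map (far \<phi>) ws ! j) (ns' ! j) (gs ! j)) [0..<length (map (far \<phi>) ws)]
      = map (far \<phi>) (map (\<lambda>j. subst_word S (ws ! j) (ns' ! j) (gs ! j)) [0..<length ws])" by (auto simp: m_subst[OF g'])
    have pj: "map (\<lambda>j. ps X (map (far \<phi>) ws ! j) (ns' ! j) (gs ! j) (blocks ns' xs ! j)) [0..<length (map (far \<phi>) ws)]
      = map (\<lambda>j. ps (U X) (ws ! j) (ns' ! j) (gs ! j) (blocks ns' xs ! j)) [0..<length ws]" by (auto simp: g')
    have "Comp (Car X) (pc X (far \<phi> w) (map (far \<phi>) ws) (map ((!) xs) (block_sum ns' gs)))
           (ps X (gamma_word T (far \<phi> w) (map (far \<phi>) ws)) (sum_list ns') (block_sum ns' gs) xs) = Comp (Car X)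
           (pa X (far \<phi> w) (map (\<lambda>j. ps (U X) (ws ! j) (ns' ! j) (gs ! j) (blocks ns' xs ! j)) [0..<length ws]))
           (pc X (far \<phi> w) (map (far \<phi>) (map (\<lambda>j. subst_word S (ws ! j) (ns' ! j) (gs ! j)) [0..<length ws])) xs)"
      using X.ax_gamma_subst[OF m_cwords[OF w], of ns' gs xs] xs l m_swords[OF g'] unfolding ss pj by simp
    then show ?case by (simp add: w A(1,4) ws(2)[OF w] m_gamma[OF w] del: map_map)
  next
    case (6 w l f m g xs)
    note w = 6(1) and xs = 6(2) and g = 6(3)
    note A = subst_word_subst[OF S w refl g]
    show ?case using X.ax_subst_subst[OF m_swords[OF w], of g m xs] xs g by (simp add: w A(1,2) m_subst[OF w])
  next
    case (7 w xs)
    note w = 7(1) and xs = 7(2)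
    show ?case using X.ax_subst_id[OF m_words[OF w], of xs] xs swords_id[OF w] by (simp add: w m_Dom[OF w])
  qed
  with data show ?thesis using is_psalg_iff[OF S] by blast
qed

lemma psalgebra_forget: "psalgebra T X ==> psalgebra S (U X)" using is_psalg_forget S by (auto simp: psalgebra_def)

lemma is_psmor_forget:
  assumes "psmorphism T X Y H"
  shows "is_psmor S (U X) (U Y) (forget_mor S \<phi> H)"
proof -
  interpret H: psmorphism T X Y H by fact
  let ?H = "forget_mor S \<phi> H"
  have data: "mor_data S (U X) (U Y) ?H" unfolding mor_data_def
  proof (intro conjI ballI)
    show "Rho ?H \<in> extensional (words S)" by (simp add: forget_mor_def)
    fix w assume w: "w \<in> words S"
    then show "nat_iso (pow_cat (Car (U X)) (Dom S w)) (Car (U Y)) (Rho ?H w) (fcomp (pow_cat (Car (U X)) (Dom S w)) (Fn ?H) (Phi (U X) w))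
        (fcomp (pow_cat (Car (U X)) (Dom S w)) (Phi (U Y) w) (pow_fun (Car (U X)) (Dom S w) (Fn ?H)))"
      using H.Rho_iso[OF m_words[OF w]] by (simp add: m_Dom[OF w])
  qed (simp add: H.F)
  have "mor_eqs S (U X) (U Y) ?H" unfolding mor_eqs_def
  proof (intro conjI ballI, safe, goal_cases)
    case (1 w ws xs)
    note w = 1(1) and xs = 1(2)
    have ws: "set ws \<subseteq> words S" "w \<in> words S" using cwordsD[OF w] by auto
    note dd = m_Doms[OF ws(1)]
    have rj: "map (\<lambda>j. pr H (map (far \<phi>) ws ! j) (bs ! j)) [0..<length (map (far \<phi>) ws)]
      = map (\<lambda>j. pr ?H (ws ! j) (bs ! j)) [0..<length ws]" for bs using ws(1) by (auto simp: subset_iff)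
    show ?case using H.pr_gamma[OF m_cwords[OF w], of xs] xs unfolding dd rj map_po_U[OF ws(1)]
      by (simp add: w ws(2) gamma_word_words[OF w] m_gamma[OF w])
  next
    case (2 xs)
    then obtain x where x: "xs = [x]" "x \<in> Ob (Car X)" by (cases xs) (auto simp: Ob_pow One_nat_def)
    show ?case using H.pr_unit[OF x(2)] by (simp add: x unit_word_words m_unit)
  next
    case (3 w l f xs)
    note w = 3(1) and xs = 3(2)
    show ?case using H.pr_subst[OF m_swords[OF w], of xs] xs swordsD[OF w] by (simp add: w subst_word_words[OF w] m_subst[OF w])
  qed
  with data show ?thesis using is_psmor_iff[OF S is_psalg_forget[OF H.X.X] is_psalg_forget[OF H.Y.X]] by blast
qed

lemma psmorphism_forget: "psmorphism T X Y H ==> psmorphism S (U X) (U Y) (forget_mor S \<phi> H)"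
  using is_psmor_forget psalgebra_forget psmorphismI by (metis psmorphism_def)

lemma forget_cell_simps [simp]: "Src (forget_cell S \<phi> \<alpha>) = forget_mor S \<phi> (Src \<alpha>)"
  "Tgt (forget_cell S \<phi> \<alpha>) = forget_mor S \<phi> (Tgt \<alpha>)" "Nt (forget_cell S \<phi> \<alpha>) = Nt \<alpha>"
  by (simp_all add: forget_cell_def)

lemma is_pscell_forget:
  assumes X: "psalgebra T X" and Y: "psalgebra T Y" and a: "is_pscell T X Y \<alpha>"
  shows "is_pscell S (U X) (U Y) (forget_cell S \<phi> \<alpha>)"
proof -
  note A = pscellD[OF X Y a]
  let ?a = "forget_cell S \<phi> \<alpha>"
  show ?thesis
  proof (rule pscellI)
    show "psmorphism S (U X) (U Y) (Src ?a)" "psmorphism S (U X) (U Y) (Tgt ?a)"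
      using psmorphism_forget[OF A(1)] psmorphism_forget[OF A(2)] by simp_all
    fix w xs assume w: "w \<in> words S" and xs: "xs \<in> tup (U X) (Dom S w)"
    show "cell_eq (U X) (U Y) ?a w xs" using A(6)[OF m_words[OF w], of xs] xs by (simp add: w m_Dom[OF w])
  qed (use A in simp_all)
qed

text \<open>An equality of records: both families \<open>Rho\<close> are cut down to
  \<open>words S\<close>, and there they agree because \<phi> preserves arities. Together with
  \<open>forget_mor_comp\<close> this makes the forgetful 2-functor strict.\<close>

lemma forget_mor_id: "forget_mor S \<phi> (psmor_id T X) = psmor_id S (U X)"
  by (auto simp: forget_mor_def psmor_id_def m_words m_Dom restrict_def)

lemma forget_mor_comp: "forget_mor S \<phi> (psmor_comp T X Y Z H G)
    = psmor_comp S (U X) (U Y) (U Z) (forget_mor S \<phi> H) (forget_mor S \<phi> G)"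
  by (auto simp: forget_mor_def psmor_comp_def m_words m_Dom restrict_def Let_def)

lemma forget_cell_hcomp: "forget_cell S \<phi> (pscell_hcomp T X Y Z \<beta> \<alpha>)
    = pscell_hcomp S (U X) (U Y) (U Z) (forget_cell S \<phi> \<beta>) (forget_cell S \<phi> \<alpha>)"
  by (simp add: forget_cell_def pscell_hcomp_def forget_mor_comp)

lemma forgetful_simps: "P0 (forgetful S T \<phi>) = U"
  "is_psmor T X Y H ==> fob (P1 (forgetful S T \<phi>) X Y) H = forget_mor S \<phi> H"
  "is_pscell T X Y \<alpha> ==> far (P1 (forgetful S T \<phi>) X Y) \<alpha> = forget_cell S \<phi> \<alpha>"
  by (simp_all add: forgetful_def psalg_hom_simps)

lemma strict_2functor_forgetful:
  "strict_2functor (PsAlg T :: (('t, 'u, 'u) psalg, _, _) twocat) (PsAlg S) (forgetful S T \<phi>)"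
proof -
  let ?K = "PsAlg T :: (('t, 'u, 'u) psalg, _, _) twocat"
  note alg = psalgebraI[OF T]
  show ?thesis
  proof (rule strict_2functorI, goal_cases)
    case 1 show ?case by (rule two_category_PsAlg[OF T])
  next
    case 2 show ?case by (rule two_category_PsAlg[OF S])
  next
    case (3 X) then show ?case using is_psalg_forget by (auto simp: forgetful_simps Obj_PsAlg)
  next
    case (4 X Y)
    note A = alg[OF 4(1)] and B = alg[OF 4(2)]
    let ?F = "P1 (forgetful S T \<phi>) X Y"
    show ?case unfolding PsAlg_simps forgetful_simps
    proof (rule is_functorI)
      show "category (psalg_hom T X Y)" "category (psalg_hom S (U X) (U Y))" by (intro category_psalg_hom A B psalgebra_forget)+
      show "fob ?F \<in> extensional (Ob (psalg_hom T X Y))"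
        "far ?F \<in> extensional (Ar (psalg_hom T X Y))" by (simp_all add: forgetful_def)
      show "fob ?F H \<in> Ob (psalg_hom S (U X) (U Y))" if "H \<in> Ob (psalg_hom T X Y)" for H
        using that is_psmor_forget[OF psmorphismI[OF A B]] by (simp add: psalg_hom_simps forgetful_simps)
      show "far ?F \<alpha> \<in> hom (psalg_hom S (U X) (U Y)) (fob ?F G) (fob ?F H)"
        if "\<alpha> \<in> hom (psalg_hom T X Y) G H" for \<alpha> G H
        using that is_pscell_forget[OF A B] by (auto simp: hom_psalg_hom forgetful_simps is_pscell_def)
      show "far ?F (Idt (psalg_hom T X Y) H) = Idt (psalg_hom S (U X) (U Y)) (fob ?F H)" if "H \<in> Ob (psalg_hom T X Y)" for H
        using that is_pscell_id[OF psmorphismI[OF A B]] by (simp add: psalg_hom_simps forgetful_simps forget_cell_def)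
      show "far ?F (Comp (psalg_hom T X Y) \<beta> \<alpha>) = Comp (psalg_hom S (U X) (U Y)) (far ?F \<beta>) (far ?F \<alpha>)"
        if "\<alpha> \<in> hom (psalg_hom T X Y) F G" "\<beta> \<in> hom (psalg_hom T X Y) G H" for \<alpha> \<beta> F G H
        using that is_pscell_vcomp[OF A B, of \<alpha> \<beta>]
        by (auto simp: hom_psalg_hom psalg_hom_simps forgetful_simps forget_cell_def)
    qed
  next
    case (5 X)
    then show ?case using is_psmor_id[OF alg[OF 5]] by (simp add: PsAlg_simps forgetful_simps forget_mor_id)
  next
    case (6 X)
    then show ?case by (simp add: forgetful_def PsAlg_simps(2) forget_mor_id)
  next
    case (7 X Y Z f g)
    note A = alg[OF 7(1)] and B = alg[OF 7(2)] and C = alg[OF 7(3)]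
    have m: "psmorphism T X Y f" "psmorphism T Y Z g" using 7 A B C by (auto simp: PsAlg_simps psalg_hom_simps intro: psmorphismI)
    have m': "is_psmor T X Y f" "is_psmor T Y Z g" using 7 by (simp_all add: PsAlg_simps psalg_hom_simps)
    show ?case using m' is_psmor_comp[OF m] is_psmor_forget[OF m(1)] is_psmor_forget[OF m(2)]
      by (simp add: PsAlg_simps forgetful_simps forget_mor_comp)
  next
    case (8 X Y Z f g)
    note A = alg[OF 8(1)] and B = alg[OF 8(2)] and C = alg[OF 8(3)]
    have m: "psmorphism T X Y f" "psmorphism T Y Z g" using 8 A B C by (auto simp: PsAlg_simps psalg_hom_simps intro: psmorphismI)
    have m': "is_psmor T X Y f" "is_psmor T Y Z g" using 8 by (simp_all add: PsAlg_simps psalg_hom_simps)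
    have "PC (forgetful S T \<phi>) X Y Z g f = id2 (PsAlg S) (U X) (U Z) (forget_mor S \<phi> (psmor_comp T X Y Z g f))"
      by (simp add: forgetful_def)
    then show ?case using m' is_psmor_comp[OF m] by (simp add: PsAlg_simps(3) forgetful_simps)
  next
    case (9 X Y Z \<alpha> \<beta> f f' g g')
    note A = alg[OF 9(1)] and B = alg[OF 9(2)] and C = alg[OF 9(3)]
    have c: "is_pscell T X Y \<alpha>" "is_pscell T Y Z \<beta>" using 9 by (simp_all add: PsAlg_simps hom_psalg_hom)
    show ?case using c is_pscell_hcomp[OF A B C c] is_pscell_forget[OF A B c(1)] is_pscell_forget[OF B C c(2)]
      by (simp add: PsAlg_simps forgetful_simps forget_cell_hcomp)
  qed
qed

end

section \<open>Formal objects and arrows of the free algebra\<close>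

text \<open>Terms are subject to no equations. Applying \<open>gamma_word T w ws\<close> to a list
  and applying first the \<open>ws\<close> and then \<open>w\<close> give different terms, related
  only by the coherence isomorphism \<open>GC\<close>; this is what freeness of a pseudo algebra
  requires, in contrast to a strict one.\<close>

datatype ('t, 'u) tm = Var 'u | App 't "('t, 'u) tm list"

text \<open>
  \<open>GC\<close>, \<open>GI\<close> and \<open>GS\<close> stand for the components of the coherence isomorphisms \<open>c\<close>, \<open>I\<close> and \<open>s\<close> of the
  free algebra, \<open>GR\<close> for those of the isomorphisms \<open>\<rho>\<close> of the universal morphism, and \<open>Gi\<close> for the
  inverse of a generating isomorphism.
\<close>

datatype ('s, 't, 'u) gen =
    GC 't "'t list" "('t, 'u) tm list"
  | GI "('t, 'u) tm"
  | GS 't nat "nat list" "('t, 'u) tm list"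
  | GR 's "'u list"

text \<open>\<open>Eta\<close> is the image of an arrow of \<open>X\<close> under the universal
  morphism, \<open>Op w\<close> the value of the functor of the word \<open>w\<close> on a list of
  arrows. Composability is left to the predicate \<open>ok\<close>.\<close>

datatype ('s, 't, 'u) ex =
    Eta 'u
  | Ide "('t, 'u) tm"
  | Cm "('s, 't, 'u) ex" "('s, 't, 'u) ex"
  | Op 't "('s, 't, 'u) ex list"
  | Gn "('s, 't, 'u) gen"
  | Gi "('s, 't, 'u) gen"

context
  fixes A :: "('t, 'u, 'u) psalg" and H :: "('s, 'u, 'u, 'u, 'u) psmor"
begin

text \<open>\<open>io\<close>, \<open>ig\<close> and \<open>ia\<close> evaluate terms, generators
  and expressions in the model \<open>H\<close>, a morphism from \<open>X\<close> to the algebra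
  obtained from \<open>A\<close> by forgetting. Variables, \<open>Eta\<close> and \<open>GR\<close>
  are evaluated by \<open>H\<close>, everything else by \<open>A\<close>.\<close>

fun io :: "('t, 'u) tm => 'u" where
  "io (Var x) = fob (Fn H) x"
| "io (App w ts) = po A w (map io ts)"

fun ig :: "('s, 't, 'u) gen => 'u" where
  "ig (GC w ws ts) = pc A w ws (map io ts)"
| "ig (GI t) = ncomp (II A) [io t]"
| "ig (GS w l f ts) = ps A w l f (map io ts)"
| "ig (GR w xs) = pr H w xs"

fun ia :: "('s, 't, 'u) ex => 'u" where
  "ia (Eta f) = far (Fn H) f"
| "ia (Ide t) = Idt (Car A) (io t)"
| "ia (Cm g f) = Comp (Car A) (ia g) (ia f)"
| "ia (Op w es) = pa A w (map ia es)"
| "ia (Gn g) = ig g"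
| "ia (Gi g) = inverse_ar (Car A) (ig g)"

end

lemma map_io_App: "map (io A H) (map2 App ws (blocks ns ts)) = map2 (po A) ws (blocks ns (map (io A H) ts))"
  by (simp add: blocks_map zip_map2 case_prod_beta comp_def)

locale free_base = theory_change S T \<phi> + X: psalgebra S X
  for S :: "'s thry" and T :: "'t thry" and \<phi> :: "(nat, 's, nat, 't) functr" and X :: "('s, 'u, 'u) psalg"
begin

text \<open>\<open>okt\<close>, \<open>okg\<close> and \<open>ok\<close> single out well-formed
  terms, generators and expressions; \<open>gs\<close>, \<open>gt\<close>, \<open>sr\<close> and
  \<open>tg\<close> are sources and targets. All are computed from the raw syntax, so typing in the
  free algebra is independent of any model.\<close>

fun okt :: "('t, 'u) tm => bool" where
  "okt (Var x) \<longleftrightarrow> x \<in> Ob (Car X)"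
| "okt (App w ts) \<longleftrightarrow> w \<in> words T \<and> length ts = Dom T w \<and> (\<forall>t\<in>set ts. okt t)"

fun gs :: "('s, 't, 'u) gen => ('t, 'u) tm" where
  "gs (GC w ws ts) = App (gamma_word T w ws) ts"
| "gs (GI t) = App (unit_word T) [t]"
| "gs (GS w l f ts) = App (subst_word T w l f) ts"
| "gs (GR w xs) = Var (po X w xs)"

fun gt :: "('s, 't, 'u) gen => ('t, 'u) tm" where
  "gt (GC w ws ts) = App w (map2 App ws (blocks (map (Dom T) ws) ts))"
| "gt (GI t) = t"
| "gt (GS w l f ts) = App w (map ((!) ts) f)"
| "gt (GR w xs) = App (far \<phi> w) (map Var xs)"

fun okg :: "('s, 't, 'u) gen => bool" where
  "okg (GC w ws ts) \<longleftrightarrow> (w, ws) \<in> cwords T \<and> length ts = sum_list (map (Dom T) ws) \<and> (\<forall>t\<in>set ts. okt t)"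
| "okg (GI t) \<longleftrightarrow> okt t"
| "okg (GS w l f ts) \<longleftrightarrow> (w, l, f) \<in> swords T \<and> length ts = l \<and> (\<forall>t\<in>set ts. okt t)"
| "okg (GR w xs) \<longleftrightarrow> w \<in> words S \<and> xs \<in> tup X (Dom S w)"

fun sr :: "('s, 't, 'u) ex => ('t, 'u) tm" where
  "sr (Eta f) = Var (Dom (Car X) f)"
| "sr (Ide t) = t"
| "sr (Cm g f) = sr f"
| "sr (Op w es) = App w (map sr es)"
| "sr (Gn g) = gs g"
| "sr (Gi g) = gt g"

fun tg :: "('s, 't, 'u) ex => ('t, 'u) tm" where
  "tg (Eta f) = Var (Cod (Car X) f)"
| "tg (Ide t) = t"
| "tg (Cm g f) = tg g"
| "tg (Op w es) = App w (map tg es)"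
| "tg (Gn g) = gt g"
| "tg (Gi g) = gs g"

fun ok :: "('s, 't, 'u) ex => bool" where
  "ok (Eta f) \<longleftrightarrow> f \<in> Ar (Car X)"
| "ok (Ide t) \<longleftrightarrow> okt t"
| "ok (Cm g f) \<longleftrightarrow> ok g \<and> ok f \<and> tg f = sr g"
| "ok (Op w es) \<longleftrightarrow> w \<in> words T \<and> length es = Dom T w \<and> (\<forall>e\<in>set es. ok e)"
| "ok (Gn g) \<longleftrightarrow> okg g"
| "ok (Gi g) \<longleftrightarrow> okg g"

lemmas gamma_words_T = gamma_words[OF T] and subst_words_T = subst_words[OF T] and unit_words_T = unit_words[OF T]

lemma okt_blocks:
  assumes "set ws \<subseteq> words T" "length ts = sum_list (map (Dom T) ws)" "\<forall>t\<in>set ts. okt t" "i < length ws"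
  shows "okt (App (ws ! i) (blocks (map (Dom T) ws) ts ! i))" "length (blocks (map (Dom T) ws) ts ! i) = Dom T (ws ! i)"
    "\<forall>t\<in>set (blocks (map (Dom T) ws) ts ! i). okt t"
  using assms set_blocks[of i "map (Dom T) ws" ts] length_blocks_nth[OF assms(2), of i] by (auto simp: subset_iff)

lemma okg_okt: "okg g ==> okt (gs g) \<and> okt (gt g)"
proof (cases g)
  case (GC w ws ts)
  assume ok: "okg g"
  have "okt x" if "x \<in> set (map2 App ws (blocks (map (Dom T) ws) ts))" for x
    using that ok GC okt_blocks(1)[of ws ts] cwordsD[of w ws T] by (auto simp: in_set_conv_nth)
  then show ?thesis using ok GC cwordsD[of w ws T] gamma_words_T[of w ws] by simp
next
  case (GI t)
  assume "okg g" then show ?thesis using GI unit_words_T by (simp add: One_nat_def)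
next
  case (GS w l f ts)
  assume "okg g" then show ?thesis using GS swordsD[of w l f T] subst_words_T[of w l f] by (auto simp: subset_iff)
next
  case (GR w xs)
  assume "okg g" then show ?thesis using GR m_words[of w] m_Dom[of w] X.po_Ob[of w xs] by (auto simp: Ob_pow)
qed

lemma ok_okt: "ok e ==> okt (sr e) \<and> okt (tg e)"
proof (induction e)
  case (Eta f)
  then show ?case using cat_Dom[OF X.C] cat_Cod[OF X.C] by simp
qed (auto simp: okg_okt)

text \<open>Sources and targets are compared as terms because a model may give different terms the
  same value. The algebra \<open>A\<close> ranges over all pseudo algebras with objects and arrows
  in \<open>'u\<close>, which includes every algebra to which the universal property will be
  applied.\<close>

definition ceq :: "('s, 't, 'u) ex => ('s, 't, 'u) ex => bool" where
  "ceq e e' \<longleftrightarrow> ok e \<and> ok e' \<and> sr e = sr e' \<and> tg e = tg e' \<and>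
     (\<forall>A H. psalgebra T A \<longrightarrow> psmorphism S X (U A) H \<longrightarrow> ia A H e = ia A H e')"

end

locale free_model = free_base S T \<phi> X + A: psalgebra T A + H: psmorphism S X "forget_alg S \<phi> A" H
  for S :: "'s thry" and T :: "'t thry" and \<phi> :: "(nat, 's, nat, 't) functr" and X :: "('s, 'u, 'u) psalg"
    and A :: "('t, 'u, 'u) psalg" and H :: "('s, 'u, 'u, 'u, 'u) psmor"
begin

lemma io_Ob: "okt t ==> io A H t \<in> Ob (Car A)"
proof (induction t)
  case (Var x)
  then show ?case using functor_ob[OF H.F] by simp
next
  case (App w ts)
  then have "map (io A H) ts \<in> tup A (Dom T w)" by (auto simp: Ob_pow)
  then show ?case using App A.po_Ob[of w] by simp
qed

lemma io_list: "\<forall>t\<in>set ts. okt t ==> length ts = n ==> map (io A H) ts \<in> tup A n" using io_Ob by (auto simp: Ob_pow)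

lemma ig_hom:
  assumes "okg g"
  shows "ig A H g \<in> hom (Car A) (io A H (gs g)) (io A H (gt g)) \<and> iso (Car A) (ig A H g)"
proof (cases g)
  case (GC w ws ts)
  have "map (io A H) ts \<in> Ob (pow_cat (Car A) (sum_list (map (Dom T) ws)))" using assms GC by (intro io_list) auto
  then show ?thesis using A.pc_hom[of w ws] assms GC by (simp add: map_io_App del: map_map)
next
  case (GI t)
  then show ?thesis using A.pI_hom[OF io_Ob] assms by simp
next
  case (GS w l f ts)
  have "map (io A H) ts \<in> tup A l" using assms GS by (intro io_list) auto
  moreover have "map ((!) (map (io A H) ts)) f = map (io A H) (map ((!) ts) f)"
    using assms GS swordsD[of w l f T] by (auto simp: subset_iff)
  ultimately show ?thesis using A.ps_hom[of w l f "map (io A H) ts"] assms GS by (simp del: map_map)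
next
  case (GR w xs)
  then show ?thesis using H.pr_hom[of w xs] assms by (simp add: comp_def)
qed

lemma ia_hom: "ok e ==> ia A H e \<in> hom (Car A) (io A H (sr e)) (io A H (tg e))"
proof (induction e)
  case (Eta f)
  then show ?case using functor_hom[OF H.F Ar_hom] by simp
next
  case (Ide t)
  then show ?case using cat_id[OF A.C io_Ob] by simp
next
  case (Cm g f)
  then show ?case using cat_comp[OF A.C] by simp
next
  case (Op w es)
  then have "map (ia A H) es \<in> hom (pow_cat (Car A) (Dom T w)) (map (io A H) (map sr es)) (map (io A H) (map tg es))"
    by (auto simp: hom_pow)
  then show ?case using Op A.pa_hom[of w] by simp
next
  case (Gn g)
  then show ?case using ig_hom by simp
next
  case (Gi g)
  then show ?case using ig_hom inverse_ar(1) by fastforce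
qed

lemma io_pow_hom:
  "\<forall>e\<in>set es. ok e ==> length es = n ==>
    map (ia A H) es \<in> hom (pow_cat (Car A) n) (map (io A H) (map sr es)) (map (io A H) (map tg es))"
  using ia_hom by (auto simp: hom_pow)

lemma ceq_ia: "ceq e e' ==> ia A H e = ia A H e'" unfolding ceq_def using A.psalgebra_axioms H.psmorphism_axioms by blast

end

text \<open>
  The objects and arrows of the free algebra have to be elements of \<open>'u\<close>: \<open>cd\<close> encodes the formal
  objects, and \<open>qt\<close> is the quotient map of the formal arrows.
\<close>

locale free_alg = free_base S T \<phi> X
  for S :: "'s thry" and T :: "'t thry" and \<phi> :: "(nat, 's, nat, 't) functr" and X :: "('s, 'u, 'u) psalg" +
  fixes cd :: "('t, 'u) tm => 'u" and qt :: "('s, 't, 'u) ex => 'u"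
  assumes cd_inj: "inj_on cd {t. okt t}"
    and qt_eq: "ok e ==> ok e' ==> qt e = qt e' \<longleftrightarrow> ceq e e'"
begin

text \<open>\<open>dc\<close> decodes an object and \<open>rp\<close> picks an expression for an
  arrow. Operations on arrows are defined on these representatives; afterwards it is checked that
  any other representative gives the same class.\<close>

definition dc :: "'u => ('t, 'u) tm" where "dc = inv_into {t. okt t} cd"
definition rp :: "'u => ('s, 't, 'u) ex" where "rp u = (SOME e. ok e \<and> qt e = u)"

lemma dc_cd [simp]: "okt t ==> dc (cd t) = t" unfolding dc_def using inv_into_f_f[OF cd_inj] by simp

lemma map_dc_cd [simp]: "\<forall>t\<in>set ts. okt t ==> map (dc \<circ> cd) ts = ts" by (simp add: map_idI)

lemma rp_qt: assumes "ok e" shows "ok (rp (qt e))" "qt (rp (qt e)) = qt e" "ceq (rp (qt e)) e"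
proof -
  have "\<exists>e'. ok e' \<and> qt e' = qt e" using assms by blast
  from someI_ex[OF this] show "ok (rp (qt e))" "qt (rp (qt e)) = qt e" by (auto simp: rp_def)
  then show "ceq (rp (qt e)) e" using qt_eq assms by blast
qed

lemma rp_sr_tg: "ok e ==> sr (rp (qt e)) = sr e" "ok e ==> tg (rp (qt e)) = tg e" using rp_qt(3) by (auto simp: ceq_def)

text \<open>Each equation between arrows of the free algebra is obtained from this rule:
  well-formedness and parallelism are checked on the syntax, and the equation itself in an arbitrary
  model.\<close>

lemma qtI:
  assumes "ok e" "ok e'" "sr e = sr e'" "tg e = tg e'"
    "\<And>A H. free_model S T \<phi> X A H ==> ia A H e = ia A H e'"
  shows "qt e = qt e'"
proof -
  have "free_model S T \<phi> X A H" if "psalgebra T A" "psmorphism S X (U A) H" for A H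
    using that free_base_axioms by (simp add: free_model_def)
  then show ?thesis using assms qt_eq[OF assms(1,2)] by (simp add: ceq_def)
qed

definition FC :: "('u, 'u) cat" where
  "FC = \<lparr>Ob = cd ` {t. okt t}, Ar = qt ` {e. ok e},
     Dom = (\<lambda>u\<in>qt ` {e. ok e}. cd (sr (rp u))), Cod = (\<lambda>u\<in>qt ` {e. ok e}. cd (tg (rp u))),
     Idt = (\<lambda>x\<in>cd ` {t. okt t}. qt (Ide (dc x))),
     Comp = (\<lambda>g f. if g \<in> qt ` {e. ok e} \<and> f \<in> qt ` {e. ok e} \<and> tg (rp f) = sr (rp g)
       then qt (Cm (rp g) (rp f)) else undefined)\<rparr>"

lemma FC_Ob: "okt t ==> cd t \<in> Ob FC" and FC_Ar: "ok e ==> qt e \<in> Ar FC" by (simp_all add: FC_def)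

lemma FC_ObE: assumes "x \<in> Ob FC" obtains t where "okt t" "x = cd t" using assms by (auto simp: FC_def)

lemma FC_ArE: assumes "f \<in> Ar FC" obtains e where "ok e" "f = qt e" using assms by (auto simp: FC_def)

lemma FC_Dom: "ok e ==> Dom FC (qt e) = cd (sr e)" and FC_Cod: "ok e ==> Cod FC (qt e) = cd (tg e)" by (simp_all add: FC_def rp_sr_tg)

lemma cd_eq: "okt t ==> okt t' ==> cd t = cd t' \<longleftrightarrow> t = t'" using cd_inj by (auto simp: inj_on_def)

lemma FC_hom: "ok e ==> qt e \<in> hom FC (cd (sr e)) (cd (tg e))" by (simp add: hom_def FC_Ar FC_Dom FC_Cod)

lemma FC_homE:
  assumes "f \<in> hom FC x y"
  obtains e where "ok e" "f = qt e" "x = cd (sr e)" "y = cd (tg e)"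
proof -
  obtain e where e: "ok e" "f = qt e" using FC_ArE[OF hom_Ar[OF assms]] .
  then show thesis using that[of e] hom_Dom[OF assms] hom_Cod[OF assms] by (simp add: FC_Dom FC_Cod)
qed

text \<open>Composing two classes requires that the source of one representative be literally the
  target of the other. Injectivity of \<open>cd\<close> provides this from equality of the coded
  objects.\<close>

lemma FC_homE2:
  assumes "f \<in> hom FC (cd t) y" "okt t"
  obtains e where "ok e" "f = qt e" "t = sr e" "y = cd (tg e)"
proof -
  obtain e where e: "ok e" "f = qt e" "cd t = cd (sr e)" "y = cd (tg e)" using FC_homE[OF assms(1)] .
  then show thesis using that[of e] ok_okt[of e] cd_eq[OF assms(2)] by blast
qed

lemma FC_Idt: "okt t ==> Idt FC (cd t) = qt (Ide t)" by (simp add: FC_def)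

text \<open>Values in models depend on classes only, so the chosen representatives in the definition
  of \<open>FC\<close> may be replaced by any others.\<close>

lemma FC_Comp:
  assumes "ok g" "ok f" "tg f = sr g"
  shows "Comp FC (qt g) (qt f) = qt (Cm g f)"
proof -
  have "qt (Cm (rp (qt g)) (rp (qt f))) = qt (Cm g f)"
  proof (rule qtI)
    fix A H assume "free_model S T \<phi> X A H"
    then interpret M: free_model S T \<phi> X A H .
    show "ia A H (Cm (rp (qt g)) (rp (qt f))) = ia A H (Cm g f)" using M.ceq_ia[OF rp_qt(3)] assms by simp
  qed (use assms rp_qt(1) rp_sr_tg in simp_all)
  then show ?thesis using assms by (simp add: FC_def rp_sr_tg)
qed

lemma category_FC: "category FC"
proof (rule categoryI, goal_cases)
  case (1 f)
  then show ?case by (elim FC_ArE) (simp add: FC_Dom FC_Cod FC_Ob ok_okt)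
next
  case (2 x)
  then show ?case using FC_hom[of "Ide t" for t] by (elim FC_ObE) (simp add: FC_Idt)
next
  case (3 f g x y z)
  obtain e where e: "ok e" "f = qt e" "x = cd (sr e)" "y = cd (tg e)" using FC_homE[OF 3(1)] .
  have "okt (tg e)" using e(1) ok_okt by blast
  then obtain e' where e': "ok e'" "g = qt e'" "tg e = sr e'" "z = cd (tg e')" using FC_homE2[OF 3(2)[unfolded e(4)]] by blast
  show ?case using FC_hom[of "Cm e' e"] e e' by (simp add: FC_Comp)
next
  case (4 f x y)
  obtain e where e: "ok e" "f = qt e" "x = cd (sr e)" "y = cd (tg e)" using FC_homE[OF 4] .
  have "qt (Cm e (Ide (sr e))) = qt e"
  proof (rule qtI)
    fix A H assume "free_model S T \<phi> X A H"
    then interpret M: free_model S T \<phi> X A H .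
    show "ia A H (Cm e (Ide (sr e))) = ia A H e" using cat_idr[OF M.A.C M.ia_hom[OF e(1)]] by simp
  qed (use e ok_okt in simp_all)
  then show ?case using e ok_okt by (simp add: FC_Idt FC_Comp)
next
  case (5 f x y)
  obtain e where e: "ok e" "f = qt e" "x = cd (sr e)" "y = cd (tg e)" using FC_homE[OF 5] .
  have "qt (Cm (Ide (tg e)) e) = qt e"
  proof (rule qtI)
    fix A H assume "free_model S T \<phi> X A H"
    then interpret M: free_model S T \<phi> X A H .
    show "ia A H (Cm (Ide (tg e)) e) = ia A H e" using cat_idl[OF M.A.C M.ia_hom[OF e(1)]] by simp
  qed (use e ok_okt in simp_all)
  then show ?case using e ok_okt by (simp add: FC_Idt FC_Comp)
next
  case (6 f g h a b c d)
  obtain e where e: "ok e" "f = qt e" "a = cd (sr e)" "b = cd (tg e)" using FC_homE[OF 6(1)] .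
  have "okt (tg e)" using e(1) ok_okt by blast
  then obtain e' where e': "ok e'" "g = qt e'" "tg e = sr e'" "c = cd (tg e')" using FC_homE2[OF 6(2)[unfolded e(4)]] by blast
  have "okt (tg e')" using e'(1) ok_okt by blast
  then obtain e'' where e'': "ok e''" "h = qt e''" "tg e' = sr e''" "d = cd (tg e'')" using FC_homE2[OF 6(3)[unfolded e'(4)]] by blast
  have "qt (Cm e'' (Cm e' e)) = qt (Cm (Cm e'' e') e)"
  proof (rule qtI)
    fix A H assume "free_model S T \<phi> X A H"
    then interpret M: free_model S T \<phi> X A H .
    show "ia A H (Cm e'' (Cm e' e)) = ia A H (Cm (Cm e'' e') e)"
      using cat_assoc[OF M.A.C M.ia_hom[OF e(1)], of "ia A H e'" _ "ia A H e''"] M.ia_hom[OF e'(1)] M.ia_hom[OF e''(1)] e' e'' by simp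
  qed (use e e' e'' in simp_all)
  then show ?case using e e' e'' by (simp add: FC_Comp)
qed

lemma extensional_FC: "extensional_cat FC" unfolding extensional_cat_def
proof (intro conjI allI impI)
  fix g f assume "\<not> (g \<in> Ar FC \<and> f \<in> Ar FC \<and> Cod FC f = Dom FC g)"
  then show "Comp FC g f = undefined" using FC_Dom FC_Cod by (auto simp: FC_def rp_qt(1) ok_okt)
qed (simp_all add: FC_def)

lemma pow_ObE:
  assumes "us \<in> Ob (pow_cat FC n)"
  obtains ts where "\<forall>t\<in>set ts. okt t" "length ts = n" "us = map cd ts"
proof -
  have "\<forall>u\<in>set us. okt (dc u) \<and> cd (dc u) = u" using assms by (auto simp: Ob_pow FC_def)
  then have "us = map cd (map dc us)" "\<forall>t\<in>set (map dc us). okt t" by (auto intro: nth_equalityI)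
  then show thesis using that[of "map dc us"] assms by (auto simp: Ob_pow)
qed

lemma pow_ArE:
  assumes "us \<in> Ar (pow_cat FC n)"
  obtains es where "\<forall>e\<in>set es. ok e" "length es = n" "us = map qt es"
proof -
  have "\<forall>u\<in>set us. ok (rp u) \<and> qt (rp u) = u" using assms rp_qt by (auto simp: Ar_pow FC_def)
  then have "us = map qt (map rp us)" "\<forall>t\<in>set (map rp us). ok t" by (auto intro: nth_equalityI)
  then show thesis using that[of "map rp us"] assms by (auto simp: Ar_pow)
qed

lemma pow_Ob: "\<forall>t\<in>set ts. okt t ==> length ts = n ==> map cd ts \<in> Ob (pow_cat FC n)" by (auto simp: Ob_pow FC_Ob)

lemma pow_Ar: "\<forall>e\<in>set es. ok e ==> length es = n ==> map qt es \<in> Ar (pow_cat FC n)" by (auto simp: Ar_pow FC_Ar)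

lemma map_cd_eq: "\<forall>t\<in>set ts. okt t ==> \<forall>t\<in>set ts'. okt t ==> map cd ts = map cd ts' \<longleftrightarrow> ts = ts'"
  using map_dc_cd by (metis list.map_comp)

lemma pow_homE:
  assumes "fs \<in> hom (pow_cat FC n) us vs"
  obtains es where "\<forall>e\<in>set es. ok e" "length es = n" "fs = map qt es" "us = map cd (map sr es)" "vs = map cd (map tg es)"
proof -
  obtain es where es: "\<forall>e\<in>set es. ok e" "length es = n" "fs = map qt es" using pow_ArE[OF hom_Ar[OF assms]] .
  then have "us = map cd (map sr es)" "vs = map cd (map tg es)" using hom_Dom[OF assms] hom_Cod[OF assms] by (auto simp: FC_Dom FC_Cod)
  with es that show thesis by blast
qed

definition FPhi :: "'t => ('u list, 'u list, 'u, 'u) functr" where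
  "FPhi = (\<lambda>w\<in>words T. \<lparr>fob = (\<lambda>us\<in>Ob (pow_cat FC (Dom T w)). cd (App w (map dc us))),
     far = (\<lambda>us\<in>Ar (pow_cat FC (Dom T w)). qt (Op w (map rp us)))\<rparr>)"

lemma FPhi_ob:
  "w \<in> words T ==> length ts = Dom T w ==> \<forall>t\<in>set ts. okt t ==> fob (FPhi w) (map cd ts) = cd (App w ts)"
  by (simp add: FPhi_def pow_Ob)

lemma FPhi_ar:
  assumes w: "w \<in> words T" and es: "length es = Dom T w" "\<forall>e\<in>set es. ok e"
  shows "far (FPhi w) (map qt es) = qt (Op w es)"
proof -
  have "qt (Op w (map rp (map qt es))) = qt (Op w es)"
  proof (rule qtI)
    fix A H assume "free_model S T \<phi> X A H"
    then interpret M: free_model S T \<phi> X A H .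
    have "map (ia A H) (map rp (map qt es)) = map (ia A H) es" using M.ceq_ia[OF rp_qt(3)] es by auto
    then show "ia A H (Op w (map rp (map qt es))) = ia A H (Op w es)" by (simp only: ia.simps)
  qed (use assms rp_qt(1) rp_sr_tg in auto)
  then show ?thesis using assms by (simp add: FPhi_def pow_Ar)
qed

lemma functor_FPhi:
  assumes w: "w \<in> words T"
  shows "is_functor (pow_cat FC (Dom T w)) FC (FPhi w)"
proof (rule is_functorI)
  let ?n = "Dom T w"
  show "category (pow_cat FC ?n)" "category FC" using category_FC category_pow by auto
  show "fob (FPhi w) \<in> extensional (Ob (pow_cat FC ?n))" "far (FPhi w) \<in> extensional (Ar (pow_cat FC ?n))"
    using w by (simp_all add: FPhi_def)
  fix us assume "us \<in> Ob (pow_cat FC ?n)"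
  then obtain ts where ts: "\<forall>t\<in>set ts. okt t" "length ts = ?n" "us = map cd ts" by (rule pow_ObE)
  show "fob (FPhi w) us \<in> Ob FC" using w ts by (simp add: FPhi_ob FC_Ob)
  have "map (Idt FC) us = map qt (map Ide ts)" using ts by (auto simp: FC_Idt)
  then have "far (FPhi w) (map (Idt FC) us) = qt (Op w (map Ide ts))" using w ts by (simp only:) (rule FPhi_ar, auto)
  \<comment> \<open>These are different expressions. They become equal in the quotient because the
    word \<open>w\<close> is interpreted by a functor in every model; the same holds for composites
    further down.\<close>
  also have "\<dots> = qt (Ide (App w ts))"
  proof (rule qtI)
    fix A H assume "free_model S T \<phi> X A H"
    then interpret M: free_model S T \<phi> X A H .
    have "map (ia A H) (map Ide ts) = map (Idt (Car A)) (map (io A H) ts)" by auto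
    then show "ia A H (Op w (map Ide ts)) = ia A H (Ide (App w ts))"
      using functor_id[OF M.A.Fun[OF w] M.io_list[OF ts(1,2)]] by (simp only: ia.simps io.simps pow_simps)
  qed (use w ts in \<open>simp_all add: comp_def\<close>)
  finally show "far (FPhi w) (Idt (pow_cat FC ?n) us) = Idt FC (fob (FPhi w) us)" using w ts by (simp add: FPhi_ob FC_Idt)
next
  let ?n = "Dom T w"
  fix fs us vs assume "fs \<in> hom (pow_cat FC ?n) us vs"
  then obtain es where es: "\<forall>e\<in>set es. ok e" "length es = ?n" "fs = map qt es" "us = map cd (map sr es)" "vs = map cd (map tg es)"
    by (rule pow_homE)
  have "fob (FPhi w) us = cd (App w (map sr es))" "fob (FPhi w) vs = cd (App w (map tg es))"
    unfolding es(4,5) using w es(1,2) ok_okt FPhi_ob[of w "map sr es"] FPhi_ob[of w "map tg es"] by auto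
  then show "far (FPhi w) fs \<in> hom FC (fob (FPhi w) us) (fob (FPhi w) vs)" using FC_hom[of "Op w es"] w es by (simp add: FPhi_ar)
  fix gs zs assume "gs \<in> hom (pow_cat FC ?n) vs zs"
  then obtain es' where es': "\<forall>e\<in>set es'. ok e" "length es' = ?n" "gs = map qt es'" "vs = map cd (map sr es')"
    by (rule pow_homE)
  \<comment> \<open>Equality of codes gives equality of the lists of terms, so that the
    representatives are composable entry by entry.\<close>
  have st: "map tg es = map sr es'" using es(5) es'(4) map_cd_eq[of "map tg es" "map sr es'"] es(1) es'(1) ok_okt by auto
  have sti: "tg (es ! i) = sr (es' ! i)" if "i < ?n" for i using arg_cong[OF st, of "\<lambda>xs. xs ! i"] that es(2) es'(2) by simp
  have oki: "ok (es ! i)" "ok (es' ! i)" if "i < ?n" for i using es(1,2) es'(1,2) that by auto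
  have okm: "\<forall>e\<in>set (map2 Cm es' es). ok e" using es(2) es'(2) sti oki by (auto simp: in_set_conv_nth simp del: in_set_zip)
  have "map2 (Comp FC) gs fs = map qt (map2 Cm es' es)" using es es' sti by (auto intro!: nth_equalityI simp: FC_Comp)
  then have "far (FPhi w) (map2 (Comp FC) gs fs) = qt (Op w (map2 Cm es' es))" using w es(2) es'(2) okm by (simp only:) (rule FPhi_ar, auto)
  also have "\<dots> = qt (Cm (Op w es') (Op w es))"
  proof (rule qtI)
    fix A H assume "free_model S T \<phi> X A H"
    then interpret M: free_model S T \<phi> X A H .
    have "map (ia A H) (map2 Cm es' es) = map2 (Comp (Car A)) (map (ia A H) es') (map (ia A H) es)"
      using es es' by (auto intro!: nth_equalityI)
    then show "ia A H (Op w (map2 Cm es' es)) = ia A H (Cm (Op w es') (Op w es))"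
      using functor_comp[OF M.A.Fun[OF w] M.io_pow_hom[OF es(1,2)], of "map (ia A H) es'"] M.io_pow_hom[OF es'(1,2)]
      unfolding st by (simp only: ia.simps pow_simps)
  next
    show "ok (Op w (map2 Cm es' es))" using w es(2) es'(2) okm by simp
    show "sr (Op w (map2 Cm es' es)) = sr (Cm (Op w es') (Op w es))" "tg (Op w (map2 Cm es' es)) = tg (Cm (Op w es') (Op w es))"
      using es es' by (auto intro!: nth_equalityI)
  qed (use w es es' st in simp_all)
  finally show "far (FPhi w) (Comp (pow_cat FC ?n) gs fs) = Comp FC (far (FPhi w) gs) (far (FPhi w) fs)"
    using w es es' st by (simp add: FPhi_ar FC_Comp)
qed

lemma Gi_Gn:
  assumes g: "okg g"
  shows "Comp FC (qt (Gi g)) (qt (Gn g)) = Idt FC (cd (gs g))" "Comp FC (qt (Gn g)) (qt (Gi g)) = Idt FC (cd (gt g))"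
proof -
  have "qt (Cm (Gi g) (Gn g)) = qt (Ide (gs g))"
  proof (rule qtI)
    fix A H assume "free_model S T \<phi> X A H"
    then interpret M: free_model S T \<phi> X A H .
    show "ia A H (Cm (Gi g) (Gn g)) = ia A H (Ide (gs g))" using M.ig_hom[OF g] inverse_ar(2)[of "Car A"] by auto
  qed (use g okg_okt in simp_all)
  then show "Comp FC (qt (Gi g)) (qt (Gn g)) = Idt FC (cd (gs g))" using g okg_okt by (simp add: FC_Comp FC_Idt)
  have "qt (Cm (Gn g) (Gi g)) = qt (Ide (gt g))"
  proof (rule qtI)
    fix A H assume "free_model S T \<phi> X A H"
    then interpret M: free_model S T \<phi> X A H .
    show "ia A H (Cm (Gn g) (Gi g)) = ia A H (Ide (gt g))" using M.ig_hom[OF g] inverse_ar(3)[of "Car A"] by auto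
  qed (use g okg_okt in simp_all)
  then show "Comp FC (qt (Gn g)) (qt (Gi g)) = Idt FC (cd (gt g))" using g okg_okt by (simp add: FC_Comp FC_Idt)
qed

lemma iso_Gn: "okg g ==> iso FC (qt (Gn g))"
  using FC_hom[of "Gn g"] FC_hom[of "Gi g"] Gi_Gn by (intro isoI[of _ _ "cd (gs g)" "cd (gt g)" "qt (Gi g)"]) auto

text \<open>A functor preserves inverses and inverses are unique, so its values on inverse
  generators are determined by those on generators. This settles the \<open>Gi\<close> case in the
  inductions over expressions.\<close>

lemma functor_Gi:
  assumes F: "is_functor FC D F" and g: "okg g"
  shows "far F (qt (Gi g)) = inverse_ar D (far F (qt (Gn g)))"
proof -
  have o: "cd (gs g) \<in> Ob FC" "cd (gt g) \<in> Ob FC" using okg_okt[OF g] FC_Ob by auto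
  have h: "qt (Gn g) \<in> hom FC (cd (gs g)) (cd (gt g))" "qt (Gi g) \<in> hom FC (cd (gt g)) (cd (gs g))"
    using FC_hom[of "Gn g"] FC_hom[of "Gi g"] g by simp_all
  show ?thesis by (rule inverse_ar_unique[OF functor_cat(2)[OF F] functor_hom[OF F h(1)] functor_hom[OF F h(2)]])
      (simp_all add: functor_comp[OF F h, symmetric] functor_comp[OF F h(2,1), symmetric] Gi_Gn[OF g] functor_id[OF F] o)
qed

definition FA :: "('t, 'u, 'u) psalg" where
  "FA = \<lparr>Car = FC, Phi = FPhi, CC = (\<lambda>(w, ws)\<in>cwords T. \<lparr>nsrc = FPhi (gamma_word T w ws),
       ntgt = gamma_fun FC (map (Dom T) ws) (FPhi w) (map FPhi ws),
       ncomp = (\<lambda>us\<in>Ob (pow_cat FC (sum_list (map (Dom T) ws))). qt (Gn (GC w ws (map dc us))))\<rparr>),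
     II = \<lparr>nsrc = FPhi (unit_word T), ntgt = unit_fun FC,
       ncomp = (\<lambda>us\<in>Ob (pow_cat FC 1). qt (Gn (GI (dc (hd us)))))\<rparr>,
     SS = (\<lambda>(w, l, f)\<in>swords T. \<lparr>nsrc = FPhi (subst_word T w l f), ntgt = subst_fun FC (FPhi w) l f,
       ncomp = (\<lambda>us\<in>Ob (pow_cat FC l). qt (Gn (GS w l f (map dc us))))\<rparr>)\<rparr>"

lemma FA_simps [simp]: "Car FA = FC" "Phi FA = FPhi" by (simp_all add: FA_def)

lemma FA_pc: "(w, ws) \<in> cwords T ==> length ts = sum_list (map (Dom T) ws) ==> \<forall>t\<in>set ts. okt t ==>
    pc FA w ws (map cd ts) = qt (Gn (GC w ws ts))" by (simp add: FA_def pow_Ob)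

lemma FA_pI: "okt t ==> ncomp (II FA) [cd t] = qt (Gn (GI t))" using pow_Ob[of "[t]" 1] by (simp add: FA_def One_nat_def)

lemma FA_ps: "(w, l, f) \<in> swords T ==> length ts = l ==> \<forall>t\<in>set ts. okt t ==>
    ps FA w l f (map cd ts) = qt (Gn (GS w l f ts))" by (simp add: FA_def pow_Ob)

lemma map2_FPhi_ob:
  assumes "set ws \<subseteq> words T" "length ts = sum_list (map (Dom T) ws)" "\<forall>t\<in>set ts. okt t"
  shows "map2 (\<lambda>w. fob (FPhi w)) ws (blocks (map (Dom T) ws) (map cd ts)) = map cd (map2 App ws (blocks (map (Dom T) ws) ts))"
proof (rule nth_equalityI)
  fix i assume "i < length (map2 (\<lambda>w. fob (FPhi w)) ws (blocks (map (Dom T) ws) (map cd ts)))"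
  then have i: "i < length ws" by simp
  then show "map2 (\<lambda>w. fob (FPhi w)) ws (blocks (map (Dom T) ws) (map cd ts)) ! i
    = map cd (map2 App ws (blocks (map (Dom T) ws) ts)) ! i"
    using okt_blocks[OF assms i] assms(1) by (simp add: blocks_map FPhi_ob subset_iff)
qed simp

lemma ok_blocks:
  assumes "set ws \<subseteq> words T" "length es = sum_list (map (Dom T) ws)" "\<forall>e\<in>set es. ok e" "i < length ws"
  shows "ok (Op (ws ! i) (blocks (map (Dom T) ws) es ! i))" "length (blocks (map (Dom T) ws) es ! i) = Dom T (ws ! i)"
    "\<forall>e\<in>set (blocks (map (Dom T) ws) es ! i). ok e"
  using assms set_blocks[of i "map (Dom T) ws" es] length_blocks_nth[OF assms(2), of i] by (auto simp: subset_iff)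

lemma map2_FPhi_ar:
  assumes "set ws \<subseteq> words T" "length es = sum_list (map (Dom T) ws)" "\<forall>e\<in>set es. ok e"
  shows "map2 (\<lambda>w. far (FPhi w)) ws (blocks (map (Dom T) ws) (map qt es))
    = map qt (map2 Op ws (blocks (map (Dom T) ws) es))" "\<forall>e\<in>set (map2 Op ws (blocks (map (Dom T) ws) es)). ok e"
proof (rule nth_equalityI)
  fix i assume "i < length (map2 (\<lambda>w. far (FPhi w)) ws (blocks (map (Dom T) ws) (map qt es)))"
  then have i: "i < length ws" by simp
  then show "map2 (\<lambda>w. far (FPhi w)) ws (blocks (map (Dom T) ws) (map qt es)) ! i
    = map qt (map2 Op ws (blocks (map (Dom T) ws) es)) ! i"
    using ok_blocks[OF assms i] assms(1) by (simp add: blocks_map FPhi_ar subset_iff)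
qed (use ok_blocks(1)[OF assms] in \<open>auto simp: in_set_conv_nth\<close>)

text \<open>The coherence transformations have the generators as components. They are invertible
  because of \<open>Gi\<close>, and natural because their values in each model are components of
  natural transformations.\<close>

lemma alg_data_FA: "alg_data T FA" unfolding alg_data_def
proof (intro conjI ballI, safe)
  show "category (Car FA)" "extensional_cat (Car FA)" by (simp_all add: category_FC extensional_FC)
  show "Phi FA \<in> extensional (words T)" "CC FA \<in> extensional (cwords T)" "SS FA \<in> extensional (swords T)"
    by (simp_all add: FA_def FPhi_def)
  show "is_functor (pow_cat (Car FA) (Dom T w)) (Car FA) (Phi FA w)" if "w \<in> words T" for w using functor_FPhi[OF that] by simp
next
  fix w ws assume w: "(w, ws) \<in> cwords T"
  let ?ns = "map (Dom T) ws" let ?n = "sum_list ?ns"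
  let ?F = "gamma_fun FC ?ns (FPhi w) (map FPhi ws)"
  let ?g = "gamma_word T w ws"
  let ?c = "CC FA (w, ws)"
  note w' = cwords_words[OF w] and g = gamma_words_T[OF w]
  have Fi: "is_functor (pow_cat FC (?ns ! i)) FC (map FPhi ws ! i)" if "i < length ?ns" for i
    using functor_FPhi[of "ws ! i"] that w'(3) by (simp add: subset_iff)
  have GF: "is_functor (pow_cat FC ?n) FC ?F"
    using functor_gamma_fun[OF category_FC _ _ Fi, of "FPhi w"] functor_FPhi[OF w'(1)] w'(2) by simp
  have src: "nsrc ?c = FPhi ?g" "ntgt ?c = ?F" using w by (simp_all add: FA_def)
  \<comment> \<open>\<open>go\<close> and \<open>ga\<close> evaluate the target functor on coded
    terms and on classes of expressions; on terms the result is the formal target of the generator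
    \<open>GC w ws ts\<close>.\<close>
  have go: "fob ?F (map cd ts) = cd (App w (map2 App ws (blocks ?ns ts)))"
    if ts: "\<forall>t\<in>set ts. okt t" "length ts = ?n" for ts
    using pow_Ob[OF ts] map2_FPhi_ob[OF w'(3) ts(2,1)] okt_blocks(1)[OF w'(3) ts(2,1)] w'
    by (simp add: map2_map1 del: map_map) (rule FPhi_ob, auto simp: in_set_conv_nth)
  have ga: "far ?F (map qt es) = qt (Op w (map2 Op ws (blocks ?ns es)))"
    if es: "\<forall>e\<in>set es. ok e" "length es = ?n" for es using pow_Ar[OF es] map2_FPhi_ar[OF w'(3) es(2,1)] w'
    by (simp add: map2_map1 del: map_map) (rule FPhi_ar, auto)
  show "nat_iso (pow_cat (Car FA) ?n) (Car FA) ?c (Phi FA ?g) (gamma_fun (Car FA) ?ns (Phi FA w) (map (Phi FA) ws))" unfolding FA_simps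
  proof (rule nat_isoI[OF is_natI])
    show "is_functor (pow_cat FC ?n) FC (nsrc ?c)" "is_functor (pow_cat FC ?n) FC (ntgt ?c)"
      using functor_FPhi[OF g(1)] GF unfolding src by (simp_all add: g)
    show "ncomp ?c \<in> extensional (Ob (pow_cat FC ?n))" using w by (simp add: FA_def)
    fix us assume "us \<in> Ob (pow_cat FC ?n)"
    then obtain ts where ts: "\<forall>t\<in>set ts. okt t" "length ts = ?n" "us = map cd ts" by (rule pow_ObE)
    have okg: "okg (GC w ws ts)" using w ts by simp
    show "ncomp ?c us \<in> hom FC (fob (nsrc ?c) us) (fob (ntgt ?c) us)"
      using FC_hom[of "Gn (GC w ws ts)"] okg unfolding src ts(3) go[OF ts(1,2)] by (simp add: FA_pc[OF w ts(2,1)] FPhi_ob[OF g(1)] g ts)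
    show "iso FC (ncomp ?c us)" using iso_Gn[OF okg] by (simp add: ts(3) FA_pc[OF w ts(2,1)])
  next
    fix fs us vs assume "fs \<in> hom (pow_cat FC ?n) us vs"
    then obtain es where es: "\<forall>e\<in>set es. ok e" "length es = ?n" "fs = map qt es" "us = map cd (map sr es)" "vs = map cd (map tg es)"
      by (rule pow_homE)
      let ?es = "map2 Op ws (blocks ?ns es)"
      let ?l = "Cm (Gn (GC w ws (map tg es))) (Op ?g es) :: ('s, 't, 'u) ex"
      let ?r = "Cm (Op w ?es) (Gn (GC w ws (map sr es)))"
    have s: "\<forall>t\<in>set (map sr es). okt t" "length (map sr es) = ?n" and t: "\<forall>t\<in>set (map tg es). okt t" "length (map tg es) = ?n"
      using es ok_okt by auto
    have oke: "ok (Op ?g es)" "ok (Op w ?es)" using es g w' map2_FPhi_ar(2)[OF w'(3) es(2,1)] by auto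
    have st: "map sr ?es = map2 App ws (blocks ?ns (map sr es))"
      "map tg ?es = map2 App ws (blocks ?ns (map tg es))" by (auto intro!: nth_equalityI simp: blocks_map)
    have "qt ?l = qt ?r"
    proof (rule qtI)
      fix A H assume "free_model S T \<phi> X A H"
      then interpret M: free_model S T \<phi> X A H .
      have "map (ia A H) ?es = map2 (pa A) ws (blocks ?ns (map (ia A H) es))" by (auto intro!: nth_equalityI simp: blocks_map)
      then show "ia A H ?l = ia A H ?r" using M.A.pc_natural[OF w M.io_pow_hom[OF es(1,2)]] by (simp only: ia.simps ig.simps)
    qed (use oke w s t st in \<open>auto simp del: map_map simp: list.map_comp\<close>)
    moreover have "Comp FC (pc FA w ws vs) (far (FPhi ?g) fs) = qt ?l"
      unfolding es(3,5) FA_pc[OF w t(2,1)] using oke(1) g w t es(1,2) by (subst FPhi_ar) (auto intro!: FC_Comp)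
    moreover have "Comp FC (far ?F fs) (pc FA w ws us) = qt ?r"
      unfolding es(3,4) FA_pc[OF w s(2,1)] ga[OF es(1,2)] using oke(2) w s st by (intro FC_Comp) auto
    ultimately show "Comp FC (ncomp ?c vs) (far (nsrc ?c) fs) = Comp FC (far (ntgt ?c) fs) (ncomp ?c us)" unfolding src by simp
  qed (simp_all add: src)
next
  have src: "nsrc (II FA) = FPhi (unit_word T)" "ntgt (II FA) = unit_fun FC" by (simp_all add: FA_def)
  show "nat_iso (pow_cat (Car FA) 1) (Car FA) (II FA) (Phi FA (unit_word T)) (unit_fun (Car FA))" unfolding FA_simps
  proof (rule nat_isoI[OF is_natI])
    show "is_functor (pow_cat FC 1) FC (nsrc (II FA))" "is_functor (pow_cat FC 1) FC (ntgt (II FA))"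
      using functor_FPhi[OF unit_words_T(1)] functor_unit_fun[OF category_FC] unfolding src by (simp_all add: unit_words_T)
    show "ncomp (II FA) \<in> extensional (Ob (pow_cat FC 1))" by (simp add: FA_def)
    fix us assume us: "us \<in> Ob (pow_cat FC 1)"
    then obtain ts where "\<forall>t\<in>set ts. okt t" "length ts = 1" "us = map cd ts" by (rule pow_ObE)
    then obtain t where t: "okt t" "us = [cd t]" by (cases ts) (auto simp: One_nat_def)
    show "ncomp (II FA) us \<in> hom FC (fob (nsrc (II FA)) us) (fob (ntgt (II FA)) us)"
      using FC_hom[of "Gn (GI t)"] FPhi_ob[OF unit_words_T(1), of "[t]"] us unfolding src t(2)
      by (simp add: FA_pI[OF t(1)] t(1) unit_words_T One_nat_def[symmetric])
    show "iso FC (ncomp (II FA) us)" using iso_Gn[of "GI t"] t by (simp add: FA_pI)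
  next
    fix fs us vs assume fs: "fs \<in> hom (pow_cat FC 1) us vs"
    then obtain es where "\<forall>e\<in>set es. ok e" "length es = 1" "fs = map qt es" "us = map cd (map sr es)" "vs = map cd (map tg es)"
      by (rule pow_homE)
    then obtain e where e: "ok e" "fs = [qt e]" "us = [cd (sr e)]" "vs = [cd (tg e)]" by (cases es) (auto simp: One_nat_def)
    have o: "ok (Op (unit_word T) [e])" using e unit_words_T by (simp add: One_nat_def)
    have "qt (Cm (Gn (GI (tg e))) (Op (unit_word T) [e])) = qt (Cm e (Gn (GI (sr e))))"
    proof (rule qtI)
      fix A H assume "free_model S T \<phi> X A H"
      then interpret M: free_model S T \<phi> X A H .
      show "ia A H (Cm (Gn (GI (tg e))) (Op (unit_word T) [e])) = ia A H (Cm e (Gn (GI (sr e))))"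
        using M.A.pI_natural[OF M.ia_hom[OF e(1)]] by simp
    qed (use o e ok_okt in simp_all)
    moreover have "far (FPhi (unit_word T)) [qt e] = qt (Op (unit_word T) [e])" using FPhi_ar[OF unit_words_T(1), of "[e]"] e o by simp
    ultimately show "Comp FC (ncomp (II FA) vs) (far (nsrc (II FA)) fs) = Comp FC (far (ntgt (II FA)) fs) (ncomp (II FA) us)"
      unfolding src using e o ok_okt hom_Ar[OF fs] by (simp add: FA_pI FC_Comp)
  qed (simp_all add: src)
next
  fix w l f assume w: "(w, l, f) \<in> swords T"
  note w' = swords_words[OF w] and g = subst_words_T[OF w]
  let ?F = "subst_fun FC (FPhi w) l f"
  let ?g = "subst_word T w l f"
  let ?c = "SS FA (w, l, f)"
  have SF: "is_functor (pow_cat FC l) FC ?F"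
    using functor_subst_fun[OF _ category_FC w'(3), of FC "FPhi w"] functor_FPhi[OF w'(1)] w'(2) by simp
  have src: "nsrc ?c = FPhi ?g" "ntgt ?c = ?F" using w by (simp_all add: FA_def)
  have go: "fob ?F (map cd ts) = cd (App w (map ((!) ts) f))"
    if ts: "\<forall>t\<in>set ts. okt t" "length ts = l" for ts
  proof -
    have "map ((!) (map cd ts)) f = map cd (map ((!) ts) f)" using w'(3) ts by (auto simp: subset_iff)
    then show ?thesis using pow_Ob[OF ts] w' ts by (simp del: map_map) (rule FPhi_ob, auto simp: subset_iff)
  qed
  have ga: "far ?F (map qt es) = qt (Op w (map ((!) es) f))"
    if es: "\<forall>e\<in>set es. ok e" "length es = l" for es
  proof -
    have "map ((!) (map qt es)) f = map qt (map ((!) es) f)" using w'(3) es by (auto simp: subset_iff)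
    then show ?thesis using pow_Ar[OF es] w' es by (simp del: map_map) (rule FPhi_ar, auto simp: subset_iff)
  qed
  show "nat_iso (pow_cat (Car FA) l) (Car FA) ?c (Phi FA ?g) (subst_fun (Car FA) (Phi FA w) l f)" unfolding FA_simps
  proof (rule nat_isoI[OF is_natI])
    show "is_functor (pow_cat FC l) FC (nsrc ?c)" "is_functor (pow_cat FC l) FC (ntgt ?c)"
      using functor_FPhi[OF g(1)] SF unfolding src by (simp_all add: g)
    show "ncomp ?c \<in> extensional (Ob (pow_cat FC l))" using w by (simp add: FA_def)
    fix us assume "us \<in> Ob (pow_cat FC l)"
    then obtain ts where ts: "\<forall>t\<in>set ts. okt t" "length ts = l" "us = map cd ts" by (rule pow_ObE)
    have okg: "okg (GS w l f ts)" using w ts by simp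
    show "ncomp ?c us \<in> hom FC (fob (nsrc ?c) us) (fob (ntgt ?c) us)"
      using FC_hom[of "Gn (GS w l f ts)"] okg unfolding src ts(3) go[OF ts(1,2)] by (simp add: FA_ps[OF w ts(2,1)] FPhi_ob[OF g(1)] g ts)
    show "iso FC (ncomp ?c us)" using iso_Gn[OF okg] by (simp add: ts(3) FA_ps[OF w ts(2,1)])
  next
    fix fs us vs assume "fs \<in> hom (pow_cat FC l) us vs"
    then obtain es where es: "\<forall>e\<in>set es. ok e" "length es = l" "fs = map qt es" "us = map cd (map sr es)" "vs = map cd (map tg es)"
      by (rule pow_homE)
      let ?l = "Cm (Gn (GS w l f (map tg es))) (Op ?g es) :: ('s, 't, 'u) ex"
      let ?r = "Cm (Op w (map ((!) es) f)) (Gn (GS w l f (map sr es))) :: ('s, 't, 'u) ex"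
    have s: "\<forall>t\<in>set (map sr es). okt t" "length (map sr es) = l" and t: "\<forall>t\<in>set (map tg es). okt t" "length (map tg es) = l"
      using es ok_okt by auto
    have oke: "ok (Op ?g es)" "ok (Op w (map ((!) es) f))" using es g w' by (auto simp: subset_iff)
    have st: "map sr (map ((!) es) f) = map ((!) (map sr es)) f" "map tg (map ((!) es) f) = map ((!) (map tg es)) f"
      using w'(3) es by (auto simp: subset_iff)
    have "qt ?l = qt ?r"
    proof (rule qtI)
      fix A H assume "free_model S T \<phi> X A H"
      then interpret M: free_model S T \<phi> X A H .
      have "map (ia A H) (map ((!) es) f) = map ((!) (map (ia A H) es)) f" using w'(3) es by (auto simp: subset_iff)
      then show "ia A H ?l = ia A H ?r" using M.A.ps_natural[OF w M.io_pow_hom[OF es(1,2)]] by (simp only: ia.simps ig.simps)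
    qed (use oke w s t st in \<open>auto simp del: map_map\<close>)
    moreover have "Comp FC (ps FA w l f vs) (far (FPhi ?g) fs) = qt ?l"
      unfolding es(3,5) FA_ps[OF w t(2,1)] using oke(1) g w t es(1,2) by (subst FPhi_ar) (auto intro!: FC_Comp)
    moreover have "Comp FC (far ?F fs) (ps FA w l f us) = qt ?r"
      unfolding es(3,4) FA_ps[OF w s(2,1)] ga[OF es(1,2)] using oke(2) w s st by (intro FC_Comp) (auto simp del: map_map)
    ultimately show "Comp FC (ncomp ?c vs) (far (nsrc ?c) fs) = Comp FC (far (ntgt ?c) fs) (ncomp ?c us)" unfolding src by simp
  qed (simp_all add: src)
qed

end

section \<open>Coherence axioms of the free algebra, and the universal morphism\<close>

context free_alg
begin

lemma FC_Comp': "ok (Cm g f) ==> Comp FC (qt g) (qt f) = qt (Cm g f)" by (simp add: FC_Comp)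

lemma ok_CmI: "ok f ==> ok g ==> tg f = sr g ==> ok (Cm g f)" by simp

lemma okt_map2_App:
  assumes "set ws \<subseteq> words T" "length ts = sum_list (map (Dom T) ws)" "\<forall>t\<in>set ts. okt t"
  shows "\<forall>t\<in>set (map2 App ws (blocks (map (Dom T) ws) ts)). okt t"
  using okt_blocks(1)[OF assms] by (auto simp: in_set_conv_nth simp del: in_set_zip)

text \<open>In every case the numbered facts rewrite the arrows of the axiom as classes of
  expressions. It remains to see that the two composites are well formed and parallel, which uses
  the equations between words and the identities on blocks, now for lists of terms; in a model they
  are equal by the axiom for \<open>A\<close>.\<close>

lemma alg_eqs_FA: "alg_eqs T FA" unfolding alg_eqs_def FA_simps
proof (intro conjI ballI allI impI, safe, goal_cases)
  case (1 w ws wss us)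
    note w = 1(1) and us = 1(2) and l = 1(3) and wj = 1(4)
  let ?ns = "map (Dom T) (concat wss)" and ?ms = "map (\<lambda>vs. sum_list (map (Dom T) vs)) wss"
  have wj': "\<And>j. j < length ws ==> (ws ! j, wss ! j) \<in> cwords T" using wj by blast
  note A = gamma_word_assoc[OF T w l wj']
  note w' = cwords_words[OF w]
  have sc: "set (concat wss) \<subseteq> words T" "length (concat wss) = sum_list (map (Dom T) ws)"
    using cwordsD[OF A(1)] gamma_words_T[OF w] by auto
  have lj: "length (wss ! j) = Dom T (ws ! j)" if "j < length ws" for j using cwordsD[OF wj'[OF that]] by auto
  obtain ts where ts: "\<forall>t\<in>set ts. okt t" "length ts = sum_list ?ns" "us = map cd ts" using pow_ObE[OF us] .
  have ts': "length ts = sum_list ?ms" using ts(2) by (simp add: sum_list_concat)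
  let ?ts' = "map2 App (concat wss) (blocks ?ns ts)"
  have okt': "\<forall>t\<in>set ?ts'. okt t" by (rule okt_map2_App[OF sc(1) ts(2,1)])
  have lt': "length ?ts' = sum_list (map (Dom T) ws)" using sc(2) by simp
  have bj: "length (blocks ?ms ts ! j) = sum_list (map (Dom T) (wss ! j))" "\<forall>t\<in>set (blocks ?ms ts ! j). okt t"
    if "j < length ws" for j using length_blocks_nth[OF ts', of j] set_blocks[of j ?ms ts] that l ts(1) by auto
  let ?gs = "map (\<lambda>j. Gn (GC (ws ! j) (wss ! j) (blocks ?ms ts ! j)) :: ('s, 't, 'u) ex) [0..<length ws]"
  let ?r1 = "Gn (GC w (map2 (gamma_word T) ws wss) ts) :: ('s, 't, 'u) ex"
  let ?r = "Cm (Op w ?gs) ?r1"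
  let ?l = "Cm (Gn (GC w ws ?ts')) (Gn (GC (gamma_word T w ws) (concat wss) ts)) :: ('s, 't, 'u) ex"
  have okgs: "\<forall>e\<in>set ?gs. ok e" using wj' bj by auto
  have 1: "pc FA w ws (map2 (\<lambda>w. fob (FPhi w)) (concat wss) (blocks ?ns us)) = qt (Gn (GC w ws ?ts'))"
    unfolding ts(3) map2_FPhi_ob[OF sc(1) ts(2,1)] by (rule FA_pc[OF w lt' okt'])
  have 2: "pc FA (gamma_word T w ws) (concat wss) us = qt (Gn (GC (gamma_word T w ws) (concat wss) ts))"
    unfolding ts(3) by (rule FA_pc[OF A(1) ts(2,1)])
  have m3: "map (\<lambda>j. pc FA (ws ! j) (wss ! j) (blocks ?ms us ! j)) [0..<length ws] = map qt ?gs"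
    unfolding ts(3) using l bj FA_pc[OF wj'] by (auto simp: blocks_map)
  have 3: "far (FPhi w) (map (\<lambda>j. pc FA (ws ! j) (wss ! j) (blocks ?ms us ! j)) [0..<length ws]) = qt (Op w ?gs)"
    unfolding m3 by (rule FPhi_ar[OF w'(1) _ okgs]) (simp add: w'(2))
  have 4: "pc FA w (map2 (gamma_word T) ws wss) us = qt ?r1" unfolding ts(3) by (rule FA_pc[OF A(2) _ ts(1)]) (simp_all only: A(3) ts')
  have o1: "ok ?l" using w A(1) lt' okt' ts by simp
  have m: "map2 App (map2 (gamma_word T) ws wss) (blocks ?ms ts) = map sr ?gs" using l by (intro nth_equalityI) auto
  have "ok ?r1" using A(2,3) ts(1) ts' by (simp only: ok.simps okg.simps)
  moreover have "ok (Op w ?gs)" using w' okgs by simp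
  moreover have "tg ?r1 = sr (Op w ?gs)" by (simp only: tg.simps sr.simps gt.simps A(3) m)
  ultimately have o2: "ok ?r" using ok_CmI by blast
  have "qt ?l = qt ?r"
  proof (rule qtI[OF o1 o2])
    \<comment> \<open>The source terms consist of the same list under two words that are equal by
      associativity of \<open>gamma_word\<close>. The targets agree by associativity of formal
      application, an instance of \<open>blocks_assoc\<close>.\<close>
    show "sr ?l = sr ?r" by (simp add: A(4))
    have "map2 App ws (blocks (map (Dom T) ws) ?ts') = map tg ?gs"
      using l by (subst blocks_assoc[OF l lj ts(2)]) (auto intro!: nth_equalityI)
    then show "tg ?l = tg ?r" by (simp only: tg.simps gt.simps)
    fix A' H assume "free_model S T \<phi> X A' H"
    then interpret M: free_model S T \<phi> X A' H .
    have "map (ia A' H) ?gs = map (\<lambda>j. pc A' (ws ! j) (wss ! j) (blocks ?ms (map (io A' H) ts) ! j)) [0..<length ws]"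
      using l by (auto simp: blocks_map)
    then show "ia A' H ?l = ia A' H ?r" using M.A.ax_assoc[OF w l wj' M.io_list[OF ts(1,2)]] by (simp only: ia.simps ig.simps map_io_App)
  qed
  then show ?case unfolding 1 2 3 4 unfolding FC_Comp'[OF o1] FC_Comp'[OF o2] .
next
  case (2 w us)
    note w = 2(1) and us = 2(2)
  obtain ts where ts: "\<forall>t\<in>set ts. okt t" "length ts = Dom T w" "us = map cd ts" using pow_ObE[OF us] .
  let ?u = "replicate (Dom T w) (unit_word T)"
  note c = cwords_unit_right[OF T w]
  have d: "map (Dom T) ?u = replicate (Dom T w) 1" by (simp only: map_replicate unit_words_T)
  have s: "sum_list (map (Dom T) ?u) = Dom T w" unfolding d by (simp add: sum_list_replicate)
  let ?gs = "map (\<lambda>t. Gn (GI t) :: ('s, 't, 'u) ex) ts"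
  let ?l = "Cm (Op w ?gs) (Gn (GC w ?u ts))"
  have okgs: "\<forall>e\<in>set ?gs. ok e" using ts by auto
  have 1: "far (FPhi w) (map (\<lambda>x. ncomp (II FA) [x]) us) = qt (Op w ?gs)"
  proof -
    have "map (\<lambda>x. ncomp (II FA) [x]) us = map qt ?gs" unfolding ts(3) using ts(1) by (auto simp: FA_pI)
    then show ?thesis using FPhi_ar[OF w _ okgs] ts(2) by simp
  qed
  have 2: "pc FA w ?u us = qt (Gn (GC w ?u ts))" unfolding ts(3) by (rule FA_pc[OF c _ ts(1)]) (simp only: s ts(2))
  have m: "map2 App ?u (blocks (map (Dom T) ?u) ts) = map sr ?gs"
    unfolding d using ts(2) by (intro nth_equalityI) (auto simp: blocks_replicate_1)
  have "ok (Gn (GC w ?u ts))" using c s ts by (simp only: ok.simps okg.simps)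
  moreover have "ok (Op w ?gs)" using w okgs ts(2) by simp
  moreover have "tg (Gn (GC w ?u ts)) = sr (Op w ?gs)" by (simp only: tg.simps sr.simps gt.simps m)
  ultimately have o1: "ok ?l" using ok_CmI by blast
  have o2: "ok (Ide (App w ts))" using w ts by simp
  have "qt ?l = qt (Ide (App w ts))"
  proof (rule qtI[OF o1 o2])
    fix A' H assume "free_model S T \<phi> X A' H"
    then interpret M: free_model S T \<phi> X A' H .
    have "map (ia A' H) ?gs = map (\<lambda>x. ncomp (II A') [x]) (map (io A' H) ts)" by simp
    then show "ia A' H ?l = ia A' H (Ide (App w ts))"
      using M.A.ax_unit_right[OF w M.io_list[OF ts(1,2)]] by (simp only: ia.simps ig.simps io.simps)
  qed (simp_all add: gamma_word_unit_right[OF T w] comp_def)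
  then show ?case unfolding 1 2 using o1 o2 by (simp add: ts(3) FPhi_ob[OF w ts(2,1)] FC_Idt FC_Comp)
next
  case (3 w us)
    note w = 3(1) and us = 3(2)
  obtain ts where ts: "\<forall>t\<in>set ts. okt t" "length ts = Dom T w" "us = map cd ts" using pow_ObE[OF us] .
  let ?l = "Cm (Gn (GI (App w ts))) (Gn (GC (unit_word T) [w] ts)) :: ('s, 't, 'u) ex"
  note c = cwords_unit_left[OF T w]
  have o2: "okt (App w ts)" using w ts by simp
  have 1: "ncomp (II FA) [fob (FPhi w) us] = qt (Gn (GI (App w ts)))" unfolding ts(3) FPhi_ob[OF w ts(2,1)] by (rule FA_pI[OF o2])
  have 2: "pc FA (unit_word T) [w] us = qt (Gn (GC (unit_word T) [w] ts))" unfolding ts(3) by (rule FA_pc[OF c _ ts(1)]) (simp add: ts(2))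
  have o1: "ok ?l" using c ts o2 by simp
  have "qt ?l = qt (Ide (App w ts))"
  proof (rule qtI[OF o1])
    fix A' H assume "free_model S T \<phi> X A' H"
    then interpret M: free_model S T \<phi> X A' H .
    show "ia A' H ?l = ia A' H (Ide (App w ts))" using M.A.ax_unit_left[OF w M.io_list[OF ts(1,2)]] by simp
  qed (use o2 gamma_word_unit_left[OF T w] in simp_all)
  then show ?case unfolding 1 2 using o1 o2 by (simp add: ts(3) FPhi_ob[OF w ts(2,1)] FC_Idt FC_Comp)
next
  case (4 w l f ws us)
    note w = 4(1) and us = 4(2) and ws = 4(3)
  let ?ns = "map (Dom T) ws" let ?n = "sum_list ?ns" let ?fb = "block_map ?ns f" let ?wf = "map ((!) ws) f"
  note A = gamma_word_subst[OF T w refl ws]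
  have f: "set f \<subseteq> {..<length ws}" using A(4) by simp
  obtain ts where ts: "\<forall>t\<in>set ts. okt t" "length ts = ?n" "us = map cd ts" using pow_ObE[OF us] .
  note fb = set_block_map[OF A(4)] and lfb = length_block_map[OF A(4)]
  have mf: "map ((!) (map h ts)) ?fb = map h (map ((!) ts) ?fb)" for h :: "('t, 'u) tm => 'u" using fb ts(2) by (auto simp: subset_iff)
  let ?tf = "map ((!) ts) ?fb"
  have tf: "\<forall>t\<in>set ?tf. okt t" "length ?tf = sum_list (map (Dom T) ?wf)"
    using fb ts(1,2) lfb unfolding A(3) by (auto simp: subset_iff simp del: map_map)
  let ?ts' = "map2 App ws (blocks ?ns ts)"
  let ?l = "Cm (Gn (GC w ?wf ?tf)) (Gn (GS (gamma_word T w ?wf) ?n ?fb ts)) :: ('s, 't, 'u) ex"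
  let ?r = "Cm (Gn (GS w (length ws) f ?ts')) (Gn (GC (subst_word T w (length ws) f) ws ts)) :: ('s, 't, 'u) ex"
  have okt': "\<forall>t\<in>set ?ts'. okt t" by (rule okt_map2_App[OF ws ts(2,1)])
  have 1: "pc FA w ?wf (map ((!) us) ?fb) = qt (Gn (GC w ?wf ?tf))" unfolding ts(3) mf by (rule FA_pc[OF A(1) tf(2,1)])
  have 2: "ps FA (gamma_word T w ?wf) ?n ?fb us = qt (Gn (GS (gamma_word T w ?wf) ?n ?fb ts))"
    unfolding ts(3) by (rule FA_ps[OF A(5) ts(2,1)])
  have 3: "ps FA w (length ws) f (map2 (\<lambda>w. fob (FPhi w)) ws (blocks ?ns us)) = qt (Gn (GS w (length ws) f ?ts'))"
    unfolding ts(3) map2_FPhi_ob[OF ws ts(2,1)] by (rule FA_ps[OF w _ okt']) simp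
  have 4: "pc FA (subst_word T w (length ws) f) ws us = qt (Gn (GC (subst_word T w (length ws) f) ws ts))"
    unfolding ts(3) by (rule FA_pc[OF A(2) ts(2,1)])
  have o1: "ok ?l" using A(1,5) tf ts by (simp del: map_map)
  have o2: "ok ?r" using A(2) w okt' ts by simp
  have "qt ?l = qt ?r"
  proof (rule qtI[OF o1 o2])
    show "sr ?l = sr ?r" by (simp add: A(6))
    \<comment> \<open>Both targets are obtained by copying the terms built over the blocks as
      prescribed by \<open>f\<close>; it makes no difference whether the blocks are copied before or
      after the words are applied.\<close>
    have "map2 App ?wf (blocks (map (Dom T) ?wf) ?tf) = map ((!) ?ts') f"
      unfolding A(3) blocks_block_map[OF A(4) ts(2)] using f by (intro map2_nth_reindex) auto
    then show "tg ?l = tg ?r" by (simp only: tg.simps gt.simps)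
    fix A' H assume "free_model S T \<phi> X A' H"
    then interpret M: free_model S T \<phi> X A' H .
    show "ia A' H ?l = ia A' H ?r" using M.A.ax_subst_gamma[OF w refl ws M.io_list[OF ts(1,2)]]
      by (simp only: ia.simps ig.simps map_io_App mf)
  qed
  then show ?case unfolding 1 2 3 4 unfolding FC_Comp'[OF o1] FC_Comp'[OF o2] .
next
  case (5 w ws ns' gs us)
    note w = 5(1) and us = 5(2) and l = 5(3,4) and g = 5(5)
  have g': "\<And>j. j < length ws ==> (ws ! j, ns' ! j, gs ! j) \<in> swords T" using g by blast
  note A = gamma_word_block_sum[OF T w l g']
  note w' = cwords_words[OF w]
  have lg: "length gs = length ns'" using l by simp
  have gb: "\<And>j. j < length ns' ==> set (gs ! j) \<subseteq> {..<ns' ! j}" using swordsD[OF g'] l by simp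
  let ?bs = "block_sum ns' gs" let ?sw = "map (\<lambda>j. subst_word T (ws ! j) (ns' ! j) (gs ! j)) [0..<length ws]"
  have bs: "set ?bs \<subseteq> {..<sum_list ns'}" by (rule set_block_sum[OF lg gb])
  obtain ts where ts: "\<forall>t\<in>set ts. okt t" "length ts = sum_list ns'" "us = map cd ts" using pow_ObE[OF us] .
  have mf: "map ((!) (map h ts)) ?bs = map h (map ((!) ts) ?bs)" for h :: "('t, 'u) tm => 'u" using bs ts(2) by (auto simp: subset_iff)
  let ?tf = "map ((!) ts) ?bs"
  have tf: "\<forall>t\<in>set ?tf. okt t" "length ?tf = sum_list (map (Dom T) ws)"
    using bs ts(1,2) by (auto simp: subset_iff length_block_sum A(3))
  have bj: "length (blocks ns' ts ! j) = ns' ! j" "\<forall>t\<in>set (blocks ns' ts ! j). okt t" if "j < length ws" for j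
    using length_blocks_nth[OF ts(2), of j] set_blocks[of j ns' ts] that l ts(1) by auto
  let ?es = "map (\<lambda>j. Gn (GS (ws ! j) (ns' ! j) (gs ! j) (blocks ns' ts ! j)) :: ('s, 't, 'u) ex) [0..<length ws]"
  let ?l = "Cm (Gn (GC w ws ?tf)) (Gn (GS (gamma_word T w ws) (sum_list ns') ?bs ts)) :: ('s, 't, 'u) ex"
  let ?r = "Cm (Op w ?es) (Gn (GC w ?sw ts))"
  have okes: "\<forall>e\<in>set ?es. ok e" using g' bj by auto
  have 1: "pc FA w ws (map ((!) us) ?bs) = qt (Gn (GC w ws ?tf))" unfolding ts(3) mf by (rule FA_pc[OF w tf(2,1)])
  have 2: "ps FA (gamma_word T w ws) (sum_list ns') ?bs us = qt (Gn (GS (gamma_word T w ws) (sum_list ns') ?bs ts))"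
    unfolding ts(3) by (rule FA_ps[OF A(4) ts(2,1)])
  have m3: "map (\<lambda>j. ps FA (ws ! j) (ns' ! j) (gs ! j) (blocks ns' us ! j)) [0..<length ws] = map qt ?es"
    unfolding ts(3) using l bj FA_ps[OF g'] by (auto simp: blocks_map)
  have 3: "far (FPhi w) (map (\<lambda>j. ps FA (ws ! j) (ns' ! j) (gs ! j) (blocks ns' us ! j)) [0..<length ws]) = qt (Op w ?es)"
    unfolding m3 by (rule FPhi_ar[OF w'(1) _ okes]) (simp add: w'(2))
  have 4: "pc FA w ?sw us = qt (Gn (GC w ?sw ts))" unfolding ts(3) by (rule FA_pc[OF A(1) _ ts(1)]) (simp_all only: A(2) ts(2))
  have o1: "ok ?l" using w A(4) tf ts by simp
  have m: "map2 App ?sw (blocks ns' ts) = map sr ?es" using l by (intro nth_equalityI) auto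
  have "ok (Gn (GC w ?sw ts))" using A(1,2) ts(1,2) by (simp only: ok.simps okg.simps)
  moreover have "ok (Op w ?es)" using w' okes by simp
  moreover have "tg (Gn (GC w ?sw ts)) = sr (Op w ?es)" by (simp only: tg.simps sr.simps gt.simps A(2) m)
  ultimately have o2: "ok ?r" using ok_CmI by blast
  have "qt ?l = qt ?r"
  proof (rule qtI[OF o1 o2])
    show "sr ?l = sr ?r" by (simp add: A(5))
    have "blocks (map length gs) ?tf = map (\<lambda>j. map ((!) (blocks ns' ts ! j)) (gs ! j)) [0..<length gs]"
      by (rule blocks_block_sum[OF lg gb ts(2)])
    then have "map2 App ws (blocks (map (Dom T) ws) ?tf) = map tg ?es" using l by (subst A(3)) (auto intro!: nth_equalityI)
    then show "tg ?l = tg ?r" by (simp only: tg.simps gt.simps)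
    fix A' H assume "free_model S T \<phi> X A' H"
    then interpret M: free_model S T \<phi> X A' H .
    have "map (ia A' H) ?es = map (\<lambda>j. ps A' (ws ! j) (ns' ! j) (gs ! j) (blocks ns' (map (io A' H) ts) ! j)) [0..<length ws]"
      using l by (auto simp: blocks_map)
    then show "ia A' H ?l = ia A' H ?r" using M.A.ax_gamma_subst[OF w l g' M.io_list[OF ts(1,2)]] by (simp only: ia.simps ig.simps mf)
  qed
  then show ?case unfolding 1 2 3 4 unfolding FC_Comp'[OF o1] FC_Comp'[OF o2] .
next
  case (6 w l f m g us)
    note w = 6(1) and us = 6(2) and g = 6(3)
  note A = subst_word_subst[OF T w refl g]
  have f: "set f \<subseteq> {..<length g}" using swordsD[OF w] by simp
  obtain ts where ts: "\<forall>t\<in>set ts. okt t" "length ts = m" "us = map cd ts" using pow_ObE[OF us] .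
  have mf: "map ((!) (map h ts)) g = map h (map ((!) ts) g)" for h :: "('t, 'u) tm => 'u" using g ts(2) by (auto simp: subset_iff)
  let ?tg = "map ((!) ts) g"
  let ?r = "Gn (GS w m (map ((!) g) f) ts) :: ('s, 't, 'u) ex"
  let ?l = "Cm (Gn (GS w (length g) f ?tg)) (Gn (GS (subst_word T w (length g) f) m g ts)) :: ('s, 't, 'u) ex"
  have tg: "\<forall>t\<in>set ?tg. okt t" "length ?tg = length g" using g ts(1,2) by (auto simp: subset_iff)
  have 1: "ps FA w (length g) f (map ((!) us) g) = qt (Gn (GS w (length g) f ?tg))" unfolding ts(3) mf by (rule FA_ps[OF w tg(2,1)])
  have 2: "ps FA (subst_word T w (length g) f) m g us = qt (Gn (GS (subst_word T w (length g) f) m g ts))"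
    unfolding ts(3) by (rule FA_ps[OF A(1) ts(2,1)])
  have 3: "ps FA w m (map ((!) g) f) us = qt ?r" unfolding ts(3) by (rule FA_ps[OF A(2) ts(2,1)])
  have o1: "ok ?l" using w A(1) tg ts by simp
  have o2: "ok ?r" using A(2) ts by simp
  have "qt ?l = qt ?r"
  proof (rule qtI[OF o1 o2])
    show "tg ?l = tg ?r" using map_nth_map_nth[OF f, of ts] by (simp del: map_map)
    fix A' H assume "free_model S T \<phi> X A' H"
    then interpret M: free_model S T \<phi> X A' H .
    show "ia A' H ?l = ia A' H ?r" using M.A.ax_subst_subst[OF w refl g M.io_list[OF ts(1,2)]] by (simp only: ia.simps ig.simps mf)
  qed (simp add: A(3))
  then show ?case unfolding 1 2 3 using o1 by (simp only: ok.simps FC_Comp)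
next
  case (7 w us)
    note w = 7(1) and us = 7(2)
  obtain ts where ts: "\<forall>t\<in>set ts. okt t" "length ts = Dom T w" "us = map cd ts" using pow_ObE[OF us] .
  note s = swords_id[OF w]
  let ?g = "GS w (Dom T w) [0..<Dom T w] ts"
  have o1: "ok (Gn ?g)" using s ts by simp
  have o2: "ok (Ide (App w ts))" using w ts by simp
  \<comment> \<open>The generator for the identity reindexing is formally different from an
    identity. Its ends coincide by \<open>subst_word_id\<close>, and axiom (7) in each model makes
    the classes equal.\<close>
  have "qt (Gn ?g) = qt (Ide (App w ts))"
  proof (rule qtI[OF o1 o2])
    show "sr (Gn ?g) = sr (Ide (App w ts))" by (simp add: subst_word_id[OF T w])
    show "tg (Gn ?g) = tg (Ide (App w ts))" using map_nth[of ts] ts(2) by simp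
    fix A' H assume "free_model S T \<phi> X A' H"
    then interpret M: free_model S T \<phi> X A' H .
    show "ia A' H (Gn ?g) = ia A' H (Ide (App w ts))"
      using M.A.ax_subst_id[OF w M.io_list[OF ts(1,2)]] by (simp only: ia.simps ig.simps io.simps)
  qed
  then show ?case using FA_ps[OF s ts(2,1)] o2 by (simp add: ts(3) FPhi_ob[OF w ts(2,1)] FC_Idt)
qed

lemma psalgebra_FA: "psalgebra T FA" using alg_data_FA alg_eqs_FA is_psalg_iff[OF T, of FA] T by (simp add: psalgebra_def)

sublocale FA: psalgebra T FA by (rule psalgebra_FA)

text \<open>The underlying functor is spelled out again inside \<open>Rho\<close>, whose sources and
  targets depend on it. The components of \<rho> are the generators \<open>GR\<close>.\<close>

definition eta :: "('s, 'u, 'u, 'u, 'u) psmor" where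
  "eta = \<lparr>Fn = \<lparr>fob = (\<lambda>x\<in>Ob (Car X). cd (Var x)), far = (\<lambda>f\<in>Ar (Car X). qt (Eta f))\<rparr>,
     Rho = (\<lambda>w\<in>words S. \<lparr> nsrc = fcomp (pow_cat (Car X) (Dom S w))
         \<lparr>fob = (\<lambda>x\<in>Ob (Car X). cd (Var x)), far = (\<lambda>f\<in>Ar (Car X). qt (Eta f))\<rparr> (Phi X w),
       ntgt = fcomp (pow_cat (Car X) (Dom S w)) (FPhi (far \<phi> w)) (pow_fun (Car X) (Dom S w)
         \<lparr>fob = (\<lambda>x\<in>Ob (Car X). cd (Var x)), far = (\<lambda>f\<in>Ar (Car X). qt (Eta f))\<rparr>),
       ncomp = (\<lambda>xs\<in>tup X (Dom S w). qt (Gn (GR w xs)))\<rparr>)\<rparr>"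

lemma eta_ob: "x \<in> Ob (Car X) ==> fob (Fn eta) x = cd (Var x)"
  and eta_ar: "f \<in> Ar (Car X) ==> far (Fn eta) f = qt (Eta f)"
  and eta_pr: "w \<in> words S ==> xs \<in> tup X (Dom S w) ==> pr eta w xs = qt (Gn (GR w xs))" by (simp_all add: eta_def)

lemma map_eta_ob: "xs \<in> tup X n ==> map (fob (Fn eta)) xs = map cd (map Var xs)" by (auto simp: Ob_pow eta_ob subset_iff)

lemma map_eta_ar: "fs \<in> Ar (pow_cat (Car X) n) ==> map (far (Fn eta)) fs = map qt (map Eta fs)" by (auto simp: Ar_pow eta_ar subset_iff)

lemma functor_eta: "is_functor (Car X) FC (Fn eta)"
proof (rule is_functorI)
  show "category (Car X)" "category FC" by (fact X.C category_FC)+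
  show "fob (Fn eta) \<in> extensional (Ob (Car X))" "far (Fn eta) \<in> extensional (Ar (Car X))" by (simp_all add: eta_def)
  show "fob (Fn eta) x \<in> Ob FC" if "x \<in> Ob (Car X)" for x using that by (simp add: eta_ob FC_Ob)
  show "far (Fn eta) f \<in> hom FC (fob (Fn eta) x) (fob (Fn eta) y)" if "f \<in> hom (Car X) x y" for f x y
    using FC_hom[of "Eta f"] hom_Ob_Dom[OF X.C that] hom_Ob_Cod[OF X.C that] that by (simp add: eta_ob eta_ar hom_Ar hom_Dom hom_Cod)
  show "far (Fn eta) (Idt (Car X) x) = Idt FC (fob (Fn eta) x)" if x: "x \<in> Ob (Car X)" for x
  proof -
    note i = cat_id[OF X.C x]
    have "qt (Eta (Idt (Car X) x)) = qt (Ide (Var x))"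
    proof (rule qtI)
      fix A H assume "free_model S T \<phi> X A H"
      then interpret M: free_model S T \<phi> X A H .
      show "ia A H (Eta (Idt (Car X) x)) = ia A H (Ide (Var x))" using functor_id[OF M.H.F x] by simp
    qed (use x i in \<open>simp_all add: hom_def\<close>)
    then show ?thesis using x i by (simp add: eta_ob eta_ar hom_Ar FC_Idt)
  qed
  show "far (Fn eta) (Comp (Car X) g f) = Comp FC (far (Fn eta) g) (far (Fn eta) f)"
    if f: "f \<in> hom (Car X) x y" and g: "g \<in> hom (Car X) y z" for f g x y z
  proof -
    note gf = cat_comp[OF X.C f g]
    have o: "ok (Cm (Eta g) (Eta f))" using f g by (simp add: hom_def)
    have "qt (Eta (Comp (Car X) g f)) = qt (Cm (Eta g) (Eta f))"
    proof (rule qtI[OF _ o])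
      fix A H assume "free_model S T \<phi> X A H"
      then interpret M: free_model S T \<phi> X A H .
      show "ia A H (Eta (Comp (Car X) g f)) = ia A H (Cm (Eta g) (Eta f))" using functor_comp[OF M.H.F f g] by simp
    qed (use f g gf in \<open>simp_all add: hom_def\<close>)
    then show ?thesis using o gf f g by (simp add: eta_ar hom_Ar FC_Comp)
  qed
qed

text \<open>In a model, \<open>Eta\<close> and \<open>GR\<close> take the values of \<open>H\<close>
  and of its isomorphisms \<rho>. The axioms of a morphism therefore hold for \<open>eta\<close>
  because they hold for each \<open>H\<close>.\<close>

lemma is_psmor_eta: "is_psmor S X (U FA) eta"
proof -
  note fe = functor_eta
  have data: "mor_data S X (U FA) eta" unfolding mor_data_def forget_alg_simps FA_simps
  proof (intro conjI ballI)
    show "is_functor (Car X) FC (Fn eta)" by (rule fe)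
    show "Rho eta \<in> extensional (words S)" by (simp add: eta_def)
    fix w assume w: "w \<in> words S"
    let ?n = "Dom S w" let ?N = "pow_cat (Car X) ?n" let ?w = "far \<phi> w"
    have src: "nsrc (Rho eta w) = fcomp ?N (Fn eta) (Phi X w)" "ntgt (Rho eta w) = fcomp ?N (FPhi ?w) (pow_fun (Car X) ?n (Fn eta))"
      using w by (simp_all add: eta_def)
    have FP: "is_functor (pow_cat FC ?n) FC (FPhi ?w)" using functor_FPhi[OF m_words[OF w]] by (simp add: m_Dom[OF w])
    show "nat_iso ?N FC (Rho eta w) (fcomp ?N (Fn eta) (Phi X w)) (fcomp ?N (Phi (U FA) w) (pow_fun (Car X) ?n (Fn eta)))"
    proof (rule nat_isoI[OF is_natI])
      show "is_functor ?N FC (nsrc (Rho eta w))" "is_functor ?N FC (ntgt (Rho eta w))"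
        unfolding src using functor_fcomp[OF X.Fun[OF w] fe] functor_fcomp[OF functor_pow_fun[OF fe] FP] by auto
      show "ncomp (Rho eta w) \<in> extensional (Ob ?N)" using w by (simp add: eta_def)
      fix xs assume xs: "xs \<in> Ob ?N"
      have vs: "\<forall>t\<in>set (map Var xs). okt t" "length (map Var xs) = Dom T ?w" using xs m_Dom[OF w] by (auto simp: Ob_pow)
      show "pr eta w xs \<in> hom FC (fob (nsrc (Rho eta w)) xs) (fob (ntgt (Rho eta w)) xs)"
        using FC_hom[of "Gn (GR w xs)"] xs w FPhi_ob[OF m_words[OF w] vs(2,1)] X.po_Ob[OF w xs]
        unfolding src by (simp add: eta_pr eta_ob map_eta_ob[OF xs] del: map_map)
      show "iso FC (pr eta w xs)" using iso_Gn[of "GR w xs"] w xs by (simp add: eta_pr)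
    next
      fix fs xs ys assume fs: "fs \<in> hom ?N xs ys"
      note P = category_pow[OF X.C, of ?n]
      note xs = hom_Ob_Dom[OF P fs] and ys = hom_Ob_Cod[OF P fs]
      have l: "length fs = Dom T ?w" "set fs \<subseteq> Ar (Car X)" "xs = map (Dom (Car X)) fs" "ys = map (Cod (Car X)) fs"
        using hom_Ar[OF fs] hom_Dom[OF fs] hom_Cod[OF fs] by (auto simp: Ar_pow m_Dom[OF w])
      note pa = X.pa_hom[OF w fs]
      have es: "length (map Eta fs) = Dom T ?w" "\<forall>e\<in>set (map Eta fs). ok e" using l by auto
      have o1: "ok (Cm (Gn (GR w ys)) (Eta (pa X w fs)))" using w ys pa by (simp add: hom_def)
      have o2: "ok (Cm (Op ?w (map Eta fs)) (Gn (GR w xs)))" using w xs es m_words[OF w] l(3) by (simp add: comp_def)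
      have "qt (Cm (Gn (GR w ys)) (Eta (pa X w fs))) = qt (Cm (Op ?w (map Eta fs)) (Gn (GR w xs)))"
      proof (rule qtI[OF o1 o2])
        fix A H assume "free_model S T \<phi> X A H"
        then interpret M: free_model S T \<phi> X A H .
        show "ia A H (Cm (Gn (GR w ys)) (Eta (pa X w fs))) = ia A H (Cm (Op ?w (map Eta fs)) (Gn (GR w xs)))"
          using M.H.pr_natural[OF w fs] w by (simp add: comp_def)
      qed (use pa l in \<open>simp_all add: hom_def comp_def\<close>)
      then show "Comp FC (pr eta w ys) (far (nsrc (Rho eta w)) fs) = Comp FC (far (ntgt (Rho eta w)) fs) (pr eta w xs)"
        unfolding src using o1 o2 hom_Ar[OF fs] w xs ys FPhi_ar[OF m_words[OF w] es] pa
        by (simp add: eta_pr eta_ar map_eta_ar[OF hom_Ar[OF fs]] FC_Comp hom_Ar del: map_map)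
    qed (use w src in simp_all)
  qed
  have "mor_eqs S X (U FA) eta" unfolding mor_eqs_def
  proof (intro conjI ballI, safe, goal_cases)
    case (1 w ws xs)
    note w = 1(1) and xs = 1(2)
    let ?ns = "map (Dom S) ws"
    note w' = cwords_words[OF w] and g = gamma_word_words[OF w] and c = m_cwords[OF w] and dd = m_Doms[OF w'(3)]
    have wi: "ws ! i \<in> words S" if "i < length ws" for i using w'(3) that by (simp add: subset_iff)
    let ?vs = "map Var xs"
    have vs: "\<forall>t\<in>set ?vs. okt t" "length ?vs = sum_list (map (Dom T) (map (far \<phi>) ws))"
      using xs unfolding dd by (auto simp: Ob_pow)
    let ?ys = "map2 (po X) ws (blocks ?ns xs)"
    have ys: "?ys \<in> tup X (Dom S w)" using X.map2_po_Ob[OF w'(3) xs] w'(2) by simp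
    let ?es = "map (\<lambda>j. Gn (GR (ws ! j) (blocks ?ns xs ! j)) :: ('s, 't, 'u) ex) [0..<length ws]"
    let ?rg = "Gn (GR w ?ys) :: ('s, 't, 'u) ex"
    let ?l = "Cm (Gn (GC (far \<phi> w) (map (far \<phi>) ws) ?vs)) (Gn (GR (gamma_word S w ws) xs)) :: ('s, 't, 'u) ex"
    let ?r = "Cm (Op (far \<phi> w) ?es) (Cm ?rg (Eta (pc X w ws xs)))"
    have bj: "blocks ?ns xs ! j \<in> tup X (Dom S (ws ! j))" if "j < length ws" for j using blocks_Ob[OF xs, of j] that by simp
    have es: "\<forall>e\<in>set ?es. ok e" "length ?es = Dom T (far \<phi> w)" using bj wi w' m_Dom[OF w'(1)] by auto
    have 1: "pc (U FA) w ws (map (fob (Fn eta)) xs) = qt (Gn (GC (far \<phi> w) (map (far \<phi>) ws) ?vs))"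
      using FA_pc[OF c vs(2,1)] w by (simp only: forget_alg_simps map_eta_ob[OF xs])
    have 2: "pr eta (gamma_word S w ws) xs = qt (Gn (GR (gamma_word S w ws) xs))" using eta_pr[OF g(1)] xs g by simp
    have m3: "map (\<lambda>j. pr eta (ws ! j) (blocks ?ns xs ! j)) [0..<length ws] = map qt ?es" using wi bj by (auto simp: eta_pr)
    have 3: "pa (U FA) w (map (\<lambda>j. pr eta (ws ! j) (blocks ?ns xs ! j)) [0..<length ws]) = qt (Op (far \<phi> w) ?es)"
      unfolding m3 using FPhi_ar[OF m_words[OF w'(1)] es(2,1)] w'(1) by (simp only: forget_alg_simps FA_simps)
    have 4: "pr eta w ?ys = qt ?rg" by (rule eta_pr[OF w'(1) ys])
    have pch: "pc X w ws xs \<in> hom (Car X) (po X (gamma_word S w ws) xs) (po X w ?ys)" by (rule X.pc_hom(1)[OF w xs])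
    have 5: "far (Fn eta) (pc X w ws xs) = qt (Eta (pc X w ws xs))" by (rule eta_ar[OF hom_Ar[OF pch]])
    \<comment> \<open>The target of \<open>GR\<close> at the composite word of \<open>S\<close> has
      to be the source of \<open>GC\<close> at the image words in \<open>T\<close>; this is
      preservation of \<gamma> by \<phi>.\<close>
    have mg: "far \<phi> (gamma_word S w ws) = gamma_word T (far \<phi> w) (map (far \<phi>) ws)" by (rule m_gamma[OF w])
    have o1: "ok ?l" using c vs g xs mg by simp
    have m: "map Var ?ys = map sr ?es" by (rule nth_equalityI) auto
    have o4: "ok (Cm ?rg (Eta (pc X w ws xs)))" using w'(1) ys pch by (simp add: hom_def)
    have o5: "ok (Op (far \<phi> w) ?es)" using es m_words[OF w'(1)] by simp
    have o2: "ok ?r" by (rule ok_CmI[OF o4 o5]) (simp only: tg.simps sr.simps gt.simps m)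
    have "qt ?l = qt ?r"
    proof (rule qtI[OF o1 o2])
      show "sr ?l = sr ?r" using pch by (simp add: hom_def)
      have "map2 App (map (far \<phi>) ws) (blocks ?ns ?vs) = map tg ?es" by (intro nth_equalityI) (auto simp: blocks_map)
      then show "tg ?l = tg ?r" by (simp only: tg.simps gt.simps dd)
      fix A H assume "free_model S T \<phi> X A H"
      then interpret M: free_model S T \<phi> X A H .
      have "map (ia A H) ?es = map (\<lambda>j. pr H (ws ! j) (blocks ?ns xs ! j)) [0..<length ws]" by auto
      moreover have "map (io A H) ?vs = map (fob (Fn H)) xs" by auto
      ultimately show "ia A H ?l = ia A H ?r" using M.H.pr_gamma[OF w xs] w w'(1) by (simp only: ia.simps ig.simps forget_alg_simps)
    qed
    then show ?case unfolding 1 2 3 4 5 forget_alg_simps FA_simps FC_Comp'[OF o1] FC_Comp'[OF o4] FC_Comp'[OF o2] .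
  next
    case xs: (2 xs)
    then obtain x where x: "xs = [x]" "x \<in> Ob (Car X)" by (cases xs) (auto simp: Ob_pow One_nat_def)
    let ?l = "Cm (Gn (GI (Var x))) (Gn (GR (unit_word S) xs)) :: ('s, 't, 'u) ex"
    note h = X.pI_hom(1)[OF x(2)]
    have o: "ok ?l" using x xs unit_word_words by (simp add: m_unit)
    have "qt ?l = qt (Eta (ncomp (II X) [x]))"
    proof (rule qtI[OF o])
      fix A H assume "free_model S T \<phi> X A H"
      then interpret M: free_model S T \<phi> X A H .
      show "ia A H ?l = ia A H (Eta (ncomp (II X) [x]))" using M.H.pr_unit[OF x(2)] by (simp add: x)
    qed (use h x in \<open>simp_all add: hom_def\<close>)
    then show ?case using o x xs h eta_pr[OF unit_word_words(1), of xs] by (simp add: eta_ob FA_pI eta_ar hom_Ar unit_word_words FC_Comp)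
  next
    case (3 w l f xs)
    note w = 3(1) and xs = 3(2)
    note w' = swords_words[OF w] and g = subst_word_words[OF w] and c = m_swords[OF w] and h = X.ps_hom(1)[OF w xs]
    let ?vs = "map Var xs" and ?xf = "map ((!) xs) f"
    let ?l = "Cm (Gn (GS (far \<phi> w) l f ?vs)) (Gn (GR (subst_word S w l f) xs)) :: ('s, 't, 'u) ex"
    let ?r = "Cm (Gn (GR w ?xf)) (Eta (ps X w l f xs)) :: ('s, 't, 'u) ex"
    have vs: "\<forall>t\<in>set ?vs. okt t" "length ?vs = l" using xs by (auto simp: Ob_pow)
    have xf: "?xf \<in> tup X (Dom S w)" using reindex_Ob[OF xs w'(3)] w'(2) by simp
    have ms: "far \<phi> (subst_word S w l f) = subst_word T (far \<phi> w) l f" by (rule m_subst[OF w])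
    have o1: "ok ?l" using c vs g xs ms by simp
    have o2: "ok ?r" using w' xf h by (simp add: hom_def)
    have "qt ?l = qt ?r"
    proof (rule qtI[OF o1 o2])
      show "sr ?l = sr ?r" using h by (simp add: hom_def)
      show "tg ?l = tg ?r" using w'(3) vs(2) by (auto simp: subset_iff)
      fix A H assume "free_model S T \<phi> X A H"
      then interpret M: free_model S T \<phi> X A H .
      have "map (io A H) ?vs = map (fob (Fn H)) xs" by auto
      then show "ia A H ?l = ia A H ?r" using M.H.pr_subst[OF w xs] w by (simp only: ia.simps ig.simps forget_alg_simps)
    qed
    then show ?case using o1 o2 FA_ps[OF c vs(2,1)] eta_pr[OF g(1), of xs] g(2) xs eta_pr[OF w'(1) xf] h w
      by (simp add: map_eta_ob[OF xs] eta_ar hom_Ar FC_Comp del: map_map)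
  qed
  with data show ?thesis using is_psmor_iff[OF S X.X is_psalg_forget[OF FA.X]] by blast
qed

end

section \<open>Strict morphisms\<close>

text \<open>An identity has equal ends, so the condition contains that the functor commutes with the
  words on objects (\<open>st_po\<close>). Naturality of \<rho> then gives the same on arrows
  (\<open>st_pa\<close>), and the axioms of a morphism become strict preservation of
  \<open>c\<close>, \<open>I\<close> and \<open>s\<close>.\<close>

definition strict_mor :: "'t thry => ('t, 'o, 'a) psalg => ('t, 'p, 'b) psalg => ('t, 'o, 'a, 'p, 'b) psmor => bool" where
  "strict_mor T X Y H \<longleftrightarrow> is_psmor T X Y H \<and>
     (\<forall>w\<in>words T. \<forall>xs\<in>tup X (Dom T w). pr H w xs = Idt (Car Y) (po Y w (map (fob (Fn H)) xs)))"

lemma strict_mor_id: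
  assumes X: "psalgebra T X"
  shows "strict_mor T X X (psmor_id T X)" unfolding strict_mor_def
proof (intro conjI ballI)
  show "is_psmor T X X (psmor_id T X)" by (rule is_psmor_id[OF X])
  fix w xs assume w: "w \<in> words T" and xs: "xs \<in> tup X (Dom T w)"
  then have "map (fob (id_fun (Car X))) xs = xs" by (intro nth_equalityI) (auto simp: Ob_pow subset_iff)
  then show "pr (psmor_id T X) w xs = Idt (Car X) (po X w (map (fob (Fn (psmor_id T X))) xs))" by (simp add: pr_psmor_id[OF X w xs])
qed

lemma strict_mor_comp:
  assumes G: "psmorphism T X Y G" "strict_mor T X Y G" and H: "psmorphism T Y Z H" "strict_mor T Y Z H"
  shows "strict_mor T X Z (psmor_comp T X Y Z H G)" unfolding strict_mor_def
proof (intro conjI ballI)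
  interpret G: psmorphism T X Y G by fact
  interpret H: psmorphism T Y Z H by fact
  show "is_psmor T X Z (psmor_comp T X Y Z H G)" by (rule is_psmor_comp[OF G(1) H(1)])
  fix w xs assume w: "w \<in> words T" and xs: "xs \<in> tup X (Dom T w)"
  note Gx = G.F_Ob[OF xs]
  have m: "map (fob (Fn (psmor_comp T X Y Z H G))) xs = map (fob (Fn H)) (map (fob (Fn G)) xs)" using xs by (auto simp: Ob_pow)
  have "far (Fn H) (pr G w xs) = Idt (Car Z) (fob (Fn H) (po Y w (map (fob (Fn G)) xs)))"
    using G(2) w xs functor_id[OF H.F G.Y.po_Ob[OF w Gx]] by (simp add: strict_mor_def)
  moreover have "pr H w (map (fob (Fn G)) xs) = Idt (Car Z) (po Z w (map (fob (Fn H)) (map (fob (Fn G)) xs)))"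
    using H(2) w Gx by (simp add: strict_mor_def)
  ultimately show "pr (psmor_comp T X Y Z H G) w xs = Idt (Car Z) (po Z w (map (fob (Fn (psmor_comp T X Y Z H G))) xs))"
    unfolding m using cat_idr[OF H.Y.C H.pr_hom(1)[OF w Gx]] by (simp add: pr_psmor_comp[OF G(1) H(1) w xs])
qed

context psmorphism
begin

context
  assumes st: "strict_mor T X Y H"
begin

lemma st_pr: "w \<in> words T ==> xs \<in> tup X (Dom T w) ==> pr H w xs = Idt (Car Y) (po Y w (map (fob (Fn H)) xs))"
  using st by (simp add: strict_mor_def)

lemma st_po:
  assumes "w \<in> words T" "xs \<in> tup X (Dom T w)"
  shows "fob (Fn H) (po X w xs) = po Y w (map (fob (Fn H)) xs)"
  using pr_hom(1)[OF assms] cat_id[OF Y.C Y.po_Ob[OF assms(1) F_Ob[OF assms(2)]]] by (simp add: st_pr[OF assms] hom_def)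

lemma st_pa:
  assumes w: "w \<in> words T" and f: "fs \<in> hom (pow_cat (Car X) (Dom T w)) xs ys"
  shows "far (Fn H) (pa X w fs) = pa Y w (map (far (Fn H)) fs)"
proof -
  note P = category_pow[OF X.C]
  note xs = hom_Ob_Dom[OF P f] and ys = hom_Ob_Cod[OF P f]
  show ?thesis using pr_natural[OF w f] cat_idl[OF Y.C functor_hom[OF F X.pa_hom[OF w f]]] cat_idr[OF Y.C Y.pa_hom[OF w map_F_hom[OF f]]]
    by (simp add: st_pr[OF w xs] st_pr[OF w ys] st_po[OF w xs] st_po[OF w ys])
qed

text \<open>In the axiom of a morphism for \<gamma> all components of \<rho> are identities, also
  those at the inner words, on which \<open>w\<close> acts as a functor. What survives is this
  equation.\<close>

lemma st_pc:
  assumes w: "(w, ws) \<in> cwords T" and xs: "xs \<in> Ob (pow_cat (Car X) (sum_list (map (Dom T) ws)))"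
  shows "far (Fn H) (pc X w ws xs) = pc Y w ws (map (fob (Fn H)) xs)"
proof -
  let ?ns = "map (Dom T) ws"
  note w' = cwords_words[OF w] and g = gamma_words[OF X.T w]
  have xsg: "xs \<in> tup X (Dom T (gamma_word T w ws))" using xs g by simp
  let ?ys = "map2 (po X) ws (blocks ?ns xs)"
  have ys: "?ys \<in> tup X (Dom T w)" using X.map2_po_Ob[OF w'(3) xs] w' by simp
  note Fys = F_Ob[OF ys]
  have bl: "pr H (ws ! j) (blocks ?ns xs ! j) = Idt (Car Y) (fob (Fn H) (po X (ws ! j) (blocks ?ns xs ! j)))"
    if "j < length ws" for j
  proof -
    have "ws ! j \<in> words T" "blocks ?ns xs ! j \<in> tup X (Dom T (ws ! j))"
      using that w'(3) blocks_Ob[OF xs, of j] by (auto simp: subset_iff)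
    from st_pr[OF this] st_po[OF this] show ?thesis by simp
  qed
  have "map (\<lambda>j. pr H (ws ! j) (blocks ?ns xs ! j)) [0..<length ws] = map (Idt (Car Y)) (map (fob (Fn H)) ?ys)"
    by (intro nth_equalityI) (auto simp: bl)
  then have 1: "pa Y w (map (\<lambda>j. pr H (ws ! j) (blocks ?ns xs ! j)) [0..<length ws]) = Idt (Car Y) (po Y w (map (fob (Fn H)) ?ys))"
    using functor_id[OF Y.Fun[OF w'(1)] Fys] by simp
  note h = functor_hom[OF F X.pc_hom(1)[OF w xs], unfolded st_po[OF w'(1) ys] st_po[OF g(1) xsg]]
  have "Comp (Car Y) (pc Y w ws (map (fob (Fn H)) xs)) (pr H (gamma_word T w ws) xs) = far (Fn H) (pc X w ws xs)"
    unfolding pr_gamma[OF w xs] 1 st_pr[OF w'(1) ys] cat_idl[OF Y.C h] ..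
  then show ?thesis using cat_idr[OF Y.C Y.pc_hom(1)[OF w F_Ob[OF xs]]] by (simp add: st_pr[OF g(1) xsg])
qed

lemma st_pI:
  assumes x: "x \<in> Ob (Car X)"
  shows "far (Fn H) (ncomp (II X) [x]) = ncomp (II Y) [fob (Fn H) x]"
proof -
  note u = unit_words[OF X.T]
  have xs: "[x] \<in> tup X (Dom T (unit_word T))" unfolding u using x by (simp add: Ob_pow One_nat_def)
  show ?thesis using pr_unit[OF x] cat_idr[OF Y.C Y.pI_hom(1)[OF functor_ob[OF F x]]] by (simp add: st_pr[OF u(1) xs])
qed

lemma st_ps:
  assumes w: "(w, l, f) \<in> swords T" and xs: "xs \<in> tup X l"
  shows "far (Fn H) (ps X w l f xs) = ps Y w l f (map (fob (Fn H)) xs)"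
proof -
  note w' = swords_words[OF w] and g = subst_words[OF X.T w]
  have xsg: "xs \<in> tup X (Dom T (subst_word T w l f))" using xs g by simp
  have xf: "map ((!) xs) f \<in> tup X (Dom T w)" using reindex_Ob[OF xs w'(3)] w'(2) by simp
  show ?thesis using pr_subst[OF w xs] cat_idr[OF Y.C Y.ps_hom(1)[OF w F_Ob[OF xs]]]
      cat_idl[OF Y.C functor_hom[OF F X.ps_hom(1)[OF w xs], unfolded st_po[OF w'(1) xf]]]
    by (simp add: st_pr[OF g(1) xsg] st_pr[OF w'(1) xf] del: map_map)
qed

end

end

section \<open>Universal property of the free algebra\<close>

context free_alg
begin

definition extn :: "('t, 'u, 'u) psalg => ('s, 'u, 'u, 'u, 'u) psmor => ('t, 'u, 'u, 'u, 'u) psmor" where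
  "extn A H = (let F = \<lparr>fob = (\<lambda>u\<in>Ob FC. io A H (dc u)), far = (\<lambda>u\<in>Ar FC. ia A H (rp u))\<rparr>
     in \<lparr>Fn = F, Rho = (\<lambda>w\<in>words T. id_nat (pow_cat FC (Dom T w)) (Car A) (fcomp (pow_cat FC (Dom T w)) F (FPhi w)))\<rparr>)"

definition restr :: "('t, 'u, 'u) psalg => ('t, 'u, 'u, 'u, 'u) psmor => ('s, 'u, 'u, 'u, 'u) psmor" where
  "restr A K = psmor_comp S X (U FA) (U A) (forget_mor S \<phi> K) eta"

text \<open>Whiskering with \<open>eta\<close>. Together with \<open>restr\<close> on morphisms it
  is the functor on hom-categories that has to be fully faithful.\<close>

definition restr2 :: "('t, 'u, 'u) psalg => ('t, 'u, 'u, 'u, 'u) pscell => ('s, 'u, 'u, 'u, 'u) pscell" where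
  "restr2 A \<alpha> = pscell_hcomp S X (U FA) (U A) (forget_cell S \<phi> \<alpha>)
     \<lparr>Src = eta, Tgt = eta, Nt = id_nat (Car X) (Car (U FA)) (Fn eta)\<rparr>"

lemma psmorphism_eta: "psmorphism S X (U FA) eta"
  by (rule psmorphismI[OF X.psalgebra_axioms psalgebra_forget[OF psalgebra_FA] is_psmor_eta])

lemma psmorphism_restr:
  assumes "psmorphism T FA A K"
  shows "psmorphism S X (U A) (restr A K)"
  unfolding restr_def using assms is_psmor_comp[OF psmorphism_eta psmorphism_forget[OF assms]] psmorphism_forget[OF assms]
  by (intro psmorphismI X.psalgebra_axioms) (auto simp: psmorphism_def)

lemma restr_ob: "x \<in> Ob (Car X) ==> fob (Fn (restr A K)) x = fob (Fn K) (cd (Var x))"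
  and restr_ar: "f \<in> Ar (Car X) ==> far (Fn (restr A K)) f = far (Fn K) (qt (Eta f))" by (simp_all add: restr_def eta_ob eta_ar)

lemma restr_pr:
  assumes K: "psmorphism T FA A K" and w: "w \<in> words S" and xs: "xs \<in> tup X (Dom S w)"
  shows "pr (restr A K) w xs = Comp (Car A) (pr K (far \<phi> w) (map cd (map Var xs))) (far (Fn K) (qt (Gn (GR w xs))))"
  unfolding restr_def using w
  by (simp add: pr_psmor_comp[OF psmorphism_eta psmorphism_forget[OF K] w xs] map_eta_ob[OF xs] eta_pr[OF w xs] del: map_map)

context
  fixes A :: "('t, 'u, 'u) psalg" and H :: "('s, 'u, 'u, 'u, 'u) psmor"
  assumes M: "free_model S T \<phi> X A H"
begin

interpretation M: free_model S T \<phi> X A H by (rule M)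

lemma extn_ob: "okt t ==> fob (Fn (extn A H)) (cd t) = io A H t" by (simp add: extn_def Let_def FC_Ob)

lemma extn_ar: "ok e ==> far (Fn (extn A H)) (qt e) = ia A H e" using M.ceq_ia[OF rp_qt(3)] by (simp add: extn_def Let_def FC_Ar)

lemma map_extn_ob: "\<forall>t\<in>set ts. okt t ==> map (fob (Fn (extn A H))) (map cd ts) = map (io A H) ts" by (auto simp: extn_ob)

lemma functor_extn: "is_functor FC (Car A) (Fn (extn A H))"
proof (rule is_functorI)
  show "category FC" "category (Car A)" by (fact category_FC M.A.C)+
  show "fob (Fn (extn A H)) \<in> extensional (Ob FC)" "far (Fn (extn A H)) \<in> extensional (Ar FC)" by (simp_all add: extn_def Let_def)
  show "fob (Fn (extn A H)) x \<in> Ob (Car A)" if "x \<in> Ob FC" for x using that by (elim FC_ObE) (simp add: extn_ob M.io_Ob)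
  show "far (Fn (extn A H)) f \<in> hom (Car A) (fob (Fn (extn A H)) x) (fob (Fn (extn A H)) y)" if "f \<in> hom FC x y" for f x y
    using that by (elim FC_homE) (simp add: extn_ob extn_ar M.ia_hom ok_okt)
  show "far (Fn (extn A H)) (Idt FC x) = Idt (Car A) (fob (Fn (extn A H)) x)" if "x \<in> Ob FC" for x
    using that by (elim FC_ObE) (simp add: FC_Idt extn_ob extn_ar)
  fix f g x y z assume f: "f \<in> hom FC x y" and g: "g \<in> hom FC y z"
  obtain e where e: "ok e" "f = qt e" "x = cd (sr e)" "y = cd (tg e)" using FC_homE[OF f] .
  have "okt (tg e)" using e(1) ok_okt by blast
  then obtain e' where e': "ok e'" "g = qt e'" "tg e = sr e'" using FC_homE2[OF g[unfolded e(4)]] by blast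
  show "far (Fn (extn A H)) (Comp FC g f) = Comp (Car A) (far (Fn (extn A H)) g) (far (Fn (extn A H)) f)"
    using e e' by (simp add: FC_Comp extn_ar)
qed

lemma extn_pr:
  assumes w: "w \<in> words T" and ts: "\<forall>t\<in>set ts. okt t" "length ts = Dom T w"
  shows "pr (extn A H) w (map cd ts) = Idt (Car A) (io A H (App w ts))"
proof -
  have "pr (extn A H) w (map cd ts) = Idt (Car A) (fob (Fn (extn A H)) (fob (FPhi w) (map cd ts)))"
    using w pow_Ob[OF ts] by (simp add: extn_def Let_def)
  also have "\<dots> = Idt (Car A) (io A H (App w ts))" using FPhi_ob[OF w ts(2,1)] w ts by (simp add: extn_ob)
  finally show ?thesis .
qed

text \<open>Evaluation commutes with all words and sends each generator to the corresponding
  component in \<open>A\<close>, by the very clauses of \<open>io\<close> and \<open>ia\<close>.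
  With identities for \<rho>, the axioms of a morphism are then instances of the unit laws in
  \<open>A\<close>.\<close>

lemma is_psmor_extn: "is_psmor T FA A (extn A H)"
proof -
  let ?K = "Fn (extn A H)"
  have data: "mor_data T FA A (extn A H)" unfolding mor_data_def FA_simps
  proof (intro conjI ballI)
    show "is_functor FC (Car A) ?K" by (rule functor_extn)
    show "Rho (extn A H) \<in> extensional (words T)" by (simp add: extn_def Let_def)
    fix w assume w: "w \<in> words T"
    let ?N = "pow_cat FC (Dom T w)"
    \<comment> \<open>In \<open>extn\<close> the isomorphism is the identity of the left-hand
      functor; this equation shows that its target is the one required.\<close>
    have "fcomp ?N ?K (FPhi w) = fcomp ?N (Phi A w) (pow_fun FC (Dom T w) ?K)"
    proof (rule functr_eqI[OF fcomp_ext(1) fcomp_ext(1) fcomp_ext(2) fcomp_ext(2)])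
      fix us assume us: "us \<in> Ob ?N"
      then obtain ts where ts: "\<forall>t\<in>set ts. okt t" "length ts = Dom T w" "us = map cd ts" by (rule pow_ObE)
      show "fob (fcomp ?N ?K (FPhi w)) us = fob (fcomp ?N (Phi A w) (pow_fun FC (Dom T w) ?K)) us"
        using us w ts map_extn_ob[OF ts(1)] by (simp add: FPhi_ob extn_ob del: map_map)
    next
      fix fs assume fs: "fs \<in> Ar ?N"
      then obtain es where es: "\<forall>e\<in>set es. ok e" "length es = Dom T w" "fs = map qt es" by (rule pow_ArE)
      have "map (far ?K) (map qt es) = map (ia A H) es" using es by (auto simp: extn_ar)
      then show "far (fcomp ?N ?K (FPhi w)) fs = far (fcomp ?N (Phi A w) (pow_fun FC (Dom T w) ?K)) fs"
        using fs w es by (simp add: FPhi_ar extn_ar del: map_map)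
    qed
    then show "nat_iso ?N (Car A) (Rho (extn A H) w) (fcomp ?N ?K (FPhi w)) (fcomp ?N (Phi A w) (pow_fun FC (Dom T w) ?K))"
      using nat_iso_id[OF functor_fcomp[OF functor_FPhi[OF w] functor_extn]] w by (simp add: extn_def Let_def)
  qed
  have "mor_eqs T FA A (extn A H)" unfolding mor_eqs_def FA_simps
  proof (intro conjI ballI, safe, goal_cases)
    case (1 w ws us)
    note w = 1(1) and us = 1(2)
    let ?ns = "map (Dom T) ws"
    obtain ts where ts: "\<forall>t\<in>set ts. okt t" "length ts = sum_list ?ns" "us = map cd ts" using pow_ObE[OF us] .
    note w' = cwords_words[OF w] and g = gamma_words_T[OF w]
    let ?ts' = "map2 App ws (blocks ?ns ts)"
    have ts': "\<forall>t\<in>set ?ts'. okt t" "length ?ts' = Dom T w" using okt_map2_App[OF w'(3) ts(2,1)] w' by auto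
    have o: "okg (GC w ws ts)" using w ts by simp
    note h = conjunct1[OF M.ig_hom[OF o]]
    have "pr (extn A H) (ws ! j) (blocks ?ns us ! j) = Idt (Car A) (io A H (?ts' ! j))" if j: "j < length ws" for j
      using extn_pr[of "ws ! j" "blocks ?ns ts ! j"] okt_blocks[OF w'(3) ts(2,1) j] j w'(3) ts(3) by (simp add: blocks_map)
    then have "map (\<lambda>j. pr (extn A H) (ws ! j) (blocks ?ns us ! j)) [0..<length ws] = map (Idt (Car A)) (map (io A H) ?ts')"
      by (intro nth_equalityI) auto
    then have 1: "pa A w (map (\<lambda>j. pr (extn A H) (ws ! j) (blocks ?ns us ! j)) [0..<length ws]) = Idt (Car A) (io A H (App w ?ts'))"
      using functor_id[OF M.A.Fun[OF w'(1)] M.io_list[OF ts']] by (simp only: pow_simps io.simps)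
    have 2: "pr (extn A H) w (map2 (\<lambda>w. fob (FPhi w)) ws (blocks ?ns us)) = Idt (Car A) (io A H (App w ?ts'))"
      unfolding ts(3) map2_FPhi_ob[OF w'(3) ts(2,1)] by (rule extn_pr[OF w'(1) ts'])
    have 3: "far ?K (pc FA w ws us) = ig A H (GC w ws ts)" unfolding ts(3) FA_pc[OF w ts(2,1)] using o by (simp add: extn_ar)
    have 4: "pr (extn A H) (gamma_word T w ws) us = Idt (Car A) (io A H (gs (GC w ws ts)))" using extn_pr[OF g(1) ts(1)] ts g by simp
    have 5: "pc A w ws (map (fob ?K) us) = ig A H (GC w ws ts)" unfolding ts(3) map_extn_ob[OF ts(1)] by simp
    show ?case unfolding 1 2 3 4 5 using cat_idl[OF M.A.C h] cat_idr[OF M.A.C h] by (simp only: gt.simps)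
  next
    case (2 us)
    then obtain ts where "\<forall>t\<in>set ts. okt t" "length ts = 1" "us = map cd ts" by (rule pow_ObE)
    then obtain t where t: "okt t" "us = [cd t]" by (cases ts) (auto simp: One_nat_def)
    have o: "okg (GI t)" using t by simp
    note h = conjunct1[OF M.ig_hom[OF o]]
    show ?case using extn_pr[OF unit_words_T(1), of "[t]"] t cat_idr[OF M.A.C h]
      by (simp add: extn_ob FA_pI extn_ar unit_words_T One_nat_def[symmetric])
  next
    case (3 w l f us)
    note w = 3(1) and us = 3(2)
    obtain ts where ts: "\<forall>t\<in>set ts. okt t" "length ts = l" "us = map cd ts" using pow_ObE[OF us] .
    note w' = swords_words[OF w] and g = subst_words_T[OF w]
    have o: "okg (GS w l f ts)" using w ts by simp
    note h = conjunct1[OF M.ig_hom[OF o]]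
    have nf: "map ((!) us) f = map cd (map ((!) ts) f)" unfolding ts(3) using ts(2) w'(3) by (auto simp: subset_iff)
    have tf: "\<forall>t\<in>set (map ((!) ts) f). okt t" "length (map ((!) ts) f) = Dom T w" using ts w' by (auto simp: subset_iff)
    have 1: "pr (extn A H) w (map ((!) us) f) = Idt (Car A) (io A H (gt (GS w l f ts)))"
      unfolding nf using extn_pr[OF w'(1) tf] by (simp only: gt.simps)
    have 2: "far ?K (ps FA w l f us) = ig A H (GS w l f ts)" unfolding ts(3) FA_ps[OF w ts(2,1)] using o by (simp add: extn_ar)
    have 3: "pr (extn A H) (subst_word T w l f) us = Idt (Car A) (io A H (gs (GS w l f ts)))" using extn_pr[OF g(1) ts(1)] ts g by simp
    have 4: "ps A w l f (map (fob ?K) us) = ig A H (GS w l f ts)" unfolding ts(3) map_extn_ob[OF ts(1)] by simp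
    show ?case unfolding 1 2 3 4 cat_idl[OF M.A.C h] by (rule cat_idr[OF M.A.C h])
  qed
  with data show ?thesis using is_psmor_iff[OF T FA.X M.A.X] by blast
qed

lemma psmorphism_extn: "psmorphism T FA A (extn A H)" by (rule psmorphismI[OF psalgebra_FA M.A.psalgebra_axioms is_psmor_extn])

lemma strict_extn: "strict_mor T FA A (extn A H)" unfolding strict_mor_def
proof (intro conjI ballI)
  show "is_psmor T FA A (extn A H)" by (rule is_psmor_extn)
  fix w us assume w: "w \<in> words T" and "us \<in> tup FA (Dom T w)"
  then obtain ts where ts: "\<forall>t\<in>set ts. okt t" "length ts = Dom T w" "us = map cd ts" unfolding FA_simps by (elim pow_ObE)
  show "pr (extn A H) w us = Idt (Car A) (po A w (map (fob (Fn (extn A H))) us))"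
    using extn_pr[OF w ts(1,2)] map_extn_ob[OF ts(1)] by (simp add: ts(3) del: map_map)
qed

text \<open>On \<open>Var\<close> and \<open>Eta\<close> evaluation returns the functor of
  \<open>H\<close>. On components of \<rho>, the identity supplied by \<open>extn\<close> is
  composed with the value of \<open>GR\<close>, which is the component of \<rho> for
  \<open>H\<close>.\<close>

lemma restr_extn: "restr A (extn A H) = H"
proof (rule psmor_eqI[OF psmorphism_restr[OF psmorphism_extn] M.H.psmorphism_axioms])
  interpret R: psmorphism S X "U A" "restr A (extn A H)" by (rule psmorphism_restr[OF psmorphism_extn])
  show "Fn (restr A (extn A H)) = Fn H" by (rule functor_eqI[OF R.F M.H.F]) (simp_all add: restr_ob restr_ar extn_ob extn_ar)
  fix w xs assume w: "w \<in> words S" and xs: "xs \<in> tup X (Dom S w)"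
  have o: "okg (GR w xs)" using w xs by simp
  have vs: "\<forall>t\<in>set (map Var xs). okt t" "length (map Var xs) = Dom T (far \<phi> w)" using xs m_Dom[OF w] by (auto simp: Ob_pow)
  show "pr (restr A (extn A H)) w xs = pr H w xs" using cat_idl[OF M.A.C conjunct1[OF M.ig_hom[OF o]]] o extn_pr[OF m_words[OF w] vs]
    by (simp add: restr_pr[OF psmorphism_extn w xs] extn_ar del: map_map)
qed

end

text \<open>A strict morphism preserves words and coherence isomorphisms, so induction on terms and
  on expressions shows that it is evaluation in the model given by its own restriction. Two strict
  morphisms with equal restrictions are therefore equal.\<close>

lemma strict_is_extn:
  assumes K: "psmorphism T FA A K" and st: "strict_mor T FA A K"
  shows "K = extn A (restr A K)"
proof -
  interpret K: psmorphism T FA A K by (rule K)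
  let ?H = "restr A K"
  have M: "free_model S T \<phi> X A ?H" using free_base_axioms K.Y.psalgebra_axioms psmorphism_restr[OF K] by (simp add: free_model_def)
  interpret M: free_model S T \<phi> X A ?H by (rule M)
  have ob: "fob (Fn K) (cd t) = io A ?H t" if "okt t" for t using that
  proof (induction t)
    case (Var x)
    then show ?case by (simp add: restr_ob)
  next
    case (App w ts)
    then have ts: "\<forall>t\<in>set ts. okt t" "length ts = Dom T w" "w \<in> words T" by auto
    have "map (fob (Fn K)) (map cd ts) = map (io A ?H) ts" using App ts by auto
    then show ?case using K.st_po[OF st ts(3), of "map cd ts"] pow_Ob[OF ts(1,2)] FPhi_ob[OF ts(3,2,1)] by (simp del: map_map)
  qed
  have obs: "map (fob (Fn K)) (map cd ts) = map (io A ?H) ts" if "\<forall>t\<in>set ts. okt t" for ts using that ob by auto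
  have gen: "far (Fn K) (qt (Gn g)) = ig A ?H g" if o: "okg g" for g
  proof (cases g)
    case (GC w ws ts)
    then show ?thesis using o K.st_pc[OF st, of w ws "map cd ts"] pow_Ob[of ts] obs[of ts] FA_pc[of w ws ts] by (simp del: map_map)
  next
    case (GI t)
    then show ?thesis using o K.st_pI[OF st, of "cd t"] FC_Ob[of t] ob[of t] FA_pI[of t] by simp
  next
    case (GS w l f ts)
    then show ?thesis using o K.st_ps[OF st, of w l f "map cd ts"] pow_Ob[of ts] obs[of ts] FA_ps[of w l f ts] by (simp del: map_map)
  next
    \<comment> \<open>By \<open>restr_pr\<close>, \<rho> of the restriction is \<rho> of
      \<open>K\<close> after the image of \<open>GR\<close>. The former is an identity since
      \<open>K\<close> is strict, so the image of \<open>GR\<close> is the value that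
      \<open>ig\<close> prescribes.\<close>
    case (GR w xs)
    then have w: "w \<in> words S" and xs: "xs \<in> tup X (Dom S w)" using o by auto
    have vs: "\<forall>t\<in>set (map Var xs). okt t" "length (map Var xs) = Dom T (far \<phi> w)"
      using xs m_Dom[OF w] by (auto simp: Ob_pow)
    have p: "map cd (map Var xs) \<in> tup FA (Dom T (far \<phi> w))" using pow_Ob[OF vs] by simp
    have "qt (Gn g) \<in> hom FC (cd (gs g)) (po FA (far \<phi> w) (map cd (map Var xs)))"
      using FC_hom[of "Gn g"] o GR FPhi_ob[OF m_words[OF w] vs(2,1)] by (simp del: map_map)
    from functor_hom[OF K.F[unfolded FA_simps] this]
    have "far (Fn K) (qt (Gn g)) \<in> hom (Car A) (fob (Fn K) (cd (gs g))) (po A (far \<phi> w) (map (fob (Fn K)) (map cd (map Var xs))))"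
      by (simp only: K.st_po[OF st m_words[OF w] p])
    from cat_idl[OF K.Y.C this] show ?thesis using GR by (simp add: restr_pr[OF K w xs] K.st_pr[OF st m_words[OF w] p] del: map_map)
  qed
  have ar: "far (Fn K) (qt e) = ia A ?H e" if "ok e" for e using that
  proof (induction e)
    case (Eta f)
    then show ?case by (simp add: restr_ar)
  next
    case (Ide t)
    then show ?case using functor_id[OF K.F, of "cd t"] FC_Ob[of t] by (simp add: FC_Idt ob)
  next
    case (Cm g f)
    then show ?case using functor_comp[OF K.F, of "qt f" "cd (sr f)" "cd (tg f)" "qt g" "cd (tg g)"] FC_hom[of f] FC_hom[of g]
      by (simp add: FC_Comp)
  next
    case (Op w es)
    then have es: "\<forall>e\<in>set es. ok e" "length es = Dom T w" "w \<in> words T" by auto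
    have m: "map (far (Fn K)) (map qt es) = map (ia A ?H) es" using Op es by auto
    have h: "map qt es \<in> hom (pow_cat (Car FA) (Dom T w)) (map (Dom FC) (map qt es)) (map (Cod FC) (map qt es))"
      using pow_Ar[OF es(1,2)] by (simp add: hom_def)
    show ?case using K.st_pa[OF st es(3) h] by (simp only: m FA_simps ia.simps FPhi_ar[OF es(3,2,1)])
  next
    case (Gn g)
    then show ?case using gen by simp
  next
    case (Gi g)
    then show ?case using gen functor_Gi[OF K.F[unfolded FA_simps]] by simp
  qed
  interpret E: psmorphism T FA A "extn A ?H" by (rule psmorphism_extn[OF M])
  show ?thesis
  proof (rule psmor_eqI[OF K E.psmorphism_axioms])
    show FF: "Fn K = Fn (extn A ?H)"
    proof (rule functor_eqI[OF K.F E.F])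
      fix x assume "x \<in> Ob (Car FA)"
      then show "fob (Fn K) x = fob (Fn (extn A ?H)) x" unfolding FA_simps by (elim FC_ObE) (simp add: ob extn_ob[OF M])
    next
      fix f assume "f \<in> Ar (Car FA)"
      then show "far (Fn K) f = far (Fn (extn A ?H)) f" unfolding FA_simps by (elim FC_ArE) (simp add: ar extn_ar[OF M])
    qed
    fix w xs assume w: "w \<in> words T" and xs: "xs \<in> tup FA (Dom T w)"
    show "pr K w xs = pr (extn A ?H) w xs" using K.st_pr[OF st w xs] E.st_pr[OF strict_extn[OF M] w xs] FF by simp
  qed
qed

section \<open>Lifting 2-cells along the universal morphism\<close>

context
  fixes A :: "('t, 'u, 'u) psalg" and G H :: "('t, 'u, 'u, 'u, 'u) psmor"
    and b :: "'u => 'u"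
begin

text \<open>The cell equation says that \<open>pr H w\<close> after the component at
  \<open>App w ts\<close> equals \<open>pa A w\<close> of the components at the \<open>ts\<close>
  after \<open>pr G w\<close>. Solving it for the component at \<open>App w ts\<close> gives the
  recursive clause, while \<open>b\<close> prescribes the components at variables.\<close>

fun al :: "('t, 'u) tm => 'u" where
  "al (Var x) = b x"
| "al (App w ts) = Comp (Car A) (inverse_ar (Car A) (pr H w (map cd ts))) (Comp (Car A) (pa A w (map al ts)) (pr G w (map cd ts)))"

end

context
  fixes A :: "('t, 'u, 'u) psalg" and G H :: "('t, 'u, 'u, 'u, 'u) psmor" and \<beta> :: "('s, 'u, 'u, 'u, 'u) pscell"
  assumes Gm: "psmorphism T FA A G" and Hm: "psmorphism T FA A H"
    and \<beta>: "is_pscell S X (U A) \<beta>" and \<beta>S: "Src \<beta> = restr A G" and \<beta>T: "Tgt \<beta> = restr A H"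
begin

interpretation G: psmorphism T FA A G by (rule Gm)
interpretation H: psmorphism T FA A H by (rule Hm)

lemmas bD = pscellD[OF X.psalgebra_axioms psalgebra_forget[OF G.Y.psalgebra_axioms] \<beta>, unfolded \<beta>S \<beta>T]

abbreviation "b \<equiv> ncomp (Nt \<beta>)"
abbreviation "a \<equiv> al A G H b"
abbreviation "CA \<equiv> Car A"
abbreviation "cA \<equiv> Comp (Car A)"

lemma b_hom: "x \<in> Ob (Car X) ==> b x \<in> hom CA (fob (Fn G) (cd (Var x))) (fob (Fn H) (cd (Var x)))"
  using nat_hom[OF bD(3)] by (simp add: bD(4,5) restr_ob)

lemma al_hom: "okt t ==> a t \<in> hom CA (fob (Fn G) (cd t)) (fob (Fn H) (cd t))"
proof (induction t)
  case (Var x)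
  then show ?case using b_hom by simp
next
  case (App w ts)
  then have ts: "\<forall>t\<in>set ts. okt t" "length ts = Dom T w" "w \<in> words T" by auto
  have p: "map cd ts \<in> tup FA (Dom T w)" using pow_Ob[OF ts(1,2)] by simp
  have "map a ts \<in> hom (pow_cat CA (Dom T w)) (map (fob (Fn G)) (map cd ts)) (map (fob (Fn H)) (map cd ts))"
    using App ts by (auto simp: hom_pow)
  from cat_comp[OF G.Y.C cat_comp[OF G.Y.C G.pr_hom(1)[OF ts(3) p] G.Y.pa_hom[OF ts(3) this]]
      inverse_ar(1)[OF H.pr_hom(2,1)[OF ts(3) p]]]
  show ?case using FPhi_ob[OF ts(3,2,1)] by simp
qed

lemma map_al_hom: "\<forall>t\<in>set ts. okt t ==> length ts = n ==>
    map a ts \<in> hom (pow_cat CA n) (map (fob (Fn G)) (map cd ts)) (map (fob (Fn H)) (map cd ts))" using al_hom by (auto simp: hom_pow)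

text \<open>The recursive clause of \<open>al\<close> with the inverse of \<open>pr H\<close>
  cancelled: the cell equation in its original form.\<close>

lemma al_App:
  assumes w: "w \<in> words T" and ts: "\<forall>t\<in>set ts. okt t" "length ts = Dom T w"
  shows "cA (pr H w (map cd ts)) (a (App w ts)) = cA (pa A w (map a ts)) (pr G w (map cd ts))"
proof -
  have p: "map cd ts \<in> tup FA (Dom T w)" using pow_Ob[OF ts] by simp
  note i = inverse_ar[OF H.pr_hom(2,1)[OF w p]]
  note h = cat_comp[OF G.Y.C G.pr_hom(1)[OF w p] G.Y.pa_hom[OF w map_al_hom[OF ts]]]
  show ?thesis using cat_assoc[OF G.Y.C h i(1) H.pr_hom(1)[OF w p]] i(3) cat_idl[OF G.Y.C h] by simp
qed

lemma pr_typed: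
  assumes w: "w \<in> words T" and ts: "\<forall>t\<in>set ts. okt t" "length ts = Dom T w"
  shows "pr G w (map cd ts) \<in> hom CA (fob (Fn G) (cd (App w ts))) (po A w (map (fob (Fn G)) (map cd ts)))"
    "pr H w (map cd ts) \<in> hom CA (fob (Fn H) (cd (App w ts))) (po A w (map (fob (Fn H)) (map cd ts)))"
    "iso CA (pr H w (map cd ts))" using G.pr_hom[OF w, of "map cd ts"] H.pr_hom[OF w, of "map cd ts"] pow_Ob[OF ts] FPhi_ob[OF w ts(2,1)]
  by (simp_all del: map_map)

text \<open>For \<open>GC\<close>, \<open>GI\<close> and \<open>GS\<close> the morphism axioms of
  \<open>G\<close> and of \<open>H\<close> are linked by naturality of the coherence isomorphism of
  \<open>A\<close>. For \<open>GR\<close> the claim is the cell equation of \<beta>, and this is the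
  only place where that equation enters. Apart from \<open>GI\<close>, both sides are compared after
  composing with an invertible arrow.\<close>

lemma al_gen:
  assumes o: "okg g"
  shows "cA (a (gt g)) (far (Fn G) (qt (Gn g))) = cA (far (Fn H) (qt (Gn g))) (a (gs g))"
proof -
  note C = G.Y.C
  let ?fG = "far (Fn G) (qt (Gn g))"
  let ?fH = "far (Fn H) (qt (Gn g))"
  have Gg: "?fG \<in> hom CA (fob (Fn G) (cd (gs g))) (fob (Fn G) (cd (gt g)))"
    and Hg: "?fH \<in> hom CA (fob (Fn H) (cd (gs g))) (fob (Fn H) (cd (gt g)))"
    using functor_hom[OF G.F[unfolded FA_simps] FC_hom[of "Gn g"]] functor_hom[OF H.F[unfolded FA_simps] FC_hom[of "Gn g"]] o by simp_all
  note as = al_hom[OF conjunct1[OF okg_okt[OF o]]] and at = al_hom[OF conjunct2[OF okg_okt[OF o]]]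
  note L = cat_comp[OF C Gg at] and R = cat_comp[OF C as Hg]
  show ?thesis
  proof (cases g)
    case (GC w ws ts)
    let ?ns = "map (Dom T) ws"
    have w: "(w, ws) \<in> cwords T" and ts: "\<forall>t\<in>set ts. okt t" "length ts = sum_list ?ns" using o GC by auto
    note w' = cwords_words[OF w]
    note g' = gamma_words_T[OF w]
    have tsg: "length ts = Dom T (gamma_word T w ws)" using ts g' by simp
    let ?ts' = "map2 App ws (blocks ?ns ts)"
    have ts': "\<forall>t\<in>set ?ts'. okt t" "length ?ts' = Dom T w" using okt_map2_App[OF w'(3) ts(2,1)] w' by auto
    let ?us = "map cd ts"
    let ?Gu = "map (fob (Fn G)) ?us"
    let ?Hu = "map (fob (Fn H)) ?us"
    let ?g = "gamma_word T w ws"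
    let ?p = "pr H w (map cd ?ts')"
    let ?q = "pr G w (map cd ?ts')"
    let ?cG = "pc A w ws ?Gu"
    let ?cH = "pc A w ws ?Hu"
    have us: "?us \<in> tup FA (sum_list ?ns)" using pow_Ob[OF ts] by simp
    have m2: "map2 (po FA) ws (blocks ?ns ?us) = map cd ?ts'" using map2_FPhi_ob[OF w'(3) ts(2,1)] by simp
    have FApc: "pc FA w ws ?us = qt (Gn g)" using FA_pc[OF w ts(2,1)] GC by simp
    let ?rG = "map (\<lambda>j. pr G (ws ! j) (blocks ?ns ?us ! j)) [0..<length ws]"
    let ?rH = "map (\<lambda>j. pr H (ws ! j) (blocks ?ns ?us ! j)) [0..<length ws]"
    let ?H = "pa A w ?rH"
    note pG = pr_typed(1)[OF w'(1) ts'] and pH = pr_typed(2,3)[OF w'(1) ts']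
    note pGg = pr_typed(1)[OF g'(1) ts(1) tsg] and pHg = pr_typed(2)[OF g'(1) ts(1) tsg]
    have rG: "?rG \<in> hom (pow_cat CA (Dom T w)) (map (fob (Fn G)) (map cd ?ts')) (map2 (po A) ws (blocks ?ns ?Gu))"
      using G.pr_blocks_hom[OF w'(3) us] w'(2) unfolding m2 by (simp only:)
    have rH: "?rH \<in> hom (pow_cat CA (Dom T w)) (map (fob (Fn H)) (map cd ?ts')) (map2 (po A) ws (blocks ?ns ?Hu))"
      using H.pr_blocks_hom[OF w'(3) us] w'(2) unfolding m2 by (simp only:)
    note a' = map_al_hom[OF ts'] and aa = map_al_hom[OF ts]
    let ?ba = "map2 (pa A) ws (blocks ?ns (map a ts))"
    let ?B = "pa A w ?ba"
    have FG: "?Gu \<in> Ob (pow_cat CA (sum_list ?ns))" "?Hu \<in> Ob (pow_cat CA (sum_list ?ns))"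
      using G.F_Ob[OF us] H.F_Ob[OF us] by simp_all
    have wj: "ws ! j \<in> words T" if "j < length ws" for j using that w'(3) by (simp add: subset_iff)
    have bj: "\<forall>t\<in>set (blocks ?ns ts ! j). okt t" "length (blocks ?ns ts ! j) = Dom T (ws ! j)" if "j < length ws" for j
      using okt_blocks[OF w'(3) ts(2,1) that] by auto
    \<comment> \<open>The cell equation at each inner word. Applying the functor \<open>w\<close> of
      \<open>A\<close> to both lists carries the components at the \<open>?ts'\<close> over to
      components at the \<open>ts\<close>.\<close>
    have comb: "map2 cA ?rH (map a ?ts') = map2 cA ?ba ?rG" using al_App[OF wj bj] by (intro nth_equalityI) (auto simp: blocks_map)
    have ba: "?ba \<in> hom (pow_cat CA (Dom T w)) (map2 (po A) ws (blocks ?ns ?Gu)) (map2 (po A) ws (blocks ?ns ?Hu))" unfolding w'(2)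
    proof (rule hom_powI)
      fix j assume j: "j < length ws"
      show "?ba ! j \<in> hom CA (map2 (po A) ws (blocks ?ns ?Gu) ! j) (map2 (po A) ws (blocks ?ns ?Hu) ! j)"
        using G.Y.pa_hom[OF wj[OF j] map_al_hom[OF bj[OF j]]] j by (simp add: blocks_map)
    qed simp_all
    note cG = G.Y.pc_hom(1)[OF w FG(1)] and cH = G.Y.pc_hom(1)[OF w FG(2)]
    note paH = G.Y.pa_hom[OF w'(1) rH] and paG = G.Y.pa_hom[OF w'(1) rG] and paa = G.Y.pa_hom[OF w'(1) a']
      and pab = G.Y.pa_hom[OF w'(1) ba]
    have aa': "map a ts \<in> hom (pow_cat CA (Dom T ?g)) ?Gu ?Hu" using aa g'(2) by simp
    note pag = G.Y.pa_hom[OF g'(1) aa']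
    have gst: "gs g = App ?g ts" "gt g = App w ?ts'" using GC by simp_all
    note Gg = Gg[unfolded gst] and Hg = Hg[unfolded gst] and as = as[unfolded gst] and at = at[unfolded gst]
    \<comment> \<open>Both sides of the claim end at the value of \<open>H\<close> on a term with
      two layers of words. The part \<open>?p\<close> takes \<open>H\<close> past the outer word and
      \<open>?H\<close> past the inner ones; their composite is the invertible arrow that will be
      cancelled.\<close>
    have i: "iso CA (cA ?H ?p)"
    proof (rule iso_comp[OF C pH(1) paH pH(2)])
      have "iso (pow_cat CA (Dom T w)) ?rH" using pr_typed(3)[OF wj bj] w'(2) by (intro iso_pow[OF C]) (auto simp: blocks_map)
      then show "iso CA ?H" by (rule functor_iso[OF G.Y.Fun[OF w'(1)] rH])
    qed
    have "cA (cA ?H ?p) (cA (a (gt g)) ?fG) = cA (cA ?H (cA ?p (a (gt g)))) ?fG"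
      unfolding gst using cat_assoc[OF C Gg at cat_comp[OF C pH(1) paH]] cat_assoc[OF C at pH(1) paH] by simp
    also have "\<dots> = cA (cA ?H (cA (pa A w (map a ?ts')) ?q)) ?fG" unfolding gst al_App[OF w'(1) ts'] ..
    also have "\<dots> = cA (cA (cA ?H (pa A w (map a ?ts'))) ?q) ?fG" using cat_assoc[OF C pG paa paH] by simp
    also have "cA ?H (pa A w (map a ?ts')) = cA ?B (pa A w ?rG)"
      using functor_comp[OF G.Y.Fun[OF w'(1)] a' rH] functor_comp[OF G.Y.Fun[OF w'(1)] rG ba] comb by simp
    also have "cA (cA (cA ?B (pa A w ?rG)) ?q) ?fG = cA ?B (cA (pa A w ?rG) (cA ?q ?fG))"
      using cat_assoc[OF C pG paG pab] cat_assoc[OF C Gg cat_comp[OF C pG paG] pab] cat_assoc[OF C Gg pG paG] by simp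
    also have "cA (pa A w ?rG) (cA ?q ?fG) = cA ?cG (pr G ?g ?us)" using G.pr_gamma[OF w us] unfolding m2 FApc by (rule sym)
    also have "cA ?B (cA ?cG (pr G ?g ?us)) = cA (cA ?B ?cG) (pr G ?g ?us)" by (rule cat_assoc[OF C pGg cG pab])
    \<comment> \<open>Naturality of \<open>c\<close> in \<open>A\<close> takes the components at the
      arguments across. From here on the chain runs through the cell equation at the composite word
      and the axiom of \<open>H\<close>, mirroring what was done for \<open>G\<close>.\<close>
    also have "cA ?B ?cG = cA ?cH (pa A ?g (map a ts))" by (rule G.Y.pc_natural[OF w aa, symmetric])
    also have "cA (cA ?cH (pa A ?g (map a ts))) (pr G ?g ?us) = cA ?cH (cA (pr H ?g ?us) (a (gs g)))"
      unfolding gst al_App[OF g'(1) ts(1) tsg] by (rule cat_assoc[OF C pGg pag cH, symmetric])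
    also have "\<dots> = cA (cA ?H (cA ?p ?fH)) (a (gs g))"
      using H.pr_gamma[OF w us] unfolding m2 FApc gst using cat_assoc[OF C as pHg cH] by simp
    also have "\<dots> = cA (cA ?H ?p) (cA ?fH (a (gs g)))"
      unfolding gst using cat_assoc[OF C Hg pH(1) paH] cat_assoc[OF C as Hg cat_comp[OF C pH(1) paH]] by simp
    finally show ?thesis by (rule iso_cancel[OF C cat_comp[OF C pH(1) paH, folded gst(2)] i L R])
  next
    case (GI t)
    then have t: "okt t" using o by simp
    let ?iG = "ncomp (II A) [fob (Fn G) (cd t)]"
    let ?iH = "ncomp (II A) [fob (Fn H) (cd t)]"
    have gst: "gs g = App (unit_word T) [t]" "gt g = t" using GI by simp_all
    note Gg = Gg[unfolded gst] and Hg = Hg[unfolded gst] and as = as[unfolded gst] and at = at[unfolded gst]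
    have ts: "\<forall>t\<in>set [t]. okt t" "length [t] = Dom T (unit_word T)" using t unit_words_T by (simp_all add: One_nat_def)
    have oc: "cd t \<in> Ob (Car FA)" using FC_Ob[OF t] by simp
    have FAI: "ncomp (II FA) [cd t] = qt (Gn g)" using FA_pI[OF t] GI by simp
    note pG = pr_typed(1)[OF unit_words_T(1) ts, simplified] and pH = pr_typed(2)[OF unit_words_T(1) ts, simplified]
    note iG = G.Y.pI_hom(1)[OF functor_ob[OF G.F oc]] and iH = G.Y.pI_hom(1)[OF functor_ob[OF H.F oc]]
    have "[a t] \<in> hom (pow_cat CA (Dom T (unit_word T))) [fob (Fn G) (cd t)] [fob (Fn H) (cd t)]" using map_al_hom[OF ts] by simp
    note pat = G.Y.pa_hom[OF unit_words_T(1) this]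
    have "cA (a t) ?fG = cA (cA (a t) ?iG) (pr G (unit_word T) [cd t])" using cat_assoc[OF C pG iG at] G.pr_unit[OF oc] FAI by simp
    also have "cA (a t) ?iG = cA ?iH (pa A (unit_word T) [a t])" by (rule G.Y.pI_natural[OF at, symmetric])
    also have "cA (cA ?iH (pa A (unit_word T) [a t])) (pr G (unit_word T) [cd t]) = cA ?iH (cA (pr H (unit_word T) [cd t]) (a (gs g)))"
      using cat_assoc[OF C pG pat iH] al_App[OF unit_words_T(1) ts] unfolding gst by (simp del: al.simps)
    also have "\<dots> = cA ?fH (a (gs g))" using cat_assoc[OF C as pH iH] H.pr_unit[OF oc] FAI unfolding gst by (simp del: al.simps)
    finally show ?thesis unfolding gst .
  next
    case (GS w l f ts)
    have w: "(w, l, f) \<in> swords T" and ts: "\<forall>t\<in>set ts. okt t" "length ts = l" using o GS by auto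
    note w' = swords_words[OF w]
    note g' = subst_words_T[OF w]
    have tsg: "length ts = Dom T (subst_word T w l f)" using ts g' by simp
    let ?tf = "map ((!) ts) f" and ?us = "map cd ts"
    let ?g = "subst_word T w l f"
    let ?Gu = "map (fob (Fn G)) ?us"
    let ?Hu = "map (fob (Fn H)) ?us"
    let ?a = "pa A w (map a ?tf)"
    let ?p = "pr H w (map cd ?tf)"
    have tf: "\<forall>t\<in>set ?tf. okt t" "length ?tf = Dom T w" using ts w' by (auto simp: subset_iff)
    have us: "?us \<in> tup FA l" using pow_Ob[OF ts] by simp
    have uf: "map ((!) ?us) f = map cd ?tf" using ts(2) w'(3) by (auto simp: subset_iff)
    have FAps: "ps FA w l f ?us = qt (Gn g)" using FA_ps[OF w ts(2,1)] GS by simp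
    have gst: "gs g = App ?g ts" "gt g = App w ?tf" using GS by simp_all
    note Gg = Gg[unfolded gst] and Hg = Hg[unfolded gst] and as = as[unfolded gst] and at = at[unfolded gst]
    note pG = pr_typed(1)[OF w'(1) tf] and pH = pr_typed(2,3)[OF w'(1) tf]
    note pGg = pr_typed(1)[OF g'(1) ts(1) tsg] and pHg = pr_typed(2)[OF g'(1) ts(1) tsg]
    have FG: "?Gu \<in> Ob (pow_cat CA l)" "?Hu \<in> Ob (pow_cat CA l)" using G.F_Ob[OF us] H.F_Ob[OF us] by simp_all
    have nm: "map ((!) ?Gu) f = map (fob (Fn G)) (map cd ?tf)"
      "map ((!) ?Hu) f = map (fob (Fn H)) (map cd ?tf)" "map ((!) (map a ts)) f = map a ?tf" using ts(2) w'(3) by (auto simp: subset_iff)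
    note sG = G.Y.ps_hom(1)[OF w FG(1), unfolded nm] and sH = G.Y.ps_hom(1)[OF w FG(2), unfolded nm]
    note a' = map_al_hom[OF tf] and aa = map_al_hom[OF ts]
    have aa': "map a ts \<in> hom (pow_cat CA (Dom T ?g)) ?Gu ?Hu" using aa g'(2) by simp
    note pag = G.Y.pa_hom[OF g'(1) aa'] and paa = G.Y.pa_hom[OF w'(1) a']
    have "cA ?p (cA (a (gt g)) ?fG) = cA (cA ?a (pr G w (map cd ?tf))) ?fG"
      unfolding gst al_App[OF w'(1) tf, symmetric] by (rule cat_assoc[OF C Gg at pH(1)])
    also have "\<dots> = cA ?a (cA (ps A w l f ?Gu) (pr G ?g ?us))"
      using G.pr_subst[OF w us] cat_assoc[OF C Gg pG paa] unfolding uf FAps by simp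
    also have "\<dots> = cA (cA ?a (ps A w l f ?Gu)) (pr G ?g ?us)" by (rule cat_assoc[OF C pGg sG paa])
    also have "cA ?a (ps A w l f ?Gu) = cA (ps A w l f ?Hu) (pa A ?g (map a ts))" using G.Y.ps_natural[OF w aa] unfolding nm by (rule sym)
    also have "cA (cA (ps A w l f ?Hu) (pa A ?g (map a ts))) (pr G ?g ?us) = cA (ps A w l f ?Hu) (cA (pr H ?g ?us) (a (gs g)))"
      unfolding gst al_App[OF g'(1) ts(1) tsg] by (rule cat_assoc[OF C pGg pag sH, symmetric])
    also have "\<dots> = cA (cA ?p ?fH) (a (gs g))" using H.pr_subst[OF w us] cat_assoc[OF C as pHg sH] unfolding uf FAps gst by simp
    also have "\<dots> = cA ?p (cA ?fH (a (gs g)))" unfolding gst by (rule cat_assoc[OF C as Hg pH(1), symmetric])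
    finally show ?thesis by (rule iso_cancel[OF C pH[folded gst(2)] L R])
  next
    case (GR w xs)
    then have w: "w \<in> words S" and xs: "xs \<in> tup X (Dom S w)" using o by auto
    have vs: "\<forall>t\<in>set (map Var xs). okt t" "length (map Var xs) = Dom T (far \<phi> w)"
      using xs m_Dom[OF w] by (auto simp: Ob_pow)
    let ?vs = "map cd (map Var xs)"
    let ?a = "pa A (far \<phi> w) (map a (map Var xs))"
    let ?pH = "pr H (far \<phi> w) ?vs"
    let ?pG = "pr G (far \<phi> w) ?vs"
    have gst: "gs g = Var (po X w xs)" "gt g = App (far \<phi> w) (map Var xs)" using GR by simp_all
    note Gg = Gg[unfolded gst] and Hg = Hg[unfolded gst] and as = as[unfolded gst] and at = at[unfolded gst]
    note pG = pr_typed(1)[OF m_words[OF w] vs] and pH = pr_typed(2,3)[OF m_words[OF w] vs]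
    note paa = G.Y.pa_hom[OF m_words[OF w] map_al_hom[OF vs]]
    have "map a (map Var xs) = map b xs" by simp
    \<comment> \<open>The cell equation of \<beta> at \<open>xs\<close>, with \<rho> of the two
      restrictions expanded into \<rho> of \<open>G\<close> and \<open>H\<close> and the images of
      \<open>GR\<close>.\<close>
    then have cell: "cA (cA ?pH ?fH) (a (gs g)) = cA ?a (cA ?pG ?fG)"
      using bD(6)[OF w xs] w GR unfolding gst restr_pr[OF Gm w xs] restr_pr[OF Hm w xs] by (simp del: map_map)
    have "cA ?pH (cA (a (gt g)) ?fG) = cA (cA ?a ?pG) ?fG"
      unfolding gst al_App[OF m_words[OF w] vs, symmetric] by (rule cat_assoc[OF C Gg at pH(1)])
    also have "\<dots> = cA ?a (cA ?pG ?fG)" by (rule cat_assoc[OF C Gg pG paa, symmetric])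
    also have "\<dots> = cA ?pH (cA ?fH (a (gs g)))" unfolding cell[symmetric] gst by (rule cat_assoc[OF C as Hg pH(1), symmetric])
    finally show ?thesis by (rule iso_cancel[OF C pH[folded gst(2)] L R])
  qed
qed

text \<open>Every arrow is the class of an expression, so naturality can be proved by induction on
  expressions: \<open>Eta\<close> is naturality of \<beta>, composites paste squares, and
  \<open>Gn\<close> is \<open>al_gen\<close>. The case \<open>Op\<close> uses naturality of \<rho>
  for both morphisms.\<close>

lemma al_natural:
  "ok e ==> cA (a (tg e)) (far (Fn G) (qt e)) = cA (far (Fn H) (qt e)) (a (sr e))"
proof (induction e)
  case (Eta f)
  then show ?case using nat_natural[OF bD(3) Ar_hom[of f]] by (simp add: bD(4,5) restr_ar)
next
  case (Ide t)
  then have t: "okt t" by simp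
  show ?case using functor_id[OF G.F, of "cd t"] functor_id[OF H.F, of "cd t"] FC_Ob[OF t] FC_Idt[OF t]
      cat_idl[OF G.Y.C al_hom[OF t]] cat_idr[OF G.Y.C al_hom[OF t]] by simp
next
  case (Cm g f)
  then have gf: "ok g" "ok f" "tg f = sr g" by auto
  note hf = FC_hom[OF gf(2)] and hg = FC_hom[OF gf(1), folded gf(3)]
  note GF = G.F[unfolded FA_simps] and HF = H.F[unfolded FA_simps]
  note Gf = functor_hom[OF GF hf] and Gg = functor_hom[OF GF hg] and Hf = functor_hom[OF HF hf] and Hg = functor_hom[OF HF hg]
  have o: "okt (sr f)" "okt (tg f)" "okt (tg g)" using gf ok_okt by blast+
  note a1 = al_hom[OF o(1)] and a2 = al_hom[OF o(2)] and a3 = al_hom[OF o(3)]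
  note C = G.Y.C
  have "cA (a (tg g)) (cA (far (Fn G) (qt g)) (far (Fn G) (qt f))) = cA (cA (far (Fn H) (qt g)) (a (tg f))) (far (Fn G) (qt f))"
    using cat_assoc[OF C Gf Gg a3] Cm.IH(1)[OF gf(1)] gf(3) by simp
  also have "\<dots> = cA (far (Fn H) (qt g)) (cA (far (Fn H) (qt f)) (a (sr f)))" using cat_assoc[OF C Gf a2 Hg] Cm.IH(2)[OF gf(2)] by simp
  also have "\<dots> = cA (cA (far (Fn H) (qt g)) (far (Fn H) (qt f))) (a (sr f))" by (rule cat_assoc[OF C a1 Hf Hg])
  finally show ?case using functor_comp[OF GF hf hg] functor_comp[OF HF hf hg] FC_Comp[OF gf] by simp
next
  case (Op w es)
  then have es: "\<forall>e\<in>set es. ok e" "length es = Dom T w" "w \<in> words T" by auto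
  let ?s = "map sr es" and ?t = "map tg es"
  have s: "\<forall>t\<in>set ?s. okt t" "length ?s = Dom T w" and t: "\<forall>t\<in>set ?t. okt t" "length ?t = Dom T w"
    using es ok_okt by auto
  have fs: "map qt es \<in> hom (pow_cat (Car FA) (Dom T w)) (map cd ?s) (map cd ?t)" using es FC_hom by (auto simp: hom_pow)
  note C = G.Y.C
  note pGs = pr_typed(1)[OF es(3) s] and pGt = pr_typed(1)[OF es(3) t] and pHs = pr_typed(2)[OF es(3) s]
    and pHt = pr_typed(2,3)[OF es(3) t]
  note ps = G.Y.pa_hom[OF es(3) map_al_hom[OF s]] and pt = G.Y.pa_hom[OF es(3) map_al_hom[OF t]]
  note Ges = G.map_F_hom[OF fs] and Hes = H.map_F_hom[OF fs]
  note pGe = G.Y.pa_hom[OF es(3) Ges] and pHe = G.Y.pa_hom[OF es(3) Hes]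
  have o: "ok (Op w es)" using es by simp
  have Gg: "far (Fn G) (qt (Op w es)) \<in> hom CA (fob (Fn G) (cd (App w ?s))) (fob (Fn G) (cd (App w ?t)))"
    and Hg: "far (Fn H) (qt (Op w es)) \<in> hom CA (fob (Fn H) (cd (App w ?s))) (fob (Fn H) (cd (App w ?t)))"
    using functor_hom[OF G.F[unfolded FA_simps] FC_hom[OF o]] functor_hom[OF H.F[unfolded FA_simps] FC_hom[OF o]] by simp_all
  have as: "a (App w ?s) \<in> hom CA (fob (Fn G) (cd (App w ?s))) (fob (Fn H) (cd (App w ?s)))"
    and at: "a (App w ?t) \<in> hom CA (fob (Fn G) (cd (App w ?t))) (fob (Fn H) (cd (App w ?t)))"
    using ok_okt[OF o] al_hom by (metis sr.simps(4), metis tg.simps(4))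
  have q: "pa FA w (map qt es) = qt (Op w es)" using FPhi_ar[OF es(3,2,1)] by simp
  \<comment> \<open>The induction hypotheses side by side. They pass through the functor
    \<open>w\<close> of \<open>A\<close>, after which \<open>pr H\<close> at the list of targets is
    cancelled.\<close>
  have comb: "map2 cA (map a ?t) (map (far (Fn G)) (map qt es)) = map2 cA (map (far (Fn H)) (map qt es)) (map a ?s)"
    using Op es by (auto intro!: nth_equalityI)
  have "cA (pr H w (map cd ?t)) (cA (a (App w ?t)) (far (Fn G) (qt (Op w es))))
    = cA (cA (pa A w (map a ?t)) (pr G w (map cd ?t))) (far (Fn G) (qt (Op w es)))"
    unfolding al_App[OF es(3) t, symmetric] by (rule cat_assoc[OF C Gg at pHt(1)])
  also have "\<dots> = cA (pa A w (map a ?t)) (cA (pa A w (map (far (Fn G)) (map qt es))) (pr G w (map cd ?s)))"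
    using cat_assoc[OF C Gg pGt pt] G.pr_natural[OF es(3) fs] unfolding q by simp
  also have "\<dots> = cA (cA (pa A w (map a ?t)) (pa A w (map (far (Fn G)) (map qt es)))) (pr G w (map cd ?s))"
    by (rule cat_assoc[OF C pGs pGe pt])
  also have "cA (pa A w (map a ?t)) (pa A w (map (far (Fn G)) (map qt es)))
    = cA (pa A w (map (far (Fn H)) (map qt es))) (pa A w (map a ?s))"
    using functor_comp[OF G.Y.Fun[OF es(3)] Ges map_al_hom[OF t]] functor_comp[OF G.Y.Fun[OF es(3)] map_al_hom[OF s] Hes] comb
    by (simp only: pow_simps)
  also have "cA (cA (pa A w (map (far (Fn H)) (map qt es))) (pa A w (map a ?s))) (pr G w (map cd ?s))
    = cA (pa A w (map (far (Fn H)) (map qt es))) (cA (pr H w (map cd ?s)) (a (App w ?s)))"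
    unfolding al_App[OF es(3) s] by (rule cat_assoc[OF C pGs ps pHe, symmetric])
  also have "\<dots> = cA (cA (pr H w (map cd ?t)) (far (Fn H) (qt (Op w es)))) (a (App w ?s))"
    using cat_assoc[OF C as pHs pHe] H.pr_natural[OF es(3) fs] unfolding q by simp
  also have "\<dots> = cA (pr H w (map cd ?t)) (cA (far (Fn H) (qt (Op w es))) (a (App w ?s)))"
    by (rule cat_assoc[OF C as Hg pHt(1), symmetric])
  finally have "cA (a (App w ?t)) (far (Fn G) (qt (Op w es))) = cA (far (Fn H) (qt (Op w es))) (a (App w ?s))"
    by (rule iso_cancel[OF C pHt cat_comp[OF C Gg at] cat_comp[OF C as Hg]])
  then show ?case by (simp only: sr.simps tg.simps)
next
  case (Gn g)
  then show ?case using al_gen by simp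
next
  case (Gi g)
  then have o: "okg g" by simp
  have h: "qt (Gn g) \<in> hom FC (cd (gs g)) (cd (gt g))" using FC_hom[of "Gn g"] o by simp
  note GF = G.F[unfolded FA_simps] and HF = H.F[unfolded FA_simps]
  note i = iso_Gn[OF o]
  \<comment> \<open>Both functors send \<open>Gi g\<close> to the chosen inverse of the image of
    \<open>Gn g\<close>, so the square for \<open>Gn g\<close> is turned around.\<close>
  show ?case using inverse_ar_square[OF G.Y.C functor_hom[OF GF h] functor_iso[OF GF h i] functor_hom[OF HF h] functor_iso[OF HF h i]
        al_hom[OF conjunct1[OF okg_okt[OF o]]] al_hom[OF conjunct2[OF okg_okt[OF o]]] al_gen[OF o, symmetric]]
    by (simp add: functor_Gi[OF GF o] functor_Gi[OF HF o])
qed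

definition lcell :: "('t, 'u, 'u, 'u, 'u) pscell" where
  "lcell = \<lparr>Src = G, Tgt = H, Nt = \<lparr>nsrc = Fn G, ntgt = Fn H, ncomp = (\<lambda>u\<in>Ob FC. a (dc u))\<rparr>\<rparr>"

lemma lcell_simps: "Src lcell = G" "Tgt lcell = H" "nsrc (Nt lcell) = Fn G" "ntgt (Nt lcell) = Fn H"
  "okt t ==> ncomp (Nt lcell) (cd t) = a t" by (simp_all add: lcell_def FC_Ob)

lemma is_pscell_lcell: "is_pscell T FA A lcell"
proof (rule pscellI, simp_all add: lcell_simps Gm Hm)
  show "is_nat FC CA (Nt lcell)"
  proof (rule is_natI)
    show "is_functor FC CA (nsrc (Nt lcell))" "is_functor FC CA (ntgt (Nt lcell))" using G.F H.F by (simp_all add: lcell_simps)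
    show "ncomp (Nt lcell) \<in> extensional (Ob FC)" by (simp add: lcell_def)
    show "ncomp (Nt lcell) x \<in> hom CA (fob (nsrc (Nt lcell)) x) (fob (ntgt (Nt lcell)) x)" if "x \<in> Ob FC" for x
      using that by (elim FC_ObE) (simp add: lcell_simps al_hom)
    fix f x y assume "f \<in> hom FC x y"
    then obtain e where e: "ok e" "f = qt e" "x = cd (sr e)" "y = cd (tg e)" by (rule FC_homE)
    then show "cA (ncomp (Nt lcell) y) (far (nsrc (Nt lcell)) f) = cA (far (ntgt (Nt lcell)) f) (ncomp (Nt lcell) x)"
      using al_natural[OF e(1)] ok_okt[OF e(1)] by (simp add: lcell_simps)
  qed
  fix w us assume w: "w \<in> words T" and us: "us \<in> Ob (pow_cat FC (Dom T w))"
  obtain ts where ts: "\<forall>t\<in>set ts. okt t" "length ts = Dom T w" "us = map cd ts" using pow_ObE[OF us] .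
  have "map (ncomp (Nt lcell)) (map cd ts) = map a ts" using ts(1) by (auto simp: lcell_simps)
  then show "cA (pr H w us) (ncomp (Nt lcell) (fob (FPhi w) us)) = cA (pa A w (map (ncomp (Nt lcell)) us)) (pr G w us)"
    using al_App[OF w ts(1,2)] FPhi_ob[OF w ts(2,1)] w ts by (simp add: lcell_simps del: map_map al.simps)
qed

lemma restr2_ncomp:
  assumes "is_pscell T FA A \<alpha>" "x \<in> Ob (Car X)"
  shows "ncomp (Nt (restr2 A \<alpha>)) x = ncomp (Nt \<alpha>) (cd (Var x))"
  using hcomp_id_right[OF functor_eta pscellD(3)[OF psalgebra_FA G.Y.psalgebra_axioms assms(1), unfolded FA_simps] assms(2)] assms(2)
  by (simp add: restr2_def pscell_hcomp_def eta_ob)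

text \<open>Restriction reads off the components at variables, where \<open>al\<close> returns
  \<open>b\<close>; the ends agree by the assumptions on the source and target of \<beta>.\<close>

lemma restr2_lcell: "restr2 A lcell = \<beta>"
proof -
  have "Nt (restr2 A lcell) = Nt \<beta>"
  proof (rule nattr_eqI)
    show "nsrc (Nt (restr2 A lcell)) = nsrc (Nt \<beta>)" "ntgt (Nt (restr2 A lcell)) = ntgt (Nt \<beta>)"
      by (simp_all add: restr2_def pscell_hcomp_def lcell_simps bD(4,5)) (simp_all add: restr_def)
    show "ncomp (Nt (restr2 A lcell)) \<in> extensional (Ob (Car X))" by (simp add: restr2_def pscell_hcomp_def)
    show "ncomp (Nt \<beta>) \<in> extensional (Ob (Car X))" by (rule nat_ext[OF bD(3)])
    show "ncomp (Nt (restr2 A lcell)) x = ncomp (Nt \<beta>) x" if "x \<in> Ob (Car X)" for x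
      using that by (simp add: restr2_ncomp[OF is_pscell_lcell] lcell_simps)
  qed
  moreover have "Src (restr2 A lcell) = Src \<beta>" "Tgt (restr2 A lcell) = Tgt \<beta>"
    unfolding \<beta>S \<beta>T by (simp_all add: restr2_def pscell_hcomp_def lcell_simps restr_def)
  ultimately show ?thesis by simp
qed

text \<open>The restriction fixes the components at variables. At \<open>App w ts\<close> the cell
  equation fixes the component after composition with \<open>pr H\<close>, which is
  invertible.\<close>

lemma lcell_unique:
  assumes c: "is_pscell T FA A \<alpha>" "Src \<alpha> = G" "Tgt \<alpha> = H" and eq: "restr2 A \<alpha> = \<beta>"
  shows "\<alpha> = lcell"
proof -
  note D = pscellD[OF psalgebra_FA G.Y.psalgebra_axioms c(1), unfolded c(2,3)]
  have "ncomp (Nt \<alpha>) (cd t) = a t" if "okt t" for t using that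
  proof (induction t)
    case (Var x)
    then show ?case using restr2_ncomp[OF c(1), of x] eq by simp
  next
    case (App w ts)
    then have ts: "\<forall>t\<in>set ts. okt t" "length ts = Dom T w" and w: "w \<in> words T" by auto
    have m: "map (ncomp (Nt \<alpha>)) (map cd ts) = map a ts" using App ts by auto
    have h: "ncomp (Nt \<alpha>) (cd (App w ts)) \<in> hom CA (fob (Fn G) (cd (App w ts))) (fob (Fn H) (cd (App w ts)))"
      using nat_hom[OF D(3), of "cd (App w ts)"] FC_Ob[OF App.prems] by (simp add: D(4,5))
    have "cA (pr H w (map cd ts)) (ncomp (Nt \<alpha>) (cd (App w ts))) = cA (pa A w (map a ts)) (pr G w (map cd ts))"
      using D(6)[OF w, of "map cd ts"] pow_Ob[OF ts] FPhi_ob[OF w ts(2,1)] m by (simp del: map_map)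
    then have "cA (pr H w (map cd ts)) (ncomp (Nt \<alpha>) (cd (App w ts))) = cA (pr H w (map cd ts)) (a (App w ts))"
      unfolding al_App[OF w ts] .
    then show ?case by (rule iso_cancel[OF G.Y.C pr_typed(2,3)[OF w ts] h al_hom[OF App.prems]])
  qed
  then have "Nt \<alpha> = Nt lcell"
    using nat_ext[OF D(3)] by (intro nattr_eqI[of _ _ "Ob FC"]) (auto simp: lcell_simps D(4,5) elim!: FC_ObE, simp add: lcell_def)
  then show ?thesis using c by (simp add: lcell_simps)
qed

end

end

section \<open>Smallness of the free algebra\<close>

unbundle cardinal_syntax

lemma lepoll_iff_ordLeq: "A \<lesssim> B \<longleftrightarrow> |A| \<le>o |B|" by (simp add: lepoll_def card_of_ordLeq[symmetric])

text \<open>The relation \<open>lesspoll\<close> is translated into strict inequality of cardinals,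
  where a union of two sets below an infinite cardinal is known to stay below it.\<close>

lemma Un_lesspoll:
  assumes "infinite C" "A \<prec> C" "B \<prec> C"
  shows "A \<union> B \<prec> C"
proof -
  have iff: "X \<prec> C \<longleftrightarrow> |X| <o |C|" for X
  proof -
    have "X \<prec> C \<longleftrightarrow> \<not> C \<lesssim> X" if "X \<lesssim> C"
      using that lepoll_antisym[of X C] eqpoll_imp_lepoll[of C X] eqpoll_sym[of X C] unfolding lesspoll_def by blast
    moreover have "\<not> C \<lesssim> X \<longleftrightarrow> |X| <o |C|"
      by (simp add: lepoll_iff_ordLeq not_ordLeq_iff_ordLess[OF card_of_Well_order card_of_Well_order])
    ultimately show ?thesis using lesspoll_imp_lepoll ordLess_imp_ordLeq[of "|X|" "|C|"] lepoll_iff_ordLeq by metis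
  qed
  show ?thesis using assms card_of_Un_ordLess_infinite unfolding iff by blast
qed

lemma Times_lepoll:
  assumes "infinite C" "A \<lesssim> C" "B \<lesssim> C"
  shows "A \<times> B \<lesssim> C"
  using times_lepoll_mono[OF assms(2,3)] card_of_Times_same_infinite[OF assms(1)] eqpoll_iff_card_of_ordIso lepoll_trans2 by blast

lemma UN_lepoll:
  assumes "infinite C" "\<And>n :: nat. A n \<lesssim> C"
  shows "(\<Union>n. A n) \<lesssim> C"
  using assms card_of_UNION_ordLeq_infinite[of C UNIV A] infinite_le_lepoll[of C] by (simp add: lepoll_iff_ordLeq)

lemma Un_lepoll:
  assumes "infinite C" "A \<lesssim> C" "B \<lesssim> C"
  shows "A \<union> B \<lesssim> C"
proof -
  \<comment> \<open>A union of two sets as a countable one, with \<open>A\<close> at index zero and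
    \<open>B\<close> at all others.\<close>
  have "A \<union> B = (\<Union>n::nat. if n = 0 then A else B)" by auto
  then show ?thesis using UN_lepoll[OF assms(1), of "\<lambda>n. if n = 0 then A else B"] assms(2,3) by auto
qed

lemma lists_lepoll:
  assumes C: "infinite C" and A: "A \<lesssim> C"
  shows "lists A \<lesssim> C"
proof -
  have "{xs \<in> lists A. length xs = n} \<lesssim> C" for n
  proof (induction n)
    case 0
    have "{xs \<in> lists A. length xs = 0} \<subseteq> {[]}" by auto
    then show ?case by (intro finite_lepoll_infinite[OF C]) (rule finite_subset, auto)
  next
    case (Suc n)
    have sub: "{xs \<in> lists A. length xs = Suc n} \<subseteq> (\<lambda>(x, xs). x # xs) ` (A \<times> {xs \<in> lists A. length xs = n})"
      by (auto simp: length_Suc_conv image_iff)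
    show ?case by (rule lepoll_trans[OF subset_image_lepoll[OF sub] Times_lepoll[OF C A Suc]])
  qed
  then have "(\<Union>n. {xs \<in> lists A. length xs = n}) \<lesssim> C" by (intro UN_lepoll[OF C])
  moreover have "(\<Union>n. {xs \<in> lists A. length xs = n}) = lists A" by blast
  ultimately show ?thesis by simp
qed

text \<open>A bound for finitely branching syntax. Each element is rebuilt by \<open>f\<close> from
  a label and a list of elements of smaller measure, so the elements of measure below
  \<open>Suc n\<close> are covered by pairs of a label and a list of elements of measure below
  \<open>n\<close>. Lists, products and countable unions do not lead beyond an infinite set.\<close>

lemma lepoll_of_trees:
  fixes m :: "'x => nat"
  assumes C: "infinite C" and L: "L \<lesssim> C"
    and K: "\<And>x. x \<in> K ==> \<exists>l\<in>L. \<exists>xs\<in>lists K. x = f l xs \<and> (\<forall>y\<in>set xs. m y < m x)"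
  shows "K \<lesssim> C"
proof -
  have "{x \<in> K. m x < n} \<lesssim> C" for n
  proof (induction n)
    case (Suc n)
    have sub: "{x \<in> K. m x < Suc n} \<subseteq> (\<lambda>(l, xs). f l xs) ` (L \<times> lists {x \<in> K. m x < n})"
    proof
      fix x assume x: "x \<in> {x \<in> K. m x < Suc n}"
      then obtain l xs where l: "l \<in> L" "xs \<in> lists K" "x = f l xs" "\<forall>y\<in>set xs. m y < m x" using K by blast
      moreover have "xs \<in> lists {x \<in> K. m x < n}" using l x by fastforce
      ultimately show "x \<in> (\<lambda>(l, xs). f l xs) ` (L \<times> lists {x \<in> K. m x < n})" by blast
    qed
    show ?case by (rule lepoll_trans[OF subset_image_lepoll[OF sub] Times_lepoll[OF C L lists_lepoll[OF C Suc]]])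
  qed simp
  then have "(\<Union>n. {x \<in> K. m x < n}) \<lesssim> C" by (intro UN_lepoll[OF C])
  moreover have "(\<Union>n. {x \<in> K. m x < n}) = K" by blast
  ultimately show ?thesis by simp
qed

context free_base
begin

context
  fixes B :: "'b set"
  assumes B: "infinite B" and OX: "Ob (Car X) \<lesssim> B" and AX: "Ar (Car X) \<lesssim> B"
    and WS: "words S \<lesssim> B" and WT: "words T \<lesssim> B"
begin

lemma lepoll_okt: "{t. okt t} \<lesssim> B"
\<comment> \<open>The label of a term is the term with its arguments erased: \<open>App w []\<close>
  for an application, the term itself for a variable.\<close>
proof (rule lepoll_of_trees[OF B, where m = size and f = "\<lambda>l ts. case l of Var x => Var x | App w _ => App w ts"])
  let ?V = "Var ` Ob (Car X) :: ('t, 'u) tm set" and ?W = "(\<lambda>w. App w []) ` words T :: ('t, 'u) tm set"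
  have "?V \<lesssim> B" "?W \<lesssim> B" using OX WT image_lepoll lepoll_trans by blast+
  then show "?V \<union> ?W \<lesssim> B" by (rule Un_lepoll[OF B])
  fix t :: "('t, 'u) tm" assume "t \<in> {t. okt t}"
  then show "\<exists>l\<in>?V \<union> ?W. \<exists>ts\<in>lists {t. okt t}. t = (case l of Var x => Var x | App w _ => App w ts) \<and>
      (\<forall>s\<in>set ts. size s < size t)"
  proof (cases t)
    case (App w ts)
    then have "App w [] \<in> ?W" "ts \<in> lists {t. okt t}" "\<forall>s\<in>set ts. size s < size t"
      using \<open>t \<in> {t. okt t}\<close> size_list_estimation'[of _ ts] by (auto simp: less_Suc_eq_le)
    then show ?thesis using App by (intro bexI[of _ "App w []"] bexI[of _ ts]) auto
  next
    case (Var x)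
    then show ?thesis using \<open>t \<in> {t. okt t}\<close> by (intro bexI[of _ t] bexI[of _ "[]"]) auto
  qed
qed

lemma lepoll_okg: "{g. okg g} \<lesssim> B"
proof -
  let ?O = "lists {t. okt t}" and ?N = "UNIV :: nat set"
  note L = lists_lepoll[OF B] and P = Times_lepoll[OF B]
  have N: "?N \<lesssim> B" using B infinite_le_lepoll by blast
  then have N': "(UNIV :: nat list set) \<lesssim> B" using L by (metis lists_UNIV)
  let ?C = "(\<lambda>(w, ws, ts). GC w ws ts) ` (words T \<times> lists (words T) \<times> ?O) :: ('s, 't, 'u) gen set"
    and ?I = "GI ` {t. okt t} :: ('s, 't, 'u) gen set"
    and ?S = "(\<lambda>(w, l, f, ts). GS w l f ts) ` (words T \<times> ?N \<times> UNIV \<times> ?O) :: ('s, 't, 'u) gen set"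
    and ?R = "(\<lambda>(w, xs). GR w xs) ` (words S \<times> lists (Ob (Car X))) :: ('s, 't, 'u) gen set"
  have "?C \<lesssim> B" using P[OF WT P[OF L[OF WT] L[OF lepoll_okt]]] image_lepoll lepoll_trans by blast
  moreover have "?I \<lesssim> B" using lepoll_okt image_lepoll lepoll_trans by blast
  moreover have "?S \<lesssim> B" using P[OF WT P[OF N P[OF N' L[OF lepoll_okt]]]] image_lepoll lepoll_trans by blast
  moreover have "?R \<lesssim> B" using P[OF WS L[OF OX]] image_lepoll lepoll_trans by blast
  ultimately have "?C \<union> ?I \<union> ?S \<union> ?R \<lesssim> B" by (intro Un_lepoll[OF B])
  moreover have "{g. okg g} \<subseteq> ?C \<union> ?I \<union> ?S \<union> ?R"
  proof
    fix g :: "('s, 't, 'u) gen" assume "g \<in> {g. okg g}"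
    then show "g \<in> ?C \<union> ?I \<union> ?S \<union> ?R"
    proof (cases g)
      case (GC w ws ts)
      then have "(w, ws, ts) \<in> words T \<times> lists (words T) \<times> ?O"
        using \<open>g \<in> {g. okg g}\<close> cwordsD[of w ws T] by auto
      then have "g \<in> ?C" unfolding GC by (rule rev_image_eqI) simp
      then show ?thesis by blast
    next
      case (GS w l f ts)
      then have "(w, l, f, ts) \<in> words T \<times> ?N \<times> UNIV \<times> ?O"
        using \<open>g \<in> {g. okg g}\<close> swordsD[of w l f T] by auto
      then have "g \<in> ?S" unfolding GS by (rule rev_image_eqI) simp
      then show ?thesis by blast
    next
      case (GR w xs)
      then have "(w, xs) \<in> words S \<times> lists (Ob (Car X))" using \<open>g \<in> {g. okg g}\<close> by (auto simp: Ob_pow)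
      then have "g \<in> ?R" unfolding GR by (rule rev_image_eqI) simp
      then show ?thesis by blast
    qed auto
  qed
  ultimately show ?thesis using subset_imp_lepoll lepoll_trans by blast
qed

lemma lepoll_ok: "{e. ok e} \<lesssim> B"
proof (rule lepoll_of_trees[OF B, where m = size and
      f = "\<lambda>l es. case l of Op w _ => Op w es | Cm _ _ => Cm (es ! 0) (es ! 1) | e => e"])
  let ?f = "\<lambda>(l :: ('s, 't, 'u) ex) es. case l of Op w _ => Op w es | Cm _ _ => Cm (es ! 0) (es ! 1) | e => e"
  \<comment> \<open>A composite carries no data besides its two factors, so one label serves for all
    of them. The factors are read from the list, and the placeholders are never inspected.\<close>
  let ?c = "Cm undefined undefined :: ('s, 't, 'u) ex"
  let ?L = "Eta ` Ar (Car X) \<union> Ide ` {t. okt t} \<union> {?c} \<union> (\<lambda>w. Op w []) ` words T \<union> Gn ` {g. okg g} \<union> Gi ` {g. okg g}"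
  have im: "h ` A \<lesssim> B" if "A \<lesssim> B" for A and h :: "_ => ('s, 't, 'u) ex" using that image_lepoll lepoll_trans by blast
  have "{?c} \<lesssim> B" by (rule finite_lepoll_infinite[OF B]) simp
  then show "?L \<lesssim> B" using im[OF AX, of Eta] im[OF lepoll_okt, of Ide] im[OF WT, of "\<lambda>w. Op w []"]
      im[OF lepoll_okg, of Gn] im[OF lepoll_okg, of Gi] by (intro Un_lepoll[OF B])
  fix e :: "('s, 't, 'u) ex" assume e: "e \<in> {e. ok e}"
  show "\<exists>l\<in>?L. \<exists>es\<in>lists {e. ok e}. e = ?f l es \<and> (\<forall>x\<in>set es. size x < size e)"
  proof (cases e)
    case (Cm g f)
    then show ?thesis using e by (intro bexI[of _ ?c] bexI[of _ "[g, f]"]) auto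
  next
    case (Op w es)
    then have "\<forall>s\<in>set es. size s < size e" using size_list_estimation'[of _ es] by (auto simp: less_Suc_eq_le)
    then show ?thesis using Op e by (intro bexI[of _ "Op w []"] bexI[of _ es]) auto
  qed (use e in \<open>intro bexI[of _ e] bexI[of _ "[]"], auto\<close>)+
qed

end

lemma ceq_equiv: "ok e ==> ceq e e" "ceq e e' ==> ceq e' e" "ceq e e' ==> ceq e' e'' ==> ceq e e''" by (simp_all add: ceq_def)

text \<open>The quotient map is an injective code applied to a representative chosen for each class,
  so it takes values in \<open>'u\<close> itself rather than in sets of expressions.\<close>

lemma ex_free_alg:
  assumes "{t. okt t} \<prec> (UNIV :: 'u set)" "{e. ok e} \<prec> (UNIV :: 'u set)"
  shows "\<exists>cd qt. free_alg S T \<phi> X cd qt"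
proof -
  obtain cd :: "('t, 'u) tm => 'u" where cd: "inj_on cd {t. okt t}" using lesspoll_imp_lepoll[OF assms(1)] by (auto simp: lepoll_def)
  obtain n :: "('s, 't, 'u) ex => 'u" where n: "inj_on n {e. ok e}" using lesspoll_imp_lepoll[OF assms(2)] by (auto simp: lepoll_def)
  define r where "r e = (SOME e'. ceq e e')" for e
  have r: "ceq e (r e)" if "ok e" for e unfolding r_def using ceq_equiv(1)[OF that] by (rule someI)
  have "n (r e) = n (r e') \<longleftrightarrow> ceq e e'" if o: "ok e" "ok e'" for e e'
  proof
    assume "n (r e) = n (r e')"
    then have "r e = r e'" using n r[OF o(1)] r[OF o(2)] by (auto simp: inj_on_def ceq_def)
    then show "ceq e e'" using r[OF o(1)] r[OF o(2)] ceq_equiv by metis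
  next
    assume "ceq e e'"
    \<comment> \<open>Equivalent expressions define the same predicate, hence the choice operator in
      \<open>r\<close> returns the same representative for both.\<close>
    then have "ceq e = ceq e'" using ceq_equiv by blast
    then show "n (r e) = n (r e')" by (simp add: r_def)
  qed
  then show ?thesis using cd free_base_axioms
    by (intro exI[of _ cd] exI[of _ "\<lambda>e. n (r e)"]) (simp add: free_alg_def free_alg_axioms_def)
qed

end

context theory_change
begin

text \<open>An infinite set \<open>B\<close> strictly smaller than the universe bounds all
  ingredients of the syntax, and with them the syntax. The carrier of the free algebra consists of
  images of the well-formed terms and expressions, so it is small.\<close>

lemma free_algebra_exists:
  fixes X :: "('s, 'u, 'u) psalg"
  assumes U: "uncountable (UNIV :: 'u set)" "Ar S \<prec> (UNIV :: 'u set)" "Ar T \<prec> (UNIV :: 'u set)"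
    and X: "X \<in> Obj (PsAlg S)"
  shows "\<exists>cd qt. free_alg S T \<phi> X cd qt \<and> free_alg.FA S T \<phi> X cd qt \<in> Obj (PsAlg T)"
proof -
  interpret X: psalgebra S X by (rule psalgebraI[OF S X])
  interpret free_base S T \<phi> X ..
  let ?U = "UNIV :: 'u set"
  have inf: "infinite ?U" using U(1) countable_finite by blast
  have XU: "Ob (Car X) \<prec> ?U" "Ar (Car X) \<prec> ?U" using X by (simp_all add: Obj_PsAlg)
  obtain n :: "nat => 'u" where n: "inj n" using inf infinite_countable_subset by blast
  \<comment> \<open>Here uncountability of the universe enters: the image of the natural numbers is
    small.\<close>
  have "range n \<prec> ?U"
    using U(1) countable_eqpoll[OF countableI_type[where 'a = nat, THEN countable_image], of ?U n] eqpoll_sym subset_imp_lepoll[of "range n" ?U]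
    by (auto simp: lesspoll_def)
  have W: "words S \<prec> ?U" "words T \<prec> ?U"
    using U(2,3) subset_imp_lepoll[of "words S" "Ar S"] subset_imp_lepoll[of "words T" "Ar T"] lesspoll_trans1 by (auto simp: words_def)
  obtain s :: "'s => 'u" where s: "inj_on s (words S)" using lesspoll_imp_lepoll[OF W(1)] by (auto simp: lepoll_def)
  obtain t :: "'t => 'u" where t: "inj_on t (words T)" using lesspoll_imp_lepoll[OF W(2)] by (auto simp: lepoll_def)
  \<comment> \<open>Words belong to other types and are represented by copies in \<open>'u\<close>.
    The image of the natural numbers makes \<open>B\<close> infinite.\<close>
  define B where "B = range n \<union> Ob (Car X) \<union> Ar (Car X) \<union> s ` words S \<union> t ` words T"
  have "s ` words S \<prec> ?U" "t ` words T \<prec> ?U" using W s t by simp_all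
  then have B: "B \<prec> ?U" unfolding B_def by (intro Un_lesspoll[OF inf] XU \<open>range n \<prec> ?U\<close>)
  have "infinite B" unfolding B_def using range_inj_infinite[OF n] by simp
  moreover have "Ob (Car X) \<lesssim> B" "Ar (Car X) \<lesssim> B" "s ` words S \<lesssim> B" "t ` words T \<lesssim> B"
    by (intro subset_imp_lepoll; auto simp: B_def)+
  ultimately have "{t. okt t} \<lesssim> B" "{e. ok e} \<lesssim> B" using s t lepoll_okt[of B] lepoll_ok[of B] by simp_all
  then have small: "{t. okt t} \<prec> ?U" "{e. ok e} \<prec> ?U" using B lesspoll_trans1 by blast+
  obtain cd qt where "free_alg S T \<phi> X cd qt" using ex_free_alg[OF small] by blast
  then interpret F: free_alg S T \<phi> X cd qt .
  have "Ob F.FC \<prec> ?U" "Ar F.FC \<prec> ?U"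
    unfolding F.FC_def using lesspoll_trans1[OF image_lepoll small(1)] lesspoll_trans1[OF image_lepoll small(2)] by simp_all
  then have "F.FA \<in> Obj (PsAlg T)" using F.FA.X by (simp add: Obj_PsAlg)
  then show ?thesis using F.free_alg_axioms by blast
qed

end

text \<open>The morphisms of \<open>S\<close> and \<open>T\<close> have to be small in number
  because words label the terms and generators of the free algebra. Uncountability of
  \<open>'u\<close> says that countable sets are small, as in a universe that contains an infinite
  set.\<close>

theorem theorem10p9:
  fixes S :: "'s thry" and T :: "'t thry" and \<phi> :: "(nat, 's, nat, 't) functr"
  assumes "is_theory S" and "is_theory T" and "theory_morphism S T \<phi>"
    and "uncountable (UNIV :: 'u set)"
    and "Ar S \<prec> (UNIV :: 'u set)" and "Ar T \<prec> (UNIV :: 'u set)"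
  shows "\<exists>F :: (('s, 'u, 'u) psalg, ('s, 'u, 'u, 'u, 'u) psmor, ('s, 'u, 'u, 'u, 'u) pscell,
                ('t, 'u, 'u) psalg, ('t, 'u, 'u, 'u, 'u) psmor, ('t, 'u, 'u, 'u, 'u) pscell) psfun.
           left_biadjoint (PsAlg S) (PsAlg T) (forgetful S T \<phi>) F \<and>
           strict_2functor (PsAlg S) (PsAlg T) F"
proof -
  interpret theory_change S T \<phi> using assms(1-3) by unfold_locales
  let ?K = "PsAlg S :: (('s, 'u, 'u) psalg, _, _) twocat" and ?L = "PsAlg T :: (('t, 'u, 'u) psalg, _, _) twocat"
  let ?G = "forgetful S T \<phi>"
  note algS = psalgebraI[OF S] and algT = psalgebraI[OF T]
  \<comment> \<open>The codes and quotient maps depend on \<open>X\<close>; choosing them for every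
    small algebra at once fixes the object map of the biadjoint.\<close>
  obtain cd :: "('s, 'u, 'u) psalg \<Rightarrow> ('t, 'u) tm \<Rightarrow> 'u" and qt :: "('s, 'u, 'u) psalg \<Rightarrow> ('s, 't, 'u) ex \<Rightarrow> 'u" where
    free: "\<And>X. X \<in> Obj ?K \<Longrightarrow> free_alg S T \<phi> X (cd X) (qt X)" and
    FObj: "\<And>X. X \<in> Obj ?K \<Longrightarrow> free_alg.FA S T \<phi> X (cd X) (qt X) \<in> Obj ?L"
    using free_algebra_exists[OF assms(4-6)] by metis
  define F0 where "F0 X = free_alg.FA S T \<phi> X (cd X) (qt X)" for X
  define \<eta> where "\<eta> X = free_alg.eta S T \<phi> X (cd X) (qt X)" for X
  \<comment> \<open>Strict morphisms are the class in which extensions along the universal arrows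
    are unique.\<close>
  define st where "st A B = {H. strict_mor T A B H}" for A B :: "('t, 'u, 'u) psalg"
  have F0: "F0 X \<in> Obj ?L" if "X \<in> Obj ?K" for X using FObj[OF that] by (simp add: F0_def)
  have \<eta>: "psmorphism S X (U (F0 X)) (\<eta> X)" if "X \<in> Obj ?K" for X
    unfolding F0_def \<eta>_def by (rule free_alg.psmorphism_eta[OF free[OF that]])
  \<comment> \<open>\<open>r\<close> and \<open>r2\<close> identify restriction as the general
    criterion writes it, by composition in the 2-categories, with \<open>restr\<close> and
    \<open>restr2\<close>.\<close>
  have r: "cmp1 ?K X (P0 ?G (F0 X)) (P0 ?G A) (fob (P1 ?G (F0 X) A) h) (\<eta> X) = free_alg.restr S T \<phi> X (cd X) (qt X) A h"
    if "X \<in> Obj ?K" "A \<in> Obj ?L" "is_psmor T (F0 X) A h" for X A h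
    using \<eta>[OF that(1)] psmorphism_forget[OF psmorphismI[OF algT[OF F0[OF that(1)]] algT[OF that(2)] that(3)]] that(3)
    by (simp add: forgetful_simps PsAlg_simps psmorphism.H free_alg.restr_def[OF free[OF that(1)]] F0_def \<eta>_def)
  have r2: "cmp2 ?K X (P0 ?G (F0 X)) (P0 ?G A) (far (P1 ?G (F0 X) A) \<alpha>) (id2 ?K X (P0 ?G (F0 X)) (\<eta> X))
      = free_alg.restr2 S T \<phi> X (cd X) (qt X) A \<alpha>"
    if "X \<in> Obj ?K" "A \<in> Obj ?L" "is_pscell T (F0 X) A \<alpha>" for X A \<alpha>
    using is_pscell_id[OF \<eta>[OF that(1)]] is_pscell_forget[OF algT[OF F0[OF that(1)]] algT[OF that(2)] that(3)] that(3)
    by (simp add: forgetful_simps PsAlg_simps free_alg.restr2_def[OF free[OF that(1)]] F0_def \<eta>_def)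
  have M: "free_model S T \<phi> X A H" if "X \<in> Obj ?K" "A \<in> Obj ?L" "is_psmor S X (U A) H" for X A H
    using that psmorphismI[OF algS[OF that(1)] psalgebra_forget[OF algT[OF that(2)]] that(3)] algT[OF that(2)] algS[OF that(1)] theory_change_axioms
    by (simp add: free_model_def free_base_def)
  have stm: "is_psmor T A B h" if "h \<in> st A B" for A B h using that by (simp add: st_def strict_mor_def)
  show ?thesis
  proof (rule left_biadjoint_of_universal_arrows[OF strict_2functor_forgetful F0, where \<eta> = \<eta> and st = st])
    show "\<eta> X \<in> Ob (HomC ?K X (P0 ?G (F0 X)))" if "X \<in> Obj ?K" for X
      using \<eta>[OF that] by (simp add: forgetful_simps PsAlg_simps psalg_hom_simps psmorphism.H)
    show "h \<in> Ob (HomC ?L A B)" if "h \<in> st A B" for A B h using stm[OF that] by (simp add: PsAlg_simps psalg_hom_simps)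
    show "Id1 ?L A \<in> st A A" if "A \<in> Obj ?L" for A using strict_mor_id[OF algT[OF that]] by (simp add: PsAlg_simps st_def)
    show "cmp1 ?L A B C k h \<in> st A C"
      if "A \<in> Obj ?L" "B \<in> Obj ?L" "C \<in> Obj ?L" and hk: "h \<in> st A B" "k \<in> st B C" for A B C h k
      using strict_mor_comp[OF psmorphismI[OF algT algT stm[OF hk(1)]] _ psmorphismI[OF algT algT stm[OF hk(2)]]] that
      by (simp add: PsAlg_simps(3)[OF stm[OF hk(2)] stm[OF hk(1)]]) (simp add: st_def)
    show "\<exists>h\<in>st (F0 X) A. cmp1 ?K X (P0 ?G (F0 X)) (P0 ?G A) (fob (P1 ?G (F0 X) A) h) (\<eta> X) = f"
      if X: "X \<in> Obj ?K" and A: "A \<in> Obj ?L" and f: "f \<in> Ob (HomC ?K X (P0 ?G A))" for X A f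
    proof -
      interpret F: free_alg S T \<phi> X "cd X" "qt X" by (rule free[OF X])
      have m: "free_model S T \<phi> X A f" using M[OF X A] f by (simp add: forgetful_simps PsAlg_simps psalg_hom_simps)
      have h: "F.extn A f \<in> st (F0 X) A" using F.strict_extn[OF m] by (simp add: st_def F0_def)
      then show ?thesis using r[OF X A stm[OF h]] F.restr_extn[OF m] by auto
    qed
    show "h = h'"
      if X: "X \<in> Obj ?K" and A: "A \<in> Obj ?L" and h: "h \<in> st (F0 X) A" "h' \<in> st (F0 X) A"
        and eq: "cmp1 ?K X (P0 ?G (F0 X)) (P0 ?G A) (fob (P1 ?G (F0 X) A) h) (\<eta> X)
          = cmp1 ?K X (P0 ?G (F0 X)) (P0 ?G A) (fob (P1 ?G (F0 X) A) h') (\<eta> X)" for X A h h'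
    proof -
      interpret F: free_alg S T \<phi> X "cd X" "qt X" by (rule free[OF X])
      \<comment> \<open>A strict morphism is recovered from its restriction, so equal restrictions
        force equality.\<close>
      have "k = F.extn A (F.restr A k)" if "k \<in> st (F0 X) A" for k
        using F.strict_is_extn psmorphismI[OF algT[OF F0[OF X]] algT[OF A] stm[OF that]] that by (simp add: st_def F0_def)
      then show ?thesis using h eq r[OF X A] stm by metis
    qed
    show "\<exists>!\<alpha>. \<alpha> \<in> hom (HomC ?L (F0 X) A) g h \<and>
        cmp2 ?K X (P0 ?G (F0 X)) (P0 ?G A) (far (P1 ?G (F0 X) A) \<alpha>) (id2 ?K X (P0 ?G (F0 X)) (\<eta> X)) = \<beta>"
      if X: "X \<in> Obj ?K" and A: "A \<in> Obj ?L" and gh: "g \<in> Ob (HomC ?L (F0 X) A)" "h \<in> Ob (HomC ?L (F0 X) A)"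
        and \<beta>: "\<beta> \<in> hom (HomC ?K X (P0 ?G A)) (cmp1 ?K X (P0 ?G (F0 X)) (P0 ?G A) (fob (P1 ?G (F0 X) A) g) (\<eta> X))
          (cmp1 ?K X (P0 ?G (F0 X)) (P0 ?G A) (fob (P1 ?G (F0 X) A) h) (\<eta> X))" for X A g h \<beta>
    proof -
      interpret F: free_alg S T \<phi> X "cd X" "qt X" by (rule free[OF X])
      have gh': "is_psmor T (F0 X) A g" "is_psmor T (F0 X) A h" using gh by (simp_all add: PsAlg_simps psalg_hom_simps)
      have b: "is_pscell S X (U A) \<beta>" "Src \<beta> = F.restr A g" "Tgt \<beta> = F.restr A h"
        using \<beta> r[OF X A gh'(1)] r[OF X A gh'(2)] by (simp_all add: forgetful_simps PsAlg_simps hom_psalg_hom)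
      note m = psmorphismI[OF algT[OF F0[OF X]] algT[OF A] gh'(1), unfolded F0_def]
        psmorphismI[OF algT[OF F0[OF X]] algT[OF A] gh'(2), unfolded F0_def]
      show ?thesis
      proof (rule ex1I)
        show "F.lcell A g h \<beta> \<in> hom (HomC ?L (F0 X) A) g h \<and>
            cmp2 ?K X (P0 ?G (F0 X)) (P0 ?G A) (far (P1 ?G (F0 X) A) (F.lcell A g h \<beta>)) (id2 ?K X (P0 ?G (F0 X)) (\<eta> X)) = \<beta>"
          using F.is_pscell_lcell[OF m b] F.restr2_lcell[OF m b] r2[OF X A] F.lcell_simps[OF m b]
          by (simp add: PsAlg_simps hom_psalg_hom F0_def)
        fix \<alpha> assume a: "\<alpha> \<in> hom (HomC ?L (F0 X) A) g h \<and>
            cmp2 ?K X (P0 ?G (F0 X)) (P0 ?G A) (far (P1 ?G (F0 X) A) \<alpha>) (id2 ?K X (P0 ?G (F0 X)) (\<eta> X)) = \<beta>"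
        then have c: "is_pscell T (F0 X) A \<alpha>" "Src \<alpha> = g" "Tgt \<alpha> = h" by (simp_all add: PsAlg_simps hom_psalg_hom)
        show "\<alpha> = F.lcell A g h \<beta>" using F.lcell_unique[OF m b, of \<alpha>] a c r2[OF X A c(1)] by (simp add: F0_def)
      qed
    qed
  qed
qed

end
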